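(* Let $0<p<2$ and $V(x)=-|x|^{-p}$ on $\mathbb{R}^2$. Then for every $a>0$ and every $b>0$, the minimization problem $$E(b)=\inf\Big\{\mathcal{E}_b(u) \;\Big|\; u\in H^1(\mathbb{R}^2),\ \|u\|_{L^2}=1\Big\}$$ has at least one minimizer that is non-negative and radially symmetric decreasing.
   Context: For $a>0$, $b>0$ and $u\in H^1(\mathbb{R}^2)$, the Kirchhoff energy functional is $$\mathcal{E}_b(u)= \int_{\mathbb{R}^2} |\nabla u|^2\,dx + b \left( \int_{\mathbb{R}^2} |\nabla u|^2\,dx \right)^2 + \int_{\mathbb{R}^2} V(x) |u(x)|^2\,dx - \frac{a}{2} \int_{\mathbb{R}^2} |u|^4\,dx .$$ A minimizer for $E(b)$ is a function $u\in H^1(\mathbb{R}^2)$ with $\|u\|_{L^2}=1$ and $\mathcal{E}_b(u)=E(b)$. *)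

theory Defs
  imports "HOL-Analysis.Analysis"
begin

fun C_k :: "nat \<Rightarrow> ('a::euclidean_space \<Rightarrow> real) \<Rightarrow> bool" where
  "C_k 0 \<phi> \<longleftrightarrow> continuous_on UNIV \<phi>"
| "C_k (Suc k) \<phi> \<longleftrightarrow>
     (\<forall>x. \<phi> differentiable at x) \<and>
     (\<forall>v\<in>Basis. C_k k (\<lambda>x. frechet_derivative \<phi> (at x) v))"

definition test_function :: "('a::euclidean_space \<Rightarrow> real) \<Rightarrow> bool" where
  "test_function \<phi> \<longleftrightarrow> (\<forall>k. C_k k \<phi>) \<and> compact (closure {x. \<phi> x \<noteq> 0})"

definition locally_integrable :: "('a::euclidean_space \<Rightarrow> 'b::euclidean_space) \<Rightarrow> bool" where
  "locally_integrable f \<longleftrightarrow> (\<forall>K. compact K \<longrightarrow> set_integrable lebesgue K f)"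

definition L2 :: "('a::euclidean_space \<Rightarrow> 'b::euclidean_space) set" where
  "L2 = {f \<in> borel_measurable lebesgue. integrable lebesgue (\<lambda>x. norm (f x) ^ 2)}"

definition L2_norm :: "('a::euclidean_space \<Rightarrow> 'b::euclidean_space) \<Rightarrow> real" where
  "L2_norm f = sqrt (\<integral>x. norm (f x) ^ 2 \<partial>lebesgue)"

definition has_weak_gradient :: "('a::euclidean_space \<Rightarrow> real) \<Rightarrow> ('a \<Rightarrow> 'a) \<Rightarrow> bool" where
  "has_weak_gradient u g \<longleftrightarrow>
     locally_integrable u \<and> locally_integrable g \<and>
     (\<forall>\<phi>. test_function \<phi> \<longrightarrow> (\<forall>v\<in>Basis.
        (\<integral>x. u x * frechet_derivative \<phi> (at x) v \<partial>lebesgue)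
          = - (\<integral>x. (g x \<bullet> v) * \<phi> x \<partial>lebesgue)))"

(* A weak gradient is unique only up to null sets; integrals of it do not
   depend on the representative chosen here. *)
definition weak_gradient :: "('a::euclidean_space \<Rightarrow> real) \<Rightarrow> 'a \<Rightarrow> 'a" where
  "weak_gradient u = (SOME g. has_weak_gradient u g)"

(* Elements of H1 are functions, not classes of functions modulo null sets. *)
definition H1 :: "('a::euclidean_space \<Rightarrow> real) set" where
  "H1 = {u \<in> L2. \<exists>g\<in>L2. has_weak_gradient u g}"

definition kirchhoff_energy ::
  "real \<Rightarrow> (real^2 \<Rightarrow> real) \<Rightarrow> real \<Rightarrow> (real^2 \<Rightarrow> real) \<Rightarrow> real" where
  "kirchhoff_energy a V b u =
     (\<integral>x. norm (weak_gradient u x) ^ 2 \<partial>lebesgue)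
     + b * (\<integral>x. norm (weak_gradient u x) ^ 2 \<partial>lebesgue) ^ 2
     + (\<integral>x. V x * \<bar>u x\<bar> ^ 2 \<partial>lebesgue)
     - a / 2 * (\<integral>x. \<bar>u x\<bar> ^ 4 \<partial>lebesgue)"

(* The infimum is taken in the extended reals, so that it is also the true
   infimum for energies that are not bounded below. *)
definition ground_state_energy :: "real \<Rightarrow> (real^2 \<Rightarrow> real) \<Rightarrow> real \<Rightarrow> ereal" where
  "ground_state_energy a V b =
     (INF u \<in> {u \<in> H1. L2_norm u = 1}. ereal (kirchhoff_energy a V b u))"

definition is_minimizer ::
  "real \<Rightarrow> (real^2 \<Rightarrow> real) \<Rightarrow> real \<Rightarrow> (real^2 \<Rightarrow> real) \<Rightarrow> bool" where
  "is_minimizer a V b u \<longleftrightarrow>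
     u \<in> H1 \<and> L2_norm u = 1 \<and>
     ereal (kirchhoff_energy a V b u) = ground_state_energy a V b"

(* The profile is constrained only on the open half-line, so no finite value
   at the origin is imposed; decreasing means non-increasing. *)
definition radially_symmetric_decreasing :: "('a::euclidean_space \<Rightarrow> real) \<Rightarrow> bool" where
  "radially_symmetric_decreasing u \<longleftrightarrow>
     (\<exists>f :: real \<Rightarrow> real. antimono_on {0<..} f \<and> (AE x in lebesgue. u x = f (norm x)))"

end

theory Submission
  imports Defs "HOL-Real_Asymp.Real_Asymp" "HOL-Probability.Helly_Selection"
    "HOL-Complex_Analysis.Great_Picard"
begin

text \<open>The Dirichlet integral of \<open>u\<close> equals the supremum over \<open>\<epsilon>\<close> of the normalized nonlocal
  energies \<open>\<integral>\<integral> |u x - u y|\<^sup>2\<close> over pairs with \<open>|x - y| < \<epsilon>\<close>. In this form it is visibly lower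
  semicontinuous, invariant under dilations of the plane, and decreased by normal contractions,
  by mollification and by polarization. On the compact class of nonnegative \<open>R\<close>-Lipschitz
  functions of mass one supported in the ball of radius \<open>R\<close> a minimizer exists by
  Arzela--Ascoli; polarizing it strictly lowers the potential energy unless it is radially
  decreasing, because \<open>|x|\<^sup>-\<^sup>p\<close> is strictly decreasing. Comparing values at radii \<open>r\<close> and \<open>2r\<close>
  bounds a radially decreasing function by a logarithm near the origin, which gives coercivity
  and dominating functions. As \<open>R\<close> grows the minimizers are a minimizing sequence for the full
  problem, Helly's theorem yields an almost everywhere limit, and the limit is nonzero since the
  infimum is negative. A dilation restores the mass without raising the energy.\<close>

section \<open>Test functions\<close>

text \<open>Before any symmetry is known, minimizing sequences of the full problem have no evident
  compactness, and a rearrangement inequality for gradients would need a limit procedure of its own.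
  A constrained minimizer avoids both: minimality makes a single polarization per pair of points
  enough, and continuity turns an almost everywhere conclusion into one for every pair. The price is
  a density result, \<open>lip_class_density\<close>, by which the Lipschitz classes reach the
  infimum over \<open>H1\<close>. In the plane a bounded Dirichlet energy does not bound the
  function, and under mass-preserving dilation the quartic term scales like the Dirichlet energy, so
  for large \<open>a\<close> only the Kirchhoff term keeps the energy bounded below. At infinity the
  available bound \<open>2 / norm x\<close> makes the quartic and potential integrals converge but
  not the mass, because its square is not integrable in the plane. Mass may therefore be lost in the
  limit although the attractive terms are not; dilating back makes both of these grow.\<close>

lemma C_kI:
  assumes "\<And>x. (f has_derivative D x) (at x)" "\<And>v. v \<in> Basis \<Longrightarrow> C_k k (\<lambda>x. D x v)"
  shows "C_k (Suc k) f"
proof -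
  have "frechet_derivative f (at x) = D x" for x
    using assms(1) by (metis frechet_derivative_at)
  then show ?thesis
    using assms by (auto simp: differentiable_def)
qed

lemma C_k_Suc_has_derivative:
  "C_k (Suc k) f \<Longrightarrow> (f has_derivative frechet_derivative f (at x)) (at x)"
  using frechet_derivative_works[of f "at x"] by simp

lemma C_k_continuous: "C_k k f \<Longrightarrow> continuous_on UNIV f"
  by (cases k) (auto intro!: continuous_at_imp_continuous_on differentiable_imp_continuous_within)

lemma C_k_SucD: "C_k (Suc k) f \<Longrightarrow> C_k k f"
proof (induction k arbitrary: f)
  case 0
  then show ?case using C_k_continuous by (metis C_k.simps(1))
next
  case (Suc k)
  from Suc.prems have d: "\<forall>x. f differentiable at x"
    and c: "\<forall>v\<in>Basis. C_k (Suc k) (\<lambda>x. frechet_derivative f (at x) v)"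
    unfolding C_k.simps(2)[of "Suc k"] by blast+
  then show ?case using Suc.IH unfolding C_k.simps(2)[of k] by blast
qed

lemma C_k_const: "C_k k (\<lambda>x. c)"
  by (induction k arbitrary: c) (auto intro!: C_kI[where D = "\<lambda>x v. 0"])

lemma C_k_add: "C_k k f \<Longrightarrow> C_k k g \<Longrightarrow> C_k k (\<lambda>x. f x + g x)"
proof (induction k arbitrary: f g)
  case 0
  then show ?case by (auto intro: continuous_intros)
next
  case (Suc k)
  show ?case
  proof (rule C_kI)
    show "((\<lambda>x. f x + g x) has_derivative
        (\<lambda>v. frechet_derivative f (at x) v + frechet_derivative g (at x) v)) (at x)" for x
      by (intro has_derivative_add C_k_Suc_has_derivative[OF Suc.prems(1)]
          C_k_Suc_has_derivative[OF Suc.prems(2)])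
    show "C_k k (\<lambda>x. frechet_derivative f (at x) v + frechet_derivative g (at x) v)" if "v \<in> Basis"
        for v
      using Suc that by auto
  qed
qed

lemma C_k_mult: "C_k k f \<Longrightarrow> C_k k g \<Longrightarrow> C_k k (\<lambda>x. f x * g x)"
proof (induction k arbitrary: f g)
  case 0
  then show ?case by (auto intro: continuous_intros)
next
  case (Suc k)
  show ?case
  proof (rule C_kI)
    show "((\<lambda>x. f x * g x) has_derivative
        (\<lambda>v. f x * frechet_derivative g (at x) v + frechet_derivative f (at x) v * g x)) (at x)"
            for x
      by (intro has_derivative_mult C_k_Suc_has_derivative[OF Suc.prems(1)]
          C_k_Suc_has_derivative[OF Suc.prems(2)])
    show "C_k k (\<lambda>x. f x * frechet_derivative g (at x) v + frechet_derivative f (at x) v * g x)"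
      if "v \<in> Basis" for v
      using Suc that C_k_SucD[OF Suc.prems(1)] C_k_SucD[OF Suc.prems(2)]
      by (intro C_k_add Suc.IH) auto
  qed
qed

lemma C_k_prod: "(\<And>i. i \<in> I \<Longrightarrow> C_k k (f i)) \<Longrightarrow> C_k k (\<lambda>x. \<Prod>i\<in>I. f i x)"
  by (induction I rule: infinite_finite_induct) (auto intro: C_k_const C_k_mult)

text \<open>The family is closed under differentiation, and its member with \<open>m = 0\<close> is the usual
  smooth function that is positive exactly on the positive half-line.\<close>
definition flat :: "nat \<Rightarrow> real \<Rightarrow> real" where
  "flat m t = (if t > 0 then exp (- 1 / t) / t ^ m else 0)"

text \<open>Away from 0 the function agrees locally with a smooth formula. At 0 the right difference
  quotient is \<open>exp (- 1 / h) / h ^ Suc m\<close>, and exponential decay beats every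
  power.\<close>

lemma flat_has_derivative:
  "(flat m has_real_derivative (flat (m + 2) t - real m * flat (m + 1) t)) (at t)"
proof -
  consider "t > 0" | "t < 0" | "t = 0" by linarith
  then show ?thesis
  proof cases
    case 1
    have "((\<lambda>t. exp (- 1 / t) / t ^ m) has_real_derivative (flat (m + 2) t - real m * flat (m
        + 1) t)) (at t)"
      using 1 by (auto intro!: derivative_eq_intros simp: flat_def field_simps power2_eq_square)
        (cases m; simp add: field_simps)+
    then show ?thesis
      by (rule has_field_derivative_transform_within_open[of _ _ _ "{0<..}"])
        (use 1 in \<open>auto simp: flat_def\<close>)
  next
    case 2
    have "((\<lambda>t. 0) has_real_derivative 0) (at t)" by simp
    then have "(flat m has_real_derivative 0) (at t)"
      by (rule has_field_derivative_transform_within_open[of _ _ _ "{..<0}"])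
        (use 2 in \<open>auto simp: flat_def\<close>)
    then show ?thesis using 2 by (simp add: flat_def)
  next
    case 3
    have "((\<lambda>h. flat m h / h) \<longlongrightarrow> 0) (at 0)"
    proof (rule filterlim_split_at_real)
      show "((\<lambda>h. flat m h / h) \<longlongrightarrow> 0) (at_left 0)"
        by (rule Lim_transform_eventually[where f = "\<lambda>_. 0"])
          (auto simp: flat_def eventually_at_filter)
      have "((\<lambda>h::real. exp (- 1 / h) / h ^ Suc m) \<longlongrightarrow> 0) (at_right 0)"
        by real_asymp
      then show "((\<lambda>h. flat m h / h) \<longlongrightarrow> 0) (at_right 0)"
        by (rule Lim_transform_eventually) (auto simp: flat_def eventually_at_filter field_simps)
    qed
    then show ?thesis using 3
      by (simp add: DERIV_def flat_def)
  qed
qed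

text \<open>An affine argument is general enough: a directional derivative multiplies by the
  constant \<open>v \<bullet> w\<close> and leaves a combination of members of the family, so the
  induction on \<open>k\<close> closes for all \<open>m\<close> at once.\<close>

lemma C_k_flat: "C_k k (\<lambda>x. flat m (x \<bullet> w + d))"
proof (induction k arbitrary: m)
  case 0
  have "continuous_on UNIV (flat m)"
    by (intro continuous_at_imp_continuous_on ballI DERIV_isCont[OF flat_has_derivative])
  then have "continuous_on UNIV (\<lambda>x. flat m (x \<bullet> w + d))"
    by (intro continuous_on_compose2[where g = "flat m"
        and f = "\<lambda>x. x \<bullet> w + d"]) (auto intro!: continuous_intros)
  then show ?case by simp
next
  case (Suc k)
  show ?case
  proof (rule C_kI)
    show "((\<lambda>x. flat m (x \<bullet> w + d)) has_derivative
      (\<lambda>v. (v \<bullet> w) * (flat (m + 2) (x \<bullet> w + d) + (- real m) * flat (m + 1) (x \<bullet> w + d)))) (at x)"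
          for x
    proof -
      have "((\<lambda>x. x \<bullet> w + d) has_derivative (\<lambda>v. v \<bullet> w)) (at x)"
        by (auto intro!: derivative_eq_intros)
      from has_derivative_compose[OF this flat_has_derivative[of m "x \<bullet> w
          + d", unfolded has_field_derivative_def]]
      show ?thesis by (simp add: o_def mult.commute)
    qed
    show "C_k k (\<lambda>x. (v \<bullet> w) * (flat (m + 2) (x \<bullet> w + d) + (- real m) * flat (m + 1) (x \<bullet> w + d)))"
        for v
      by (intro C_k_mult C_k_add C_k_const Suc.IH)
  qed
qed

text \<open>For \<open>c > 0\<close> a smooth function that is positive exactly on
  \<open>box a b\<close>. Increasing \<open>c\<close> steepens it towards the indicator of the box,
  and the product over coordinates reduces smoothness to functions of one variable.\<close>

definition bump :: "real \<Rightarrow> 'a::euclidean_space \<Rightarrow> 'a \<Rightarrow> 'a \<Rightarrow> real" where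
  "bump c a b x = (\<Prod>i\<in>Basis. flat 0 (c * ((x - a) \<bullet> i)) * flat 0 (c * ((b - x) \<bullet> i)))"

lemma flat0_bounds: "0 \<le> flat 0 t" "flat 0 t \<le> 1"
  by (auto simp: flat_def)

lemma bump_nonneg: "0 \<le> bump c a b x"
  unfolding bump_def by (intro prod_nonneg mult_nonneg_nonneg ballI flat0_bounds)

lemma bump_le1: "bump c a b x \<le> 1"
  unfolding bump_def using flat0_bounds by (intro prod_le_1 conjI) (auto intro!: mult_le_one)

lemma bump_outside: "c > 0 \<Longrightarrow> x \<notin> box a b \<Longrightarrow> bump c a b x = 0"
  by (force simp: bump_def box_def flat_def inner_diff_left zero_less_mult_iff)

lemma bump_inside:
  assumes "c > 0" "x \<in> box a b" shows "bump c a b x > 0"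
  unfolding bump_def
proof (rule prod_pos)
  fix i :: 'a assume "i \<in> Basis"
  then have "(x - a) \<bullet> i > 0" "(b - x) \<bullet> i > 0"
    using assms by (auto simp: box_def inner_diff_left)
  then show "0 < flat 0 (c * ((x - a) \<bullet> i)) * flat 0 (c * ((b - x) \<bullet> i))"
    using assms by (simp add: flat_def)
qed

lemma bump_tendsto: "(\<lambda>n. bump (real (Suc n)) a b x) \<longlonglongrightarrow> indicator (box a b) x"
proof (cases "x \<in> box a b")
  case True
  have "(\<lambda>n. flat 0 (real (Suc n) * t)) \<longlonglongrightarrow> 1" if "t > 0" for t
  proof -
    have "(\<lambda>n. exp (- 1 / (real (Suc n) * t))) \<longlonglongrightarrow> 1" using that by real_asymp
    then show ?thesis using that by (simp add: flat_def)
  qed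
  then have "(\<lambda>n. bump (real (Suc n)) a b x) \<longlonglongrightarrow> (\<Prod>i\<in>(Basis::'a set). 1 * 1)"
    unfolding bump_def using True
    by (intro tendsto_prod tendsto_mult) (auto simp: box_def inner_diff_left)
  then show ?thesis using True by simp
next
  case False
  then show ?thesis by (simp add: bump_outside)
qed

lemma test_function_bump: assumes "c > 0" shows "test_function (bump c a b)"
  unfolding test_function_def
proof
  have "C_k k (\<lambda>x. \<Prod>i\<in>Basis. flat 0 (x \<bullet> (c *\<^sub>R i) + (- c * (a \<bullet> i)))
         * flat 0 (x \<bullet> (- c *\<^sub>R i) + c * (b \<bullet> i)))" for k
    by (intro C_k_prod C_k_mult C_k_flat)
  then show "\<forall>k. C_k k (bump c a b)"
    by (simp add: bump_def[abs_def] inner_diff_left algebra_simps)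
  have "{x. bump c a b x \<noteq> 0} \<subseteq> box a b"
    using assms bump_outside by blast
  then show "compact (closure {x. bump c a b x \<noteq> 0})"
    by (meson bounded_box bounded_subset compact_closure)
qed

lemma test_function_continuous: "test_function \<phi> \<Longrightarrow> continuous_on UNIV \<phi>"
  unfolding test_function_def by (meson C_k_continuous)

lemma test_function_has_derivative:
  "test_function \<phi> \<Longrightarrow> (\<phi> has_derivative frechet_derivative \<phi> (at x)) (at x)"
  unfolding test_function_def using C_k_Suc_has_derivative by blast

lemma frechet_derivative_expand:
  assumes "test_function \<rho>"
  shows "frechet_derivative \<rho> (at w) z = (\<Sum>i\<in>Basis. (z \<bullet> i) * frechet_derivative \<rho> (at w) i)"
proof -
  have lin: "linear (frechet_derivative \<rho> (at w))"
    using test_function_has_derivative[OF assms] has_derivative_linear by blast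
  have "frechet_derivative \<rho> (at w) z = frechet_derivative \<rho> (at w) (\<Sum>i\<in>Basis. (z \<bullet> i) *\<^sub>R i)"
    by (simp add: euclidean_representation)
  then show ?thesis by (simp add: linear_sum[OF lin] linear_cmul[OF lin])
qed

lemma test_function_derivative_continuous:
  assumes "test_function \<phi>" shows "continuous_on UNIV (\<lambda>x. frechet_derivative \<phi> (at x) v)"
proof -
  have "\<forall>v\<in>Basis. C_k 0 (\<lambda>x. frechet_derivative \<phi> (at x) v)"
    using assms unfolding test_function_def by (metis C_k.simps(2))
  then have "continuous_on UNIV (\<lambda>x. \<Sum>i\<in>Basis. (v \<bullet> i) * frechet_derivative \<phi> (at x) i)"
    by (auto intro!: continuous_intros)
  then show ?thesis by (subst frechet_derivative_expand[OF assms])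
qed

lemma test_function_support:
  assumes "test_function \<phi>"
  obtains R where "R > 0" "\<And>x. norm x \<ge> R \<Longrightarrow> \<phi> x = 0" "\<And>x v. norm x \<ge> R \<Longrightarrow> frechet_derivative \<phi> (at x)
      v = 0"
proof -
  have "bounded (closure {x. \<phi> x \<noteq> 0})"
    using assms compact_imp_bounded by (auto simp: test_function_def)
  then obtain R where R: "R > 0" "\<And>x. x \<in> closure {x. \<phi> x \<noteq> 0} \<Longrightarrow> norm x \<le> R"
    by (meson bounded_pos)
  have z: "\<phi> x = 0" if "norm x > R" for x
  proof (rule ccontr)
    assume "\<phi> x \<noteq> 0"
    then have "x \<in> closure {x. \<phi> x \<noteq> 0}"
      using closure_subset[of "{x. \<phi> x \<noteq> 0}"] by auto
    with R(2) that show False by fastforce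
  qed
  \<comment> \<open>The function may vanish at a point without vanishing near it. Enlarging the
    radius by 1 places \<open>x\<close> in the open set \<open>- cball 0 R\<close>, where the
    function is identically 0.\<close>
  have "frechet_derivative \<phi> (at x) v = 0" if "norm x \<ge> R + 1" for x v
  proof -
    have "((\<lambda>x. 0) has_derivative (\<lambda>v. 0::real)) (at x)" by simp
    then have "(\<phi> has_derivative (\<lambda>v. 0)) (at x)"
      by (rule has_derivative_transform_within_open[of _ _ _ _ "- cball 0 R"]) (use z that in auto)
    then show ?thesis by (metis frechet_derivative_at)
  qed
  with z R show ?thesis by (intro that[of "R + 1"]) auto
qed

lemma compact_support_bounded:
  fixes f :: "'a::euclidean_space \<Rightarrow> real"
  assumes "continuous_on UNIV f" "\<And>x. norm x \<ge> R \<Longrightarrow> f x = 0"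
  obtains C where "C > 0" "\<And>x. \<bar>f x\<bar> \<le> C"
proof -
  have "bounded (f ` cball 0 R)"
    by (intro compact_imp_bounded compact_continuous_image compact_cball continuous_on_subset[OF
        assms(1)]) auto
  then obtain C where "C > 0" "\<forall>x\<in>cball 0 R. \<bar>f x\<bar> \<le> C"
    unfolding bounded_pos by auto
  then show ?thesis
    by (intro that[of C]) (metis abs_zero assms(2) less_imp_le linorder_le_less_linear mem_cball_0)+
qed

lemma integrable_compact_support:
  fixes f :: "'a::euclidean_space \<Rightarrow> real"
  assumes "continuous_on UNIV f" "\<And>x. norm x \<ge> R \<Longrightarrow> f x = 0"
  shows "integrable lborel f"
proof -
  have "integrable lborel (\<lambda>x. indicator (cball 0 R) x *\<^sub>R f x)"
    by (intro borel_integrable_compact compact_cball continuous_on_subset[OF assms(1)]) auto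
  also have "(\<lambda>x. indicator (cball 0 R) x *\<^sub>R f x) = f"
    using assms(2) by (auto simp: indicator_def fun_eq_iff)
  finally show ?thesis .
qed

section \<open>Translation estimate for weak gradients\<close>

lemma nn_integral_lborel_translate:
  fixes f :: "'a::euclidean_space \<Rightarrow> ennreal"
  assumes "f \<in> borel_measurable borel"
  shows "(\<integral>\<^sup>+x. f (x + c) \<partial>lborel) = (\<integral>\<^sup>+x. f x \<partial>lborel)"
proof -
  have "(\<integral>\<^sup>+x. f x \<partial>lborel) = (\<integral>\<^sup>+x. f x \<partial>distr lborel borel ((+) c))"
    by (simp add: lborel_distr_plus)
  also have "\<dots> = (\<integral>\<^sup>+x. f (c + x) \<partial>lborel)"
    using assms by (subst nn_integral_distr) auto
  finally show ?thesis by (simp add: add.commute)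
qed

lemma integral_lborel_translate:
  fixes f :: "'a::euclidean_space \<Rightarrow> real"
  assumes "f \<in> borel_measurable borel"
  shows "(\<integral>x. f (x + c) \<partial>lborel) = (\<integral>x. f x \<partial>lborel)"
proof -
  have "(\<integral>x. f x \<partial>lborel) = (\<integral>x. f x \<partial>distr lborel borel ((+) c))"
    by (simp add: lborel_distr_plus)
  also have "\<dots> = (\<integral>x. f (c + x) \<partial>lborel)"
    using assms by (subst integral_distr) auto
  finally show ?thesis by (simp add: add.commute)
qed

lemma nn_integral_lborel_reflect:
  fixes f :: "'a::euclidean_space \<Rightarrow> ennreal"
  assumes "f \<in> borel_measurable borel"
  shows "(\<integral>\<^sup>+x. f (c - x) \<partial>lborel) = (\<integral>\<^sup>+x. f x \<partial>lborel)"
proof -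
  have "(\<integral>\<^sup>+x. f x \<partial>lborel) = (\<integral>\<^sup>+x. f x \<partial>density (distr lborel borel (\<lambda>x::'a. c
      + (-1) *\<^sub>R x)) (\<lambda>_. ennreal (\<bar>-1\<bar> ^ DIM('a))))"
    using lborel_affine[of "-1" c] by simp
  also have "\<dots> = (\<integral>\<^sup>+x. f (c - x) \<partial>lborel)"
    using assms by (subst nn_integral_density) (auto simp: nn_integral_distr)
  finally show ?thesis by simp
qed

lemma integral_lborel_reflect:
  fixes f :: "'a::euclidean_space \<Rightarrow> real"
  assumes "f \<in> borel_measurable borel"
  shows "(\<integral>x. f (c - x) \<partial>lborel) = (\<integral>x. f x \<partial>lborel)"
proof -
  have "lborel = distr lborel borel (\<lambda>x::'a. c + (-1) *\<^sub>R x)"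
    using lborel_affine[of "-1" c] by (simp add: density_1)
  then have "(\<integral>x. f x \<partial>lborel) = (\<integral>x. f x \<partial>distr lborel borel (\<lambda>x::'a. c + (-1) *\<^sub>R x))"
    by simp
  also have "\<dots> = (\<integral>x. f (c - x) \<partial>lborel)"
    using assms by (subst integral_distr) auto
  finally show ?thesis by simp
qed

text \<open>Boxes form an intersection-stable generator of the Borel sets, so vanishing integrals
  pass from boxes to all Borel sets. Cutting \<open>f\<close> off to a large box first makes it
  integrable, which complements and countable unions need.\<close>

lemma AE_zero_if_box_integrals_zero:
  fixes f :: "'a::euclidean_space \<Rightarrow> real"
  assumes [measurable]: "f \<in> borel_measurable borel"
    and int: "\<And>R. integrable lborel (\<lambda>x. indicator (cball 0 R) x * f x)"
    and box: "\<And>a b. (\<integral>x. indicator (box a b) x * f x \<partial>lborel) = 0"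
  shows "AE x in lborel. f x = 0"
proof -
  have AEn: "AE x in lborel. indicator (box (- (real n *\<^sub>R One)) (real n *\<^sub>R One)) x * f x = 0"
      for n
  proof -
    define l u :: 'a where "l = - (real n *\<^sub>R One)" and "u = real n *\<^sub>R One"
    define h where "h x = indicator (box l u) x * f x" for x
    obtain R where R: "box l u \<subseteq> cball 0 R"
      using bounded_box[of l u] unfolding bounded_iff by (auto simp: subset_iff)
    have inth: "integrable lborel h"
    proof (rule Bochner_Integration.integrable_bound[OF int[of R]])
      show "AE x in lborel. norm (h x) \<le> norm (indicator (cball 0 R) x * f x)"
        using R by (intro AE_I2) (auto simp: h_def indicator_def)
    qed (simp_all add: h_def[abs_def])
    have "set_lebesgue_integral lborel A h = 0" if "A \<in> sets lborel" for A
    proof -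
      let ?G = "range (\<lambda>(a, b). box a b :: 'a set)"
      have "A \<in> sigma_sets UNIV ?G"
        using that by (simp add: borel_eq_box)
      have "Int_stable ?G" "?G \<subseteq> Pow UNIV" by (auto simp: Int_stable_def box_Int_box)
      from this \<open>A \<in> sigma_sets UNIV ?G\<close> show ?thesis
      proof (induction rule: sigma_sets_induct_disjoint)
        case (basic A)
        then obtain a b where A: "A = box a b" by auto
        \<comment> \<open>The cutoff box intersected with a box of the generator is again a box, so
          the hypothesis on boxes still applies to \<open>h\<close>.\<close>
        have "indicator A x *\<^sub>R h x = indicator (box (\<Sum>i\<in>Basis. max (a\<bullet>i) (l\<bullet>i) *\<^sub>R i) (\<Sum>i\<in>Basis.
            min (b\<bullet>i) (u\<bullet>i) *\<^sub>R i)) x * f x" for x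
          unfolding A h_def box_Int_box[symmetric] by (simp add: indicator_def)
        then show ?case unfolding set_lebesgue_integral_def by (simp only: box)
      next
        case empty
        then show ?case by (simp add: set_lebesgue_integral_def)
      next
        case (compl A)
        have A: "A \<in> sets lborel" using compl(1) by (simp add: borel_eq_box)
        have "set_lebesgue_integral lborel (UNIV - A) h = (\<integral>x. h x - indicator A x *\<^sub>R h x \<partial>lborel)"
          unfolding set_lebesgue_integral_def by (intro Bochner_Integration.integral_cong) (auto
              simp: indicator_def)
        also have "\<dots> = (\<integral>x. h x \<partial>lborel) - (\<integral>x. indicator A x *\<^sub>R h x \<partial>lborel)"
          using A by (intro Bochner_Integration.integral_diff inth integrable_mult_indicator) auto
        also have "\<dots> = 0"
          using compl(2) box[of l u] by (simp add: set_lebesgue_integral_def h_def)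
        finally show ?case .
      next
        case (union A)
        then have A: "A i \<in> sets lborel" for i by (simp add: borel_eq_box image_subset_iff)
        have "set_lebesgue_integral lborel (\<Union>i. A i) h = (\<Sum>i. set_lebesgue_integral lborel (A i) h)"
        proof (rule lebesgue_integral_countable_add)
          show "set_integrable lborel (\<Union> (range A)) h"
            unfolding set_integrable_def using A by (intro integrable_mult_indicator inth) auto
        qed (use A union in \<open>auto simp: disjoint_family_on_def\<close>)
        then show ?case using union by simp
      qed
    qed
    from sigma_finite_measure.density_zero[OF sigma_finite_lborel inth this] show ?thesis
        by (simp add: h_def l_def u_def)
  qed
  have "AE x in lborel. \<forall>n. indicator (box (- (real n *\<^sub>R One)) (real n *\<^sub>R One)) x * f x = 0"
    using AEn by (subst AE_all_countable) blast
  then show ?thesis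
  proof eventually_elim
    case (elim x)
    have "x \<in> (\<Union>n::nat. box (- (real n *\<^sub>R One)) (real n *\<^sub>R One))"
      by (simp only: UN_box_eq_UNIV UNIV_I)
    then show ?case using elim by (auto simp: indicator_def split: if_splits)
  qed
qed

text \<open>The fundamental lemma of the calculus of variations. The bumps of a box are bounded by
  1, vanish outside it and tend to its indicator, so dominated convergence reduces test functions to
  boxes.\<close>

lemma AE_zero_if_test_integrals_zero:
  fixes f :: "'a::euclidean_space \<Rightarrow> real"
  assumes [measurable]: "f \<in> borel_measurable borel"
    and int: "\<And>R. integrable lborel (\<lambda>x. indicator (cball 0 R) x * f x)"
    and test: "\<And>\<phi>. test_function \<phi> \<Longrightarrow> (\<integral>x. f x * \<phi> x \<partial>lborel) = 0"
  shows "AE x in lborel. f x = 0"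
proof (rule AE_zero_if_box_integrals_zero)
  fix a b :: 'a
  obtain R where R: "box a b \<subseteq> cball 0 R"
    using bounded_box[of a b] unfolding bounded_iff by (auto simp: subset_iff)
  have [measurable]: "bump c a b \<in> borel_measurable borel" if "c > 0" for c
    using test_function_continuous[OF test_function_bump[OF that]]
        by (rule borel_measurable_continuous_onI)
  have "(\<lambda>n. \<integral>x. f x * bump (real (Suc n)) a b x \<partial>lborel) \<longlonglongrightarrow> (\<integral>x. f x * indicator (box a b)
      x \<partial>lborel)"
  proof (rule integral_dominated_convergence)
    show "integrable lborel (\<lambda>x. norm (indicator (cball 0 R) x * f x))"
      using int by (rule integrable_norm)
    show "AE x in lborel. (\<lambda>n. f x * bump (real (Suc n)) a b x) \<longlonglongrightarrow> f x * indicator (box a b) x"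
      by (intro AE_I2 tendsto_mult tendsto_const bump_tendsto)
    show "AE x in lborel. norm (f x * bump (real (Suc n)) a b x) \<le> norm (indicator (cball 0 R) x * f
        x)" for n
    proof (rule AE_I2)
      fix x
      show "norm (f x * bump (real (Suc n)) a b x) \<le> norm (indicator (cball 0 R) x * f x)"
      proof (cases "x \<in> box a b")
        case True
        then show ?thesis using R bump_nonneg[of "real (Suc n)" a b x] bump_le1[of "real (Suc n)" a
            b x]
          by (auto simp: abs_mult indicator_def intro!: mult_left_le)
      next
        case False
        then show ?thesis by (simp add: bump_outside)
      qed
    qed
  qed auto
  moreover have "(\<integral>x. f x * bump (real (Suc n)) a b x \<partial>lborel) = 0" for n
    by (intro test test_function_bump) simp
  ultimately have "(\<integral>x. f x * indicator (box a b) x \<partial>lborel) = 0"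
    by (simp add: LIMSEQ_const_iff)
  then show "(\<integral>x. indicator (box a b) x * f x \<partial>lborel) = 0" by (simp add: mult.commute)
qed (use int in auto)

text \<open>Fubini and the changes of variables are carried out for Borel functions on
  \<open>lborel\<close>, while members of \<open>H1\<close> are only Lebesgue measurable. The
  representative is built coordinate by coordinate.\<close>

lemma lebesgue_borel_representative:
  fixes u :: "'a::euclidean_space \<Rightarrow> 'b::euclidean_space"
  assumes "u \<in> borel_measurable lebesgue"
  obtains u' where "u' \<in> borel_measurable borel" "AE x in lborel. u x = u' x"
proof -
  have "\<exists>h. h \<in> borel_measurable lborel \<and> (AE x in lborel. u x \<bullet> b = h x)" for b
  proof -
    have "(\<lambda>x. u x \<bullet> b) \<in> borel_measurable lebesgue"
      using assms by simp
    from completion_ex_borel_measurable_real[OF this] show ?thesis by blast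
  qed
  then obtain h where h: "\<And>b. h b \<in> borel_measurable lborel" "\<And>b. AE x in lborel. u x \<bullet> b = h b x"
    by metis
  have "AE x in lborel. \<forall>b\<in>Basis. u x \<bullet> b = h b x"
    using h(2) by (intro AE_finite_allI) auto
  then have "AE x in lborel. u x = (\<Sum>b\<in>Basis. h b x *\<^sub>R b)"
  proof eventually_elim
    case (elim x)
    then have "(\<Sum>b\<in>Basis. h b x *\<^sub>R b) = (\<Sum>b\<in>Basis. (u x \<bullet> b) *\<^sub>R b)"
      by (intro sum.cong) auto
    then show ?case by (simp add: euclidean_representation)
  qed
  moreover have "(\<lambda>x. \<Sum>b\<in>Basis. h b x *\<^sub>R b) \<in> borel_measurable borel"
    using h(1) by simp
  ultimately show ?thesis by (intro that)
qed

text \<open>The variance of \<open>k\<close> under the probability density \<open>\<rho>\<close> is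
  nonnegative. If the right side is infinite there is nothing to show; otherwise
  \<open>\<bar>k x\<bar> \<le> 1 + (k x)\<^sup>2\<close> makes the mean well defined.\<close>

lemma jensen_square:
  fixes k \<rho> :: "'a \<Rightarrow> real"
  assumes [measurable]: "k \<in> borel_measurable M" "\<rho> \<in> borel_measurable M"
    and \<rho>: "\<And>x. \<rho> x \<ge> 0" "integrable M \<rho>" "(\<integral>x. \<rho> x \<partial>M) = 1"
  shows "ennreal ((\<integral>x. k x * \<rho> x \<partial>M)\<^sup>2) \<le> (\<integral>\<^sup>+x. ennreal ((k x)\<^sup>2 * \<rho> x) \<partial>M)"
proof (cases "(\<integral>\<^sup>+x. ennreal ((k x)\<^sup>2 * \<rho> x) \<partial>M) = \<infinity>")
  case False
  have int2: "integrable M (\<lambda>x. (k x)\<^sup>2 * \<rho> x)"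
    using False \<rho>(1) by (intro integrableI_nonneg) (auto simp: top.not_eq_extremum)
  have int1: "integrable M (\<lambda>x. k x * \<rho> x)"
  proof (rule Bochner_Integration.integrable_bound)
    show "integrable M (\<lambda>x. \<rho> x + (k x)\<^sup>2 * \<rho> x)" using int2 \<rho> by simp
    show "AE x in M. norm (k x * \<rho> x) \<le> norm (\<rho> x + (k x)\<^sup>2 * \<rho> x)"
    proof (rule AE_I2)
      fix x
      have "\<bar>k x\<bar> \<le> 1 + (k x)\<^sup>2"
        using sum_power2_ge_zero[of "\<bar>k x\<bar> - 1" 0] zero_le_power2[of "k x"]
            by (simp add: power2_eq_square algebra_simps)
      then have "\<bar>k x\<bar> * \<rho> x \<le> (1 + (k x)\<^sup>2) * \<rho> x" by (intro mult_right_mono \<rho>)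
      then show "norm (k x * \<rho> x) \<le> norm (\<rho> x + (k x)\<^sup>2 * \<rho> x)"
        using \<rho>(1)[of x] by (simp add: abs_mult algebra_simps)
    qed
  qed auto
  define m where "m = (\<integral>x. k x * \<rho> x \<partial>M)"
  have "0 \<le> (\<integral>x. (k x - m)\<^sup>2 * \<rho> x \<partial>M)"
    using \<rho>(1) by (intro Bochner_Integration.integral_nonneg) auto
  also have "\<dots> = (\<integral>x. (k x)\<^sup>2 * \<rho> x - 2 * m * (k x * \<rho> x) + m\<^sup>2 * \<rho> x \<partial>M)"
    by (intro Bochner_Integration.integral_cong refl) (simp add: power2_diff algebra_simps)
  also have "\<dots> = (\<integral>x. (k x)\<^sup>2 * \<rho> x \<partial>M) - 2 * m * m + m\<^sup>2"
    using int1 int2 \<rho> by (simp add: m_def)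
  finally have "m\<^sup>2 \<le> (\<integral>x. (k x)\<^sup>2 * \<rho> x \<partial>M)" by (simp add: power2_eq_square)
  then have "ennreal (m\<^sup>2) \<le> ennreal (\<integral>x. (k x)\<^sup>2 * \<rho> x \<partial>M)" by (rule ennreal_leI)
  also have "\<dots> = (\<integral>\<^sup>+x. ennreal ((k x)\<^sup>2 * \<rho> x) \<partial>M)"
    using int2 \<rho>(1) by (subst nn_integral_eq_integral) auto
  finally show ?thesis by (simp add: m_def)
qed simp

text \<open>The values lie in \<open>ennreal\<close> so that Fatou's lemma and Tonelli's theorem
  apply before integrability is known.\<close>

definition sqnorm :: "('a::euclidean_space \<Rightarrow> 'b::euclidean_space) \<Rightarrow> ennreal" where
  "sqnorm f = (\<integral>\<^sup>+x. ennreal ((norm (f x))\<^sup>2) \<partial>lborel)"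

text \<open>Only the duality identity of \<open>has_weak_gradient\<close>, transferred to
  \<open>lborel\<close>; integrability is supplied separately, by bounds on \<open>sqnorm\<close> or
  by local integrability.\<close>

definition weak_grad :: "('a::euclidean_space \<Rightarrow> real) \<Rightarrow> ('a \<Rightarrow> 'a) \<Rightarrow> bool" where
  "weak_grad u g \<longleftrightarrow> (\<forall>\<phi>. test_function \<phi> \<longrightarrow> (\<forall>v\<in>Basis.
     (\<integral>x. u x * frechet_derivative \<phi> (at x) v \<partial>lborel) = - (\<integral>x. (g x \<bullet> v) * \<phi> x \<partial>lborel)))"

lemma sqnorm_component_le:
  assumes [measurable]: "g \<in> borel_measurable borel" and "norm v \<le> 1"
  shows "sqnorm (\<lambda>x. g x \<bullet> v) \<le> sqnorm g"
  unfolding sqnorm_def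
proof (intro nn_integral_mono ennreal_leI power_mono norm_ge_zero)
  fix x show "norm (g x \<bullet> v) \<le> norm (g x)"
    using Cauchy_Schwarz_ineq2[of "g x" v] mult_left_mono[OF assms(2) norm_ge_zero[of "g x"]]
        by simp
qed

lemma integrable_sqnorm:
  fixes f :: "'a::euclidean_space \<Rightarrow> 'b::euclidean_space"
  assumes [measurable]: "f \<in> borel_measurable borel" and "sqnorm f < \<infinity>"
  shows "integrable lborel (\<lambda>x. (norm (f x))\<^sup>2)"
  using assms by (intro integrableI_nonneg) (auto simp: sqnorm_def)

lemma sqnorm_compact_support_finite:
  fixes f :: "'a::euclidean_space \<Rightarrow> real"
  assumes "continuous_on UNIV f" "\<And>x. norm x \<ge> R \<Longrightarrow> f x = 0"
  shows "sqnorm f < \<infinity>"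
proof -
  have "integrable lborel (\<lambda>x. (f x)\<^sup>2)"
    by (rule integrable_compact_support[where R = R]) (auto intro!: continuous_intros assms)
  then show ?thesis by (auto simp: sqnorm_def real_integrable_def top.not_eq_extremum)
qed

lemma integrable_times_bounded_support:
  fixes u \<phi> :: "'a::euclidean_space \<Rightarrow> real"
  assumes [measurable]: "u \<in> borel_measurable borel" "\<phi> \<in> borel_measurable borel"
    and u: "sqnorm u < \<infinity>" and C: "\<And>x. \<bar>\<phi> x\<bar> \<le> C" and R: "\<And>x. norm x \<ge> R \<Longrightarrow> \<phi> x = 0"
  shows "integrable lborel (\<lambda>x. u x * \<phi> x)"
proof (rule Bochner_Integration.integrable_bound)
  have "integrable lborel (\<lambda>x. (u x)\<^sup>2)"
    using integrable_sqnorm[OF assms(1) u] by simp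
  moreover have "integrable lborel (indicator (cball 0 R) :: 'a \<Rightarrow> real)"
    using emeasure_lborel_cball_finite[of 0 R] by (simp add: integrable_indicator_iff)
  ultimately show "integrable lborel (\<lambda>x. C * ((u x)\<^sup>2 + indicator (cball 0 R) x))" by auto
  have "C \<ge> 0" using C[of 0] by linarith
  show "AE x in lborel. norm (u x * \<phi> x) \<le> norm (C * ((u x)\<^sup>2 + indicator (cball 0 R) x))"
  proof (rule AE_I2)
    fix x
    show "norm (u x * \<phi> x) \<le> norm (C * ((u x)\<^sup>2 + indicator (cball 0 R) x))"
    proof (cases "norm x \<le> R")
      case True
      have "\<bar>u x\<bar> \<le> (u x)\<^sup>2 + 1"
        using zero_le_power2[of "\<bar>u x\<bar> - 1"] zero_le_power2[of "u x"] unfolding power2_diff by simp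
      then have "\<bar>u x\<bar> * \<bar>\<phi> x\<bar> \<le> ((u x)\<^sup>2 + 1) * C"
        using C by (intro mult_mono) auto
      then show ?thesis using True \<open>C \<ge> 0\<close> by (simp add: abs_mult mult.commute)
    next
      case False
      then show ?thesis using R by simp
    qed
  qed
qed auto

lemma C_k_translate: "C_k k f \<Longrightarrow> C_k k (\<lambda>x. f (x - c))"
proof (induction k arbitrary: f)
  case 0
  then have "continuous_on UNIV f" by simp
  then have "continuous_on UNIV (\<lambda>x. f (x - c))"
    by (rule continuous_on_compose2) (auto intro!: continuous_intros)
  then show ?case by simp
next
  case (Suc k)
  show ?case
  proof (rule C_kI)
    show "((\<lambda>x. f (x - c)) has_derivative frechet_derivative f (at (x - c))) (at x)" for x
    proof -
      have "((\<lambda>x. x - c) has_derivative (\<lambda>v. v)) (at x)"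
        by (auto intro!: derivative_eq_intros)
      from has_derivative_compose[OF this C_k_Suc_has_derivative[OF Suc.prems, of "x - c"]]
      show ?thesis by (simp add: o_def)
    qed
    show "C_k k (\<lambda>x. frechet_derivative f (at (x - c)) v)" if "v \<in> Basis" for v
      using Suc.prems that by (intro Suc.IH) simp
  qed
qed

lemma test_function_translate:
  assumes "test_function \<phi>" shows "test_function (\<lambda>x. \<phi> (x - c))"
proof -
  obtain R where R: "\<And>x. norm x \<ge> R \<Longrightarrow> \<phi> x = 0"
    using test_function_support[OF assms] by metis
  have "{x. \<phi> (x - c) \<noteq> 0} \<subseteq> ball c R"
    using R by (force simp: dist_norm norm_minus_commute)
  then have "bounded {x. \<phi> (x - c) \<noteq> 0}" using bounded_ball bounded_subset by blast
  then show ?thesis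
    using assms by (auto simp: test_function_def C_k_translate compact_closure)
qed

lemma frechet_derivative_translate:
  assumes "test_function \<phi>"
  shows "frechet_derivative (\<lambda>x. \<phi> (x - c)) (at x) = frechet_derivative \<phi> (at (x - c))"
proof -
  have "((\<lambda>x. x - c) has_derivative (\<lambda>v. v)) (at x)"
    by (auto intro!: derivative_eq_intros)
  from has_derivative_compose[OF this test_function_has_derivative[OF assms, of "x - c"]]
  show ?thesis by (simp add: o_def frechet_derivative_at[symmetric])
qed

lemma test_function_measurable:
  assumes "test_function \<phi>"
  shows "\<phi> \<in> borel_measurable borel" "(\<lambda>x. frechet_derivative \<phi> (at x) v) \<in> borel_measurable borel"
  using assms by (auto intro: borel_measurable_continuous_onI test_function_continuous
      test_function_derivative_continuous)

lemma integrable_times_test: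
  assumes "u \<in> borel_measurable borel" "sqnorm u < \<infinity>" "test_function \<phi>"
  shows "integrable lborel (\<lambda>x. u x * \<phi> x)"
    "integrable lborel (\<lambda>x. u x * frechet_derivative \<phi> (at x) v)"
proof -
  obtain R where R: "\<And>x. norm x \<ge> R \<Longrightarrow> \<phi> x = 0" "\<And>x v. norm x \<ge> R \<Longrightarrow> frechet_derivative \<phi> (at x) v
      = 0"
    using test_function_support[OF assms(3)] by metis
  obtain C where C: "\<And>x. \<bar>\<phi> x\<bar> \<le> C"
    using compact_support_bounded[OF test_function_continuous[OF assms(3)], of R] R by metis
  obtain D where D: "\<And>x. \<bar>frechet_derivative \<phi> (at x) v\<bar> \<le> D"
    using compact_support_bounded[OF test_function_derivative_continuous[OF assms(3)], of R v] R
        by metis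
  show "integrable lborel (\<lambda>x. u x * \<phi> x)"
    using assms C R by (intro integrable_times_bounded_support[where C = C
        and R = R]) (auto intro: test_function_measurable)
  show "integrable lborel (\<lambda>x. u x * frechet_derivative \<phi> (at x) v)"
    using assms D R by (intro integrable_times_bounded_support[where C = D
        and R = R]) (auto intro: test_function_measurable)
qed

text \<open>The definition tests basis directions only. Translations by an arbitrary vector
  \<open>z\<close> need the identity in direction \<open>z\<close>, and both sides are linear in
  it.\<close>

lemma weak_grad_direction:
  fixes z :: "'a::euclidean_space"
  assumes [measurable]: "u \<in> borel_measurable borel" "g \<in> borel_measurable borel"
    and L2: "sqnorm u < \<infinity>" "sqnorm g < \<infinity>" and wg: "weak_grad u g" and \<phi>: "test_function \<phi>"
  shows "(\<integral>x. u x * frechet_derivative \<phi> (at x) z \<partial>lborel) = - (\<integral>x. (g x \<bullet> z) * \<phi> x \<partial>lborel)"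
proof -
  note eq = frechet_derivative_expand[OF \<phi>, of _ z]
  have gi: "sqnorm (\<lambda>x. g x \<bullet> i) < \<infinity>" if "i \<in> Basis" for i
    using sqnorm_component_le[of g i] L2(2) that by (auto simp: order_le_less_trans)
  have "(\<integral>x. u x * frechet_derivative \<phi> (at x) z \<partial>lborel)
      = (\<integral>x. (\<Sum>i\<in>Basis. (z \<bullet> i) * (u x * frechet_derivative \<phi> (at x) i)) \<partial>lborel)"
    by (subst eq) (simp add: sum_distrib_left algebra_simps)
  also have "\<dots> = (\<Sum>i\<in>Basis. (z \<bullet> i) * (\<integral>x. u x * frechet_derivative \<phi> (at x) i \<partial>lborel))"
    by (subst Bochner_Integration.integral_sum)
      (use integrable_times_test(2)[OF assms(1) L2(1) \<phi>] in auto)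
  also have "\<dots> = (\<Sum>i\<in>Basis. (z \<bullet> i) * - (\<integral>x. (g x \<bullet> i) * \<phi> x \<partial>lborel))"
    using wg \<phi> by (intro sum.cong) (auto simp: weak_grad_def)
  also have "\<dots> = - (\<integral>x. (\<Sum>i\<in>Basis. (z \<bullet> i) * ((g x \<bullet> i) * \<phi> x)) \<partial>lborel)"
    by (subst Bochner_Integration.integral_sum)
      (use integrable_times_test(1)[OF _ gi \<phi>] in \<open>auto simp: sum_negf\<close>)
  also have "(\<lambda>x. \<Sum>i\<in>Basis. (z \<bullet> i) * ((g x \<bullet> i) * \<phi> x)) = (\<lambda>x. (g x \<bullet> z) * \<phi> x)"
    by (rule ext, subst (3) euclidean_inner) (simp add: sum_distrib_left sum_distrib_right
        algebra_simps)
  finally show ?thesis .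
qed


lemma sqnorm_translate:
  assumes [measurable]: "g \<in> borel_measurable borel"
  shows "sqnorm (\<lambda>x. g (x + c)) = sqnorm g"
  unfolding sqnorm_def by (rule nn_integral_lborel_translate) measurable

lemma test_function_segment:
  assumes "test_function \<phi>"
  shows "\<phi> (x - z) - \<phi> x = - (\<integral>t. indicator {0..1} t * frechet_derivative \<phi> (at (x
      - t *\<^sub>R z)) z \<partial>lborel)"
proof -
  have "(\<integral>t. indicator {0..1} t *\<^sub>R (- frechet_derivative \<phi> (at (x - t *\<^sub>R z)) z) \<partial>lborel) = \<phi> (x
      - 1 *\<^sub>R z) - \<phi> (x - 0 *\<^sub>R z)"
  proof (rule integral_FTC_atLeastAtMost)
    fix t :: real
    have "((\<lambda>t. x - t *\<^sub>R z) has_derivative (\<lambda>s. - s *\<^sub>R z)) (at t within {0..1})"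
      by (auto intro!: derivative_eq_intros)
    from has_derivative_compose[OF this test_function_has_derivative[OF assms, of "x - t *\<^sub>R z"]]
    have d: "((\<lambda>t. \<phi> (x - t *\<^sub>R z)) has_derivative (\<lambda>s. frechet_derivative \<phi> (at (x
        - t *\<^sub>R z)) (- s *\<^sub>R z))) (at t within {0..1})"
      by (simp add: o_def)
    have lin: "linear (frechet_derivative \<phi> (at (x - t *\<^sub>R z)))"
      using test_function_has_derivative[OF assms] has_derivative_linear by blast
    have "frechet_derivative \<phi> (at (x - t *\<^sub>R z)) (- s *\<^sub>R z) = s *\<^sub>R (- frechet_derivative \<phi> (at (x
        - t *\<^sub>R z)) z)" for s
      using linear_cmul[OF lin, of "- s" z] by simp
    then show "((\<lambda>t. \<phi> (x - t *\<^sub>R z)) has_vector_derivative - frechet_derivative \<phi> (at (x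
        - t *\<^sub>R z)) z) (at t within {0..1})"
      using d by (simp add: has_vector_derivative_def)
  next
    show "continuous_on {0..1} (\<lambda>t. - frechet_derivative \<phi> (at (x - t *\<^sub>R z)) z)"
      by (intro continuous_on_minus continuous_on_compose2[OF test_function_derivative_continuous[OF
          assms, of z]])
        (auto intro!: continuous_intros)
  qed simp
  then show ?thesis by simp
qed

text \<open>Supplies the integrability that Fubini asks for when a segment average of
  \<open>G\<close> is paired with a bounded function of compact support.\<close>

lemma integrable_product_square:
  fixes G :: "'a::euclidean_space \<Rightarrow> real" and z :: 'a
  assumes [measurable]: "G \<in> borel_measurable borel" "\<psi> \<in> borel_measurable borel"
      and G: "sqnorm G < \<infinity>"
    and C: "\<And>x. \<bar>\<psi> x\<bar> \<le> C" and R: "\<And>x. norm x \<ge> R \<Longrightarrow> \<psi> x = 0"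
  shows "integrable (lborel \<Otimes>\<^sub>M lborel) (\<lambda>p. indicator {0..1} (fst p) * (G (snd p
      + fst p *\<^sub>R z) * \<psi> (snd p)) :: real)"
proof (rule integrableI_bounded)
  have [measurable]: "cball (0::'a) R \<in> sets borel" by simp
  have "C \<ge> 0" using C[of 0] by linarith
  have bnd: "\<bar>G y * \<psi> x\<bar> \<le> C * ((norm (G y))\<^sup>2 + indicator (cball 0 R) x)" for x y
  proof (cases "norm x \<le> R")
    case True
    have "\<bar>G y\<bar> \<le> (G y)\<^sup>2 + 1"
      using zero_le_power2[of "\<bar>G y\<bar> - 1"] zero_le_power2[of "G y"] unfolding power2_diff by simp
    then have "\<bar>G y\<bar> * \<bar>\<psi> x\<bar> \<le> ((G y)\<^sup>2 + 1) * C"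
      using C by (intro mult_mono) auto
    then show ?thesis using True by (simp add: abs_mult mult.commute)
  next
    case False
    then show ?thesis using R \<open>C \<ge> 0\<close> by simp
  qed
  have "(\<integral>\<^sup>+p. ennreal (norm (indicator {0..1} (fst p) * (G (snd p + fst p *\<^sub>R z) * \<psi> (snd p)) ::
      real)) \<partial>(lborel \<Otimes>\<^sub>M lborel))
      = (\<integral>\<^sup>+t. \<integral>\<^sup>+x. ennreal (indicator {0..1} t * \<bar>G (x + t *\<^sub>R z) * \<psi> x\<bar>) \<partial>lborel \<partial>lborel)"
    by (subst lborel.nn_integral_fst[symmetric]) (auto simp: abs_mult)
  also have "\<dots> \<le> (\<integral>\<^sup>+t. \<integral>\<^sup>+x. indicator {0..1} t * (ennreal C * (ennreal ((norm (G (x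
      + t *\<^sub>R z)))\<^sup>2) + indicator (cball 0 R) x)) \<partial>lborel \<partial>lborel)"
  proof (intro nn_integral_mono)
    fix t :: real and x :: 'a
    have "ennreal \<bar>G (x + t *\<^sub>R z) * \<psi> x\<bar> \<le> ennreal (C * ((norm (G (x + t *\<^sub>R z)))\<^sup>2
        + indicator (cball 0 R) x))"
      by (intro ennreal_leI bnd)
    also have "\<dots> = ennreal C * (ennreal ((norm (G (x + t *\<^sub>R z)))\<^sup>2) + indicator (cball 0 R) x)"
      using \<open>C \<ge> 0\<close> by (simp add: ennreal_mult ennreal_indicator)
    finally show "ennreal (indicator {0..1} t * \<bar>G (x + t *\<^sub>R z) * \<psi> x\<bar>)
        \<le> indicator {0..1} t * (ennreal C * (ennreal ((norm (G (x + t *\<^sub>R z)))\<^sup>2)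
        + indicator (cball 0 R) x))"
      by (auto simp: indicator_def)
  qed
  also have "\<dots> = (\<integral>\<^sup>+t. indicator {0..1} (t::real) * (ennreal C * (sqnorm G
      + emeasure lborel (cball (0::'a) R))) \<partial>lborel)"
  proof (intro nn_integral_cong)
    fix t :: real
    have "(\<integral>\<^sup>+x. indicator {0..1} t * (ennreal C * (ennreal ((norm (G (x + t *\<^sub>R z)))\<^sup>2)
        + indicator (cball 0 R) x)) \<partial>lborel)
       = indicator {0..1} t * (ennreal C * (sqnorm (\<lambda>x. G (x + t *\<^sub>R z))
           + emeasure lborel (cball (0::'a) R)))"
      unfolding sqnorm_def
      by (subst nn_integral_cmult, measurable)+ (subst nn_integral_add, auto)
    then show "(\<integral>\<^sup>+x. indicator {0..1} t * (ennreal C * (ennreal ((norm (G (x + t *\<^sub>R z)))\<^sup>2)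
        + indicator (cball 0 R) x)) \<partial>lborel)
       = indicator {0..1} t * (ennreal C * (sqnorm G + emeasure lborel (cball (0::'a) R)))"
      by (simp add: sqnorm_translate)
  qed
  also have "\<dots> = ennreal C * (sqnorm G + emeasure lborel (cball (0::'a) R))"
    by (subst nn_integral_multc) auto
  also have "\<dots> < \<infinity>"
    using G emeasure_lborel_cball_finite[of "0::'a" R] by (simp add: ennreal_mult_less_top)
  finally show "(\<integral>\<^sup>+p. ennreal (norm (indicator {0..1} (fst p) * (G (snd p
      + fst p *\<^sub>R z) * \<psi> (snd p)) :: real)) \<partial>(lborel \<Otimes>\<^sub>M lborel)) < \<infinity>" .
qed measurable

text \<open>Almost everywhere \<open>u (x + z) - u x\<close> is the average of
  \<open>g \<bullet> z\<close> over the segment from \<open>x\<close> to \<open>x + z\<close>. For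
  smooth functions this is the fundamental theorem of calculus; here it is verified against test
  functions. Jensen's inequality and translation invariance then bound the average.\<close>

lemma sqnorm_difference_le:
  fixes u :: "'a::euclidean_space \<Rightarrow> real" and z :: 'a
  assumes [measurable]: "u \<in> borel_measurable borel" "g \<in> borel_measurable borel"
    and L2: "sqnorm u < \<infinity>" "sqnorm g < \<infinity>" and wg: "weak_grad u g"
  shows "sqnorm (\<lambda>x. u (x + z) - u x) \<le> sqnorm (\<lambda>x. g x \<bullet> z)"
proof -
  define G where "G x = g x \<bullet> z" for x
  have [measurable]: "G \<in> borel_measurable borel" by (simp add: G_def[abs_def])
  have G: "sqnorm G < \<infinity>"
  proof -
    have "sqnorm G \<le> ennreal ((norm z)\<^sup>2) * sqnorm g"
      unfolding sqnorm_def
    proof (subst nn_integral_cmult[symmetric], simp, intro nn_integral_mono)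
      fix x
      have "\<bar>G x\<bar> \<le> norm z * norm (g x)"
        using Cauchy_Schwarz_ineq2[of "g x" z] by (simp add: G_def mult.commute)
      from power_mono[OF this, of 2] show "ennreal ((norm (G x))\<^sup>2) \<le> ennreal ((norm z)\<^sup>2) * ennreal
          ((norm (g x))\<^sup>2)"
        by (simp add: ennreal_mult[symmetric] power_mult_distrib ennreal_leI)
    qed
    also have "\<dots> < \<infinity>" using L2(2) by (simp add: ennreal_mult_less_top)
    finally show ?thesis .
  qed
  define F where "F x = (\<integral>t. G (x + t *\<^sub>R z) * indicator {0..1} t \<partial>lborel)" for x
  have [measurable]: "F \<in> borel_measurable borel" unfolding F_def[abs_def] by measurable
  have F2: "sqnorm F \<le> sqnorm G"
  proof -
    have "sqnorm F \<le> (\<integral>\<^sup>+x. \<integral>\<^sup>+t. ennreal ((G (x + t *\<^sub>R z))\<^sup>2 * indicator {0..1}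
        t) \<partial>lborel \<partial>lborel)"
      unfolding sqnorm_def F_def real_norm_def power2_abs
      by (intro nn_integral_mono jensen_square) auto
    also have "\<dots> = (\<integral>\<^sup>+t. \<integral>\<^sup>+x. ennreal ((G (x + t *\<^sub>R z))\<^sup>2 * indicator {0..1} t) \<partial>lborel \<partial>lborel)"
      by (rule lborel_pair.Fubini'[symmetric]) measurable
    also have "\<dots> = (\<integral>\<^sup>+t. sqnorm G * indicator {0..1} (t::real) \<partial>lborel)"
    proof (rule nn_integral_cong)
      fix t :: real
      show "(\<integral>\<^sup>+x. ennreal ((G (x + t *\<^sub>R z))\<^sup>2 * indicator {0..1} t) \<partial>lborel)
          = sqnorm G * indicator {0..1} t"
        using sqnorm_translate[of G "t *\<^sub>R z"]
        by (simp add: ennreal_mult ennreal_indicator nn_integral_multc sqnorm_def)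
    qed
    also have "\<dots> = sqnorm G" by (subst nn_integral_cmult_indicator) auto
    finally show ?thesis .
  qed
  define h where "h x = u (x + z) - u x - F x" for x
  have [measurable]: "h \<in> borel_measurable borel" by (simp add: h_def[abs_def])
  have loc: "integrable lborel (\<lambda>x. f x * indicator (cball 0 R) x)"
    if "f \<in> borel_measurable borel" "sqnorm f < \<infinity>" for f :: "'a \<Rightarrow> real" and R
    by (rule integrable_times_bounded_support[OF that(1) _ that(2), of _ 1 "R
        + 1"]) (auto simp: indicator_def)
  have uz: "sqnorm (\<lambda>x. u (x + z)) < \<infinity>" using sqnorm_translate[of u z] L2(1) by simp
  have Ffin: "sqnorm F < \<infinity>" using F2 G by (rule order_le_less_trans)
  have "AE x in lborel. h x = 0"
  proof (rule AE_zero_if_test_integrals_zero)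
    fix R :: real
    have "integrable lborel (\<lambda>x. u (x + z) * indicator (cball 0 R) x - u x * indicator (cball 0 R) x
        - F x * indicator (cball 0 R) x)"
      using loc[OF _ uz, of R] loc[OF _ L2(1), of R] loc[OF _ Ffin, of R] by simp
    then show "integrable lborel (\<lambda>x. indicator (cball 0 R) x * h x)"
      by (simp add: h_def algebra_simps)
  next
    fix \<phi> :: "'a \<Rightarrow> real" assume \<phi>: "test_function \<phi>"
    note [measurable] = test_function_measurable[OF \<phi>]
    obtain R where R: "\<And>x. norm x \<ge> R \<Longrightarrow> \<phi> x = 0" "\<And>x v. norm x \<ge> R \<Longrightarrow> frechet_derivative \<phi> (at x) v
        = 0"
      using test_function_support[OF \<phi>] by metis
    obtain C where C: "\<And>x. \<bar>\<phi> x\<bar> \<le> C"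
      using compact_support_bounded[OF test_function_continuous[OF \<phi>], of R] R by metis
    obtain D where D: "\<And>x. \<bar>frechet_derivative \<phi> (at x) z\<bar> \<le> D"
      using compact_support_bounded[OF test_function_derivative_continuous[OF \<phi>], of R z] R by metis
    let ?D = "\<lambda>y. frechet_derivative \<phi> (at y) z"
    have "D \<ge> 0" using D[of 0] by linarith
    \<comment> \<open>The translation is moved onto the test function, whose increment is a genuine
      segment integral.\<close>
    have "(\<integral>x. (u (x + z) - u x) * \<phi> x \<partial>lborel) = (\<integral>x. u (x + z) * \<phi> (x + z - z) \<partial>lborel)
        - (\<integral>x. u x * \<phi> x \<partial>lborel)"
      using integrable_times_test(1)[OF _ L2(1) \<phi>] integrable_times_test(1)[OF _ uz \<phi>]
      by (simp add: left_diff_distrib)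
    also have "(\<integral>x. u (x + z) * \<phi> (x + z - z) \<partial>lborel) = (\<integral>x. u x * \<phi> (x - z) \<partial>lborel)"
      by (rule integral_lborel_translate) measurable
    also have "\<dots> - (\<integral>x. u x * \<phi> x \<partial>lborel) = (\<integral>x. u x * (\<phi> (x - z) - \<phi> x) \<partial>lborel)"
      using integrable_times_test(1)[OF _ L2(1) \<phi>] integrable_times_test(1)[OF _ L2(1)
          test_function_translate[OF \<phi>, of z]]
      by (simp add: right_diff_distrib)
    also have "\<dots> = - (\<integral>x. (\<integral>t. indicator {0..1} t * (u x * ?D (x - t *\<^sub>R z)) \<partial>lborel) \<partial>lborel)"
      unfolding test_function_segment[OF \<phi>]
      by (simp add: mult.left_commute)
    also have "(\<integral>x. (\<integral>t. indicator {0..1} t * (u x * ?D (x - t *\<^sub>R z)) \<partial>lborel) \<partial>lborel)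
       = (\<integral>t. (\<integral>x. indicator {0..1} t * (u x * ?D (x - t *\<^sub>R z)) \<partial>lborel) \<partial>lborel)"
    proof (rule lborel_pair.Fubini_integral)
      have "integrable (lborel \<Otimes>\<^sub>M lborel) (\<lambda>p. indicator {0..1} (fst p) * (\<bar>u (snd p
          + fst p *\<^sub>R 0)\<bar> * (D * indicator (cball 0 (R + norm z)) (snd p))) :: real)"
        using L2(1) \<open>D \<ge> 0\<close>
        by (intro integrable_product_square[where C = D and R = "R + norm z + 1"])
          (auto simp: indicator_def sqnorm_def)
      then have "integrable (lborel \<Otimes>\<^sub>M lborel) (\<lambda>p. indicator {0..1} (fst p) * (u (snd p) * ?D (snd
          p - fst p *\<^sub>R z)) :: real)"
      proof (rule Bochner_Integration.integrable_bound)
        show "AE p in lborel \<Otimes>\<^sub>M lborel. norm (indicator {0..1} (fst p) * (u (snd p) * ?D (snd p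
            - fst p *\<^sub>R z)) :: real)
          \<le> norm (indicator {0..1} (fst p) * (\<bar>u (snd p + fst p *\<^sub>R 0)\<bar> * (D * indicator (cball 0 (R
              + norm z)) (snd p))) :: real)"
        proof (rule AE_I2)
          fix p :: "real \<times> 'a"
          define t x where "t = fst p" and "x = snd p"
          have "norm (indicator {0..1} t * (u x * ?D (x - t *\<^sub>R z))) \<le> norm (indicator {0..1} t *
              (\<bar>u (x + t *\<^sub>R 0)\<bar> * (D * indicator (cball 0 (R + norm z)) x)) :: real)"
          proof (cases "t \<in> {0..1} \<and> norm x > R + norm z")
            case True
            then have "norm (t *\<^sub>R z) \<le> norm z" by (simp add: mult_left_le_one_le)
            then have "norm (x - t *\<^sub>R z) \<ge> R" using True norm_triangle_ineq2[of x "t *\<^sub>R z"]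
                by linarith
            then show ?thesis using R by simp
          next
            case False
            then show ?thesis using D \<open>D \<ge> 0\<close> by (auto simp: indicator_def abs_mult intro!:
                mult_left_mono)
          qed
          then show "norm (indicator {0..1} (fst p) * (u (snd p) * ?D (snd p
              - fst p *\<^sub>R z)) :: real)
            \<le> norm (indicator {0..1} (fst p) * (\<bar>u (snd p + fst p *\<^sub>R 0)\<bar> * (D * indicator (cball 0
                (R + norm z)) (snd p))) :: real)" by (simp add: t_def x_def)
        qed
      qed measurable
      then show "integrable (lborel \<Otimes>\<^sub>M lborel) (\<lambda>(t, x). indicator {0..1} t * (u x * ?D (x
          - t *\<^sub>R z)))"
        by (simp add: split_beta')
    qed
    \<comment> \<open>For each fixed \<open>t\<close> the weak gradient is tested with the translate
      of \<open>\<phi>\<close> by \<open>t *\<^sub>R z\<close>.\<close>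
    also have "\<dots> = (\<integral>t. (\<integral>x. - (indicator {0..1} t * (G (x + t *\<^sub>R z) * \<phi> x)) \<partial>lborel) \<partial>lborel)"
    proof (rule Bochner_Integration.integral_cong[OF refl])
      fix t :: real
      have "(\<integral>x. u x * ?D (x - t *\<^sub>R z) \<partial>lborel) = - (\<integral>x. G x * \<phi> (x - t *\<^sub>R z) \<partial>lborel)"
        using weak_grad_direction[OF _ _ L2 wg test_function_translate[OF \<phi>, of "t *\<^sub>R z"], of z]
        by (simp add: frechet_derivative_translate[OF \<phi>] G_def)
      also have "(\<integral>x. G x * \<phi> (x - t *\<^sub>R z) \<partial>lborel) = (\<integral>x. G (x + t *\<^sub>R z) * \<phi> (x + t *\<^sub>R z
          - t *\<^sub>R z) \<partial>lborel)"
        by (rule integral_lborel_translate[symmetric]) measurable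
      finally show "(\<integral>x. indicator {0..1} t * (u x * ?D (x - t *\<^sub>R z)) \<partial>lborel)
          = (\<integral>x. - (indicator {0..1} t * (G (x + t *\<^sub>R z) * \<phi> x)) \<partial>lborel)"
        by simp
    qed
    also have "\<dots> = - (\<integral>t. (\<integral>x. indicator {0..1} t * (G (x + t *\<^sub>R z) * \<phi> x) \<partial>lborel) \<partial>lborel)"
      by simp
    also have "(\<integral>t. (\<integral>x. indicator {0..1} t * (G (x + t *\<^sub>R z) * \<phi> x) \<partial>lborel) \<partial>lborel)
       = (\<integral>x. (\<integral>t. indicator {0..1} t * (G (x + t *\<^sub>R z) * \<phi> x) \<partial>lborel) \<partial>lborel)"
    proof (rule lborel_pair.Fubini_integral[symmetric])
      have "integrable (lborel \<Otimes>\<^sub>M lborel) (\<lambda>p. indicator {0..1} (fst p) * (G (snd p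
          + fst p *\<^sub>R z) * \<phi> (snd p)) :: real)"
        by (rule integrable_product_square[where C = C and R = R]) (use G C R in auto)
      then show "integrable (lborel \<Otimes>\<^sub>M lborel) (\<lambda>(t, x). indicator {0..1} t * (G (x
          + t *\<^sub>R z) * \<phi> x))"
        by (simp add: split_beta')
    qed
    also have "\<dots> = (\<integral>x. F x * \<phi> x \<partial>lborel)"
    proof (rule Bochner_Integration.integral_cong[OF refl])
      fix x
      have "(\<integral>t. indicator {0..1} t * (G (x + t *\<^sub>R z) * \<phi> x) \<partial>lborel) = (\<integral>t. (G (x
          + t *\<^sub>R z) * indicator {0..1} t) * \<phi> x \<partial>lborel)"
        by (simp add: mult_ac)
      then show "(\<integral>t. indicator {0..1} t * (G (x + t *\<^sub>R z) * \<phi> x) \<partial>lborel) = F x * \<phi> x"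
        by (simp add: F_def)
    qed
    finally have eq: "(\<integral>x. (u (x + z) - u x) * \<phi> x \<partial>lborel) = (\<integral>x. F x * \<phi> x \<partial>lborel)" by simp
    have "integrable lborel (\<lambda>x. (u (x + z) - u x) * \<phi> x)"
      using integrable_times_test(1)[OF _ L2(1) \<phi>] integrable_times_test(1)[OF _ uz \<phi>]
      by (simp add: left_diff_distrib)
    then show "(\<integral>x. h x * \<phi> x \<partial>lborel) = 0"
      using eq integrable_times_test(1)[OF _ Ffin \<phi>]
      by (simp add: h_def left_diff_distrib[of _ "F _"])
  qed measurable
  then have "sqnorm (\<lambda>x. u (x + z) - u x) = sqnorm F"
    unfolding sqnorm_def h_def by (intro nn_integral_cong_AE) auto
  with F2 show ?thesis by (simp add: G_def[abs_def])
qed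

section \<open>The nonlocal Dirichlet energy\<close>

lemma nn_integral_lborel_scale:
  fixes f :: "'a::euclidean_space \<Rightarrow> ennreal"
  assumes [measurable]: "f \<in> borel_measurable borel" and "c > 0"
  shows "(\<integral>\<^sup>+x. f x \<partial>lborel) = ennreal (c ^ DIM('a)) * (\<integral>\<^sup>+x. f (c *\<^sub>R x) \<partial>lborel)"
proof -
  have "(\<integral>\<^sup>+x. f x \<partial>lborel) = (\<integral>\<^sup>+x. f x \<partial>density (distr lborel borel (\<lambda>x::'a. 0
      + c *\<^sub>R x)) (\<lambda>_. ennreal (\<bar>c\<bar> ^ DIM('a))))"
    using lborel_affine[of c "0::'a"] assms by simp
  also have "\<dots> = (\<integral>\<^sup>+x. ennreal (c ^ DIM('a)) * f (c *\<^sub>R x) \<partial>lborel)"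
    using assms(2) by (subst nn_integral_density) (auto simp: nn_integral_distr)
  finally show ?thesis by (simp add: nn_integral_cmult)
qed

text \<open>Reflection in the hyperplane \<open>x \<bullet> e = c\<close> when
  \<open>norm e = 1\<close>; for such \<open>e\<close> it is an isometric involution.\<close>

definition refl_hyp :: "'a::real_inner \<Rightarrow> real \<Rightarrow> 'a \<Rightarrow> 'a" where
  "refl_hyp e c x = x - (2 * (x \<bullet> e - c)) *\<^sub>R e"

lemma refl_hyp_invol: "norm e = 1 \<Longrightarrow> refl_hyp e c (refl_hyp e c x) = x"
  by (simp add: refl_hyp_def inner_diff_left norm_eq_1 algebra_simps)

lemma dist_refl_hyp:
  assumes "norm e = 1" shows "dist (refl_hyp e c x) (refl_hyp e c y) = dist x y"
proof -
  have eq: "refl_hyp e c x - refl_hyp e c y = (x - y) - (2 * ((x - y) \<bullet> e)) *\<^sub>R e"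
    by (simp add: refl_hyp_def inner_diff_left algebra_simps)
  have expand: "(a - t *\<^sub>R e) \<bullet> (a - t *\<^sub>R e) = a \<bullet> a - 2 * t * (a \<bullet> e) + t * t * (e \<bullet> e)" for a t
    by (simp add: inner_diff_left inner_diff_right inner_commute[of e a] algebra_simps)
  have "norm ((x - y) - (2 * ((x - y) \<bullet> e)) *\<^sub>R e) = norm (x - y)"
    unfolding norm_eq_sqrt_inner expand using assms by (simp add: norm_eq_1)
  then show ?thesis by (simp add: dist_norm eq)
qed

lemma measurable_refl_hyp [measurable]: "refl_hyp (e::'a::euclidean_space) c
    \<in> borel_measurable borel"
  unfolding refl_hyp_def[abs_def] by measurable

lemma refl_hyp_0_orthogonal:
  assumes "norm e = 1" shows "orthogonal_transformation (refl_hyp e 0)"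
  unfolding orthogonal_transformation
proof
  show "linear (refl_hyp e 0)"
    by (rule linearI) (simp_all add: refl_hyp_def inner_add_left algebra_simps)
  show "\<forall>v. norm (refl_hyp e 0 v) = norm v"
    using dist_refl_hyp[OF assms, of 0 _ 0] by (simp add: refl_hyp_def dist_norm)
qed

text \<open>An involution has equal preimages and images, so the preimage of a box is its image
  under an orthogonal map and has the same measure; the measures of boxes determine
  \<open>lborel\<close>.\<close>

lemma lborel_distr_refl_0:
  assumes "norm (e::real^2) = 1" shows "distr lborel borel (refl_hyp e 0) = lborel"
proof (rule lborel_eqI[symmetric])
  fix l u :: "real^2" assume le: "\<And>b. b \<in> Basis \<Longrightarrow> l \<bullet> b \<le> u \<bullet> b"
  have pre: "refl_hyp e 0 -` box l u = refl_hyp e 0 ` box l u"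
    using refl_hyp_invol[OF assms] by (auto simp: image_iff) metis
  have [measurable]: "refl_hyp e 0 -` box l u \<in> sets borel"
    using measurable_sets_borel[OF measurable_refl_hyp, of "box l u" e 0] by simp
  have "measure lborel (refl_hyp e 0 -` box l u) = measure lebesgue (refl_hyp e 0 ` box l u)"
    by (simp add: pre[symmetric] measure_completion)
  also have "\<dots> = measure lebesgue (box l u)"
    by (rule measure_orthogonal_image[OF refl_hyp_0_orthogonal[OF assms]]) (simp add:
        lmeasurable_open)
  finally have m: "measure lborel (refl_hyp e 0 -` box l u) = measure lborel (box l u)"
    by (simp add: measure_completion)
  have "refl_hyp e 0 ` box l u \<in> lmeasurable"
    by (rule measurable_orthogonal_image[OF refl_hyp_0_orthogonal[OF assms]]) (simp add:
        lmeasurable_open)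
  then have "emeasure lborel (refl_hyp e 0 -` box l u) < \<infinity>"
    by (simp add: pre[symmetric] fmeasurable_def emeasure_completion)
  then have "emeasure lborel (refl_hyp e 0 -` box l u) = emeasure lborel (box l u)"
    using emeasure_eq_ennreal_measure[of lborel "box l u"] emeasure_eq_ennreal_measure[of lborel
        "refl_hyp e 0 -` box l u"] m
      emeasure_lborel_box_finite[of l u] by auto
  then show "emeasure (distr lborel borel (refl_hyp e 0)) (box l u) = ennreal (\<Prod>b\<in>Basis. (u
      - l) \<bullet> b)"
    using le by (simp add: emeasure_distr inner_diff_left)
qed simp

lemma nn_integral_lborel_refl:
  fixes f :: "real^2 \<Rightarrow> ennreal"
  assumes [measurable]: "f \<in> borel_measurable borel" and e: "norm e = 1"
  shows "(\<integral>\<^sup>+x. f (refl_hyp e c x) \<partial>lborel) = (\<integral>\<^sup>+x. f x \<partial>lborel)"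
proof -
  have eq: "refl_hyp e c x = refl_hyp e 0 x + (2 * c) *\<^sub>R e" for x
    by (simp add: refl_hyp_def algebra_simps)
  have "(\<integral>\<^sup>+x. f (refl_hyp e c x) \<partial>lborel) = (\<integral>\<^sup>+x. f (x + (2 * c) *\<^sub>R e) \<partial>distr lborel borel
      (refl_hyp e 0))"
    unfolding eq by (subst nn_integral_distr) auto
  also have "\<dots> = (\<integral>\<^sup>+x. f x \<partial>lborel)"
    unfolding lborel_distr_refl_0[OF e] by (rule nn_integral_lborel_translate) measurable
  finally show ?thesis .
qed

text \<open>The value is pi / 4, but only its finiteness and positivity enter the argument.\<close>

definition ball_moment :: real where
  "ball_moment = enn2real (\<integral>\<^sup>+z. (if norm (z::real^2) < 1 then ennreal ((axis 1 1 \<bullet> z)\<^sup>2) else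
      0) \<partial>lborel)"

lemma
  shows ball_moment_eq: "(\<integral>\<^sup>+z. (if norm (z::real^2) < 1 then ennreal ((axis 1 1 \<bullet> z)\<^sup>2) else
      0) \<partial>lborel) = ennreal ball_moment"
  and ball_moment_pos: "ball_moment > 0"
proof -
  let ?e = "axis 1 1 :: real^2"
  let ?I = "\<integral>\<^sup>+z. (if norm (z::real^2) < 1 then ennreal ((?e \<bullet> z)\<^sup>2) else 0) \<partial>lborel"
  have ne: "norm ?e = 1" by simp
  have "?I \<le> (\<integral>\<^sup>+z. indicator (ball 0 1) (z::real^2) \<partial>lborel)"
  proof (rule nn_integral_mono)
    fix z :: "real^2"
    have "(?e \<bullet> z)\<^sup>2 \<le> 1" if "norm z < 1"
      using Cauchy_Schwarz_ineq2[of ?e z] that ne by (simp add: abs_square_le_1)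
    then show "(if norm z < 1 then ennreal ((?e \<bullet> z)\<^sup>2) else 0) \<le> indicator (ball 0 1) z"
      using ennreal_leI[of "(?e \<bullet> z)\<^sup>2" 1] by (auto simp: indicator_def)
  qed
  also have "\<dots> < \<infinity>" using emeasure_lborel_ball_finite[of "0::real^2" 1] by simp
  finally have fin: "?I < \<infinity>" .
  then show "?I = ennreal ball_moment" unfolding ball_moment_def by simp
  \<comment> \<open>On the disc of radius 1/4 about half the unit axis vector the first coordinate
    is at least 1/4, and this disc lies inside the unit disc.\<close>
  have "ennreal (1/16) * emeasure lborel (ball ((1/2) *\<^sub>R ?e) (1/4)) = (\<integral>\<^sup>+z. ennreal (1/16) *
      indicator (ball ((1/2) *\<^sub>R ?e) (1/4)) z \<partial>lborel)"
    by (subst nn_integral_cmult_indicator) auto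
  also have "\<dots> \<le> ?I"
  proof (rule nn_integral_mono)
    fix z :: "real^2"
    show "ennreal (1/16) * indicator (ball ((1/2) *\<^sub>R ?e) (1/4)) z \<le> (if norm z
        < 1 then ennreal ((?e \<bullet> z)\<^sup>2) else 0)"
    proof (cases "z \<in> ball ((1/2) *\<^sub>R ?e) (1/4)")
      case True
      then have d: "norm (z - (1/2) *\<^sub>R ?e) < 1/4" by (simp add: dist_norm norm_minus_commute)
      have "norm z \<le> norm (z - (1/2) *\<^sub>R ?e) + norm ((1/2) *\<^sub>R ?e)"
        using norm_triangle_ineq[of "z - (1/2) *\<^sub>R ?e" "(1/2) *\<^sub>R ?e"] by simp
      then have n1: "norm z < 1" using d ne by simp
      have "\<bar>?e \<bullet> (z - (1/2) *\<^sub>R ?e)\<bar> < 1/4"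
        using Cauchy_Schwarz_ineq2[of ?e "z - (1/2) *\<^sub>R ?e"] d ne by simp
      then have "?e \<bullet> z \<ge> 1/4"
        using ne by (simp only: inner_diff_right inner_scaleR_right norm_eq_1 abs_less_iff) simp
      then have "(1/4)\<^sup>2 \<le> (?e \<bullet> z)\<^sup>2" by (intro power_mono) auto
      then show ?thesis using True n1 by (simp add: power2_eq_square ennreal_leI)
    qed simp
  qed
  finally have "ennreal (1/16) * emeasure lborel (ball ((1/2) *\<^sub>R ?e) (1/4)) \<le> ?I" .
  moreover have "emeasure lborel (ball ((1/2) *\<^sub>R ?e) (1/4)) > 0"
    using content_ball_pos[of "1/4" "(1/2) *\<^sub>R ?e"]
        by (auto simp: measure_def enn2real_positive_iff)
  ultimately have "?I > 0"
    by (auto simp: zero_less_iff_neq_zero)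
  then show "ball_moment > 0" using fin unfolding ball_moment_def
      by (simp add: enn2real_positive_iff)
qed

lemma DIM_real2 [simp]: "DIM(real^2) = 2" by simp

text \<open>Reflections preserve the disc, so the moment depends on \<open>w\<close> through its
  norm only. Of the four powers of \<open>\<epsilon>\<close> two come from the area and two from the
  squared integrand.\<close>

lemma second_moment_isotropic:
  fixes w :: "real^2"
  assumes "\<epsilon> > 0"
  shows "(\<integral>\<^sup>+z. (if norm z < \<epsilon> then ennreal ((w \<bullet> z)\<^sup>2) else 0) \<partial>lborel) = ennreal (ball_moment * \<epsilon>
      ^ 4 * (norm w)\<^sup>2)"
proof -
  let ?e = "axis 1 1 :: real^2"
  have unit: "(\<integral>\<^sup>+z. (if norm z < 1 then ennreal ((e \<bullet> z)\<^sup>2) else 0) \<partial>lborel) = ennreal ball_moment"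
      if e: "norm e = 1" for e :: "real^2"
  proof (cases "e = ?e")
    case True
    show ?thesis unfolding True by (rule ball_moment_eq)
  next
    case False
    \<comment> \<open>Unit normal of the line through the origin in which \<open>e\<close> is
      mirrored to the axis vector.\<close>
    define f where "f = (1 / norm (e - ?e)) *\<^sub>R (e - ?e)"
    have f: "norm f = 1" using False by (simp add: f_def)
    have "(e - ?e) \<bullet> (e - ?e) = 2 * (e \<bullet> (e - ?e))"
      using e by (simp add: inner_diff_left inner_diff_right norm_eq_1 inner_commute)
    then have n2: "2 * (e \<bullet> (e - ?e)) = (norm (e - ?e))\<^sup>2" by (simp add: power2_norm_eq_inner)
    have "refl_hyp f 0 e = e - (2 * (e \<bullet> (e - ?e)) / (norm (e - ?e))\<^sup>2) *\<^sub>R (e - ?e)"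
      by (simp add: refl_hyp_def f_def power2_eq_square)
    also have "\<dots> = ?e" unfolding n2 using False by simp
    finally have re: "refl_hyp f 0 e = ?e" .
    have sw: "e \<bullet> refl_hyp f 0 z = refl_hyp f 0 e \<bullet> z" for z
      by (simp add: refl_hyp_def inner_diff_left inner_diff_right inner_commute)
    have nr: "norm (refl_hyp f 0 z) = norm z" for z
      using dist_refl_hyp[OF f, of 0 z 0] by (simp add: refl_hyp_def dist_norm)
    have "(\<integral>\<^sup>+z. (if norm z < 1 then ennreal ((e \<bullet> z)\<^sup>2) else 0) \<partial>lborel)
       = (\<integral>\<^sup>+z. (if norm (refl_hyp f 0 z) < 1 then ennreal ((e \<bullet> refl_hyp f 0 z)\<^sup>2) else
           0) \<partial>lborel)"
      by (rule nn_integral_lborel_refl[symmetric, OF _ f]) measurable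
    also have "\<dots> = ennreal ball_moment"
      by (simp only: nr sw re ball_moment_eq)
    finally show ?thesis .
  qed
  show ?thesis
  proof (cases "w = 0")
    case False
    define e where "e = (1 / norm w) *\<^sub>R w"
    have e: "norm e = 1" using False by (simp add: e_def)
    have we: "w = norm w *\<^sub>R e" using False by (simp add: e_def)
    have "(\<integral>\<^sup>+z. (if norm z < \<epsilon> then ennreal ((w \<bullet> z)\<^sup>2) else 0) \<partial>lborel)
      = ennreal (\<epsilon> ^ DIM(real^2)) * (\<integral>\<^sup>+z. (if norm (\<epsilon> *\<^sub>R z) < \<epsilon> then ennreal ((w \<bullet> (\<epsilon> *\<^sub>R z))\<^sup>2)
          else 0) \<partial>lborel)"
      by (rule nn_integral_lborel_scale[OF _ assms]) measurable
    also have "(\<integral>\<^sup>+z. (if norm (\<epsilon> *\<^sub>R z) < \<epsilon> then ennreal ((w \<bullet> (\<epsilon> *\<^sub>R z))\<^sup>2) else 0) \<partial>lborel)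
      = (\<integral>\<^sup>+z. ennreal ((norm w)\<^sup>2 * \<epsilon>\<^sup>2) * (if norm z < 1 then ennreal ((e \<bullet> z)\<^sup>2) else
          0) \<partial>lborel)"
    proof (rule nn_integral_cong)
      fix z :: "real^2"
      have "w \<bullet> (\<epsilon> *\<^sub>R z) = norm w * \<epsilon> * (e \<bullet> z)" by (subst we) simp
      then show "(if norm (\<epsilon> *\<^sub>R z) < \<epsilon> then ennreal ((w \<bullet> (\<epsilon> *\<^sub>R z))\<^sup>2) else 0)
        = ennreal ((norm w)\<^sup>2 * \<epsilon>\<^sup>2) * (if norm z < 1 then ennreal ((e \<bullet> z)\<^sup>2) else 0)"
        using assms by (simp add: power_mult_distrib ennreal_mult mult_ac)
    qed
    also have "\<dots> = ennreal ((norm w)\<^sup>2 * \<epsilon>\<^sup>2) * ennreal ball_moment"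
      by (subst nn_integral_cmult) (auto simp: unit[OF e])
    finally show ?thesis
      using assms ball_moment_pos by (simp add: ennreal_mult[symmetric] power4_eq_xxxx
          power2_eq_square mult_ac)
  qed (simp cong: if_cong)
qed

section \<open>Nonlocal energies and their supremum\<close>

definition nl_energy :: "real \<Rightarrow> (real^2 \<Rightarrow> real) \<Rightarrow> ennreal" where
  "nl_energy \<epsilon> u = (\<integral>\<^sup>+x. \<integral>\<^sup>+y. (if dist x y < \<epsilon> then ennreal ((u x
      - u y)\<^sup>2) else 0) \<partial>lborel \<partial>lborel)"

text \<open>The denominator is the moment of \<open>second_moment_isotropic\<close> for a unit
  vector, so a constant slope contributes its square per unit area. With a supremum nothing has to
  be known about how the quotients vary with \<open>\<epsilon>\<close>.\<close>

definition dirichlet :: "(real^2 \<Rightarrow> real) \<Rightarrow> ennreal" where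
  "dirichlet u = (SUP \<epsilon>\<in>{0<..}. nl_energy \<epsilon> u / ennreal (ball_moment * \<epsilon> ^ 4))"

lemma nl_energy_le_dirichlet:
  assumes "\<epsilon> > 0" shows "nl_energy \<epsilon> u \<le> ennreal (ball_moment * \<epsilon> ^ 4) * dirichlet u"
proof -
  have pos: "ball_moment * \<epsilon> ^ 4 > 0" using assms ball_moment_pos by simp
  have "nl_energy \<epsilon> u / ennreal (ball_moment * \<epsilon> ^ 4) \<le> dirichlet u"
    unfolding dirichlet_def using assms by (intro SUP_upper) auto
  from mult_left_mono[OF this, of "ennreal (ball_moment * \<epsilon> ^ 4)"] show ?thesis
    using pos ennreal_mult_divide_eq[of "ennreal (ball_moment * \<epsilon> ^ 4)" "nl_energy \<epsilon> u"]
    by (simp add: ennreal_times_divide mult.commute ennreal_eq_0_iff not_le)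
qed

lemma dirichlet_le:
  assumes "\<And>\<epsilon>. \<epsilon> > 0 \<Longrightarrow> nl_energy \<epsilon> u \<le> ennreal (ball_moment * \<epsilon> ^ 4) * M"
  shows "dirichlet u \<le> M"
  unfolding dirichlet_def
proof (rule SUP_least)
  fix \<epsilon> :: real assume "\<epsilon> \<in> {0<..}"
  then have pos: "ball_moment * \<epsilon> ^ 4 > 0" and "\<epsilon> > 0" using ball_moment_pos by auto
  from divide_right_mono_ennreal[OF assms[OF this(2)], of "ennreal (ball_moment * \<epsilon> ^ 4)"]
  show "nl_energy \<epsilon> u / ennreal (ball_moment * \<epsilon> ^ 4) \<le> M"
    using pos ennreal_mult_divide_eq[of "ennreal (ball_moment * \<epsilon> ^ 4)" M]
    by (simp add: mult.commute ennreal_eq_0_iff not_le)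
qed

lemma nl_energy_shift_form:
  assumes [measurable]: "u \<in> borel_measurable borel"
  shows "nl_energy \<epsilon> u = (\<integral>\<^sup>+z. (if norm z < \<epsilon> then sqnorm (\<lambda>x. u (x + z) - u x) else 0) \<partial>lborel)"
proof -
  have "nl_energy \<epsilon> u = (\<integral>\<^sup>+x. \<integral>\<^sup>+z. (if norm z < \<epsilon> then ennreal ((u (x + z)
      - u x)\<^sup>2) else 0) \<partial>lborel \<partial>lborel)"
    unfolding nl_energy_def
  proof (rule nn_integral_cong)
    fix x :: "real^2"
    have "(\<integral>\<^sup>+z. (if dist x (z + x) < \<epsilon> then ennreal ((u x - u (z + x))\<^sup>2) else 0) \<partial>lborel) =
      (\<integral>\<^sup>+y. (if dist x y < \<epsilon> then ennreal ((u x - u y)\<^sup>2) else 0) \<partial>lborel)"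
      by (rule nn_integral_lborel_translate) measurable
    then show "(\<integral>\<^sup>+y. (if dist x y < \<epsilon> then ennreal ((u x - u y)\<^sup>2) else 0) \<partial>lborel)
      = (\<integral>\<^sup>+z. (if norm z < \<epsilon> then ennreal ((u (x + z) - u x)\<^sup>2) else 0) \<partial>lborel)"
      by (simp add: dist_norm add.commute[of _ x] power2_commute[of "u x"] cong: if_cong)
  qed
  also have "\<dots> = (\<integral>\<^sup>+z. \<integral>\<^sup>+x. (if norm z < \<epsilon> then ennreal ((u (x + z)
      - u x)\<^sup>2) else 0) \<partial>lborel \<partial>lborel)"
    by (rule lborel_pair.Fubini') measurable
  also have "\<dots> = (\<integral>\<^sup>+z. (if norm z < \<epsilon> then sqnorm (\<lambda>x. u (x + z) - u x) else 0) \<partial>lborel)"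
    by (intro nn_integral_cong) (simp add: sqnorm_def)
  finally show ?thesis .
qed

text \<open>Integrating the translation estimate over \<open>norm z < \<epsilon>\<close> and
  exchanging the integrals leaves, at each \<open>x\<close>, the second moment in direction
  \<open>g x\<close>, which is exactly the normalization times
  \<open>(norm (g x))\<^sup>2\<close>.\<close>

lemma dirichlet_le_weak_grad:
  fixes u :: "real^2 \<Rightarrow> real"
  assumes [measurable]: "u \<in> borel_measurable borel" "g \<in> borel_measurable borel"
    and "sqnorm u < \<infinity>" "sqnorm g < \<infinity>" "weak_grad u g"
  shows "dirichlet u \<le> sqnorm g"
proof (rule dirichlet_le)
  fix \<epsilon> :: real assume \<epsilon>: "\<epsilon> > 0"
  have "nl_energy \<epsilon> u \<le> (\<integral>\<^sup>+z. (if norm z < \<epsilon> then sqnorm (\<lambda>x. g x \<bullet> z) else 0) \<partial>lborel)"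
    unfolding nl_energy_shift_form[OF assms(1)]
    using sqnorm_difference_le[OF assms] by (intro nn_integral_mono) auto
  also have "\<dots> = (\<integral>\<^sup>+z. \<integral>\<^sup>+x. (if norm z < \<epsilon> then ennreal ((g x \<bullet> z)\<^sup>2) else 0) \<partial>lborel \<partial>lborel)"
    by (intro nn_integral_cong) (simp add: sqnorm_def)
  also have "\<dots> = (\<integral>\<^sup>+x. \<integral>\<^sup>+z. (if norm z < \<epsilon> then ennreal ((g x \<bullet> z)\<^sup>2) else 0) \<partial>lborel \<partial>lborel)"
    by (rule lborel_pair.Fubini') measurable
  also have "\<dots> = (\<integral>\<^sup>+x. ennreal (ball_moment * \<epsilon> ^ 4) * ennreal ((norm (g x))\<^sup>2) \<partial>lborel)"
    unfolding second_moment_isotropic[OF \<epsilon>]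
    using ball_moment_pos \<epsilon> by (intro nn_integral_cong) (simp add: ennreal_mult)
  also have "\<dots> = ennreal (ball_moment * \<epsilon> ^ 4) * sqnorm g"
    by (simp add: nn_integral_cmult sqnorm_def)
  finally show "nl_energy \<epsilon> u \<le> ennreal (ball_moment * \<epsilon> ^ 4) * sqnorm g" .
qed

lemma nl_energy_contraction:
  assumes "\<And>x y. \<bar>v x - v y\<bar> \<le> \<bar>u x - u y\<bar>"
  shows "nl_energy \<epsilon> v \<le> nl_energy \<epsilon> u"
  unfolding nl_energy_def
  by (intro nn_integral_mono) (auto intro!: ennreal_leI power_mono_even simp: assms
      abs_le_square_iff[symmetric])

lemma dirichlet_mono:
  assumes "\<And>\<epsilon>. \<epsilon> > 0 \<Longrightarrow> nl_energy \<epsilon> v \<le> nl_energy \<epsilon> u"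
  shows "dirichlet v \<le> dirichlet u"
  by (rule dirichlet_le) (meson assms nl_energy_le_dirichlet order_trans)

lemma nl_energy_Fatou:
  assumes [measurable]: "\<And>n. u n \<in> borel_measurable borel" "w \<in> borel_measurable borel"
    and lim: "AE x in lborel. (\<lambda>n. u n x) \<longlonglongrightarrow> w x"
  shows "nl_energy \<epsilon> w \<le> liminf (\<lambda>n. nl_energy \<epsilon> (u n))"
proof -
  have "nl_energy \<epsilon> w \<le> (\<integral>\<^sup>+x. \<integral>\<^sup>+y. liminf (\<lambda>n. (if dist x y < \<epsilon> then ennreal ((u n x
      - u n y)\<^sup>2) else 0)) \<partial>lborel \<partial>lborel)"
    unfolding nl_energy_def
  proof (rule nn_integral_mono_AE, use lim in eventually_elim)
    case (elim x)
    note x = this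
    show ?case
    proof (rule nn_integral_mono_AE, use lim in eventually_elim)
      case (elim y)
      have "(\<lambda>n. if dist x y < \<epsilon> then ennreal ((u n x - u n y)\<^sup>2) else 0) \<longlonglongrightarrow> (if dist x y
          < \<epsilon> then ennreal ((w x - w y)\<^sup>2) else 0)"
        using x elim by (auto intro!: tendsto_ennrealI tendsto_intros)
      then show ?case by (simp add: lim_imp_Liminf)
    qed
  qed
  also have "\<dots> \<le> (\<integral>\<^sup>+x. liminf (\<lambda>n. \<integral>\<^sup>+y. (if dist x y < \<epsilon> then ennreal ((u n x
      - u n y)\<^sup>2) else 0) \<partial>lborel) \<partial>lborel)"
    by (intro nn_integral_mono nn_integral_liminf) measurable
  also have "\<dots> \<le> liminf (\<lambda>n. nl_energy \<epsilon> (u n))"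
    unfolding nl_energy_def by (intro nn_integral_liminf) measurable
  finally show ?thesis .
qed

text \<open>Fatou's lemma is used at a fixed \<open>\<epsilon>\<close>, where the normalization is a
  constant; the supremum over \<open>\<epsilon>\<close> comes last.\<close>

lemma dirichlet_lsc:
  assumes "\<And>n. u n \<in> borel_measurable borel" "w \<in> borel_measurable borel"
    and lim: "AE x in lborel. (\<lambda>n. u n x) \<longlonglongrightarrow> w x"
    and bd: "\<And>n. dirichlet (u n) \<le> ennreal (A n)" and A: "A \<longlonglongrightarrow> A0" "\<And>n. A n \<ge> 0"
  shows "dirichlet w \<le> ennreal A0"
proof (rule dirichlet_le)
  fix \<epsilon> :: real assume \<epsilon>: "\<epsilon> > 0"
  have "nl_energy \<epsilon> w \<le> liminf (\<lambda>n. nl_energy \<epsilon> (u n))"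
    by (rule nl_energy_Fatou[OF assms(1-3)])
  also have "\<dots> \<le> liminf (\<lambda>n. ennreal (ball_moment * \<epsilon> ^ 4 * A n))"
  proof (rule Liminf_mono, rule always_eventually, rule allI)
    fix n
    have "nl_energy \<epsilon> (u n) \<le> ennreal (ball_moment * \<epsilon> ^ 4) * ennreal (A n)"
      using nl_energy_le_dirichlet[OF \<epsilon>, of "u n"] bd[of n]
          by (meson mult_left_mono order_trans zero_le)
    then show "nl_energy \<epsilon> (u n) \<le> ennreal (ball_moment * \<epsilon> ^ 4 * A n)"
      using A(2)[of n] ball_moment_pos \<epsilon> by (simp add: ennreal_mult)
  qed
  also have "\<dots> = ennreal (ball_moment * \<epsilon> ^ 4 * A0)"
    by (intro lim_imp_Liminf tendsto_ennrealI tendsto_intros A) simp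
  also have "\<dots> = ennreal (ball_moment * \<epsilon> ^ 4) * ennreal A0"
    using LIMSEQ_le_const[OF A(1), of 0] A(2) ball_moment_pos \<epsilon> by (simp add: ennreal_mult)
  finally show "nl_energy \<epsilon> w \<le> ennreal (ball_moment * \<epsilon> ^ 4) * ennreal A0" .
qed

text \<open>Each of the two variables contributes a factor \<open>s\<^sup>2\<close>, and the scale
  becomes \<open>\<epsilon> / s\<close>. The normalization \<open>\<epsilon> ^ 4\<close> changes by
  exactly the inverse factor, which is the conformal invariance of the Dirichlet energy in the
  plane.\<close>

lemma nl_energy_dilate:
  assumes [measurable]: "u \<in> borel_measurable borel" and s: "s > 0"
  shows "nl_energy \<epsilon> (\<lambda>x. u ((1/s) *\<^sub>R x)) = ennreal (s ^ 4) * nl_energy (\<epsilon> / s) u"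
proof -
  have inner: "(\<integral>\<^sup>+y. (if dist (s *\<^sub>R x) y < \<epsilon> then ennreal ((u x - u ((1/s) *\<^sub>R y))\<^sup>2) else
      0) \<partial>lborel)
    = ennreal (s\<^sup>2) * (\<integral>\<^sup>+y. (if dist x y < \<epsilon> / s then ennreal ((u x - u y)\<^sup>2) else 0) \<partial>lborel)"
        for x
  proof -
    have "(\<integral>\<^sup>+y. (if dist (s *\<^sub>R x) y < \<epsilon> then ennreal ((u x - u ((1/s) *\<^sub>R y))\<^sup>2) else 0) \<partial>lborel)
      = ennreal (s ^ DIM(real^2)) * (\<integral>\<^sup>+y. (if dist (s *\<^sub>R x) (s *\<^sub>R y) < \<epsilon> then ennreal ((u x
          - u ((1/s) *\<^sub>R (s *\<^sub>R y)))\<^sup>2) else 0) \<partial>lborel)"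
      by (rule nn_integral_lborel_scale[OF _ s]) measurable
    moreover have "dist (s *\<^sub>R x) (s *\<^sub>R y) = s * dist x y" for y
      using s by (simp add: dist_norm scaleR_diff_right[symmetric])
    ultimately show ?thesis using s by (simp add: pos_less_divide_eq mult.commute cong: if_cong)
  qed
  have "nl_energy \<epsilon> (\<lambda>x. u ((1/s) *\<^sub>R x)) = ennreal (s ^ DIM(real^2)) *
    (\<integral>\<^sup>+x. \<integral>\<^sup>+y. (if dist (s *\<^sub>R x) y < \<epsilon> then ennreal ((u ((1/s) *\<^sub>R (s *\<^sub>R x))
        - u ((1/s) *\<^sub>R y))\<^sup>2) else 0) \<partial>lborel \<partial>lborel)"
    unfolding nl_energy_def by (rule nn_integral_lborel_scale[OF _ s]) measurable
  also have "\<dots> = ennreal (s ^ 2) * (ennreal (s\<^sup>2) * nl_energy (\<epsilon> / s) u)"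
    using s by (simp add: inner nn_integral_cmult nl_energy_def cong: if_cong)
  finally show ?thesis
    by (simp add: mult.assoc[symmetric] ennreal_mult[symmetric] power_add[symmetric])
qed

lemma dirichlet_dilate_le:
  assumes [measurable]: "u \<in> borel_measurable borel" and s: "s > 0"
  shows "dirichlet (\<lambda>x. u ((1/s) *\<^sub>R x)) \<le> dirichlet u"
proof (rule dirichlet_le)
  fix \<epsilon> :: real assume \<epsilon>: "\<epsilon> > 0"
  have "nl_energy \<epsilon> (\<lambda>x. u ((1/s) *\<^sub>R x)) \<le> ennreal (s ^ 4) * (ennreal (ball_moment * (\<epsilon> / s) ^ 4) *
      dirichlet u)"
    unfolding nl_energy_dilate[OF assms] using \<epsilon> s
        by (intro mult_left_mono nl_energy_le_dirichlet) auto
  also have "\<dots> = ennreal (ball_moment * \<epsilon> ^ 4) * dirichlet u"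
    using s ball_moment_pos \<epsilon> by (simp add: mult.assoc[symmetric] ennreal_mult[symmetric]
        power_divide)
  finally show "nl_energy \<epsilon> (\<lambda>x. u ((1/s) *\<^sub>R x)) \<le> ennreal (ball_moment * \<epsilon> ^ 4) * dirichlet u" .
qed

section \<open>Square-integrable functions\<close>

text \<open>The sum of the squares has finite integral, hence is finite almost everywhere, and the
  terms of a convergent series tend to 0.\<close>

lemma AE_tendsto_0_if_sqnorm_summable:
  fixes f :: "nat \<Rightarrow> 'a::euclidean_space \<Rightarrow> 'b::euclidean_space"
  assumes [measurable]: "\<And>k. f k \<in> borel_measurable borel"
    and le: "\<And>k. sqnorm (f k) \<le> ennreal (c k)" and c: "summable c" "\<And>k. c k \<ge> 0"
  shows "AE x in lborel. (\<lambda>k. f k x) \<longlonglongrightarrow> 0"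
proof -
  have "(\<integral>\<^sup>+x. (\<Sum>k. ennreal ((norm (f k x))\<^sup>2)) \<partial>lborel) = (\<Sum>k. sqnorm (f k))"
    unfolding sqnorm_def by (rule nn_integral_suminf) measurable
  also have "\<dots> \<le> (\<Sum>k. ennreal (c k))" by (intro suminf_le le) auto
  also have "\<dots> < \<infinity>" using c by (simp add: suminf_ennreal2)
  finally have "AE x in lborel. (\<Sum>k. ennreal ((norm (f k x))\<^sup>2)) \<noteq> \<infinity>"
    by (intro nn_integral_PInf_AE) auto
  then show ?thesis
  proof eventually_elim
    case (elim x)
    then have "summable (\<lambda>k. (norm (f k x))\<^sup>2)"
      using summable_iff_suminf_neq_top[of "\<lambda>k. (norm (f k x))\<^sup>2"] by auto
    then have "(\<lambda>k. (norm (f k x))\<^sup>2) \<longlonglongrightarrow> 0" by (rule summable_LIMSEQ_zero)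
    then have "(\<lambda>k. sqrt ((norm (f k x))\<^sup>2)) \<longlonglongrightarrow> sqrt 0" by (rule tendsto_real_sqrt)
    then show ?case by (simp add: tendsto_norm_zero_iff)
  qed
qed

lemma sqnorm_Fatou:
  fixes f :: "nat \<Rightarrow> 'a::euclidean_space \<Rightarrow> 'b::euclidean_space"
  assumes [measurable]: "\<And>k. f k \<in> borel_measurable borel" "g \<in> borel_measurable borel"
    and lim: "AE x in lborel. (\<lambda>k. f k x) \<longlonglongrightarrow> g x" and le: "\<forall>\<^sub>F k in sequentially. sqnorm (f k) \<le> M"
  shows "sqnorm g \<le> M"
proof -
  have "sqnorm g \<le> (\<integral>\<^sup>+x. liminf (\<lambda>k. ennreal ((norm (f k x))\<^sup>2)) \<partial>lborel)"
    unfolding sqnorm_def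
  proof (rule nn_integral_mono_AE, use lim in eventually_elim)
    case (elim x)
    then have "(\<lambda>k. ennreal ((norm (f k x))\<^sup>2)) \<longlonglongrightarrow> ennreal ((norm (g x))\<^sup>2)"
      by (intro tendsto_ennrealI tendsto_intros)
    from lim_imp_Liminf[OF trivial_limit_sequentially this] show ?case by simp
  qed
  also have "\<dots> \<le> liminf (\<lambda>k. sqnorm (f k))"
    unfolding sqnorm_def by (intro nn_integral_liminf) measurable
  also have "\<dots> \<le> liminf (\<lambda>k::nat. M)" by (rule Liminf_mono[OF le])
  also have "\<dots> = M" by (simp add: Liminf_const)
  finally show ?thesis .
qed

text \<open>The Riesz-Fischer argument: a fast subsequence converges almost everywhere, and Fatou's
  lemma transfers the bounds to its limit.\<close>

lemma sqnorm_complete: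
  fixes g :: "nat \<Rightarrow> 'a::euclidean_space \<Rightarrow> 'b::euclidean_space"
  assumes [measurable]: "\<And>k. g k \<in> borel_measurable borel"
    and Cauchy: "\<And>\<eta>::real. \<eta> > 0 \<Longrightarrow> \<exists>N. \<forall>j\<ge>N. \<forall>k\<ge>N. sqnorm (\<lambda>x. g j x - g k x) \<le> ennreal \<eta>"
    and bd: "\<And>k. sqnorm (g k) \<le> M"
  obtains h where "h \<in> borel_measurable borel" "sqnorm h \<le> M"
    "\<And>\<eta>::real. \<eta> > 0 \<Longrightarrow> \<exists>N. \<forall>k\<ge>N. sqnorm (\<lambda>x. g k x - h x) \<le> ennreal \<eta>"
proof -
  \<comment> \<open>The rate \<open>(1/8)^i\<close> leaves the summable \<open>(1/2)^i\<close> after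
    the increments are multiplied by \<open>2^i\<close>, whose square is \<open>4^i\<close>.\<close>
  have "\<exists>N. \<forall>i. \<forall>j\<ge>N i. \<forall>k\<ge>N i. sqnorm (\<lambda>x. g j x - g k x) \<le> ennreal ((1/8)^i)"
    using Cauchy by (intro choice) auto
  then obtain N where N: "\<And>i j k. j \<ge> N i \<Longrightarrow> k \<ge> N i \<Longrightarrow> sqnorm (\<lambda>x. g j x - g k x)
      \<le> ennreal ((1/8)^i)"
    by blast
  \<comment> \<open>Summing makes the indices nondecreasing and at least \<open>N i\<close>; the
    extra summand makes them unbounded.\<close>
  define r where "r i = (\<Sum>l\<le>i. N l) + i" for i
  have rN: "r i \<ge> N i" for i
    using member_le_sum[of i "{..i}" N] by (simp add: r_def)
  have rS: "r (Suc i) \<ge> r i" and ri: "r i \<ge> i" for i by (simp_all add: r_def)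
  \<comment> \<open>Once the rescaled increments tend to 0, the increments themselves are eventually
    below \<open>(1/2)^i\<close>, so the telescoping series converges absolutely.\<close>
  define f where "f i x = (2::real)^i *\<^sub>R (g (r (Suc i)) x - g (r i) x)" for i x
  have [measurable]: "f i \<in> borel_measurable borel" for i unfolding f_def[abs_def] by measurable
  have "AE x in lborel. (\<lambda>i. f i x) \<longlonglongrightarrow> 0"
  proof (rule AE_tendsto_0_if_sqnorm_summable)
    fix i
    have "sqnorm (f i) = ennreal (4^i) * sqnorm (\<lambda>x. g (r (Suc i)) x - g (r i) x)"
      unfolding sqnorm_def f_def
      by (subst nn_integral_cmult[symmetric]) (auto simp: power_mult_distrib ennreal_mult
          power_mult[symmetric] mult.commute[of i] power_mult[of 2 2 i])
    also have "\<dots> \<le> ennreal (4^i) * ennreal ((1/8)^i)"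
      using rN[of i] rS[of i] by (intro mult_left_mono N) auto
    also have "\<dots> = ennreal ((1/2)^i)"
      by (simp add: ennreal_mult[symmetric] power_mult_distrib[symmetric])
    finally show "sqnorm (f i) \<le> ennreal ((1/2)^i)" .
  qed (auto intro: summable_geometric)
  then have conv: "AE x in lborel. convergent (\<lambda>i. g (r i) x)"
  proof eventually_elim
    case (elim x)
    then obtain i0 where i0: "\<And>i. i \<ge> i0 \<Longrightarrow> norm (f i x) < 1"
      using LIMSEQ_D[of _ 0 1] by auto
    have "summable (\<lambda>i. g (r (Suc i)) x - g (r i) x)"
    proof (rule summable_comparison_test)
      show "\<exists>N. \<forall>n\<ge>N. norm (g (r (Suc n)) x - g (r n) x) \<le> (1/2)^n"
      proof (intro exI[of _ i0] allI impI)
        fix n assume "n \<ge> i0"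
        have "2 ^ n * norm (g (r (Suc n)) x - g (r n) x) < 1"
          using i0[OF \<open>n \<ge> i0\<close>] unfolding f_def norm_scaleR by simp
        then show "norm (g (r (Suc n)) x - g (r n) x) \<le> (1/2)^n"
          by (simp add: field_simps power_divide)
      qed
    qed (auto intro: summable_geometric)
    then have "convergent (\<lambda>n. \<Sum>i<n. g (r (Suc i)) x - g (r i) x)"
      by (simp add: summable_iff_convergent)
    then have "convergent (\<lambda>n. (\<Sum>i<n. g (r (Suc i)) x - g (r i) x) + g (r 0) x)"
      by (intro convergent_add convergent_const)
    then show ?case using sum_lessThan_telescope[of "\<lambda>i. g (r i) x"] by simp
  qed
  define h where "h x = lim (\<lambda>i. g (r i) x)" for x
  have [measurable]: "h \<in> borel_measurable borel" unfolding h_def[abs_def] by measurable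
  have lim: "AE x in lborel. (\<lambda>i. g (r i) x) \<longlonglongrightarrow> h x"
    using conv by eventually_elim (simp add: h_def convergent_LIMSEQ_iff)
  show ?thesis
  proof
    show "sqnorm h \<le> M" by (rule sqnorm_Fatou[OF _ _ lim]) (use bd in auto)
  next
    fix \<eta> :: real assume "\<eta> > 0"
    from Cauchy[OF this] obtain K where K: "\<And>j k. j \<ge> K \<Longrightarrow> k \<ge> K \<Longrightarrow> sqnorm (\<lambda>x. g j x - g k x)
        \<le> ennreal \<eta>" by blast
    have "sqnorm (\<lambda>x. g k x - h x) \<le> ennreal \<eta>" if "k \<ge> K" for k
    proof (rule sqnorm_Fatou[where f = "\<lambda>i x. g k x - g (r i) x"])
      show "AE x in lborel. (\<lambda>i. g k x - g (r i) x) \<longlonglongrightarrow> g k x - h x"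
        using lim by eventually_elim (intro tendsto_intros)
      show "\<forall>\<^sub>F i in sequentially. sqnorm (\<lambda>x. g k x - g (r i) x) \<le> ennreal \<eta>"
        using K[OF that] ri by (intro eventually_sequentiallyI[of K]) (meson order_trans)
    qed auto
    then show "\<exists>N. \<forall>k\<ge>N. sqnorm (\<lambda>x. g k x - h x) \<le> ennreal \<eta>" by blast
  qed measurable
qed

text \<open>Young's inequality with a weight \<open>t\<close> takes the place of the Cauchy-Schwarz
  inequality.\<close>

lemma integral_product_tendsto_0:
  fixes f :: "nat \<Rightarrow> 'a::euclidean_space \<Rightarrow> real"
  assumes [measurable]: "\<And>k. f k \<in> borel_measurable borel" "\<psi> \<in> borel_measurable borel"
    and f: "\<And>\<eta>::real. \<eta> > 0 \<Longrightarrow> \<exists>N. \<forall>k\<ge>N. sqnorm (f k) \<le> ennreal \<eta>" and \<psi>: "sqnorm \<psi> < \<infinity>"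
  shows "(\<lambda>k. \<integral>x. f k x * \<psi> x \<partial>lborel) \<longlonglongrightarrow> 0"
proof (rule LIMSEQ_I)
  fix e :: real assume e: "e > 0"
  define P where "P = (\<integral>x. (norm (\<psi> x))\<^sup>2 \<partial>lborel)"
  have P: "P \<ge> 0" unfolding P_def by simp
  \<comment> \<open>This weight gives \<open>t * P \<le> e\<close>, also when \<open>P = 0\<close>;
    the final bound is then \<open>(e / 2 + e) / 2\<close>.\<close>
  define t where "t = e / (P + 1)"
  have t: "t > 0" "t * P \<le> e" using e P by (auto simp: t_def field_simps)
  have "e * t > 0" using e t by simp
  from f[of "e * t / 2"] this obtain N where N: "\<And>k. k \<ge> N \<Longrightarrow> sqnorm (f k) \<le> ennreal (e * t / 2)"
      by auto
  have "norm ((\<integral>x. f k x * \<psi> x \<partial>lborel) - 0) < e" if "k \<ge> N" for k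
  proof -
    have fin: "sqnorm (f k) < \<infinity>" using N[OF that] by (simp add: order_le_less_trans)
    have If: "integrable lborel (\<lambda>x. (norm (f k x))\<^sup>2)"
        and Ip: "integrable lborel (\<lambda>x. (norm (\<psi> x))\<^sup>2)"
      using integrable_sqnorm[OF assms(1) fin] integrable_sqnorm[OF assms(2) \<psi>] by auto
    have "ennreal (\<integral>x. (norm (f k x))\<^sup>2 \<partial>lborel) = sqnorm (f k)"
      unfolding sqnorm_def using If by (intro nn_integral_eq_integral[symmetric]) auto
    then have F: "(\<integral>x. (norm (f k x))\<^sup>2 \<partial>lborel) \<le> e * t / 2"
      using N[OF that] \<open>e * t > 0\<close> by (metis divide_nonneg_nonneg ennreal_le_iff less_imp_le
          zero_le_numeral)
    have pw: "\<bar>f k x * \<psi> x\<bar> \<le> ((norm (f k x))\<^sup>2 / t + t * (norm (\<psi> x))\<^sup>2) / 2" for x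
    proof -
      have "0 \<le> (\<bar>f k x\<bar> - t * \<bar>\<psi> x\<bar>)\<^sup>2 / t" using t by simp
      also have "\<dots> = (norm (f k x))\<^sup>2 / t - 2 * \<bar>f k x * \<psi> x\<bar> + t * (norm (\<psi> x))\<^sup>2"
        using t by (simp add: power2_diff abs_mult field_simps power2_eq_square)
      finally show ?thesis by simp
    qed
    have "\<bar>\<integral>x. f k x * \<psi> x \<partial>lborel\<bar> \<le> (\<integral>x. \<bar>f k x * \<psi> x\<bar> \<partial>lborel)"
      by (rule integral_abs_bound)
    also have "\<dots> \<le> (\<integral>x. ((norm (f k x))\<^sup>2 / t + t * (norm (\<psi> x))\<^sup>2) / 2 \<partial>lborel)"
      using pw If Ip t by (intro integral_mono_AE') (auto intro!: AE_I2 add_nonneg_nonneg)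
    also have "\<dots> = ((\<integral>x. (norm (f k x))\<^sup>2 \<partial>lborel) / t + t * P) / 2"
      using If Ip by (simp add: P_def)
    also have "\<dots> \<le> (e / 2 + e) / 2"
      using F t by (intro divide_right_mono add_mono) (auto simp: field_simps)
    also have "\<dots> < e" using e by simp
    finally show ?thesis by simp
  qed
  then show "\<exists>N. \<forall>k\<ge>N. norm ((\<integral>x. f k x * \<psi> x \<partial>lborel) - 0) < e" by blast
qed

text \<open>A translate of \<open>\<psi>\<close> has the same integral. Writing the increment as a
  segment integral and exchanging the order of integration leaves the integral of the
  derivative.\<close>

lemma integral_derivative_test_function_0:
  fixes \<psi> :: "'a::euclidean_space \<Rightarrow> real"
  assumes \<psi>: "test_function \<psi>"
  shows "(\<integral>x. frechet_derivative \<psi> (at x) v \<partial>lborel) = 0"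
proof -
  let ?D = "\<lambda>x. frechet_derivative \<psi> (at x) v"
  note [measurable] = test_function_measurable[OF \<psi>]
  obtain R where R: "\<And>x. norm x \<ge> R \<Longrightarrow> \<psi> x = 0" "\<And>x v. norm x \<ge> R \<Longrightarrow> frechet_derivative \<psi> (at x) v
      = 0"
    using test_function_support[OF \<psi>] by metis
  have int\<psi>: "integrable lborel \<psi>"
    by (rule integrable_compact_support[OF test_function_continuous[OF \<psi>] R(1)])
  have sq: "sqnorm ?D < \<infinity>"
    by (rule sqnorm_compact_support_finite[OF test_function_derivative_continuous[OF \<psi>] R(2)])
  have "integrable (lborel \<Otimes>\<^sub>M lborel) (\<lambda>p. indicator {0..1} (fst p) * (?D (snd p
      + fst p *\<^sub>R (- v)) * indicator (cball 0 (R + norm v)) (snd p)) :: real)"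
    using sq by (intro integrable_product_square[where C = 1
        and R = "R + norm v + 1"]) (auto simp: indicator_def)
  also have "(\<lambda>p. indicator {0..1} (fst p) * (?D (snd p + fst p *\<^sub>R (- v)) * indicator (cball 0 (R
      + norm v)) (snd p)) :: real)
     = (\<lambda>p. indicator {0..1} (fst p) * ?D (snd p - fst p *\<^sub>R v))"
  proof
    fix p :: "real \<times> 'a"
    have "?D (snd p - fst p *\<^sub>R v) = 0" if "fst p \<in> {0..1}" "norm (snd p) > R + norm v"
    proof -
      have "norm (fst p *\<^sub>R v) \<le> norm v" using that by (simp add: mult_left_le_one_le)
      then have "norm (snd p - fst p *\<^sub>R v) \<ge> R" using that norm_triangle_ineq2[of "snd p" "fst p
          *\<^sub>R v"] by linarith
      then show ?thesis by (rule R)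
    qed
    then show "indicator {0..1} (fst p) * (?D (snd p + fst p *\<^sub>R (- v)) * indicator (cball 0 (R
        + norm v)) (snd p)) = indicator {0..1} (fst p) * ?D (snd p - fst p *\<^sub>R v)"
      by (auto simp: indicator_def)
  qed
  finally have int: "integrable (lborel \<Otimes>\<^sub>M lborel) (\<lambda>(t, x). indicator {0..1} t * ?D (x
      - t *\<^sub>R v))"
    by (simp add: split_beta')
  have "(\<integral>x. \<psi> (x - v) \<partial>lborel) = (\<integral>x. \<psi> x \<partial>lborel)"
    using integral_lborel_translate[of \<psi> "- v"] by simp
  moreover have int\<psi>v: "integrable lborel (\<lambda>x. \<psi> (x - v))"
  proof (rule integrable_compact_support[OF test_function_continuous[OF test_function_translate[OF
      \<psi>]]])
    fix x :: 'a assume "norm x \<ge> R + norm v"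
    then have "norm (x - v) \<ge> R" using norm_triangle_ineq2[of x v] by linarith
    then show "\<psi> (x - v) = 0" by (rule R)
  qed
  ultimately have "0 = (\<integral>x. \<psi> (x - v) - \<psi> x \<partial>lborel)"
    using int\<psi> int\<psi>v by simp
  also have "\<dots> = - (\<integral>x. (\<integral>t. indicator {0..1} t * ?D (x - t *\<^sub>R v) \<partial>lborel) \<partial>lborel)"
    by (simp add: test_function_segment[OF \<psi>])
  also have "(\<integral>x. (\<integral>t. indicator {0..1} t * ?D (x - t *\<^sub>R v) \<partial>lborel) \<partial>lborel)
      = (\<integral>t. (\<integral>x. indicator {0..1} t * ?D (x - t *\<^sub>R v) \<partial>lborel) \<partial>lborel)"
    by (rule lborel_pair.Fubini_integral[OF int])
  also have "\<dots> = (\<integral>t. indicator {0..1} (t::real) * (\<integral>x. ?D x \<partial>lborel) \<partial>lborel)"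
    using integral_lborel_translate[of ?D "- _ *\<^sub>R v"] by simp
  also have "\<dots> = (\<integral>x. ?D x \<partial>lborel)" by simp
  finally show ?thesis by simp
qed

section \<open>Mollification\<close>

definition conv :: "('a::euclidean_space \<Rightarrow> real) \<Rightarrow> ('a \<Rightarrow> real) \<Rightarrow> 'a \<Rightarrow> real" where
  "conv u \<rho> x = (\<integral>y. u y * \<rho> (x - y) \<partial>lborel)"

definition conv_grad :: "('a::euclidean_space \<Rightarrow> real) \<Rightarrow> ('a \<Rightarrow> real) \<Rightarrow> 'a \<Rightarrow> 'a" where
  "conv_grad u \<rho> x = (\<Sum>i\<in>Basis. conv u (\<lambda>w. frechet_derivative \<rho> (at w) i) x *\<^sub>R i)"

lemma measurable_conv:
  assumes [measurable]: "u \<in> borel_measurable borel" "\<rho> \<in> borel_measurable borel"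
  shows "conv u \<rho> \<in> borel_measurable borel"
  unfolding conv_def[abs_def] by measurable

lemma measurable_conv_grad:
  assumes [measurable]: "u \<in> borel_measurable borel" and \<rho>: "test_function \<rho>"
  shows "conv_grad u \<rho> \<in> borel_measurable borel"
  unfolding conv_grad_def[abs_def]
  by (intro borel_measurable_sum borel_measurable_scaleR measurable_conv test_function_measurable \<rho>
      assms) simp

lemma conv_alt:
  assumes [measurable]: "u \<in> borel_measurable borel" "\<rho> \<in> borel_measurable borel"
  shows "conv u \<rho> x = (\<integral>w. u (x - w) * \<rho> w \<partial>lborel)"
  using integral_lborel_reflect[of "\<lambda>y. u y * \<rho> (x - y)" x] by (simp add: conv_def)

lemma sqnorm_reflect:
  assumes [measurable]: "u \<in> borel_measurable borel"
  shows "sqnorm (\<lambda>w. u (x - w)) = sqnorm u"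
  unfolding sqnorm_def by (rule nn_integral_lborel_reflect) measurable

lemma integrable_conv:
  assumes [measurable]: "u \<in> borel_measurable borel" and u: "sqnorm u < \<infinity>" and \<rho>: "test_function \<rho>"
  shows "integrable lborel (\<lambda>w. u (x - w) * \<rho> w)"
    "integrable lborel (\<lambda>w. u (x - w) * frechet_derivative \<rho> (at w) v)"
proof -
  have "sqnorm (\<lambda>w. u (x - w)) < \<infinity>" using u by (simp add: sqnorm_reflect)
  from integrable_times_test[OF _ this \<rho>]
  show "integrable lborel (\<lambda>w. u (x - w) * \<rho> w)" "integrable lborel (\<lambda>w. u (x
      - w) * frechet_derivative \<rho> (at w) v)"
    by simp_all
qed

locale mollifier =
  fixes \<rho> :: "'a::euclidean_space \<Rightarrow> real"
  assumes test: "test_function \<rho>" and nonneg: "\<And>x. \<rho> x \<ge> 0" and int1: "(\<integral>x. \<rho> x \<partial>lborel) = 1"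
begin

lemma \<rho>_measurable [measurable]: "\<rho> \<in> borel_measurable borel"
  by (rule test_function_measurable[OF test])

lemma \<rho>_integrable: "integrable lborel \<rho>"
  using int1 not_integrable_integral_eq by fastforce

lemma nn_int1: "(\<integral>\<^sup>+x. ennreal (\<rho> x) \<partial>lborel) = 1"
  using nn_integral_eq_integral[OF \<rho>_integrable] nonneg int1 by simp

lemma conv_square_le:
  assumes [measurable]: "u \<in> borel_measurable borel"
  shows "ennreal ((conv u \<rho> x)\<^sup>2) \<le> (\<integral>\<^sup>+w. ennreal ((u (x - w))\<^sup>2 * \<rho> w) \<partial>lborel)"
  unfolding conv_alt[OF assms \<rho>_measurable]
  by (rule jensen_square) (auto simp: nonneg \<rho>_integrable int1)

lemma sqnorm_conv_le:
  assumes [measurable]: "u \<in> borel_measurable borel"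
  shows "sqnorm (conv u \<rho>) \<le> sqnorm u"
proof -
  have "sqnorm (conv u \<rho>) \<le> (\<integral>\<^sup>+x. \<integral>\<^sup>+w. ennreal ((u (x - w))\<^sup>2 * \<rho> w) \<partial>lborel \<partial>lborel)"
    unfolding sqnorm_def by (intro nn_integral_mono) (simp add: conv_square_le)
  also have "\<dots> = (\<integral>\<^sup>+w. \<integral>\<^sup>+x. ennreal ((u (x - w))\<^sup>2 * \<rho> w) \<partial>lborel \<partial>lborel)"
    by (rule lborel_pair.Fubini') measurable
  also have "\<dots> = (\<integral>\<^sup>+w. sqnorm u * ennreal (\<rho> w) \<partial>lborel)"
  proof (rule nn_integral_cong)
    fix w
    have "(\<integral>\<^sup>+x. ennreal ((u (x - w))\<^sup>2 * \<rho> w) \<partial>lborel) = sqnorm (\<lambda>x. u (x + - w)) * ennreal (\<rho> w)"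
      unfolding sqnorm_def by (subst nn_integral_multc[symmetric]) (auto simp: nonneg ennreal_mult)
    then show "(\<integral>\<^sup>+x. ennreal ((u (x - w))\<^sup>2 * \<rho> w) \<partial>lborel) = sqnorm u * ennreal (\<rho> w)"
      by (simp only: sqnorm_translate[OF assms])
  qed
  also have "\<dots> = sqnorm u" by (simp add: nn_integral_cmult nn_int1)
  finally show ?thesis .
qed

lemma conv_diff:
  assumes "u \<in> borel_measurable borel" "sqnorm u < \<infinity>"
  shows "conv u \<rho> x - conv u \<rho> y = (\<integral>w. (u (x - w) - u (y - w)) * \<rho> w \<partial>lborel)"
  using integrable_conv(1)[OF assms test, of x] integrable_conv(1)[OF assms test, of y]
  by (simp add: conv_alt[OF assms(1) \<rho>_measurable] left_diff_distrib)

lemma conv_diff_self: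
  assumes "u \<in> borel_measurable borel" "sqnorm u < \<infinity>"
  shows "conv u \<rho> x - u x = (\<integral>w. (u (x - w) - u x) * \<rho> w \<partial>lborel)"
  using integrable_conv(1)[OF assms test, of x] \<rho>_integrable int1
  by (simp add: conv_alt[OF assms(1) \<rho>_measurable] left_diff_distrib)

end

text \<open>The convolution is an average of translates of \<open>u\<close>. Jensen's inequality
  bounds its squared increments by averages of squared increments of the translates, and all
  translates have the same nonlocal energy.\<close>

lemma nl_energy_conv_le:
  fixes u :: "real^2 \<Rightarrow> real"
  assumes \<rho>: "mollifier \<rho>" and [measurable]: "u \<in> borel_measurable borel" and u: "sqnorm u < \<infinity>"
  shows "nl_energy \<epsilon> (conv u \<rho>) \<le> nl_energy \<epsilon> u"
proof -
  interpret mollifier \<rho> by (rule \<rho>)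
  have "nl_energy \<epsilon> (conv u \<rho>) \<le> (\<integral>\<^sup>+x. \<integral>\<^sup>+y. \<integral>\<^sup>+w. (if dist x y < \<epsilon> then ennreal ((u (x - w) - u (y
      - w))\<^sup>2 * \<rho> w) else 0) \<partial>lborel \<partial>lborel \<partial>lborel)"
    unfolding nl_energy_def
  proof (intro nn_integral_mono)
    fix x y :: "real^2"
    have "ennreal ((conv u \<rho> x - conv u \<rho> y)\<^sup>2) \<le> (\<integral>\<^sup>+w. ennreal ((u (x - w) - u (y
        - w))\<^sup>2 * \<rho> w) \<partial>lborel)"
      unfolding conv_diff[OF assms(2,3)] by (rule jensen_square) (auto simp: nonneg \<rho>_integrable
          int1)
    then show "(if dist x y < \<epsilon> then ennreal ((conv u \<rho> x - conv u \<rho> y)\<^sup>2) else 0) \<le>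
       (\<integral>\<^sup>+w. (if dist x y < \<epsilon> then ennreal ((u (x - w) - u (y - w))\<^sup>2 * \<rho> w) else 0) \<partial>lborel)"
      by auto
  qed
  also have "\<dots> = (\<integral>\<^sup>+x. \<integral>\<^sup>+w. \<integral>\<^sup>+y. (if dist x y < \<epsilon> then ennreal ((u (x - w) - u (y
      - w))\<^sup>2 * \<rho> w) else 0) \<partial>lborel \<partial>lborel \<partial>lborel)"
    by (intro nn_integral_cong lborel_pair.Fubini') measurable
  also have "\<dots> = (\<integral>\<^sup>+w. \<integral>\<^sup>+x. \<integral>\<^sup>+y. (if dist x y < \<epsilon> then ennreal ((u (x - w) - u (y
      - w))\<^sup>2 * \<rho> w) else 0) \<partial>lborel \<partial>lborel \<partial>lborel)"
    by (rule lborel_pair.Fubini') measurable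
  also have "\<dots> = (\<integral>\<^sup>+w. nl_energy \<epsilon> u * ennreal (\<rho> w) \<partial>lborel)"
  proof (rule nn_integral_cong)
    fix w :: "real^2"
    have "(\<integral>\<^sup>+x. \<integral>\<^sup>+y. (if dist x y < \<epsilon> then ennreal ((u (x - w) - u (y
        - w))\<^sup>2 * \<rho> w) else 0) \<partial>lborel \<partial>lborel)
      = (\<integral>\<^sup>+x. (\<integral>\<^sup>+y. (if dist x y < \<epsilon> then ennreal ((u (x - w) - u (y - w))\<^sup>2) else 0) \<partial>lborel) *
          ennreal (\<rho> w) \<partial>lborel)"
      by (intro nn_integral_cong, subst nn_integral_multc[symmetric])
        (auto simp: nonneg ennreal_mult intro!: nn_integral_cong)
    also have "\<dots> = (\<integral>\<^sup>+x. \<integral>\<^sup>+y. (if dist x y < \<epsilon> then ennreal ((u (x - w) - u (y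
        - w))\<^sup>2) else 0) \<partial>lborel \<partial>lborel) * ennreal (\<rho> w)"
      by (rule nn_integral_multc) measurable
    also have "(\<integral>\<^sup>+x. \<integral>\<^sup>+y. (if dist x y < \<epsilon> then ennreal ((u (x - w) - u (y
        - w))\<^sup>2) else 0) \<partial>lborel \<partial>lborel)
      = (\<integral>\<^sup>+x. \<integral>\<^sup>+y. (if dist (x + - w) y < \<epsilon> then ennreal ((u (x + - w)
          - u y)\<^sup>2) else 0) \<partial>lborel \<partial>lborel)"
    proof (rule nn_integral_cong)
      fix x :: "real^2"
      have "(\<integral>\<^sup>+y. (if dist (x + - w) (y + - w) < \<epsilon> then ennreal ((u (x + - w) - u (y +
          - w))\<^sup>2) else 0) \<partial>lborel)
        = (\<integral>\<^sup>+y. (if dist (x + - w) y < \<epsilon> then ennreal ((u (x + - w) - u y)\<^sup>2) else 0) \<partial>lborel)"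
        by (rule nn_integral_lborel_translate) measurable
      then show "(\<integral>\<^sup>+y. (if dist x y < \<epsilon> then ennreal ((u (x - w) - u (y - w))\<^sup>2) else 0) \<partial>lborel)
        = (\<integral>\<^sup>+y. (if dist (x + - w) y < \<epsilon> then ennreal ((u (x + - w) - u y)\<^sup>2) else 0) \<partial>lborel)"
        by (simp add: dist_norm cong: if_cong)
    qed
    also have "\<dots> = nl_energy \<epsilon> u"
      unfolding nl_energy_def by (rule nn_integral_lborel_translate) measurable
    finally show "(\<integral>\<^sup>+x. \<integral>\<^sup>+y. (if dist x y < \<epsilon> then ennreal ((u (x - w) - u (y
        - w))\<^sup>2 * \<rho> w) else 0) \<partial>lborel \<partial>lborel) = nl_energy \<epsilon> u * ennreal (\<rho> w)" .
  qed
  also have "\<dots> = nl_energy \<epsilon> u" by (simp add: nn_integral_cmult nn_int1)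
  finally show ?thesis .
qed

text \<open>The mollification error is an average of increments of length below
  \<open>\<delta>\<close>, so the nonlocal energy at scale \<open>\<delta>\<close> controls it
  directly, without any gradient.\<close>

lemma sqnorm_conv_diff_le:
  fixes u :: "real^2 \<Rightarrow> real"
  assumes \<rho>: "mollifier \<rho>" and [measurable]: "u \<in> borel_measurable borel" and u: "sqnorm u < \<infinity>"
    and C: "\<And>x. \<rho> x \<le> C" and \<delta>: "\<And>x. norm x \<ge> \<delta> \<Longrightarrow> \<rho> x = 0"
  shows "sqnorm (\<lambda>x. conv u \<rho> x - u x) \<le> ennreal C * nl_energy \<delta> u"
proof -
  interpret mollifier \<rho> by (rule \<rho>)
  have "sqnorm (\<lambda>x. conv u \<rho> x - u x) \<le> (\<integral>\<^sup>+x. \<integral>\<^sup>+w. ennreal ((u (x - w)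
      - u x)\<^sup>2 * \<rho> w) \<partial>lborel \<partial>lborel)"
    unfolding sqnorm_def conv_diff_self[OF assms(2,3)] real_norm_def power2_abs
    by (intro nn_integral_mono jensen_square) (auto simp: nonneg \<rho>_integrable int1)
  also have "\<dots> \<le> (\<integral>\<^sup>+x. ennreal C * (\<integral>\<^sup>+y. (if dist x y < \<delta> then ennreal ((u x
      - u y)\<^sup>2) else 0) \<partial>lborel) \<partial>lborel)"
  proof (rule nn_integral_mono)
    fix x :: "real^2"
    have "(\<integral>\<^sup>+w. ennreal ((u (x - w) - u x)\<^sup>2 * \<rho> w) \<partial>lborel)
      \<le> (\<integral>\<^sup>+w. ennreal C * (if dist x (x - w) < \<delta> then ennreal ((u x - u (x
          - w))\<^sup>2) else 0) \<partial>lborel)"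
    proof (rule nn_integral_mono)
      fix w :: "real^2"
      show "ennreal ((u (x - w) - u x)\<^sup>2 * \<rho> w) \<le> ennreal C * (if dist x (x - w)
          < \<delta> then ennreal ((u x - u (x - w))\<^sup>2) else 0)"
      proof (cases "norm w < \<delta>")
        case True
        have "(u (x - w) - u x)\<^sup>2 * \<rho> w \<le> C * (u x - u (x - w))\<^sup>2"
          using mult_right_mono[OF C[of w], of "(u x - u (x - w))\<^sup>2"]
              by (simp add: power2_commute[of "u x"] mult.commute)
        moreover have "C \<ge> 0" using nonneg[of 0] C[of 0] by linarith
        ultimately show ?thesis using True by (simp add: dist_norm ennreal_mult[symmetric]
            ennreal_leI)
      qed (simp add: \<delta>)
    qed
    also have "\<dots> = (\<integral>\<^sup>+y. ennreal C * (if dist x y < \<delta> then ennreal ((u x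
        - u y)\<^sup>2) else 0) \<partial>lborel)"
      by (rule nn_integral_lborel_reflect) measurable
    finally show "(\<integral>\<^sup>+w. ennreal ((u (x - w) - u x)\<^sup>2 * \<rho> w) \<partial>lborel) \<le> ennreal C * (\<integral>\<^sup>+y. (if dist
        x y < \<delta> then ennreal ((u x - u y)\<^sup>2) else 0) \<partial>lborel)"
      by (simp add: nn_integral_cmult)
  qed
  also have "\<dots> = ennreal C * nl_energy \<delta> u"
    unfolding nl_energy_def by (rule nn_integral_cmult) measurable
  finally show ?thesis .
qed

lemma integrable_kernel:
  fixes u :: "'a::euclidean_space \<Rightarrow> real" and K :: "'a \<times> 'a \<Rightarrow> real"
  assumes [measurable]: "u \<in> borel_measurable borel" "K \<in> borel_measurable (lborel \<Otimes>\<^sub>M lborel)"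
    and u: "sqnorm u < \<infinity>" and C: "\<And>x y. \<bar>K (x, y)\<bar> \<le> C" and R: "\<And>x y. norm x \<ge> R \<or> norm y \<ge> R
        \<Longrightarrow> K (x, y) = 0"
  shows "integrable (lborel \<Otimes>\<^sub>M lborel) (\<lambda>p. u (snd p) * K p)"
proof (rule Bochner_Integration.integrable_bound)
  have [measurable]: "cball (0::'a) R \<in> sets borel" by simp
  have i1: "integrable lborel (indicator (cball 0 R) :: 'a \<Rightarrow> real)"
    using emeasure_lborel_cball_finite[of "0::'a" R] by (simp add: integrable_indicator_iff)
  have i2: "integrable lborel (\<lambda>y. u y * indicator (cball 0 R) y)"
    by (rule integrable_times_bounded_support[OF assms(1) _ u, of _ 1 "R
        + 1"]) (auto simp: indicator_def)
  have "integrable (lborel \<Otimes>\<^sub>M lborel) (\<lambda>(x, y). (indicator (cball (0::'a) R) x :: real) * (u y *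
      indicator (cball 0 R) y))"
    by (rule lborel_pair.Fubini_integrable) (use i1 i2 in \<open>auto simp: abs_mult\<close>)
  then show "integrable (lborel \<Otimes>\<^sub>M lborel) (\<lambda>p. C * ((indicator (cball (0::'a) R) (fst p) :: real)
      * (u (snd p) * indicator (cball 0 R) (snd p))))"
    by (simp add: split_beta')
  have "C \<ge> 0" using C[of 0 0] by linarith
  show "AE p in lborel \<Otimes>\<^sub>M lborel. norm (u (snd p) * K p) \<le> norm (C * ((indicator (cball (0::'a) R)
      (fst p) :: real) * (u (snd p) * indicator (cball 0 R) (snd p))))"
  proof (rule AE_I2)
    fix p :: "'a \<times> 'a"
    obtain x y where p: "p = (x, y)" by (cases p)
    show "norm (u (snd p) * K p) \<le> norm (C * ((indicator (cball (0::'a) R) (fst p) :: real) * (u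
        (snd p) * indicator (cball 0 R) (snd p))))"
    proof (cases "norm x \<le> R \<and> norm y \<le> R")
      case True
      then show ?thesis using mult_left_mono[OF C[of x y], of "\<bar>u y\<bar>"] \<open>C \<ge> 0\<close>
          by (simp add: p abs_mult mult.commute)
    next
      case False
      then have "norm x \<ge> R \<or> norm y \<ge> R" by auto
      from R[OF this] show ?thesis by (simp add: p)
    qed
  qed
qed measurable

lemma test_function_mult:
  assumes "test_function f" "test_function g" shows "test_function (\<lambda>x. f x * g x)"
proof -
  have "{x. f x * g x \<noteq> 0} \<subseteq> {x. f x \<noteq> 0}" by auto
  then have "closure {x. f x * g x \<noteq> 0} \<subseteq> closure {x. f x \<noteq> 0}" by (rule closure_mono)
  then have "compact (closure {x. f x * g x \<noteq> 0})"
    using assms(1) unfolding test_function_def by (meson closed_closure compact_Int_closed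
        compact_closure compact_imp_bounded bounded_subset closure_subset order_trans)
  then show ?thesis unfolding test_function_def
    by (intro conjI allI C_k_mult) (use assms in \<open>auto simp: test_function_def\<close>)
qed

text \<open>The product is a test function, so its derivative has integral zero.\<close>

lemma integral_by_parts_test:
  fixes \<rho> \<phi> :: "'a::euclidean_space \<Rightarrow> real"
  assumes \<rho>: "test_function \<rho>" and \<phi>: "test_function \<phi>"
  shows "(\<integral>x. \<rho> (x - y) * frechet_derivative \<phi> (at x) v \<partial>lborel) = - (\<integral>x. frechet_derivative \<rho> (at
      (x - y)) v * \<phi> x \<partial>lborel)"
proof -
  have \<rho>y: "test_function (\<lambda>x. \<rho> (x - y))" by (rule test_function_translate[OF \<rho>])
  obtain R where R: "\<And>x. norm x \<ge> R \<Longrightarrow> \<phi> x = 0" "\<And>x v. norm x \<ge> R \<Longrightarrow> frechet_derivative \<phi> (at x) v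
      = 0"
    using test_function_support[OF \<phi>] by metis
  have hd: "((\<lambda>x. \<rho> (x - y) * \<phi> x) has_derivative (\<lambda>v. \<rho> (x - y) * frechet_derivative \<phi> (at x) v
      + frechet_derivative \<rho> (at (x - y)) v * \<phi> x)) (at x)" for x
    using has_derivative_mult[OF test_function_has_derivative[OF \<rho>y] test_function_has_derivative[OF
        \<phi>]]
    by (simp add: frechet_derivative_translate[OF \<rho>])
  have eq: "frechet_derivative (\<lambda>x. \<rho> (x - y) * \<phi> x) (at x) v = \<rho> (x - y) * frechet_derivative \<phi> (at
      x) v + frechet_derivative \<rho> (at (x - y)) v * \<phi> x" for x
    by (subst frechet_derivative_at[OF hd, symmetric]) simp
  have cd: "continuous_on UNIV (\<lambda>x. frechet_derivative \<rho> (at (x - y)) v)"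
    using test_function_derivative_continuous[OF \<rho>y, of v]
        by (simp add: frechet_derivative_translate[OF \<rho>])
  have "integrable lborel (\<lambda>x. \<rho> (x - y) * frechet_derivative \<phi> (at x) v)"
    by (rule integrable_compact_support[where R = R])
      (auto intro!: continuous_intros test_function_derivative_continuous[OF \<phi>]
          test_function_continuous[OF \<rho>y] simp: R)
  moreover have "integrable lborel (\<lambda>x. frechet_derivative \<rho> (at (x - y)) v * \<phi> x)"
    by (rule integrable_compact_support[where R = R])
      (auto intro!: continuous_intros cd test_function_continuous[OF \<phi>] simp: R)
  ultimately show ?thesis
    using integral_derivative_test_function_0[OF test_function_mult[OF \<rho>y \<phi>], of v]
    by (simp add: eq)
qed

text \<open>Fubini moves the integral in \<open>x\<close> onto the kernel and the test function,
  where integration by parts is available; a second exchange brings it back.\<close>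

lemma weak_grad_conv:
  fixes u :: "'a::euclidean_space \<Rightarrow> real"
  assumes \<rho>: "test_function \<rho>" and [measurable]: "u \<in> borel_measurable borel" and u: "sqnorm u < \<infinity>"
  shows "weak_grad (conv u \<rho>) (conv_grad u \<rho>)"
  unfolding weak_grad_def
proof (intro allI impI ballI)
  fix \<phi> :: "'a \<Rightarrow> real" and v :: 'a
  assume \<phi>: "test_function \<phi>" and v: "v \<in> Basis"
  note [measurable] = test_function_measurable[OF \<phi>] test_function_measurable[OF \<rho>]
  let ?D\<phi> = "\<lambda>x. frechet_derivative \<phi> (at x) v" and ?D\<rho> = "\<lambda>x. frechet_derivative \<rho> (at x) v"
  have g: "conv_grad u \<rho> x \<bullet> v = conv u ?D\<rho> x" for x
    using v by (simp add: conv_grad_def inner_sum_left inner_Basis if_distrib cong: if_cong)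
  have swap: "(\<integral>x. (\<integral>y. u y * (f (x - y) * h x) \<partial>lborel) \<partial>lborel) = (\<integral>y. u y * (\<integral>x. f (x
      - y) * h x \<partial>lborel) \<partial>lborel)"
    if f: "continuous_on UNIV f" and fR: "\<And>x. norm x \<ge> R \<Longrightarrow> f x = 0" and h: "continuous_on UNIV h"
        and hR: "\<And>x. norm x \<ge> S \<Longrightarrow> h x = 0" for f h :: "'a \<Rightarrow> real" and R S
  proof -
    obtain C where C: "C > 0" "\<And>x. \<bar>f x\<bar> \<le> C" using compact_support_bounded[OF f fR] by metis
    obtain D where D: "D > 0" "\<And>x. \<bar>h x\<bar> \<le> D" using compact_support_bounded[OF h hR] by metis
    have [measurable]: "f \<in> borel_measurable borel" "h \<in> borel_measurable borel"
      using f h by (auto intro: borel_measurable_continuous_onI)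
    have "integrable (lborel \<Otimes>\<^sub>M lborel) (\<lambda>p. u (snd p) * (\<lambda>p. f (fst p - snd p) * h (fst p)) p)"
    \<comment> \<open>Where \<open>h x\<close> is not forced to vanish one has
      \<open>norm x < S\<close>, and then the kernel confines \<open>y\<close> to the ball of radius
      \<open>\<bar>R\<bar> + \<bar>S\<bar>\<close>.\<close>
    proof (rule integrable_kernel[where C = "C * D" and R = "\<bar>R\<bar> + \<bar>S\<bar>"])
      show "\<bar>f (fst (x, y) - snd (x, y)) * h (fst (x, y))\<bar> \<le> C * D" for x y
        using C D by (simp add: abs_mult mult_mono less_imp_le)
      show "f (fst (x, y) - snd (x, y)) * h (fst (x, y)) = 0" if "norm x \<ge> \<bar>R\<bar> + \<bar>S\<bar> \<or> norm y \<ge> \<bar>R\<bar>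
          + \<bar>S\<bar>" for x y
      proof (cases "norm x \<ge> S")
        case False
        then have "norm y \<ge> \<bar>R\<bar> + \<bar>S\<bar>" using that by linarith
        then have "norm (x - y) \<ge> R" using False norm_triangle_ineq2[of y x]
            by (simp add: norm_minus_commute)
        then show ?thesis by (simp add: fR)
      qed (simp add: hR)
    qed (use u in auto)
    then have "integrable (lborel \<Otimes>\<^sub>M lborel) (\<lambda>(x, y). u y * (f (x - y) * h x))"
      by (simp add: split_beta')
    from lborel_pair.Fubini_integral[OF this] show ?thesis by simp
  qed
  obtain R where R: "\<And>x. norm x \<ge> R \<Longrightarrow> \<phi> x = 0" "\<And>x v. norm x \<ge> R \<Longrightarrow> frechet_derivative \<phi> (at x) v
      = 0"
    using test_function_support[OF \<phi>] by metis
  obtain S where S: "\<And>x. norm x \<ge> S \<Longrightarrow> \<rho> x = 0" "\<And>x v. norm x \<ge> S \<Longrightarrow> frechet_derivative \<rho> (at x) v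
      = 0"
    using test_function_support[OF \<rho>] by metis
  have "(\<integral>x. conv u \<rho> x * ?D\<phi> x \<partial>lborel) = (\<integral>x. (\<integral>y. u y * (\<rho> (x - y) * ?D\<phi> x) \<partial>lborel) \<partial>lborel)"
    by (simp add: conv_def mult.assoc[symmetric])
  also have "\<dots> = (\<integral>y. u y * (\<integral>x. \<rho> (x - y) * ?D\<phi> x \<partial>lborel) \<partial>lborel)"
    by (rule swap) (auto intro: test_function_derivative_continuous test_function_continuous \<phi> \<rho> R
        S)
  also have "\<dots> = - (\<integral>y. u y * (\<integral>x. ?D\<rho> (x - y) * \<phi> x \<partial>lborel) \<partial>lborel)"
    by (simp add: integral_by_parts_test[OF \<rho> \<phi>])
  also have "(\<integral>y. u y * (\<integral>x. ?D\<rho> (x - y) * \<phi> x \<partial>lborel) \<partial>lborel) = (\<integral>x. (\<integral>y. u y * (?D\<rho> (x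
      - y) * \<phi> x) \<partial>lborel) \<partial>lborel)"
    by (rule swap[symmetric]) (auto intro: test_function_derivative_continuous
        test_function_continuous \<phi> \<rho> R S)
  also have "\<dots> = (\<integral>x. (conv_grad u \<rho> x \<bullet> v) * \<phi> x \<partial>lborel)"
    by (simp add: g) (simp add: conv_def mult.assoc[symmetric])
  finally show "(\<integral>x. conv u \<rho> x * ?D\<phi> x \<partial>lborel) = - (\<integral>x. (conv_grad u \<rho> x \<bullet> v) * \<phi> x \<partial>lborel)" .
qed

lemma integrable_conv':
  fixes u f :: "'a::euclidean_space \<Rightarrow> real"
  assumes [measurable]: "u \<in> borel_measurable borel" and u: "sqnorm u < \<infinity>"
    and f: "continuous_on UNIV f" and R: "\<And>x. norm x \<ge> R \<Longrightarrow> f x = 0"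
  shows "integrable lborel (\<lambda>y. u y * f (x - y))"
proof -
  have [measurable]: "f \<in> borel_measurable borel" using f by (rule borel_measurable_continuous_onI)
  obtain C where C: "\<And>x. \<bar>f x\<bar> \<le> C" using compact_support_bounded[OF f R] by metis
  show ?thesis
  proof (rule integrable_times_bounded_support[where C = C and R = "R + norm x"])
    fix y :: 'a assume "norm y \<ge> R + norm x"
    then have "norm (x - y) \<ge> R" using norm_triangle_ineq2[of y x] by (simp add: norm_minus_commute)
    then show "f (x - y) = 0" by (rule R)
  qed (use u C in auto)
qed

lemma conv_grad_inner:
  assumes [measurable]: "u \<in> borel_measurable borel" and u: "sqnorm u < \<infinity>" and \<rho>: "test_function \<rho>"
  shows "conv_grad u \<rho> x \<bullet> z = conv u (\<lambda>w. frechet_derivative \<rho> (at w) z) x"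
proof -
  obtain R where R: "\<And>x v. norm x \<ge> R \<Longrightarrow> frechet_derivative \<rho> (at x) v = 0"
    using test_function_support[OF \<rho>] by metis
  have "conv u (\<lambda>w. frechet_derivative \<rho> (at w) z) x = (\<integral>y. (\<Sum>i\<in>Basis. (z \<bullet> i) * (u y *
      frechet_derivative \<rho> (at (x - y)) i)) \<partial>lborel)"
    unfolding conv_def by (subst frechet_derivative_expand[OF \<rho>]) (simp add: sum_distrib_left
        mult_ac)
  also have "\<dots> = (\<Sum>i\<in>Basis. (z \<bullet> i) * conv u (\<lambda>w. frechet_derivative \<rho> (at w) i) x)"
    unfolding conv_def
    by (subst Bochner_Integration.integral_sum)
      (auto intro!: integrable_conv'[where R = R and f = "\<lambda>w. frechet_derivative \<rho> (at w) _"]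
          test_function_derivative_continuous \<rho> u R)
  also have "\<dots> = conv_grad u \<rho> x \<bullet> z"
    by (simp add: conv_grad_def inner_sum_left mult.commute inner_commute[of z])
  finally show ?thesis by simp
qed

text \<open>Convergence along the single sequence \<open>1 / real (Suc n)\<close> is all that
  Fatou's lemma will ask for. The kernel is Lipschitz along \<open>z\<close> and has compact
  support, which provides the dominating function.\<close>

lemma conv_difference_quotient:
  fixes u \<rho> :: "'a::euclidean_space \<Rightarrow> real"
  assumes [measurable]: "u \<in> borel_measurable borel" and u: "sqnorm u < \<infinity>" and \<rho>: "test_function \<rho>"
  shows "(\<lambda>n. (conv u \<rho> (x + (1 / real (Suc n)) *\<^sub>R z) - conv u \<rho> x) / (1 / real (Suc n)))
      \<longlonglongrightarrow> conv_grad u \<rho> x \<bullet> z"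
proof -
  note [measurable] = test_function_measurable[OF \<rho>]
  let ?D = "\<lambda>w. frechet_derivative \<rho> (at w) z"
  obtain R where R: "R > 0" "\<And>x. norm x \<ge> R \<Longrightarrow> \<rho> x = 0" "\<And>x v. norm x \<ge> R \<Longrightarrow> frechet_derivative \<rho> (at
      x) v = 0"
    using test_function_support[OF \<rho>] by metis
  obtain D where D: "D > 0" "\<And>w. \<bar>?D w\<bar> \<le> D"
    using compact_support_bounded[OF test_function_derivative_continuous[OF \<rho>], of R z] R by metis
  have der: "((\<lambda>t. \<rho> (w + t *\<^sub>R z)) has_field_derivative ?D (w + t *\<^sub>R z)) (at t)" for w
      and t :: real
  proof -
    have "((\<lambda>t. w + t *\<^sub>R z) has_derivative (\<lambda>s. s *\<^sub>R z)) (at t)"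
      by (auto intro!: derivative_eq_intros)
    from has_derivative_compose[OF this test_function_has_derivative[OF \<rho>, of "w + t *\<^sub>R z"]]
    have "((\<lambda>t. \<rho> (w + t *\<^sub>R z)) has_derivative (\<lambda>s. frechet_derivative \<rho> (at (w
        + t *\<^sub>R z)) (s *\<^sub>R z))) (at t)"
      by (simp add: o_def)
    moreover have lin: "linear (frechet_derivative \<rho> (at (w + t *\<^sub>R z)))"
      using test_function_has_derivative[OF \<rho>] has_derivative_linear by blast
    then have "(\<lambda>s. frechet_derivative \<rho> (at (w + t *\<^sub>R z)) (s *\<^sub>R z)) = (*) (?D (w + t *\<^sub>R z))"
      by (simp add: linear_cmul fun_eq_iff mult.commute)
    ultimately show ?thesis by (simp add: has_field_derivative_def)
  qed
  have lip: "\<bar>\<rho> (w + t *\<^sub>R z) - \<rho> w\<bar> \<le> D * \<bar>t\<bar>" for w and t :: real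
    using field_differentiable_bound[of UNIV "\<lambda>t. \<rho> (w + t *\<^sub>R z)" "\<lambda>t. ?D (w
        + t *\<^sub>R z)" D t 0] der D(2)
    by (auto intro: has_field_derivative_at_within)
  have "(\<lambda>n. \<integral>y. u y * ((\<rho> (x + (1 / real (Suc n)) *\<^sub>R z - y) - \<rho> (x
      - y)) / (1 / real (Suc n))) \<partial>lborel) \<longlonglongrightarrow> (\<integral>y. u y * ?D (x - y) \<partial>lborel)"
  proof (rule integral_dominated_convergence)
    let ?B = "\<lambda>y. \<bar>u y\<bar> * (D * indicator (cball 0 (R + norm x + norm z)) y)"
    show "integrable lborel ?B"
      using u D(1) by (intro integrable_times_bounded_support[where C = D
          and R = "R + norm x + norm z + 1"]) (auto simp: sqnorm_def indicator_def)
    show "AE y in lborel. (\<lambda>n. u y * ((\<rho> (x + (1 / real (Suc n)) *\<^sub>R z - y) - \<rho> (x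
        - y)) / (1 / real (Suc n)))) \<longlonglongrightarrow> u y * ?D (x - y)"
    proof (intro AE_I2 tendsto_mult tendsto_const)
      fix y :: 'a
      have "((\<lambda>h. (\<rho> (x - y + h *\<^sub>R z) - \<rho> (x - y)) / h) \<longlongrightarrow> ?D (x - y)) (at 0)"
        using der[of "x - y" 0] by (simp add: DERIV_def)
      moreover have "filterlim (\<lambda>n. 1 / real (Suc n)) (at 0) sequentially"
        by (rule filterlim_atI) (use LIMSEQ_Suc[OF lim_1_over_n] in auto)
      ultimately have "(\<lambda>n. (\<rho> (x - y + (1 / real (Suc n)) *\<^sub>R z) - \<rho> (x - y)) / (1 / real (Suc n)))
          \<longlonglongrightarrow> ?D (x - y)"
        by (rule filterlim_compose)
      then show "(\<lambda>n. (\<rho> (x + (1 / real (Suc n)) *\<^sub>R z - y) - \<rho> (x - y)) / (1 / real (Suc n)))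
          \<longlonglongrightarrow> ?D (x - y)"
        by (simp add: algebra_simps)
    qed
    show "AE y in lborel. norm (u y * ((\<rho> (x + (1 / real (Suc n)) *\<^sub>R z - y) - \<rho> (x
        - y)) / (1 / real (Suc n)))) \<le> ?B y" for n
    proof (rule AE_I2)
      fix y :: 'a
      define t where "t = 1 / real (Suc n)"
      have t: "0 < t" "t \<le> 1" by (simp_all add: t_def)
      have eq: "x + t *\<^sub>R z - y = (x - y) + t *\<^sub>R z" by simp
      have "\<bar>(\<rho> (x + t *\<^sub>R z - y) - \<rho> (x - y)) / t\<bar> \<le> D * indicator (cball 0 (R + norm x
          + norm z)) y"
      proof (cases "norm y \<le> R + norm x + norm z")
        case True
        then show ?thesis using lip[of "x - y" t] t unfolding eq
            by (simp add: abs_divide pos_divide_le_eq)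
      next
        case False
        have "norm (t *\<^sub>R z) \<le> norm z" using t by (simp add: mult_left_le_one_le)
        moreover have "norm y \<le> norm (x + t *\<^sub>R z - y) + norm x + norm (t *\<^sub>R z)"
          using norm_triangle_ineq2[of y "x + t *\<^sub>R z"] norm_triangle_ineq[of x "t *\<^sub>R z"]
              by (simp add: norm_minus_commute)
        moreover have "norm y \<le> norm (x - y) + norm x"
          using norm_triangle_ineq2[of y x] by (simp add: norm_minus_commute)
        ultimately have "norm (x + t *\<^sub>R z - y) \<ge> R" "norm (x - y) \<ge> R"
          using False norm_ge_zero[of z] by linarith+
        then show ?thesis using R(2) D(1) by (simp add: indicator_def)
      qed
      from mult_left_mono[OF this, of "\<bar>u y\<bar>"]
      show "norm (u y * ((\<rho> (x + (1 / real (Suc n)) *\<^sub>R z - y) - \<rho> (x - y)) / (1 / real (Suc n))))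
          \<le> ?B y"
        by (simp add: abs_mult t_def)
    qed
  qed measurable
  moreover have "(conv u \<rho> (x + t *\<^sub>R z) - conv u \<rho> x) / t = (\<integral>y. u y * ((\<rho> (x + t *\<^sub>R z - y) - \<rho> (x
      - y)) / t) \<partial>lborel)" for t
    using integrable_conv'[OF assms(1) u test_function_continuous[OF \<rho>] R(2), where x = "x
        + t *\<^sub>R z"]
      integrable_conv'[OF assms(1) u test_function_continuous[OF \<rho>] R(2), where x = x]
    unfolding conv_def by (subst Bochner_Integration.integral_diff[symmetric]) (auto simp:
        right_diff_distrib diff_divide_distrib)
  ultimately show ?thesis
    by (simp only: conv_grad_inner[OF assms] conv_def[of u ?D])
qed

text \<open>The converse of \<open>dirichlet_le_weak_grad\<close> for mollified functions:
  difference quotients converge pointwise to the derivative, and Fatou's lemma compares its second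
  moment with the nonlocal energy at scale \<open>\<epsilon> n\<close>.\<close>

lemma sqnorm_conv_grad_le:
  fixes u :: "real^2 \<Rightarrow> real"
  assumes [measurable]: "u \<in> borel_measurable borel" and u: "sqnorm u < \<infinity>" and \<rho>: "test_function \<rho>"
  shows "sqnorm (conv_grad u \<rho>) \<le> dirichlet (conv u \<rho>)"
proof -
  define v where "v = conv u \<rho>"
  define G where "G = conv_grad u \<rho>"
  define \<epsilon> where "\<epsilon> n = 1 / real (Suc n)" for n
  have \<epsilon>: "\<epsilon> n > 0" for n by (simp add: \<epsilon>_def)
  have [measurable]: "v \<in> borel_measurable borel" "G \<in> borel_measurable borel"
    using measurable_conv[OF assms(1) test_function_measurable(1)[OF \<rho>]] measurable_conv_grad[OF
        assms(1) \<rho>] by (simp_all add: v_def G_def)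
  have "ennreal ball_moment * sqnorm G = (\<integral>\<^sup>+x. \<integral>\<^sup>+z. (if norm z < 1 then ennreal ((G x \<bullet> z)\<^sup>2) else
      0) \<partial>lborel \<partial>lborel)"
    using second_moment_isotropic[of 1] ball_moment_pos
    by (simp add: sqnorm_def nn_integral_cmult[symmetric] ennreal_mult)
  also have "\<dots> = (\<integral>\<^sup>+x. \<integral>\<^sup>+z. liminf (\<lambda>n. (if norm z < 1 then ennreal (((v (x + \<epsilon> n *\<^sub>R z)
      - v x) / \<epsilon> n)\<^sup>2) else 0)) \<partial>lborel \<partial>lborel)"
  proof (intro nn_integral_cong)
    fix x z :: "real^2"
    have "(\<lambda>n. (v (x + \<epsilon> n *\<^sub>R z) - v x) / \<epsilon> n) \<longlonglongrightarrow> G x \<bullet> z"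
      unfolding v_def G_def \<epsilon>_def by (rule conv_difference_quotient[OF assms])
    then have "(\<lambda>n. if norm z < 1 then ennreal (((v (x + \<epsilon> n *\<^sub>R z) - v x) / \<epsilon> n)\<^sup>2) else 0)
        \<longlonglongrightarrow> (if norm z < 1 then ennreal ((G x \<bullet> z)\<^sup>2) else 0)"
      by (auto intro!: tendsto_ennrealI tendsto_power)
    from lim_imp_Liminf[OF trivial_limit_sequentially this]
    show "(if norm z < 1 then ennreal ((G x \<bullet> z)\<^sup>2) else 0) = liminf (\<lambda>n. (if norm z
        < 1 then ennreal (((v (x + \<epsilon> n *\<^sub>R z) - v x) / \<epsilon> n)\<^sup>2) else 0))"
      by simp
  qed
  also have "\<dots> \<le> (\<integral>\<^sup>+x. liminf (\<lambda>n. \<integral>\<^sup>+z. (if norm z < 1 then ennreal (((v (x + \<epsilon> n *\<^sub>R z)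
      - v x) / \<epsilon> n)\<^sup>2) else 0) \<partial>lborel) \<partial>lborel)"
    by (intro nn_integral_mono nn_integral_liminf) measurable
  also have "\<dots> \<le> liminf (\<lambda>n. \<integral>\<^sup>+x. \<integral>\<^sup>+z. (if norm z < 1 then ennreal (((v (x + \<epsilon> n *\<^sub>R z)
      - v x) / \<epsilon> n)\<^sup>2) else 0) \<partial>lborel \<partial>lborel)"
    by (intro nn_integral_liminf) measurable
  also have "\<dots> \<le> liminf (\<lambda>n::nat. ennreal ball_moment * dirichlet v)"
  proof (rule Liminf_mono, rule always_eventually, rule allI)
    fix n
    have e2: "ennreal ((1 / \<epsilon> n)\<^sup>2) * ennreal ((\<epsilon> n)\<^sup>2) = 1"
      using \<epsilon>[of n] by (simp add: ennreal_mult[symmetric] power_mult_distrib[symmetric])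
    have "(\<integral>\<^sup>+x. \<integral>\<^sup>+z. (if norm z < 1 then ennreal (((v (x + \<epsilon> n *\<^sub>R z)
        - v x) / \<epsilon> n)\<^sup>2) else 0) \<partial>lborel \<partial>lborel)
       = (\<integral>\<^sup>+z. \<integral>\<^sup>+x. (if norm z < 1 then ennreal (((v (x + \<epsilon> n *\<^sub>R z)
           - v x) / \<epsilon> n)\<^sup>2) else 0) \<partial>lborel \<partial>lborel)"
      by (rule lborel_pair.Fubini') measurable
    also have "\<dots> = (\<integral>\<^sup>+z. ennreal ((1 / \<epsilon> n)\<^sup>2) * (if norm (\<epsilon> n *\<^sub>R z) < \<epsilon> n then sqnorm (\<lambda>x. v (x
        + \<epsilon> n *\<^sub>R z) - v x) else 0) \<partial>lborel)"
    proof (rule nn_integral_cong)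
      fix z :: "real^2"
      have "(\<integral>\<^sup>+x. ennreal (((v (x + \<epsilon> n *\<^sub>R z) - v x) / \<epsilon> n)\<^sup>2) \<partial>lborel) = ennreal ((1 / \<epsilon> n)\<^sup>2) *
          sqnorm (\<lambda>x. v (x + \<epsilon> n *\<^sub>R z) - v x)"
        unfolding sqnorm_def by (subst nn_integral_cmult[symmetric]) (auto simp:
            ennreal_mult[symmetric] power_divide)
      then show "(\<integral>\<^sup>+x. (if norm z < 1 then ennreal (((v (x + \<epsilon> n *\<^sub>R z)
          - v x) / \<epsilon> n)\<^sup>2) else 0) \<partial>lborel) = ennreal ((1 / \<epsilon> n)\<^sup>2) * (if norm (\<epsilon> n *\<^sub>R z)
          < \<epsilon> n then sqnorm (\<lambda>x. v (x + \<epsilon> n *\<^sub>R z) - v x) else 0)"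
        using \<epsilon>[of n] by simp
    qed
    also have "\<dots> = ennreal ((1 / \<epsilon> n)\<^sup>2) * (\<integral>\<^sup>+z. (if norm (\<epsilon> n *\<^sub>R z) < \<epsilon> n then sqnorm (\<lambda>x. v (x
        + \<epsilon> n *\<^sub>R z) - v x) else 0) \<partial>lborel)"
      unfolding sqnorm_def by (rule nn_integral_cmult) measurable
    \<comment> \<open>A factor \<open>(\<epsilon> n)\<^sup>2\<close> is inserted as the Jacobian of
      the change of variables \<open>\<epsilon> n *\<^sub>R z\<close>, which turns the integral over
      \<open>z\<close> into a nonlocal energy.\<close>
    also have "\<dots> = ennreal ((1 / \<epsilon> n)\<^sup>2) * (ennreal ((1 / \<epsilon> n)\<^sup>2) * (ennreal ((\<epsilon> n)\<^sup>2) * (\<integral>\<^sup>+z. (if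
        norm (\<epsilon> n *\<^sub>R z) < \<epsilon> n then sqnorm (\<lambda>x. v (x + \<epsilon> n *\<^sub>R z) - v x) else 0) \<partial>lborel)))"
      by (subst (2) mult.assoc[symmetric]) (simp add: e2)
    also have "ennreal ((\<epsilon> n)\<^sup>2) * (\<integral>\<^sup>+z. (if norm (\<epsilon> n *\<^sub>R z) < \<epsilon> n then sqnorm (\<lambda>x. v (x
        + \<epsilon> n *\<^sub>R z) - v x) else 0) \<partial>lborel) = nl_energy (\<epsilon> n) v"
    proof -
      have "(\<integral>\<^sup>+z. (if norm z < \<epsilon> n then sqnorm (\<lambda>x. v (x + z) - v x) else 0) \<partial>lborel)
          = ennreal (\<epsilon> n ^ DIM(real^2)) * (\<integral>\<^sup>+z. (if norm (\<epsilon> n *\<^sub>R z) < \<epsilon> n then sqnorm (\<lambda>x. v (x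
          + \<epsilon> n *\<^sub>R z) - v x) else 0) \<partial>lborel)"
        unfolding sqnorm_def by (rule nn_integral_lborel_scale[OF _ \<epsilon>]) measurable
      then show ?thesis by (simp add: nl_energy_shift_form)
    qed
    also have "ennreal ((1 / \<epsilon> n)\<^sup>2) * (ennreal ((1 / \<epsilon> n)\<^sup>2) * nl_energy (\<epsilon> n) v)
        \<le> ennreal ((1 / \<epsilon> n)\<^sup>2) * (ennreal ((1 / \<epsilon> n)\<^sup>2) * (ennreal (ball_moment * \<epsilon> n ^ 4) *
        dirichlet v))"
      by (intro mult_left_mono nl_energy_le_dirichlet \<epsilon>) auto
    also have "\<dots> = ennreal ball_moment * dirichlet v"
      using \<epsilon>[of n] ball_moment_pos
      by (simp add: mult.assoc[symmetric] ennreal_mult[symmetric] power_divide)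
    finally show "(\<integral>\<^sup>+x. \<integral>\<^sup>+z. (if norm z < 1 then ennreal (((v (x + \<epsilon> n *\<^sub>R z)
        - v x) / \<epsilon> n)\<^sup>2) else 0) \<partial>lborel \<partial>lborel) \<le> ennreal ball_moment * dirichlet v" .
  qed
  also have "\<dots> = ennreal ball_moment * dirichlet v" by (simp add: Liminf_const)
  finally show ?thesis
    using ball_moment_pos by (simp add: ennreal_mult_le_mult_iff v_def G_def)
qed

section \<open>Mollifiers at dyadic scales\<close>

definition moll_mass :: real where
  "moll_mass = (\<integral>x. bump 1 (- One) One (x :: real^2) \<partial>lborel)"

definition moll :: "real \<Rightarrow> real^2 \<Rightarrow> real" where
  "moll m x = m\<^sup>2 / moll_mass * bump 1 (- One) One (m *\<^sub>R x)"

lemma moll_mass_pos: "moll_mass > 0"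
proof -
  let ?b = "bump 1 (- One) One :: real^2 \<Rightarrow> real"
  have int: "integrable lborel ?b"
    using test_function_bump[of 1 "- One" "One :: real^2"] integrable_compact_support
        test_function_continuous test_function_support
    by (metis zero_less_one)
  have "moll_mass \<noteq> 0"
  proof
    assume "moll_mass = 0"
    then have "AE x in lborel. ?b x = 0"
      using integral_nonneg_eq_0_iff_AE[OF int] by (simp add: moll_mass_def bump_nonneg)
    then have "AE x in lborel. x \<notin> box (- One) (One :: real^2)"
      by eventually_elim (metis bump_inside less_irrefl zero_less_one)
    then have "emeasure lborel (box (- One) (One :: real^2)) = 0"
      by (subst (asm) AE_iff_measurable[of "box (- One) (One :: real^2)"]) auto
    moreover have "emeasure lborel (box (- One) (One :: real^2)) = ennreal (\<Prod>b\<in>(Basis::(real^2)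
        set). (One - (- One)) \<bullet> b)"
      by (rule emeasure_lborel_box) simp
    moreover have "(\<Prod>b\<in>(Basis::(real^2) set). (One - (- One)) \<bullet> b) = (\<Prod>b\<in>(Basis::(real^2) set). 2)"
      by (intro prod.cong) (simp_all only: inner_diff_left inner_minus_left inner_sum_left_Basis,
          simp)
    ultimately show False by (simp only: prod_constant ennreal_eq_0_iff) (simp add: not_le)
  qed
  moreover have "moll_mass \<ge> 0" unfolding moll_mass_def by (simp add: bump_nonneg)
  ultimately show ?thesis by simp
qed

lemma moll_bounds:
  assumes "m > 0" shows "0 \<le> moll m x" "moll m x \<le> m\<^sup>2 / moll_mass"
  using moll_mass_pos bump_nonneg[of 1 "- One" One "m *\<^sub>R x"]
    mult_left_mono[OF bump_le1[of 1 "- One" One "m *\<^sub>R x"], of "m\<^sup>2 / moll_mass"]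
  by (simp_all add: moll_def)

text \<open>On the square carrying the bump the moduli of the coordinates add up to at most 2, so
  points of norm 3 or more lie outside.\<close>

lemma moll_support:
  assumes "m > 0" "norm x \<ge> 3 / m" shows "moll m x = 0"
proof -
  have "m *\<^sub>R x \<notin> box (- One) One"
  proof
    assume "m *\<^sub>R x \<in> box (- One) One"
    then have "\<bar>(m *\<^sub>R x) \<bullet> b\<bar> \<le> 1" if "b \<in> Basis" for b
      using that by (force simp: box_def abs_le_iff)
    then have "(\<Sum>b\<in>Basis. \<bar>(m *\<^sub>R x) \<bullet> b\<bar>) \<le> (\<Sum>b\<in>(Basis::(real^2) set). 1)" by (rule sum_mono)
    also have "\<dots> = 2" by (simp only: sum_constant DIM_real2)
    finally have "norm (m *\<^sub>R x) \<le> 2" using norm_le_l1[of "m *\<^sub>R x"] by linarith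
    then show False using assms by (simp add: field_simps)
  qed
  then show ?thesis by (simp add: moll_def bump_outside)
qed

lemma mollifier_moll:
  assumes m: "m > 0" shows "mollifier (moll m)"
proof
  have eq: "bump 1 (- One) One (m *\<^sub>R x) = bump m (- ((1 / m) *\<^sub>R One)) ((1 / m) *\<^sub>R One) x"
      for x :: "real^2"
    unfolding bump_def using m by (intro prod.cong refl) (simp add: inner_diff_left
        right_diff_distrib inner_add_left distrib_left)
  have "test_function (\<lambda>x. m\<^sup>2 / moll_mass * bump m (- ((1 / m) *\<^sub>R One)) ((1 / m) *\<^sub>R
      (One::real^2)) x)"
    unfolding test_function_def
  proof (intro conjI allI C_k_mult C_k_const)
    show "C_k k (bump m (- ((1 / m) *\<^sub>R One)) ((1 / m) *\<^sub>R (One::real^2)))" for k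
      using test_function_bump[OF m] by (auto simp: test_function_def)
    have "m\<^sup>2 / moll_mass \<noteq> 0" using m moll_mass_pos by simp
    then show "compact (closure {x. m\<^sup>2 / moll_mass * bump m (- ((1 / m) *\<^sub>R One)) ((1 / m) *\<^sub>R
        (One::real^2)) x \<noteq> 0})"
      using test_function_bump[OF m, of "- ((1 / m) *\<^sub>R One)" "(1 / m) *\<^sub>R (One::real^2)"]
          by (simp add: test_function_def)
  qed
  then show t: "test_function (moll m)" by (simp add: moll_def[abs_def] eq)
  show "0 \<le> moll m x" for x by (rule moll_bounds[OF m])
  let ?b = "bump 1 (- One) One :: real^2 \<Rightarrow> real"
  have [measurable]: "?b \<in> borel_measurable borel"
    by (rule test_function_measurable[OF test_function_bump]) simp
  have "ennreal moll_mass = (\<integral>\<^sup>+x. ennreal (?b x) \<partial>lborel)"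
    unfolding moll_mass_def
    by (rule nn_integral_eq_integral[symmetric])
      (use moll_mass_pos not_integrable_integral_eq[of lborel ?b] in \<open>auto simp: bump_nonneg
          moll_mass_def\<close>)
  also have "\<dots> = ennreal (m ^ DIM(real^2)) * (\<integral>\<^sup>+x. ennreal (?b (m *\<^sub>R x)) \<partial>lborel)"
    by (rule nn_integral_lborel_scale[OF _ m]) measurable
  also have "\<dots> = (\<integral>\<^sup>+x. ennreal (m\<^sup>2 * ?b (m *\<^sub>R x)) \<partial>lborel)"
    by (simp add: nn_integral_cmult[symmetric] ennreal_mult bump_nonneg)
  finally have "(\<integral>x. m\<^sup>2 * ?b (m *\<^sub>R x) \<partial>lborel) = moll_mass"
    by (subst integral_eq_nn_integral) (use moll_mass_pos in \<open>auto simp: bump_nonneg\<close>)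
  then have "(\<integral>x. (m\<^sup>2 * ?b (m *\<^sub>R x)) / moll_mass \<partial>lborel) = 1"
    using moll_mass_pos by simp
  then show "(\<integral>x. moll m x \<partial>lborel) = 1" by (simp add: moll_def)
qed

definition dyadic_moll :: "nat \<Rightarrow> real^2 \<Rightarrow> real" where
  "dyadic_moll k = moll (2 ^ k)"

lemma mollifier_dyadic: "mollifier (dyadic_moll k)"
  by (simp add: dyadic_moll_def mollifier_moll)

text \<open>At \<open>m = 2 ^ k\<close> the kernel bound \<open>m\<^sup>2 / moll_mass\<close> times
  \<open>ball_moment * (3 / m) ^ 4\<close> equals \<open>moll_rate / m\<^sup>2\<close>; 81 is the
  fourth power of the 3 in \<open>moll_support\<close>.\<close>

definition moll_rate :: real where "moll_rate = 81 * ball_moment / moll_mass"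

lemma moll_rate_pos: "moll_rate > 0"
  using ball_moment_pos moll_mass_pos by (simp add: moll_rate_def)

lemma sqnorm_dyadic_diff_le:
  fixes u :: "real^2 \<Rightarrow> real"
  assumes "u \<in> borel_measurable borel" "sqnorm u < \<infinity>"
  shows "sqnorm (\<lambda>x. conv u (dyadic_moll k) x - u x) \<le> ennreal (moll_rate * (1/4)^k) * dirichlet u"
proof -
  let ?m = "2 ^ k :: real"
  have "sqnorm (\<lambda>x. conv u (dyadic_moll k) x - u x) \<le> ennreal (?m\<^sup>2 / moll_mass) * nl_energy (3 /
      ?m) u"
    unfolding dyadic_moll_def using moll_bounds(2)[of ?m] moll_support[of ?m]
    by (intro sqnorm_conv_diff_le mollifier_moll assms) auto
  also have "\<dots> \<le> ennreal (?m\<^sup>2 / moll_mass) * (ennreal (ball_moment * (3 / ?m) ^ 4) * dirichlet u)"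
    by (intro mult_left_mono nl_energy_le_dirichlet) auto
  also have "\<dots> = ennreal (?m\<^sup>2 / moll_mass * (ball_moment * (3 / ?m) ^ 4)) * dirichlet u"
    using moll_mass_pos ball_moment_pos by (simp add: mult.assoc[symmetric] ennreal_mult[symmetric])
  also have "?m\<^sup>2 / moll_mass * (ball_moment * (3 / ?m) ^ 4) = moll_rate * (1 / ?m\<^sup>2)"
    by (simp add: moll_rate_def power_divide power2_eq_square power4_eq_xxxx)
  also have "1 / ?m\<^sup>2 = (1/4)^k"
    by (simp add: power_divide power2_eq_square power_mult_distrib[symmetric])
  finally show ?thesis .
qed

text \<open>The errors decay geometrically along dyadic scales, so the whole sequence converges
  almost everywhere, not only a subsequence.\<close>

lemma dyadic_conv_tendsto_AE:
  fixes u :: "real^2 \<Rightarrow> real"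
  assumes [measurable]: "u \<in> borel_measurable borel" and u: "sqnorm u < \<infinity>" "dirichlet u < \<infinity>"
  shows "AE x in lborel. (\<lambda>k. conv u (dyadic_moll k) x) \<longlonglongrightarrow> u x"
proof -
  obtain M where M: "dirichlet u = ennreal M" "M \<ge> 0" using u(2) by (cases "dirichlet u") auto
  have [measurable]: "dyadic_moll k \<in> borel_measurable borel" for k
    by (rule mollifier.\<rho>_measurable[OF mollifier_dyadic])
  have "AE x in lborel. (\<lambda>k. conv u (dyadic_moll k) x - u x) \<longlonglongrightarrow> 0"
  proof (rule AE_tendsto_0_if_sqnorm_summable)
    show "(\<lambda>x. conv u (dyadic_moll k) x - u x) \<in> borel_measurable borel" for k
      using measurable_conv[of u "dyadic_moll k"] by simp
    show "sqnorm (\<lambda>x. conv u (dyadic_moll k) x - u x) \<le> ennreal (moll_rate * (1/4)^k * M)" for k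
      using sqnorm_dyadic_diff_le[OF assms(1) u(1), of k] M moll_rate_pos
          by (simp add: ennreal_mult)
    show "summable (\<lambda>k. moll_rate * (1/4)^k * M)" by (intro summable_mult summable_mult2
        summable_geometric) simp
  qed (use M moll_rate_pos in auto)
  then show ?thesis by eventually_elim (simp add: LIM_zero_iff)
qed

section \<open>Finite nonlocal energy characterizes H^1\<close>

lemma sqnorm_parallelogram:
  assumes [measurable]: "g \<in> borel_measurable borel" "h \<in> borel_measurable borel"
  shows "sqnorm (\<lambda>x. g x - h x) + sqnorm (\<lambda>x. g x + h x) = 2 * sqnorm g + 2 * sqnorm h"
proof -
  have pl: "(norm (g x - h x))\<^sup>2 + (norm (g x + h x))\<^sup>2 = 2 * (norm (g x))\<^sup>2 + 2 * (norm (h x))\<^sup>2"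
      for x
    by (simp add: power2_norm_eq_inner inner_add_left inner_add_right inner_diff_left
        inner_diff_right inner_commute)
  have "sqnorm (\<lambda>x. g x - h x) + sqnorm (\<lambda>x. g x + h x) = (\<integral>\<^sup>+x. ennreal ((norm (g x - h x))\<^sup>2
      + (norm (g x + h x))\<^sup>2) \<partial>lborel)"
    unfolding sqnorm_def by (subst nn_integral_add[symmetric]) auto
  also have "\<dots> = (\<integral>\<^sup>+x. 2 * ennreal ((norm (g x))\<^sup>2) + 2 * ennreal ((norm (h x))\<^sup>2) \<partial>lborel)"
    unfolding pl by (simp add: ennreal_mult)
  also have "\<dots> = 2 * sqnorm g + 2 * sqnorm h"
    unfolding sqnorm_def by (simp add: nn_integral_add nn_integral_cmult)
  finally show ?thesis .
qed

lemma sqnorm_scale: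
  assumes [measurable]: "g \<in> borel_measurable borel"
  shows "sqnorm (\<lambda>x. c *\<^sub>R g x) = ennreal (c\<^sup>2) * sqnorm g"
  unfolding sqnorm_def by (subst nn_integral_cmult[symmetric]) (auto simp: power_mult_distrib
      ennreal_mult)

lemma sqnorm_component_finite:
  assumes "g \<in> borel_measurable borel" "sqnorm g < \<infinity>" "i \<in> Basis"
  shows "sqnorm (\<lambda>x. g x \<bullet> i) < \<infinity>"
  using sqnorm_component_le[OF assms(1), of i] assms(2,3) by (auto simp: order_le_less_trans)

lemma weak_grad_average:
  assumes [measurable]: "u \<in> borel_measurable borel" "v \<in> borel_measurable borel" "g
      \<in> borel_measurable borel" "h \<in> borel_measurable borel"
    and L2: "sqnorm u < \<infinity>" "sqnorm v < \<infinity>" "sqnorm g < \<infinity>" "sqnorm h < \<infinity>"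
    and wg: "weak_grad u g" "weak_grad v h"
  shows "weak_grad (\<lambda>x. (1/2) *\<^sub>R (u x + v x)) (\<lambda>x. (1/2) *\<^sub>R (g x + h x))"
  unfolding weak_grad_def
proof (intro allI impI ballI)
  fix \<phi> :: "'a \<Rightarrow> real" and i :: 'a
  assume \<phi>: "test_function \<phi>" and i: "i \<in> Basis"
  let ?D = "\<lambda>x. frechet_derivative \<phi> (at x) i"
  have "(\<integral>x. (1/2) *\<^sub>R (u x + v x) * ?D x \<partial>lborel) = (1/2) * ((\<integral>x. u x * ?D x \<partial>lborel)
      + (\<integral>x. v x * ?D x \<partial>lborel))"
    using integrable_times_test(2)[OF assms(1) L2(1) \<phi>, of i] integrable_times_test(2)[OF assms(2)
        L2(2) \<phi>, of i]
    by (simp add: distrib_right add_divide_distrib)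
  also have "\<dots> = - ((1/2) * ((\<integral>x. (g x \<bullet> i) * \<phi> x \<partial>lborel) + (\<integral>x. (h x \<bullet> i) * \<phi> x \<partial>lborel)))"
    using wg \<phi> i by (simp add: weak_grad_def field_simps)
  also have "(1/2) * ((\<integral>x. (g x \<bullet> i) * \<phi> x \<partial>lborel) + (\<integral>x. (h x \<bullet> i) * \<phi> x \<partial>lborel))
      = (\<integral>x. (1/2) *\<^sub>R (g x + h x) \<bullet> i * \<phi> x \<partial>lborel)"
    using integrable_times_test(1)[OF _ sqnorm_component_finite[OF assms(3) L2(3) i] \<phi>]
      integrable_times_test(1)[OF _ sqnorm_component_finite[OF assms(4) L2(4) i] \<phi>]
    by (simp add: inner_add_left distrib_right add_divide_distrib)
  finally show "(\<integral>x. (1/2) *\<^sub>R (u x + v x) * ?D x \<partial>lborel) = - (\<integral>x. (1/2) *\<^sub>R (g x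
      + h x) \<bullet> i * \<phi> x \<partial>lborel)" .
qed

lemma sqnorm_test_finite:
  assumes "test_function \<phi>"
  shows "sqnorm \<phi> < \<infinity>" "sqnorm (\<lambda>x. frechet_derivative \<phi> (at x) v) < \<infinity>"
proof -
  obtain R where R: "\<And>x. norm x \<ge> R \<Longrightarrow> \<phi> x = 0" "\<And>x v. norm x \<ge> R \<Longrightarrow> frechet_derivative \<phi> (at x) v
      = 0"
    using test_function_support[OF assms] by metis
  show "sqnorm \<phi> < \<infinity>"
    by (rule sqnorm_compact_support_finite[OF test_function_continuous[OF assms] R(1)])
  show "sqnorm (\<lambda>x. frechet_derivative \<phi> (at x) v) < \<infinity>"
    by (rule sqnorm_compact_support_finite[OF test_function_derivative_continuous[OF assms] R(2)])
qed

lemma weak_grad_limit: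
  fixes u :: "'a::euclidean_space \<Rightarrow> real" and U :: "nat \<Rightarrow> 'a \<Rightarrow> real"
  assumes [measurable]: "\<And>k. U k \<in> borel_measurable borel" "\<And>k. G k \<in> borel_measurable borel" "u
      \<in> borel_measurable borel" "g \<in> borel_measurable borel"
    and L2: "\<And>k. sqnorm (U k) < \<infinity>" "\<And>k. sqnorm (G k) < \<infinity>" "sqnorm u < \<infinity>" "sqnorm g < \<infinity>"
    and wg: "\<And>k. weak_grad (U k) (G k)"
    and U: "\<And>\<eta>::real. \<eta> > 0 \<Longrightarrow> \<exists>N. \<forall>k\<ge>N. sqnorm (\<lambda>x. U k x - u x) \<le> ennreal \<eta>"
    and G: "\<And>\<eta>::real. \<eta> > 0 \<Longrightarrow> \<exists>N. \<forall>k\<ge>N. sqnorm (\<lambda>x. G k x - g x) \<le> ennreal \<eta>"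
  shows "weak_grad u g"
  unfolding weak_grad_def
proof (intro allI impI ballI)
  fix \<phi> :: "'a \<Rightarrow> real" and i :: 'a
  assume \<phi>: "test_function \<phi>" and i: "i \<in> Basis"
  note [measurable] = test_function_measurable[OF \<phi>]
  let ?D = "\<lambda>x. frechet_derivative \<phi> (at x) i"
  have "(\<lambda>k. \<integral>x. (U k x - u x) * ?D x \<partial>lborel) \<longlonglongrightarrow> 0"
    by (rule integral_product_tendsto_0[OF _ _ U sqnorm_test_finite(2)[OF \<phi>]]) auto
  moreover have "(\<integral>x. (U k x - u x) * ?D x \<partial>lborel) = (\<integral>x. U k x * ?D x \<partial>lborel)
      - (\<integral>x. u x * ?D x \<partial>lborel)" for k
    using integrable_times_test(2)[OF _ L2(1) \<phi>] integrable_times_test(2)[OF _ L2(3) \<phi>]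
    by (simp add: left_diff_distrib)
  ultimately have 1: "(\<lambda>k. \<integral>x. U k x * ?D x \<partial>lborel) \<longlonglongrightarrow> (\<integral>x. u x * ?D x \<partial>lborel)"
    by (simp add: LIM_zero_iff)
  have Gi: "\<exists>N. \<forall>k\<ge>N. sqnorm (\<lambda>x. (G k x - g x) \<bullet> i) \<le> ennreal \<eta>" if "\<eta> > 0" for \<eta> :: real
  proof -
    have "sqnorm (\<lambda>x. (G k x - g x) \<bullet> i) \<le> sqnorm (\<lambda>x. G k x - g x)" for k
      using i by (intro sqnorm_component_le) auto
    with G[OF that] show ?thesis by (meson order_trans)
  qed
  have "(\<lambda>k. \<integral>x. ((G k x - g x) \<bullet> i) * \<phi> x \<partial>lborel) \<longlonglongrightarrow> 0"
    by (rule integral_product_tendsto_0[OF _ _ Gi sqnorm_test_finite(1)[OF \<phi>]]) auto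
  moreover have "(\<integral>x. ((G k x - g x) \<bullet> i) * \<phi> x \<partial>lborel) = (\<integral>x. (G k x \<bullet> i) * \<phi> x \<partial>lborel)
      - (\<integral>x. (g x \<bullet> i) * \<phi> x \<partial>lborel)" for k
    using integrable_times_test(1)[OF _ sqnorm_component_finite[OF assms(2) L2(2) i] \<phi>]
      integrable_times_test(1)[OF _ sqnorm_component_finite[OF assms(4) L2(4) i] \<phi>]
    by (simp add: inner_diff_left left_diff_distrib)
  ultimately have "(\<lambda>k. \<integral>x. (G k x \<bullet> i) * \<phi> x \<partial>lborel) \<longlonglongrightarrow> (\<integral>x. (g x \<bullet> i) * \<phi> x \<partial>lborel)"
    by (simp add: LIM_zero_iff)
  then have "(\<lambda>k. \<integral>x. U k x * ?D x \<partial>lborel) \<longlonglongrightarrow> - (\<integral>x. (g x \<bullet> i) * \<phi> x \<partial>lborel)"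
    using wg \<phi> i by (simp add: weak_grad_def tendsto_minus)
  with 1 show "(\<integral>x. u x * ?D x \<partial>lborel) = - (\<integral>x. (g x \<bullet> i) * \<phi> x \<partial>lborel)"
    by (rule LIMSEQ_unique)
qed

text \<open>The gradients of the mollifications form a Cauchy sequence by the parallelogram law: their
  norms are at most the Dirichlet energy of the limit, while by lower semicontinuity averages of
  two late members cannot have asymptotically less energy than the limit.\<close>
lemma finite_dirichlet_weak_grad:
  fixes u :: "real^2 \<Rightarrow> real"
  assumes [measurable]: "u \<in> borel_measurable borel" and u: "sqnorm u < \<infinity>" "dirichlet u < \<infinity>"
  obtains g where "g \<in> borel_measurable borel" "weak_grad u g" "sqnorm g \<le> dirichlet u"
proof -
  obtain M where M: "dirichlet u = ennreal M" "M \<ge> 0" using u(2) by (cases "dirichlet u") auto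
  define U where "U k = conv u (dyadic_moll k)" for k
  define G where "G k = conv_grad u (dyadic_moll k)" for k
  have t: "test_function (dyadic_moll k)" for k by (rule mollifier.test[OF mollifier_dyadic])
  have [measurable]: "U k \<in> borel_measurable borel" "G k \<in> borel_measurable borel" for k
    using measurable_conv[OF assms(1) test_function_measurable(1)[OF t]] measurable_conv_grad[OF
        assms(1) t]
    by (simp_all add: U_def G_def)
  have GM: "sqnorm (G k) \<le> ennreal M" for k
  proof -
    have "sqnorm (G k) \<le> dirichlet (U k)"
      unfolding U_def G_def by (rule sqnorm_conv_grad_le[OF assms(1) u(1) t])
    also have "\<dots> \<le> dirichlet u"
      unfolding U_def by (intro dirichlet_mono nl_energy_conv_le[OF mollifier_dyadic] assms)
    finally show ?thesis by (simp add: M)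
  qed
  have Gfin: "sqnorm (G k) < \<infinity>" for k using GM[of k] by (simp add: order_le_less_trans)
  have Ufin: "sqnorm (U k) < \<infinity>" for k
    using mollifier.sqnorm_conv_le[OF mollifier_dyadic assms(1), of k] u(1)
        by (simp add: U_def order_le_less_trans)
  have wg: "weak_grad (U k) (G k)" for k
    unfolding U_def G_def by (rule weak_grad_conv[OF t assms(1) u(1)])
  have lim: "AE x in lborel. (\<lambda>k. U k x) \<longlonglongrightarrow> u x"
    unfolding U_def by (rule dyadic_conv_tendsto_AE[OF assms(1) u])
  have Cauchy: "\<exists>N. \<forall>j\<ge>N. \<forall>k\<ge>N. sqnorm (\<lambda>x. G j x - G k x) \<le> ennreal \<eta>" if \<eta>: "\<eta> > 0" for \<eta> :: real
  proof (rule ccontr)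
    assume "\<not> ?thesis"
    then have "\<forall>N. \<exists>j k. j \<ge> N \<and> k \<ge> N \<and> \<not> sqnorm (\<lambda>x. G j x - G k x) \<le> ennreal \<eta>" by blast
    then obtain J K where JK: "\<And>N. J N \<ge> N" "\<And>N. K N \<ge> N" "\<And>N. \<not> sqnorm (\<lambda>x. G (J N) x - G (K N) x)
        \<le> ennreal \<eta>"
      by metis
    \<comment> \<open>Averages of the pairs that violate the Cauchy property; they still tend to
      \<open>u\<close> almost everywhere.\<close>
    define w where "w N x = (1/2) *\<^sub>R (U (J N) x + U (K N) x)" for N x
    have [measurable]: "w N \<in> borel_measurable borel" for N unfolding w_def[abs_def] by measurable
    \<comment> \<open>The parallelogram law gives \<open>d + s \<le> 4 * M\<close> with
      \<open>d > \<eta>\<close>, and the gradient of the average has square norm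
      \<open>s / 4\<close>.\<close>
    have bound: "dirichlet (w N) \<le> ennreal (M - \<eta> / 4) \<and> M - \<eta> / 4 \<ge> 0" for N
    proof -
      let ?d = "sqnorm (\<lambda>x. G (J N) x - G (K N) x)" and ?s = "sqnorm (\<lambda>x. G (J N) x + G (K N) x)"
      have "?d + ?s \<le> 2 * ennreal M + 2 * ennreal M"
        unfolding sqnorm_parallelogram[OF \<open>G (J N) \<in> _\<close> \<open>G (K N) \<in> _\<close>]
            by (intro add_mono mult_left_mono GM) auto
      also have "\<dots> = ennreal (2 * M) + ennreal (2 * M)" using M(2) by (simp add: ennreal_mult)
      also have "\<dots> = ennreal (4 * M)" using M(2) by (subst ennreal_plus[symmetric]) auto
      finally have ds: "?d + ?s \<le> ennreal (4 * M)" .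
      have "?d \<le> ennreal (4 * M)" "?s \<le> ennreal (4 * M)"
        by (rule order_trans[OF _ ds], simp)+
      then have "?d \<noteq> top" "?s \<noteq> top" by (auto simp: top_unique)
      then obtain d s where d: "?d = ennreal d" "d \<ge> 0" and s: "?s = ennreal s" "s \<ge> 0"
        by (meson ennreal_cases)
      have "d + s \<le> 4 * M" using ds d s M(2) by (simp add: ennreal_plus[symmetric] del:
          ennreal_plus)
      moreover have "d > \<eta>" using JK(3)[of N] d \<eta> by (simp add: not_le)
      ultimately have s4: "s / 4 \<le> M - \<eta> / 4" by simp
      have h: "sqnorm (\<lambda>x. (1/2) *\<^sub>R (G (J N) x + G (K N) x)) = ennreal (s / 4)"
        by (subst sqnorm_scale) (use s in \<open>auto simp: ennreal_mult[symmetric] power2_eq_square\<close>)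
      have sw: "sqnorm (w N) < \<infinity>"
      proof -
        have "sqnorm (w N) = ennreal ((1/2)\<^sup>2) * sqnorm (\<lambda>x. U (J N) x + U (K N) x)"
          unfolding w_def by (rule sqnorm_scale) measurable
        also have "sqnorm (\<lambda>x. U (J N) x + U (K N) x) \<le> 2 * sqnorm (U (J N)) + 2 * sqnorm (U (K N))"
          by (subst sqnorm_parallelogram[symmetric]) auto
        then have "ennreal ((1/2)\<^sup>2) * sqnorm (\<lambda>x. U (J N) x + U (K N) x) < \<infinity>"
          using Ufin[of "J N"] Ufin[of "K N"] by (auto simp: ennreal_mult_less_top
              order_le_less_trans)
        finally show ?thesis .
      qed
      have "dirichlet (w N) \<le> sqnorm (\<lambda>x. (1/2) *\<^sub>R (G (J N) x + G (K N) x))"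
      proof (rule dirichlet_le_weak_grad[OF _ _ sw])
        show "weak_grad (w N) (\<lambda>x. (1/2) *\<^sub>R (G (J N) x + G (K N) x))"
          unfolding w_def by (rule weak_grad_average) (use Ufin Gfin wg in auto)
      qed (auto simp: h)
      also have "\<dots> \<le> ennreal (M - \<eta> / 4)" unfolding h by (rule ennreal_leI[OF s4])
      finally show ?thesis using s4 s(2) by simp
    qed
    \<comment> \<open>Impossible, since \<open>dirichlet u = ennreal M\<close>.\<close>
    have "dirichlet u \<le> ennreal (M - \<eta> / 4)"
    proof (rule dirichlet_lsc[where u = w and A = "\<lambda>_. M - \<eta> / 4"])
      have FJ: "filterlim J sequentially sequentially"
          and FK: "filterlim K sequentially sequentially"
        using filterlim_at_top_mono[OF filterlim_ident, of J] filterlim_at_top_mono[OF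
            filterlim_ident, of K] JK by auto
      show "AE x in lborel. (\<lambda>N. w N x) \<longlonglongrightarrow> u x"
        using lim
      proof eventually_elim
        case (elim x)
        have "(\<lambda>N. (1/2) *\<^sub>R (U (J N) x + U (K N) x)) \<longlonglongrightarrow> (1/2) *\<^sub>R (u x + u x)"
          by (intro tendsto_intros filterlim_compose[OF elim FJ] filterlim_compose[OF elim FK])
        then show ?case by (simp add: w_def)
      qed
    qed (use bound in auto)
    then show False using M \<eta> bound by (simp add: ennreal_le_iff2)
  qed
  obtain g where g: "g \<in> borel_measurable borel" "sqnorm g \<le> ennreal M"
    "\<And>\<eta>::real. \<eta> > 0 \<Longrightarrow> \<exists>N. \<forall>k\<ge>N. sqnorm (\<lambda>x. G k x - g x) \<le> ennreal \<eta>"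
    by (rule sqnorm_complete[where g = G and M = "ennreal M"], measurable, erule Cauchy, rule GM,
        rule that, assumption, assumption, blast)
  have "weak_grad u g"
  proof (rule weak_grad_limit[where U = U and G = G])
    fix \<eta> :: real assume \<eta>: "\<eta> > 0"
    have "(\<lambda>k. moll_rate * (1/4)^k * M) \<longlonglongrightarrow> moll_rate * 0 * M"
      by (intro tendsto_intros LIMSEQ_realpow_zero) auto
    then have "\<forall>\<^sub>F k in sequentially. moll_rate * (1/4)^k * M < \<eta>"
      using \<eta> by (auto dest!: order_tendstoD(2))
    then obtain N where N: "\<And>k. k \<ge> N \<Longrightarrow> moll_rate * (1/4)^k * M < \<eta>"
      by (auto simp: eventually_sequentially)
    have "sqnorm (\<lambda>x. U k x - u x) \<le> ennreal \<eta>" if "k \<ge> N" for k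
    proof -
      have "sqnorm (\<lambda>x. U k x - u x) \<le> ennreal (moll_rate * (1/4)^k * M)"
        using sqnorm_dyadic_diff_le[OF assms(1) u(1), of k] M moll_rate_pos
            by (simp add: U_def ennreal_mult)
      also have "\<dots> \<le> ennreal \<eta>" using N[OF that] by (intro ennreal_leI) simp
      finally show ?thesis .
    qed
    then show "\<exists>N. \<forall>k\<ge>N. sqnorm (\<lambda>x. U k x - u x) \<le> ennreal \<eta>" by blast
  next
    show "sqnorm g < \<infinity>" using g(2) by (simp add: order_le_less_trans)
  qed (use g Ufin Gfin wg u in auto)
  then show ?thesis using g M by (intro that[of g]) auto
qed

section \<open>Transfer to \<open>lebesgue\<close>, \<open>H1\<close> and the Kirchhoff
  energy\<close>

lemma AE_lebesgue_iff: "(AE x in lebesgue. P x) \<longleftrightarrow> (AE x in lborel. P x)"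
  by (rule AE_completion_iff)

lemma borel_measurable_lebesgueI: "f \<in> borel_measurable borel \<Longrightarrow> f \<in> borel_measurable lebesgue"
  by (simp add: measurable_completion)

lemma integral_lebesgue_eq_lborel:
  fixes f g :: "'a::euclidean_space \<Rightarrow> real"
  assumes "f \<in> borel_measurable lebesgue" "g \<in> borel_measurable borel" "AE x in lborel. f x = g x"
  shows "(\<integral>x. f x \<partial>lebesgue) = (\<integral>x. g x \<partial>lborel)"
proof -
  have "(\<integral>x. f x \<partial>lebesgue) = (\<integral>x. g x \<partial>lebesgue)"
    by (intro integral_cong_AE) (use assms borel_measurable_lebesgueI[OF assms(2)] in \<open>auto simp:
        AE_lebesgue_iff\<close>)
  also have "\<dots> = (\<integral>x. g x \<partial>lborel)" using assms(2) by (intro integral_completion) simp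
  finally show ?thesis .
qed

lemma locally_integrable_measurable:
  fixes f :: "'a::euclidean_space \<Rightarrow> 'b::euclidean_space"
  assumes "locally_integrable f" shows "f \<in> borel_measurable lebesgue"
proof (rule borel_measurable_LIMSEQ_metric)
  show "(\<lambda>x. indicator (cball 0 (real n)) x *\<^sub>R f x) \<in> borel_measurable lebesgue" for n
    using assms unfolding locally_integrable_def set_integrable_def
        by (meson borel_measurable_integrable compact_cball)
  show "(\<lambda>n. indicator (cball 0 (real n)) x *\<^sub>R f x) \<longlonglongrightarrow> f x" for x
  proof (rule tendsto_eventually)
    obtain N :: nat where "norm x \<le> real N" using real_arch_simple by blast
    then show "\<forall>\<^sub>F n in sequentially. indicator (cball 0 (real n)) x *\<^sub>R f x = f x"
      by (intro eventually_sequentiallyI[of N]) (auto simp: indicator_def)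
  qed
qed

lemma locally_integrable_sqnorm:
  fixes f :: "'a::euclidean_space \<Rightarrow> 'b::euclidean_space"
  assumes f: "f \<in> borel_measurable lebesgue" and f': "f' \<in> borel_measurable borel" "AE x in lborel.
      f x = f' x" "sqnorm f' < \<infinity>"
  shows "locally_integrable f"
  unfolding locally_integrable_def set_integrable_def
proof (intro allI impI)
  fix K :: "'a set" assume K: "compact K"
  have Kb: "K \<in> sets lborel" using K by (simp add: borel_compact)
  have K1: "integrable lborel (indicator K :: 'a \<Rightarrow> real)"
    using K emeasure_compact_finite[OF K] Kb by (simp add: integrable_indicator_iff)
  have "integrable lborel (\<lambda>x. indicator K x *\<^sub>R f' x)"
  proof (rule Bochner_Integration.integrable_bound)
    show "integrable lborel (\<lambda>x. indicator K x + (norm (f' x))\<^sup>2)"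
      using K1 integrable_sqnorm[OF f'(1,3)] by auto
    show "AE x in lborel. norm (indicator K x *\<^sub>R f' x) \<le> norm (indicator K x + (norm (f' x))\<^sup>2)"
    proof (rule AE_I2)
      fix x
      have "norm (f' x) \<le> 1 + (norm (f' x))\<^sup>2"
        using zero_le_power2[of "norm (f' x) - 1"] norm_ge_zero[of "f' x"] unfolding power2_diff
            by (simp, linarith)
      then show "norm (indicator K x *\<^sub>R f' x) \<le> norm (indicator K x + (norm (f' x))\<^sup>2)"
        by (auto simp: indicator_def)
    qed
  qed (use f'(1) Kb in auto)
  then have "integrable lebesgue (\<lambda>x. indicator K x *\<^sub>R f' x)"
    using f'(1) Kb by (subst integrable_completion) auto
  then show "integrable lebesgue (\<lambda>x. indicator K x *\<^sub>R f x)"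
  proof (rule integrable_cong_AE_imp)
    have "K \<in> sets lebesgue" using K by (simp add: borel_compact)
    then show "(\<lambda>x. indicator K x *\<^sub>R f x) \<in> borel_measurable lebesgue" using f by simp
    show "AE x in lebesgue. indicator K x *\<^sub>R f' x = indicator K x *\<^sub>R f x"
      unfolding AE_lebesgue_iff using f'(2) by eventually_elim simp
  qed
qed

lemma has_weak_gradient_iff:
  fixes u :: "'a::euclidean_space \<Rightarrow> real"
  assumes [measurable]: "u \<in> borel_measurable lebesgue" "g \<in> borel_measurable lebesgue" "u'
      \<in> borel_measurable borel" "g' \<in> borel_measurable borel"
    and u: "AE x in lborel. u x = u' x" and g: "AE x in lborel. g x = g' x"
  shows "has_weak_gradient u g \<longleftrightarrow> locally_integrable u \<and> locally_integrable g \<and> weak_grad u' g'"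
proof -
  have "(\<integral>x. u x * frechet_derivative \<phi> (at x) v \<partial>lebesgue) = (\<integral>x. u' x * frechet_derivative \<phi> (at
      x) v \<partial>lborel)"
    "(\<integral>x. (g x \<bullet> v) * \<phi> x \<partial>lebesgue) = (\<integral>x. (g' x \<bullet> v) * \<phi> x \<partial>lborel)" if \<phi>: "test_function \<phi>"
        for \<phi> v
  proof -
    note m = test_function_measurable[OF \<phi>]
    note [measurable] = m m[THEN borel_measurable_lebesgueI]
    have ae: "AE x in lborel. u x * frechet_derivative \<phi> (at x) v = u' x * frechet_derivative \<phi> (at
        x) v"
      "AE x in lborel. (g x \<bullet> v) * \<phi> x = (g' x \<bullet> v) * \<phi> x"
      using u g by (eventually_elim, simp)+
    show "(\<integral>x. u x * frechet_derivative \<phi> (at x) v \<partial>lebesgue) = (\<integral>x. u' x * frechet_derivative \<phi> (at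
        x) v \<partial>lborel)"
      by (rule integral_lebesgue_eq_lborel[OF _ _ ae(1)]) measurable
    show "(\<integral>x. (g x \<bullet> v) * \<phi> x \<partial>lebesgue) = (\<integral>x. (g' x \<bullet> v) * \<phi> x \<partial>lborel)"
      by (rule integral_lebesgue_eq_lborel[OF _ _ ae(2)]) measurable
  qed
  then show ?thesis unfolding has_weak_gradient_def weak_grad_def by auto
qed

text \<open>Local integrability is all that comes with the gradient chosen by
  \<open>weak_gradient\<close>, so uniqueness is proved at that level, by testing the difference
  coordinate by coordinate.\<close>

lemma weak_grad_unique:
  fixes u :: "'a::euclidean_space \<Rightarrow> real"
  assumes g: "g \<in> borel_measurable borel" "locally_integrable g"
      and h: "h \<in> borel_measurable borel" "locally_integrable h"
    and wg: "weak_grad u g" "weak_grad u h"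
  shows "AE x in lborel. g x = h x"
proof -
  have loc: "integrable lborel (\<lambda>x. indicator (cball 0 R) x *\<^sub>R f x)"
      if f: "f \<in> borel_measurable borel" "locally_integrable f" for f :: "'a \<Rightarrow> 'a" and R
  proof -
    have [measurable]: "cball (0::'a) R \<in> sets borel" by simp
    have "integrable lebesgue (\<lambda>x. indicator (cball 0 R) x *\<^sub>R f x)"
      using f(2) compact_cball unfolding locally_integrable_def set_integrable_def by blast
    then show ?thesis using f(1) by (subst (asm) integrable_completion) auto
  qed
  have "AE x in lborel. \<forall>i\<in>Basis. (g x - h x) \<bullet> i = 0"
  proof (rule AE_finite_allI[OF finite_Basis])
    fix i :: 'a assume i: "i \<in> Basis"
    have [measurable]: "g \<in> borel_measurable borel" "h \<in> borel_measurable borel" by fact+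
    have loci: "integrable lborel (\<lambda>x. indicator (cball 0 R) x * (f x \<bullet> i))"
        if f: "f \<in> borel_measurable borel" "locally_integrable f" for f :: "'a \<Rightarrow> 'a" and R
      using integrable_inner_left[OF loc[OF f, of R], of i] by simp
    show "AE x in lborel. (g x - h x) \<bullet> i = 0"
    proof (rule AE_zero_if_test_integrals_zero)
      show "integrable lborel (\<lambda>x. indicator (cball 0 R) x * ((g x - h x) \<bullet> i))" for R
        using loci[OF g, of R] loci[OF h, of R] by (simp add: inner_diff_left right_diff_distrib)
      fix \<phi> :: "'a \<Rightarrow> real" assume \<phi>: "test_function \<phi>"
      note [measurable] = test_function_measurable[OF \<phi>]
      obtain R where R: "\<And>x. norm x \<ge> R \<Longrightarrow> \<phi> x = 0"
        using test_function_support[OF \<phi>] by metis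
      obtain C where C: "\<And>x. \<bar>\<phi> x\<bar> \<le> C"
        using compact_support_bounded[OF test_function_continuous[OF \<phi>] R] by metis
      have int: "integrable lborel (\<lambda>x. (f x \<bullet> i) * \<phi> x)"
          if f: "f \<in> borel_measurable borel" "locally_integrable f" for f
      proof (rule Bochner_Integration.integrable_bound)
        show "integrable lborel (\<lambda>x. C * (indicator (cball 0 R) x * (f x \<bullet> i)))"
          by (intro integrable_mult_right loci f)
        show "AE x in lborel. norm ((f x \<bullet> i) * \<phi> x) \<le> norm (C * (indicator (cball 0 R) x * (f x \<bullet>
            i)))"
        proof (rule AE_I2)
          fix x
          have "C \<ge> 0" using C[of 0] by linarith
          then show "norm ((f x \<bullet> i) * \<phi> x) \<le> norm (C * (indicator (cball 0 R) x * (f x \<bullet> i)))"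
            using mult_right_mono[OF C[of x], of "\<bar>f x \<bullet> i\<bar>"] R[of x]
                by (auto simp: indicator_def abs_mult mult.commute)
        qed
      qed (use f in measurable)
      have "(\<integral>x. (g x \<bullet> i) * \<phi> x \<partial>lborel) = (\<integral>x. (h x \<bullet> i) * \<phi> x \<partial>lborel)"
        using wg \<phi> i by (auto simp: weak_grad_def)
      then show "(\<integral>x. (g x - h x) \<bullet> i * \<phi> x \<partial>lborel) = 0"
        using int[OF g] int[OF h] by (simp add: inner_diff_left left_diff_distrib)
    qed measurable
  qed
  then show ?thesis
  proof eventually_elim
    case (elim x)
    then have "g x - h x = 0" by (simp add: euclidean_all_zero_iff)
    then show ?case by simp
  qed
qed

text \<open>The gradient of \<open>finite_dirichlet_weak_grad\<close> has square norm exactly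
  \<open>dirichlet u'\<close> by two opposite estimates, and uniqueness carries this over to the
  representative picked by the choice operator.\<close>

lemma weak_gradient_sqnorm:
  fixes u :: "real^2 \<Rightarrow> real"
  assumes u: "u \<in> borel_measurable lebesgue" "u' \<in> borel_measurable borel" "AE x in lborel. u x
      = u' x"
    and L2: "sqnorm u' < \<infinity>" "dirichlet u' < \<infinity>"
  shows "u \<in> H1" "(\<integral>x. (norm (weak_gradient u x))\<^sup>2 \<partial>lebesgue) = enn2real (dirichlet u')"
proof -
  obtain g where g: "g \<in> borel_measurable borel" "weak_grad u' g" "sqnorm g \<le> dirichlet u'"
    using finite_dirichlet_weak_grad[OF u(2) L2] by metis
  have gfin: "sqnorm g < \<infinity>" using g(3) L2(2) by (rule order_le_less_trans)
  have eq: "sqnorm g = dirichlet u'"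
    using g dirichlet_le_weak_grad[OF u(2) g(1) L2(1) gfin g(2)] by (intro antisym)
  have gl: "g \<in> borel_measurable lebesgue" by (rule borel_measurable_lebesgueI[OF g(1)])
  have li: "locally_integrable u" "locally_integrable g"
    using locally_integrable_sqnorm[OF u L2(1)] locally_integrable_sqnorm[OF gl g(1) _ gfin] by auto
  have hg: "has_weak_gradient u g"
    by (subst has_weak_gradient_iff[OF u(1) gl u(2) g(1) u(3)]) (use li g in auto)
  have gL2: "g \<in> L2"
    using gl integrable_sqnorm[OF g(1) gfin] g(1) unfolding L2_def
        by (auto simp: integrable_completion)
  have uL2: "u \<in> L2"
  proof -
    have "integrable lebesgue (\<lambda>x. (norm (u' x))\<^sup>2)"
      using integrable_sqnorm[OF u(2) L2(1)] u(2) by (subst integrable_completion) auto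
    then have "integrable lebesgue (\<lambda>x. (norm (u x))\<^sup>2)"
      by (rule integrable_cong_AE_imp) (use u in \<open>auto simp: AE_lebesgue_iff\<close>)
    then show ?thesis using u(1) unfolding L2_def by simp
  qed
  show "u \<in> H1" unfolding H1_def using uL2 gL2 hg by auto
  define w where "w = weak_gradient u"
  have hw: "has_weak_gradient u w"
    unfolding w_def weak_gradient_def by (rule someI[where P = "has_weak_gradient u"], rule hg)
  then have lw: "locally_integrable w" by (simp add: has_weak_gradient_def)
  have wl: "w \<in> borel_measurable lebesgue" by (rule locally_integrable_measurable[OF lw])
  obtain w' where w': "w' \<in> borel_measurable borel" "AE x in lborel. w x = w' x"
    by (rule lebesgue_borel_representative[OF wl])
  have ww: "weak_grad u' w'" using hw has_weak_gradient_iff[OF u(1) wl u(2) w'(1) u(3) w'(2)]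
      by simp
  have lw': "locally_integrable w'"
    unfolding locally_integrable_def set_integrable_def
  proof (intro allI impI)
    fix K :: "(real^2) set" assume K: "compact K"
    then have "integrable lebesgue (\<lambda>x. indicator K x *\<^sub>R w x)"
      using lw unfolding locally_integrable_def set_integrable_def by blast
    then show "integrable lebesgue (\<lambda>x. indicator K x *\<^sub>R w' x)"
    proof (rule integrable_cong_AE_imp)
      have "K \<in> sets lebesgue" using K by (simp add: borel_compact)
      then show "(\<lambda>x. indicator K x *\<^sub>R w' x) \<in> borel_measurable lebesgue"
        using borel_measurable_lebesgueI[OF w'(1)] by simp
      show "AE x in lebesgue. indicator K x *\<^sub>R w x = indicator K x *\<^sub>R w' x"
        unfolding AE_lebesgue_iff using w'(2) by eventually_elim simp
    qed
  qed
  have "AE x in lborel. g x = w' x"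
    by (rule weak_grad_unique[OF g(1) li(2) w'(1) lw' g(2) ww])
  with w'(2) have ae: "AE x in lborel. (norm (w x))\<^sup>2 = (norm (g x))\<^sup>2" by eventually_elim simp
  have "(\<integral>x. (norm (w x))\<^sup>2 \<partial>lebesgue) = (\<integral>x. (norm (g x))\<^sup>2 \<partial>lborel)"
    by (rule integral_lebesgue_eq_lborel[OF _ _ ae]) (use wl g(1) in auto)
  also have "\<dots> = enn2real (sqnorm g)"
    unfolding sqnorm_def using g(1) by (intro integral_eq_nn_integral) auto
  finally show "(\<integral>x. (norm (weak_gradient u x))\<^sup>2 \<partial>lebesgue) = enn2real (dirichlet u')"
    by (simp add: w_def eq)
qed

lemma sqnorm_L2:
  fixes u :: "'a::euclidean_space \<Rightarrow> 'b::euclidean_space"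
  assumes "u \<in> L2" "u' \<in> borel_measurable borel" "AE x in lborel. u x = u' x"
  shows "sqnorm u' < \<infinity>"
proof -
  have "integrable lebesgue (\<lambda>x. (norm (u' x))\<^sup>2)"
    by (rule integrable_cong_AE_imp[where g = "\<lambda>x. (norm (u x))\<^sup>2"])
      (use assms in \<open>auto simp: L2_def AE_lebesgue_iff intro!: borel_measurable_power
          borel_measurable_norm borel_measurable_lebesgueI\<close>)
  then have "integrable lborel (\<lambda>x. (norm (u' x))\<^sup>2)"
    using assms(2) by (subst (asm) integrable_completion) auto
  then show ?thesis by (auto simp: sqnorm_def real_integrable_def top.not_eq_extremum)
qed

text \<open>The reverse passage, needed for arbitrary competitors: a square integrable weak gradient
  makes the supremum of nonlocal energies finite.\<close>

lemma H1_borel_representative: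
  fixes u :: "real^2 \<Rightarrow> real"
  assumes "u \<in> H1"
  obtains u' where "u' \<in> borel_measurable borel" "AE x in lborel. u x = u' x" "sqnorm u'
      < \<infinity>" "dirichlet u' < \<infinity>"
proof -
  from assms obtain g where uL2: "u \<in> L2" and gL2: "g \<in> L2" and hg: "has_weak_gradient u g"
    by (auto simp: H1_def)
  have ul: "u \<in> borel_measurable lebesgue" and gl: "g \<in> borel_measurable lebesgue"
    using uL2 gL2 by (auto simp: L2_def)
  obtain u' where u': "u' \<in> borel_measurable borel" "AE x in lborel. u x = u' x"
    by (rule lebesgue_borel_representative[OF ul])
  obtain g' where g': "g' \<in> borel_measurable borel" "AE x in lborel. g x = g' x"
    by (rule lebesgue_borel_representative[OF gl])
  have wg: "weak_grad u' g'" using hg has_weak_gradient_iff[OF ul gl u'(1) g'(1) u'(2) g'(2)]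
      by simp
  have fin: "sqnorm u' < \<infinity>" "sqnorm g' < \<infinity>"
    using sqnorm_L2[OF uL2 u'] sqnorm_L2[OF gL2 g'] by auto
  have "dirichlet u' < \<infinity>"
    using dirichlet_le_weak_grad[OF u'(1) g'(1) fin wg] fin(2) by (rule order_le_less_trans)
  with u' fin show ?thesis by (intro that)
qed

definition potential :: "real \<Rightarrow> (real^2 \<Rightarrow> real) \<Rightarrow> ennreal" where
  "potential p u = (\<integral>\<^sup>+x. ennreal (norm x powr (- p) * (u x)\<^sup>2) \<partial>lborel)"

definition quartic :: "(real^2 \<Rightarrow> real) \<Rightarrow> ennreal" where
  "quartic u = (\<integral>\<^sup>+x. ennreal ((u x) ^ 4) \<partial>lborel)"

text \<open>\<open>enn2real\<close> sends infinity to 0, as the Bochner integral does for a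
  nonnegative function that is not integrable. The match with \<open>kirchhoff_energy\<close>
  therefore does not depend on the potential and quartic integrals being finite.\<close>

definition energy :: "real \<Rightarrow> real \<Rightarrow> real \<Rightarrow> (real^2 \<Rightarrow> real) \<Rightarrow> real" where
  "energy p a b u = enn2real (dirichlet u) + b * (enn2real (dirichlet u))\<^sup>2
     - enn2real (potential p u) - a / 2 * enn2real (quartic u)"

lemma kirchhoff_energy_eq:
  fixes u :: "real^2 \<Rightarrow> real"
  assumes u: "u \<in> borel_measurable lebesgue" "u' \<in> borel_measurable borel" "AE x in lborel. u x
      = u' x"
    and L2: "sqnorm u' < \<infinity>" "dirichlet u' < \<infinity>"
  shows "kirchhoff_energy a (\<lambda>x. - (norm x powr (- p))) b u = energy p a b u'"
    "L2_norm u = sqrt (enn2real (sqnorm u'))"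
proof -
  note [measurable] = u(1,2)
  have "(\<integral>x. - (norm x powr (- p)) * \<bar>u x\<bar>\<^sup>2 \<partial>lebesgue) = (\<integral>x. - (norm x powr (- p) * (u'
      x)\<^sup>2) \<partial>lborel)"
  proof (rule integral_lebesgue_eq_lborel)
    have "(\<lambda>x::real^2. norm x powr (- p)) \<in> borel_measurable borel" by measurable
    from borel_measurable_lebesgueI[OF this] show "(\<lambda>x. - (norm x powr (- p)) * \<bar>u x\<bar>\<^sup>2)
        \<in> borel_measurable lebesgue"
      using u(1) by simp
    show "AE x in lborel. - (norm x powr (- p)) * \<bar>u x\<bar>\<^sup>2 = - (norm x powr (- p) * (u' x)\<^sup>2)"
      using u(3) by eventually_elim simp
  qed measurable
  also have "\<dots> = - enn2real (potential p u')"
    unfolding potential_def by (subst integral_minus, subst integral_eq_nn_integral) auto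
  finally have P: "(\<integral>x. - (norm x powr (- p)) * \<bar>u x\<bar>\<^sup>2 \<partial>lebesgue) = - enn2real (potential p u')" .
  have "(\<integral>x. \<bar>u x\<bar> ^ 4 \<partial>lebesgue) = (\<integral>x. (u' x) ^ 4 \<partial>lborel)"
    by (rule integral_lebesgue_eq_lborel) (use u in auto)
  also have "\<dots> = enn2real (quartic u')"
    unfolding quartic_def by (rule integral_eq_nn_integral) auto
  finally have Q: "(\<integral>x. \<bar>u x\<bar> ^ 4 \<partial>lebesgue) = enn2real (quartic u')" .
  show "kirchhoff_energy a (\<lambda>x. - (norm x powr (- p))) b u = energy p a b u'"
    unfolding kirchhoff_energy_def energy_def P Q weak_gradient_sqnorm(2)[OF u L2] by simp
  have "(\<integral>x. (norm (u x))\<^sup>2 \<partial>lebesgue) = (\<integral>x. (norm (u' x))\<^sup>2 \<partial>lborel)"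
    by (rule integral_lebesgue_eq_lborel) (use u in auto)
  also have "\<dots> = enn2real (sqnorm u')"
    unfolding sqnorm_def by (rule integral_eq_nn_integral) auto
  finally show "L2_norm u = sqrt (enn2real (sqnorm u'))" by (simp add: L2_norm_def)
qed

section \<open>Lipschitz competitors\<close>

lemma emeasure_ball_real2:
  assumes "r \<ge> 0" shows "emeasure lborel (ball (c::real^2) r) = ennreal (pi * r\<^sup>2)"
proof -
  have "unit_ball_vol (real DIM(real^2)) = pi" by (simp add: eval_unit_ball_vol)
  then show ?thesis using emeasure_ball[OF assms, of c] by (simp only: DIM_real2)
qed

lemma sets_ball_lborel: "ball x r \<in> sets lborel" by simp

lemma measurable_ball_multiple: "(\<lambda>x. (c::ennreal) * indicator (ball y r) x)
    \<in> borel_measurable lborel"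
proof -
  have [measurable]: "ball y r \<in> sets borel" by simp
  show ?thesis by measurable
qed

lemma ennreal_term_le_suminf: "(f k :: ennreal) \<le> (\<Sum>k. f k)"
  using sum_le_suminf[of f "{k}"] by simp

text \<open>Between the radii \<open>(1/2)^(k+1)\<close> and \<open>(1/2)^k\<close> the integrand is
  at most \<open>(2 powr q)^(k+1)\<close>, and the enclosing disc has area
  \<open>pi * ((1/2)^k)\<^sup>2\<close>. The resulting geometric series has ratio
  \<open>2 powr q / 4\<close>, below 1 exactly for \<open>q < 2\<close>.\<close>

lemma powr_integrable_near_0:
  assumes q: "q \<ge> 0" "q < 2"
  shows "(\<integral>\<^sup>+x. (if norm x < 1 then ennreal (norm (x::real^2) powr (- q)) else 0) \<partial>lborel) < \<infinity>"
proof -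
  have emb: "emeasure lborel (ball (0::real^2) ((1/2)^k)) = ennreal (pi * ((1/2)^k)\<^sup>2)" for k :: nat
    by (rule emeasure_ball_real2) simp
  define c where "c k = (2 powr q) ^ (k + 1) * (pi * ((1/2)^k)\<^sup>2)" for k :: nat
  have "(\<integral>\<^sup>+x. (if norm x < 1 then ennreal (norm (x::real^2) powr (- q)) else 0) \<partial>lborel)
     \<le> (\<integral>\<^sup>+x. (\<Sum>k. ennreal ((2 powr q) ^ (k + 1)) * indicator (ball 0 ((1/2)^k))
         (x::real^2)) \<partial>lborel)"
  proof (rule nn_integral_mono)
    fix x :: "real^2"
    show "(if norm x < 1 then ennreal (norm x powr (- q)) else 0) \<le> (\<Sum>k. ennreal ((2 powr q) ^ (k
        + 1)) * indicator (ball 0 ((1/2)^k)) x)"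
    proof (cases "norm x < 1 \<and> x \<noteq> 0")
      case True
      then have "norm x > 0" by simp
      from real_arch_pow_inv[OF this, of "1/2"] obtain n where "(1/2)^n < norm x" by auto
      then have ex: "\<exists>k. (1/2)^(k+1) \<le> norm x"
        using power_decreasing[of n "n + 1" "1/2::real"] by (intro exI[of _ n]) linarith
      \<comment> \<open>The annulus containing \<open>x\<close>: minimality gives the outer bound,
        which for \<open>k = 0\<close> is \<open>norm x < 1\<close>.\<close>
      define k where "k = (LEAST k. (1/2)^(k+1) \<le> norm x)"
      have k1: "(1/2)^(k+1) \<le> norm x" unfolding k_def by (rule LeastI_ex[OF ex])
      have k2: "norm x < (1/2)^k"
      proof (cases k)
        case (Suc j)
        then have "\<not> (1/2)^(j+1) \<le> norm x" using not_less_Least[of j "\<lambda>k. (1/2)^(k+1) \<le> norm x"]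
            by (simp add: k_def)
        then show ?thesis using Suc by simp
      qed (use True in simp)
      have "norm x powr (- q) \<le> ((1/2)^(k+1)) powr (- q)"
        using k1 q by (intro powr_mono2') auto
      also have "\<dots> = (2 powr q) ^ (k + 1)"
        by (simp add: powr_minus powr_power[symmetric] powr_realpow[symmetric] powr_powr
            power_one_over powr_divide inverse_eq_divide mult.commute del: power_Suc)
      finally have "ennreal (norm x powr (- q)) \<le> ennreal ((2 powr q) ^ (k + 1)) * indicator (ball 0
          ((1/2)^k)) x"
        using k2 by (simp add: ennreal_leI)
      also have "\<dots> \<le> (\<Sum>k. ennreal ((2 powr q) ^ (k + 1)) * indicator (ball 0 ((1/2)^k)) x)"
        by (rule ennreal_term_le_suminf)
      finally show ?thesis using True by simp
    \<comment> \<open>At the origin the integrand is 0, because \<open>0 powr y = 0\<close>.\<close>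
    qed (auto simp: powr_def)
  qed
  also have "\<dots> = (\<Sum>k. ennreal (c k))"
  proof (subst nn_integral_suminf)
    show "(\<lambda>x::real^2. ennreal ((2 powr q) ^ (k + 1)) * indicator (ball 0 ((1/2)^k)) x)
        \<in> borel_measurable lborel" for k
      by (rule measurable_ball_multiple)
    have "(\<integral>\<^sup>+x. ennreal ((2 powr q) ^ (k + 1)) * indicator (ball 0 ((1/2)^k)) (x::real^2) \<partial>lborel)
        = ennreal (c k)" for k
      unfolding c_def by (subst nn_integral_cmult_indicator, rule sets_ball_lborel, subst emb, rule
          ennreal_mult[symmetric]) (rule zero_le_power mult_nonneg_nonneg powr_ge_zero pi_ge_zero
          zero_le_power2)+
    then show "(\<Sum>k. \<integral>\<^sup>+x. ennreal ((2 powr q) ^ (k + 1)) * indicator (ball 0 ((1/2)^k))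
        (x::real^2) \<partial>lborel) = (\<Sum>k. ennreal (c k))"
      by (rule arg_cong[of _ _ suminf, OF ext])
  qed
  also have "\<dots> < \<infinity>"
  proof -
    have "2 powr q < 2 powr 2" using q by (intro powr_less_mono) auto
    then have r: "2 powr q / 4 < 1" by simp
    have "c = (\<lambda>k. (2 powr q * pi) * (2 powr q / 4) ^ k)"
      by (auto simp: c_def fun_eq_iff power_divide power_mult[symmetric] mult.commute[of _ 2]
          power_mult[of 2 2])
    moreover have "summable (\<lambda>k. (2 powr q * pi) * (2 powr q / 4) ^ k)"
      using r by (intro summable_mult summable_geometric) auto
    ultimately have "summable c" by simp
    moreover have "c k \<ge> 0" for k by (simp add: c_def)
    ultimately show ?thesis by (simp add: suminf_ennreal2)
  qed
  finally show ?thesis .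
qed

text \<open>The same comparison with annuli growing outwards; the ratio is now
  \<open>2 powr (- q) * 4\<close>, below 1 exactly for \<open>q > 2\<close>.\<close>

lemma powr_integrable_at_infinity:
  assumes q: "q > 2"
  shows "(\<integral>\<^sup>+x. (if norm x \<ge> 1 then ennreal (norm (x::real^2) powr (- q)) else 0) \<partial>lborel) < \<infinity>"
proof -
  have emb: "emeasure lborel (ball (0::real^2) (2^(k+1))) = ennreal (pi * (2^(k+1))\<^sup>2)" for k :: nat
    by (rule emeasure_ball_real2) simp
  define c where "c k = (2 powr (- q)) ^ k * (pi * (2^(k+1))\<^sup>2)" for k :: nat
  have "(\<integral>\<^sup>+x. (if norm x \<ge> 1 then ennreal (norm (x::real^2) powr (- q)) else 0) \<partial>lborel)
     \<le> (\<integral>\<^sup>+x. (\<Sum>k. ennreal ((2 powr (- q)) ^ k) * indicator (ball 0 (2^(k+1)))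
         (x::real^2)) \<partial>lborel)"
  proof (rule nn_integral_mono)
    fix x :: "real^2"
    show "(if norm x \<ge> 1 then ennreal (norm x powr (- q)) else 0) \<le> (\<Sum>k. ennreal ((2 powr (- q)) ^
        k) * indicator (ball 0 (2^(k+1))) x)"
    proof (cases "norm x \<ge> 1")
      case True
      obtain n where "norm x < 2^n" using real_arch_pow[of 2 "norm x"] by auto
      then have ex: "\<exists>k. norm x < 2^(k+1)"
        using power_increasing[of n "n + 1" "2::real"] by (intro exI[of _ n]) linarith
      define k where "k = (LEAST k. norm x < 2^(k+1))"
      have k1: "norm x < 2^(k+1)" unfolding k_def by (rule LeastI_ex[OF ex])
      have k2: "2^k \<le> norm x"
      proof (cases k)
        case (Suc j)
        then have "\<not> norm x < 2^(j+1)" using not_less_Least[of j "\<lambda>k. norm x < 2^(k+1)"]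
            by (simp add: k_def)
        then show ?thesis using Suc by simp
      qed (use True in simp)
      have "norm x powr (- q) \<le> (2^k) powr (- q)"
        using k2 q by (intro powr_mono2') auto
      also have "\<dots> = (2 powr (- q)) ^ k"
        by (simp add: powr_power[symmetric] powr_realpow[symmetric] powr_powr mult.commute)
      finally have "ennreal (norm x powr (- q)) \<le> ennreal ((2 powr (- q)) ^ k) * indicator (ball 0
          (2^(k+1))) x"
        using k1 by (simp add: ennreal_leI)
      also have "\<dots> \<le> (\<Sum>k. ennreal ((2 powr (- q)) ^ k) * indicator (ball 0 (2^(k+1))) x)"
        by (rule ennreal_term_le_suminf)
      finally show ?thesis using True by simp
    qed simp
  qed
  also have "\<dots> = (\<Sum>k. ennreal (c k))"
  proof (subst nn_integral_suminf)
    show "(\<lambda>x::real^2. ennreal ((2 powr (- q)) ^ k) * indicator (ball 0 (2^(k+1))) x)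
        \<in> borel_measurable lborel" for k
      by (rule measurable_ball_multiple)
    have "(\<integral>\<^sup>+x. ennreal ((2 powr (- q)) ^ k) * indicator (ball 0 (2^(k+1))) (x::real^2) \<partial>lborel)
        = ennreal (c k)" for k
      unfolding c_def by (subst nn_integral_cmult_indicator, rule sets_ball_lborel, subst emb, rule
          ennreal_mult[symmetric]) (rule zero_le_power mult_nonneg_nonneg powr_ge_zero pi_ge_zero
          zero_le_power2)+
    then show "(\<Sum>k. \<integral>\<^sup>+x. ennreal ((2 powr (- q)) ^ k) * indicator (ball 0 (2^(k+1)))
        (x::real^2) \<partial>lborel) = (\<Sum>k. ennreal (c k))"
      by (rule arg_cong[of _ _ suminf, OF ext])
  qed
  also have "\<dots> < \<infinity>"
  proof -
    have "2 powr (- q) < 2 powr (- 2)" using q by (intro powr_less_mono) auto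
    also have "2 powr (- 2) = (1/4 :: real)" by (simp add: powr_minus_divide)
    finally have r: "2 powr (- q) * 4 < 1" by simp
    have "c = (\<lambda>k. (4 * pi) * (2 powr (- q) * 4) ^ k)"
      by (auto simp: c_def fun_eq_iff power_mult_distrib power_mult[symmetric] mult.commute[of _ 2]
          power_mult[of 2 2])
    moreover have "summable (\<lambda>k. (4 * pi) * (2 powr (- q) * 4) ^ k)"
      using r by (intro summable_mult summable_geometric) auto
    ultimately have "summable c" by simp
    moreover have "c k \<ge> 0" for k by (simp add: c_def)
    ultimately show ?thesis by (simp add: suminf_ennreal2)
  qed
  finally show ?thesis .
qed

definition powr_mass :: "real \<Rightarrow> real" where
  "powr_mass q = enn2real (\<integral>\<^sup>+x. (if norm x < 1 then ennreal (norm (x::real^2) powr (- q)) else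
      0) \<partial>lborel)"

lemma powr_mass_nonneg: "powr_mass q \<ge> 0" by (simp add: powr_mass_def)

lemma nn_integral_powr_ball:
  assumes q: "q \<ge> 0" "q < 2" and \<rho>: "\<rho> > 0"
  shows "(\<integral>\<^sup>+x. (if norm x < \<rho> then ennreal (norm (x::real^2) powr (- q)) else 0) \<partial>lborel)
      = ennreal (\<rho> powr (2 - q) * powr_mass q)"
proof -
  have "(\<integral>\<^sup>+x. (if norm x < \<rho> then ennreal (norm (x::real^2) powr (- q)) else 0) \<partial>lborel)
    = ennreal (\<rho> ^ DIM(real^2)) * (\<integral>\<^sup>+x. (if norm (\<rho> *\<^sub>R x) < \<rho> then ennreal (norm (\<rho> *\<^sub>R
        (x::real^2)) powr (- q)) else 0) \<partial>lborel)"
    by (rule nn_integral_lborel_scale[OF _ \<rho>]) measurable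
  also have "(\<integral>\<^sup>+x. (if norm (\<rho> *\<^sub>R x) < \<rho> then ennreal (norm (\<rho> *\<^sub>R (x::real^2)) powr (- q)) else
      0) \<partial>lborel)
    = (\<integral>\<^sup>+x. ennreal (\<rho> powr (- q)) * (if norm x < 1 then ennreal (norm (x::real^2) powr (- q)) else
        0) \<partial>lborel)"
    using \<rho> by (intro nn_integral_cong) (simp add: powr_mult ennreal_mult)
  also have "\<dots> = ennreal (\<rho> powr (- q)) * ennreal (powr_mass q)"
    using powr_integrable_near_0[OF q] by (subst nn_integral_cmult) (auto simp: powr_mass_def)
  also have "ennreal (\<rho> ^ DIM(real^2)) * (ennreal (\<rho> powr (- q)) * ennreal (powr_mass q))
      = ennreal (\<rho>\<^sup>2 * \<rho> powr (- q) * powr_mass q)"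
    using powr_mass_nonneg[of q] by (simp add: ennreal_mult mult.assoc)
  also have "\<rho>\<^sup>2 * \<rho> powr (- q) = \<rho> powr (2 - q)"
    using powr_add[of \<rho> 2 "- q"] \<rho> by simp
  finally show ?thesis .
qed

text \<open>One number bounds both the Lipschitz constant and the support radius, so the classes
  increase with \<open>R\<close> and a single index exhausts them; for fixed \<open>R\<close> the
  class is compact under uniform convergence.\<close>

definition lip_class :: "real \<Rightarrow> (real^2 \<Rightarrow> real) set" where
  "lip_class R = {u. (\<forall>x y. \<bar>u x - u y\<bar> \<le> R * dist x y) \<and> (\<forall>x. u x \<ge> 0) \<and>
     (\<forall>x. norm x \<ge> R \<longrightarrow> u x = 0) \<and> sqnorm u = 1}"

lemma lipschitz_continuous:
  fixes u :: "'a::metric_space \<Rightarrow> real"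
  assumes "\<And>x y. \<bar>u x - u y\<bar> \<le> R * dist x y"
  shows "continuous_on UNIV u"
proof (rule lipschitz_on_continuous_on)
  show "(max R 0)-lipschitz_on UNIV u"
  proof (rule lipschitz_onI)
    fix x y :: 'a
    have "R * dist x y \<le> max R 0 * dist x y" by (intro mult_right_mono) auto
    then show "dist (u x) (u y) \<le> max R 0 * dist x y" using assms[of x y]
        by (simp add: dist_real_def)
  qed simp
qed

lemma lip_classD:
  assumes "u \<in> lip_class R"
  shows "\<bar>u x - u y\<bar> \<le> R * dist x y" "u x \<ge> 0" "norm x \<ge> R \<Longrightarrow> u x = 0" "sqnorm u = 1"
    "continuous_on UNIV u" "u \<in> borel_measurable borel"
proof -
  show l: "\<bar>u x - u y\<bar> \<le> R * dist x y" for x y using assms by (simp add: lip_class_def)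
  show "u x \<ge> 0" "norm x \<ge> R \<Longrightarrow> u x = 0" "sqnorm u = 1" using assms by (simp_all add: lip_class_def)
  show "continuous_on UNIV u" using l by (rule lipschitz_continuous)
  then show "u \<in> borel_measurable borel" by (rule borel_measurable_continuous_onI)
qed

lemma lip_class_pos: "u \<in> lip_class R \<Longrightarrow> R > 0"
proof (rule ccontr)
  assume u: "u \<in> lip_class R" and "\<not> R > 0"
  then have "u = (\<lambda>x. 0)" using lip_classD(3)[OF u] by (intro ext) (smt (verit) norm_ge_zero)
  then have "sqnorm u = 0" by (simp add: sqnorm_def)
  then show False using lip_classD(4)[OF u] by simp
qed

text \<open>Comparison with a point of norm \<open>R\<close>, where the function vanishes; its
  distance from \<open>x\<close> is at most \<open>2 * R\<close>.\<close>

lemma lip_class_bound: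
  assumes u: "u \<in> lip_class R" shows "u x \<le> 2 * R\<^sup>2"
proof (cases "norm x < R")
  case True
  have R: "R > 0" by (rule lip_class_pos[OF u])
  let ?y = "R *\<^sub>R (axis 1 1 :: real^2)"
  have ny: "norm ?y = R" using R by simp
  have "u x = \<bar>u x - u ?y\<bar>" using lip_classD(2)[OF u, of x] lip_classD(3)[OF u, of ?y] ny by simp
  also have "\<dots> \<le> R * dist x ?y" by (rule lip_classD(1)[OF u])
  also have "dist x ?y \<le> 2 * R" using norm_triangle_ineq4[of x ?y] ny True unfolding dist_norm
      by linarith
  then have "R * dist x ?y \<le> R * (2 * R)" using R by (intro mult_left_mono) auto
  finally show ?thesis by (simp add: power2_eq_square)
next
  case False
  then show ?thesis using lip_classD(3)[OF u, of x] by simp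
qed

lemma second_moment_norm:
  assumes "\<epsilon> > 0"
  shows "(\<integral>\<^sup>+z. (if norm (z::real^2) < \<epsilon> then ennreal ((norm z)\<^sup>2) else 0) \<partial>lborel)
      = ennreal (ball_moment * \<epsilon> ^ 4) * 2"
proof -
  have "(\<integral>\<^sup>+z. (if norm (z::real^2) < \<epsilon> then ennreal ((norm z)\<^sup>2) else 0) \<partial>lborel)
    = (\<integral>\<^sup>+z. (\<Sum>i\<in>Basis. if norm z < \<epsilon> then ennreal ((i \<bullet> (z::real^2))\<^sup>2) else 0) \<partial>lborel)"
  proof (rule nn_integral_cong)
    fix z :: "real^2"
    have "(norm z)\<^sup>2 = (\<Sum>i\<in>Basis. (i \<bullet> z)\<^sup>2)"
      by (simp only: power2_norm_eq_inner) (subst euclidean_inner, simp add: power2_eq_square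
          inner_commute)
    then show "(if norm z < \<epsilon> then ennreal ((norm z)\<^sup>2) else 0) = (\<Sum>i\<in>Basis.
        if norm z < \<epsilon> then ennreal ((i \<bullet> z)\<^sup>2) else 0)"
      by (simp add: sum_ennreal)
  qed
  also have "\<dots> = (\<Sum>i\<in>(Basis::(real^2) set). \<integral>\<^sup>+z. (if norm z < \<epsilon> then ennreal ((i \<bullet> z)\<^sup>2) else
      0) \<partial>lborel)"
    by (rule nn_integral_sum) measurable
  also have "\<dots> = (\<Sum>i\<in>(Basis::(real^2) set). ennreal (ball_moment * \<epsilon> ^ 4))"
    by (intro sum.cong refl) (simp add: second_moment_isotropic[OF assms])
  also have "\<dots> = ennreal (ball_moment * \<epsilon> ^ 4) * 2"
    by (simp only: sum_constant DIM_real2) (simp add: mult.commute)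
  finally show ?thesis .
qed

text \<open>An increment by \<open>z\<close> is at most \<open>L * norm z\<close> and lives on the
  support and its translate, so its square integral is of order \<open>(norm z)\<^sup>2\<close>,
  which the normalization absorbs.\<close>

lemma dirichlet_lipschitz_finite:
  fixes u :: "real^2 \<Rightarrow> real"
  assumes lip: "\<And>x y. \<bar>u x - u y\<bar> \<le> L * dist x y" and supp: "\<And>x. norm x \<ge> R \<Longrightarrow> u x = 0"
  shows "dirichlet u < \<infinity>"
proof -
  have [measurable]: "u \<in> borel_measurable borel"
    by (rule borel_measurable_continuous_onI[OF lipschitz_continuous[OF lip]])
  have [measurable]: "cball (0::real^2) R \<in> sets borel" by simp
  let ?B = "emeasure lborel (cball (0::real^2) R)"
  have sq: "sqnorm (\<lambda>x. u (x + z) - u x) \<le> ennreal (L\<^sup>2 * (norm z)\<^sup>2) * (?B + ?B)" for z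
  proof -
    have "sqnorm (\<lambda>x. u (x + z) - u x) \<le> (\<integral>\<^sup>+x. ennreal (L\<^sup>2 * (norm z)\<^sup>2) * (indicator (cball 0 R)
        (x + z) + indicator (cball 0 R) x) \<partial>lborel)"
      unfolding sqnorm_def
    proof (rule nn_integral_mono)
      fix x :: "real^2"
      show "ennreal ((norm (u (x + z) - u x))\<^sup>2) \<le> ennreal (L\<^sup>2 * (norm z)\<^sup>2) * (indicator (cball 0
          R) (x + z) + indicator (cball 0 R) x)"
      proof (cases "norm (x + z) \<le> R \<or> norm x \<le> R")
        case True
        have "\<bar>u (x + z) - u x\<bar> \<le> L * norm z" using lip[of "x + z" x] by (simp add: dist_norm)
        from power_mono[OF this, of 2] have "(norm (u (x + z) - u x))\<^sup>2 \<le> L\<^sup>2 * (norm z)\<^sup>2"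
          by (simp add: power_mult_distrib)
        then have "ennreal ((norm (u (x + z) - u x))\<^sup>2) \<le> ennreal (L\<^sup>2 * (norm z)\<^sup>2) * 1"
            by (simp add: ennreal_leI)
        also have "\<dots> \<le> ennreal (L\<^sup>2 * (norm z)\<^sup>2) * (indicator (cball 0 R) (x + z)
            + indicator (cball 0 R) x)"
          using True by (intro mult_left_mono) (auto simp: indicator_def)
        finally show ?thesis .
      next
        case False
        then show ?thesis using supp[of x] supp[of "x + z"] by simp
      qed
    qed
    also have "\<dots> = ennreal (L\<^sup>2 * (norm z)\<^sup>2) * ((\<integral>\<^sup>+x. indicator (cball 0 R) (x + z) \<partial>lborel)
        + (\<integral>\<^sup>+x. indicator (cball 0 R) (x::real^2) \<partial>lborel))"
      by (subst nn_integral_cmult, measurable) (subst nn_integral_add, auto)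
    also have "(\<integral>\<^sup>+x. indicator (cball 0 R) (x + z) \<partial>lborel) = (\<integral>\<^sup>+x. indicator (cball 0 R)
        (x::real^2) \<partial>lborel)"
      by (rule nn_integral_lborel_translate) measurable
    finally show ?thesis by simp
  qed
  have "dirichlet u \<le> ennreal (L\<^sup>2) * (?B + ?B) * 2"
  proof (rule dirichlet_le)
    fix \<epsilon> :: real assume \<epsilon>: "\<epsilon> > 0"
    have "nl_energy \<epsilon> u \<le> (\<integral>\<^sup>+z. (ennreal (L\<^sup>2) * (?B + ?B)) * (if norm z
        < \<epsilon> then ennreal ((norm (z::real^2))\<^sup>2) else 0) \<partial>lborel)"
      unfolding nl_energy_shift_form[OF \<open>u \<in> borel_measurable borel\<close>]
    proof (rule nn_integral_mono)
      fix z :: "real^2"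
      have "sqnorm (\<lambda>x. u (x + z) - u x) \<le> (ennreal (L\<^sup>2) * (?B + ?B)) * ennreal ((norm z)\<^sup>2)"
        using sq[of z] by (simp only: ennreal_mult[OF zero_le_power2 zero_le_power2] mult_ac)
      then show "(if norm z < \<epsilon> then sqnorm (\<lambda>x. u (x + z) - u x) else 0) \<le> (ennreal (L\<^sup>2) * (?B
          + ?B)) * (if norm z < \<epsilon> then ennreal ((norm z)\<^sup>2) else 0)"
        by auto
    qed
    also have "\<dots> = (ennreal (L\<^sup>2) * (?B + ?B)) * (ennreal (ball_moment * \<epsilon> ^ 4) * 2)"
      by (subst nn_integral_cmult) (auto simp: second_moment_norm[OF \<epsilon>])
    finally show "nl_energy \<epsilon> u \<le> ennreal (ball_moment * \<epsilon> ^ 4) * (ennreal (L\<^sup>2) * (?B + ?B) * 2)"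
      by (simp add: mult_ac)
  qed
  also have "\<dots> < \<infinity>"
    using emeasure_lborel_cball_finite[of "0::real^2" R] by (simp add: ennreal_mult_less_top)
  finally show ?thesis .
qed

lemma dirichlet_lip_class: "u \<in> lip_class R \<Longrightarrow> dirichlet u < \<infinity>"
  by (rule dirichlet_lipschitz_finite[of u R R]) (auto simp: lip_classD)

section \<open>Polarization\<close>

text \<open>Two-point rearrangement: of the values at a mirror pair the larger goes to the side
  \<open>x \<bullet> e \<le> c\<close>, which contains the origin when
  \<open>c \<ge> 0\<close>.\<close>

definition polarize :: "real^2 \<Rightarrow> real \<Rightarrow> (real^2 \<Rightarrow> real) \<Rightarrow> real^2 \<Rightarrow> real" where
  "polarize e c u x = (if x \<bullet> e \<le> c then max (u x) (u (refl_hyp e c x)) else min (u x) (u (refl_hyp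
      e c x)))"

lemma refl_hyp_side: "norm e = 1 \<Longrightarrow> refl_hyp e c x \<bullet> e - c = - (x \<bullet> e - c)"
  by (simp add: refl_hyp_def inner_diff_left norm_eq_1)

lemma refl_hyp_fixed: "x \<bullet> e = c \<Longrightarrow> refl_hyp e c x = x"
  by (simp add: refl_hyp_def)

text \<open>The sign of the last product decides which pairing is the nearer one: reflecting one of
  two points increases their distance exactly when they lie strictly on the same side.\<close>

lemma dist_refl_hyp_right:
  assumes "norm e = 1"
  shows "(dist x (refl_hyp e c y))\<^sup>2 = (dist x y)\<^sup>2 + 4 * ((x \<bullet> e - c) * (y \<bullet> e - c))"
proof -
  have expand: "(norm (a + t *\<^sub>R e))\<^sup>2 = (norm a)\<^sup>2 + 2 * t * (a \<bullet> e) + t * t" for a and t :: real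
    using assms by (simp add: power2_norm_eq_inner inner_add_left inner_add_right inner_commute[of e
        a] norm_eq_1 algebra_simps)
  have "x - refl_hyp e c y = (x - y) + (2 * (y \<bullet> e - c)) *\<^sub>R e" by (simp add: refl_hyp_def)
  then show ?thesis
    unfolding dist_norm by (simp only: expand inner_diff_left) (simp add: algebra_simps)
qed

lemma norm_refl_hyp:
  assumes "norm e = 1"
  shows "(norm (refl_hyp e c x))\<^sup>2 = (norm x)\<^sup>2 + 4 * c * (c - x \<bullet> e)"
  using dist_refl_hyp_right[OF assms, of 0 c x] by (simp add: dist_norm algebra_simps)

lemma measurable_polarize [measurable]:
  assumes [measurable]: "u \<in> borel_measurable borel"
  shows "polarize e c u \<in> borel_measurable borel"
  unfolding polarize_def[abs_def] by measurable

lemma polarize_cases: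
  assumes "norm e = 1"
  shows "(x \<bullet> e \<le> c \<and> polarize e c u x = max (u x) (u (refl_hyp e c x)) \<and> polarize e c u (refl_hyp e
      c x) = min (u x) (u (refl_hyp e c x)))
    \<or> (x \<bullet> e \<ge> c \<and> polarize e c u x = min (u x) (u (refl_hyp e c x)) \<and> polarize e c u (refl_hyp e c
        x) = max (u x) (u (refl_hyp e c x)))"
proof (cases "x \<bullet> e = c")
  case True
  then show ?thesis by (simp add: polarize_def refl_hyp_fixed)
next
  case False
  have "refl_hyp e c x \<bullet> e \<le> c \<longleftrightarrow> x \<bullet> e \<ge> c" using refl_hyp_side[OF assms, of c x] by linarith
  then show ?thesis using False by (auto simp: polarize_def refl_hyp_invol[OF assms] max.commute
      min.commute)
qed

text \<open>Polarization keeps or exchanges the two values at each mirror pair, so it does not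
  change an integrand symmetrized over the reflection; the factor 2 then cancels.\<close>

lemma nn_integral_polarize:
  fixes F :: "real \<Rightarrow> ennreal"
  assumes [measurable]: "u \<in> borel_measurable borel" "F \<in> borel_measurable borel"
      and e: "norm e = 1"
  shows "(\<integral>\<^sup>+x. F (polarize e c u x) \<partial>lborel) = (\<integral>\<^sup>+x. F (u x) \<partial>lborel)"
proof -
  have double: "2 * (\<integral>\<^sup>+x. G x \<partial>lborel) = (\<integral>\<^sup>+x. G x + G (refl_hyp e c x) \<partial>lborel)"
    if [measurable]: "G \<in> borel_measurable borel" for G :: "real^2 \<Rightarrow> ennreal"
    using nn_integral_lborel_refl[OF that e, of c] by (subst nn_integral_add) (auto simp: mult_2)
  have "F (polarize e c u x) + F (polarize e c u (refl_hyp e c x)) = F (u x)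
      + F (u (refl_hyp e c x))" for x
    using polarize_cases[OF e, of x c u] by (auto simp: max_def min_def add.commute)
  then have "2 * (\<integral>\<^sup>+x. F (polarize e c u x) \<partial>lborel) = 2 * (\<integral>\<^sup>+x. F (u x) \<partial>lborel)"
    by (simp add: double)
  then show ?thesis by (simp add: ennreal_mult_cancel_left)
qed

lemma nn_integral2_add:
  fixes f g :: "'a::euclidean_space \<Rightarrow> 'a \<Rightarrow> ennreal"
  assumes [measurable]: "case_prod f \<in> borel_measurable (lborel \<Otimes>\<^sub>M lborel)" "case_prod g
      \<in> borel_measurable (lborel \<Otimes>\<^sub>M lborel)"
  shows "(\<integral>\<^sup>+x. \<integral>\<^sup>+y. f x y + g x y \<partial>lborel \<partial>lborel) = (\<integral>\<^sup>+x. \<integral>\<^sup>+y. f x y \<partial>lborel \<partial>lborel)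
      + (\<integral>\<^sup>+x. \<integral>\<^sup>+y. g x y \<partial>lborel \<partial>lborel)"
proof -
  have "(\<integral>\<^sup>+y. f x y + g x y \<partial>lborel) = (\<integral>\<^sup>+y. f x y \<partial>lborel) + (\<integral>\<^sup>+y. g x y \<partial>lborel)" for x
    by (rule nn_integral_add) measurable
  then show ?thesis
    by (simp only:) (rule nn_integral_add; measurable)
qed

text \<open>Pairing larger with larger and smaller with smaller maximizes the sum of products, hence
  minimizes the sum of squared differences.\<close>

lemma sorted_squares_le:
  fixes a a' b b' :: real
  shows "(max a a' - max b b')\<^sup>2 + (min a a' - min b b')\<^sup>2 \<le> (a - b)\<^sup>2 + (a' - b')\<^sup>2"
proof -
  have h: "a * b + a' * b' \<le> a * b' + a' * b" if "(a \<le> a' \<and> b' \<le> b) \<or> (a' \<le> a \<and> b \<le> b')"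
  proof -
    have "0 \<le> (a' - a) * (b - b')" using that by (auto intro: mult_nonneg_nonneg mult_nonpos_nonpos)
    then show ?thesis by (simp add: algebra_simps)
  qed
  show ?thesis
  proof (cases "a \<le> a'"; cases "b \<le> b'")
    assume "a \<le> a'" "\<not> b \<le> b'"
    with h show ?thesis by (simp add: max_def min_def power2_eq_square algebra_simps)
  next
    assume "\<not> a \<le> a'" "b \<le> b'"
    with h show ?thesis by (simp add: max_def min_def power2_eq_square algebra_simps)
  qed (simp_all add: max_def min_def)
qed

text \<open>Summed over the four pairs obtained by reflecting one or both points, the nonlocal energy
  density of the polarization is dominated: interchanging the two values at a mirror pair moves
  the larger value to the side where the interaction is stronger.\<close>
lemma nl_energy_polarize:
  assumes [measurable]: "u \<in> borel_measurable borel" and e: "norm e = 1"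
  shows "nl_energy \<epsilon> (polarize e c u) \<le> nl_energy \<epsilon> u"
proof -
  let ?s = "refl_hyp e c"
  let ?f = "\<lambda>u x y. (if dist x y < \<epsilon> then ennreal ((u x - u y)\<^sup>2) else 0)"
  \<comment> \<open>Reflecting either variable of integration leaves the energy unchanged, so it can
    be symmetrized over all four pairs.\<close>
  have four: "4 * nl_energy \<epsilon> u = (\<integral>\<^sup>+x. \<integral>\<^sup>+y. (?f u x y + ?f u (?s x) (?s y)) + (?f u x (?s y)
      + ?f u (?s x) y) \<partial>lborel \<partial>lborel)"
    if [measurable]: "u \<in> borel_measurable borel" for u :: "real^2 \<Rightarrow> real"
  proof -
    have refl: "(\<integral>\<^sup>+x. \<integral>\<^sup>+y. ?f u (?s x) y \<partial>lborel \<partial>lborel) = nl_energy \<epsilon> u"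
      unfolding nl_energy_def by (rule nn_integral_lborel_refl[OF _ e]) measurable
    have inner: "(\<integral>\<^sup>+y. ?f u x (?s y) \<partial>lborel) = (\<integral>\<^sup>+y. ?f u x y \<partial>lborel)" for x
      by (rule nn_integral_lborel_refl[OF _ e]) measurable
    have m1: "case_prod (\<lambda>x y. ?f u x y) \<in> borel_measurable (lborel \<Otimes>\<^sub>M lborel)"
      and m2: "case_prod (\<lambda>x y. ?f u (?s x) (?s y)) \<in> borel_measurable (lborel \<Otimes>\<^sub>M lborel)"
      and m3: "case_prod (\<lambda>x y. ?f u x (?s y)) \<in> borel_measurable (lborel \<Otimes>\<^sub>M lborel)"
      and m4: "case_prod (\<lambda>x y. ?f u (?s x) y) \<in> borel_measurable (lborel \<Otimes>\<^sub>M lborel)"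
      by measurable
    have m12: "case_prod (\<lambda>x y. ?f u x y + ?f u (?s x) (?s y)) \<in> borel_measurable (lborel \<Otimes>\<^sub>M
        lborel)"
      and m34: "case_prod (\<lambda>x y. ?f u x (?s y) + ?f u (?s x) y) \<in> borel_measurable (lborel \<Otimes>\<^sub>M
          lborel)"
      by measurable
    have "(\<integral>\<^sup>+x. \<integral>\<^sup>+y. (?f u x y + ?f u (?s x) (?s y)) + (?f u x (?s y)
        + ?f u (?s x) y) \<partial>lborel \<partial>lborel)
      = ((\<integral>\<^sup>+x. \<integral>\<^sup>+y. ?f u x y \<partial>lborel \<partial>lborel) + (\<integral>\<^sup>+x. \<integral>\<^sup>+y. ?f u (?s x) (?s y) \<partial>lborel \<partial>lborel))
       + ((\<integral>\<^sup>+x. \<integral>\<^sup>+y. ?f u x (?s y) \<partial>lborel \<partial>lborel) + (\<integral>\<^sup>+x. \<integral>\<^sup>+y. ?f u (?s x)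
           y \<partial>lborel \<partial>lborel))"
      by (simp only: nn_integral2_add[of "\<lambda>x y. ?f u x y + ?f u (?s x) (?s y)" "\<lambda>x y. ?f u x (?s y)
          + ?f u (?s x) y", OF m12 m34]
          nn_integral2_add[OF m1 m2] nn_integral2_add[OF m3 m4])
    also have "\<dots> = (nl_energy \<epsilon> u + nl_energy \<epsilon> u) + (nl_energy \<epsilon> u + nl_energy \<epsilon> u)"
      unfolding inner refl by (simp add: nl_energy_def)
    also have "\<dots> = 2 * nl_energy \<epsilon> u + 2 * nl_energy \<epsilon> u" by (simp only: mult_2)
    also have "\<dots> = (2 + 2) * nl_energy \<epsilon> u" by (simp only: distrib_right)
    finally show ?thesis by simp
  qed
  have pw: "(?f (polarize e c u) x y + ?f (polarize e c u) (?s x) (?s y))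
      + (?f (polarize e c u) x (?s y) + ?f (polarize e c u) (?s x) y)
     \<le> (?f u x y + ?f u (?s x) (?s y)) + (?f u x (?s y) + ?f u (?s x) y)" for x y
  proof -
    define a a' b b' where "a = u x" and "a' = u (?s x)" and "b = u y" and "b' = u (?s y)"
    define A A' B B' where "A = polarize e c u x" and "A' = polarize e c u (?s x)"
        and "B = polarize e c u y" and "B' = polarize e c u (?s y)"
    define d1 d2 where "d1 = dist x y" and "d2 = dist x (?s y)"
    have d: "dist (?s x) (?s y) = d1" "dist (?s x) y = d2"
      using dist_refl_hyp[OF e, of c x y] dist_refl_hyp[OF e, of c x "?s y"]
          by (simp_all add: d1_def d2_def refl_hyp_invol[OF e])
    have dd: "d2\<^sup>2 = d1\<^sup>2 + 4 * ((x \<bullet> e - c) * (y \<bullet> e - c))"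
      unfolding d1_def d2_def by (rule dist_refl_hyp_right[OF e])
    have dpos: "d1 \<ge> 0" "d2 \<ge> 0" by (simp_all add: d1_def d2_def)
    have T: "(if d1 < \<epsilon> then ennreal ((p - q)\<^sup>2) else 0) + (if d1 < \<epsilon> then ennreal ((p'
        - q')\<^sup>2) else 0) + ((if d2 < \<epsilon> then ennreal ((p - q')\<^sup>2) else 0) + (if d2
        < \<epsilon> then ennreal ((p' - q)\<^sup>2) else 0))
      = ennreal ((if d1 < \<epsilon> then (p - q)\<^sup>2 + (p' - q')\<^sup>2 else 0) + (if d2 < \<epsilon> then (p - q')\<^sup>2 + (p'
          - q)\<^sup>2 else 0))" for p p' q q'
      by (auto simp: ennreal_plus[symmetric] simp del: ennreal_plus)
    have X: "(A = max a a' \<and> A' = min a a') \<or> (A = min a a' \<and> A' = max a a')"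
      and Y: "(B = max b b' \<and> B' = min b b') \<or> (B = min b b' \<and> B' = max b b')"
      using polarize_cases[OF e, of x c u] polarize_cases[OF e, of y c u]
      by (auto simp: A_def A'_def B_def B'_def a_def a'_def b_def b'_def)
    \<comment> \<open>Both pairings together are unaffected by polarization, so there is equality
      when \<open>d1\<close> and \<open>d2\<close> are both below \<open>\<epsilon>\<close>.\<close>
    have sum: "((A - B)\<^sup>2 + (A' - B')\<^sup>2) + ((A - B')\<^sup>2 + (A' - B)\<^sup>2) = ((a - b)\<^sup>2 + (a' - b')\<^sup>2)
        + ((a - b')\<^sup>2 + (a' - b)\<^sup>2)"
      using X Y by (auto simp: max_def min_def)
    have s1: "(max a a' - max b b')\<^sup>2 + (min a a' - min b b')\<^sup>2 \<le> (a - b)\<^sup>2 + (a' - b')\<^sup>2"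
      by (rule sorted_squares_le)
    have s2: "(max a a' - max b b')\<^sup>2 + (min a a' - min b b')\<^sup>2 \<le> (a - b')\<^sup>2 + (a' - b)\<^sup>2"
      using sorted_squares_le[of a a' b' b] by (simp add: max.commute min.commute)
    \<comment> \<open>If only one of the distances is below \<open>\<epsilon>\<close>, it is the
      smaller one; a decrease for the nearer pairing is therefore enough.\<close>
    have "d1 \<le> d2 \<and> (A - B)\<^sup>2 + (A' - B')\<^sup>2 \<le> (a - b)\<^sup>2 + (a' - b')\<^sup>2
       \<or> d2 \<le> d1 \<and> (A - B')\<^sup>2 + (A' - B)\<^sup>2 \<le> (a - b')\<^sup>2 + (a' - b)\<^sup>2"
    proof -
      have le12: "d1 \<le> d2" if "(x \<bullet> e - c) * (y \<bullet> e - c) \<ge> 0"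
        by (rule power2_le_imp_le[OF _ dpos(2)]) (use dd that in linarith)
      have le21: "d2 \<le> d1" if "(x \<bullet> e - c) * (y \<bullet> e - c) \<le> 0"
        by (rule power2_le_imp_le[OF _ dpos(1)]) (use dd that in linarith)
      from polarize_cases[OF e, of x c u] polarize_cases[OF e, of y c u] show ?thesis
      proof (elim disjE)
        assume "x \<bullet> e \<le> c \<and> polarize e c u x = max (u x) (u (?s x)) \<and> polarize e c u (?s x)
            = min (u x) (u (?s x))"
          "y \<bullet> e \<le> c \<and> polarize e c u y = max (u y) (u (?s y)) \<and> polarize e c u (?s y)
              = min (u y) (u (?s y))"
        then show ?thesis using le12 s1 by (auto simp: A_def A'_def B_def B'_def a_def a'_def b_def
            b'_def mult_nonpos_nonpos)
      next
        assume "x \<bullet> e \<ge> c \<and> polarize e c u x = min (u x) (u (?s x)) \<and> polarize e c u (?s x)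
            = max (u x) (u (?s x))"
          "y \<bullet> e \<ge> c \<and> polarize e c u y = min (u y) (u (?s y)) \<and> polarize e c u (?s y)
              = max (u y) (u (?s y))"
        then show ?thesis using le12 s1 by (auto simp: A_def A'_def B_def B'_def a_def a'_def b_def
            b'_def)
      next
        assume "x \<bullet> e \<le> c \<and> polarize e c u x = max (u x) (u (?s x)) \<and> polarize e c u (?s x)
            = min (u x) (u (?s x))"
          "y \<bullet> e \<ge> c \<and> polarize e c u y = min (u y) (u (?s y)) \<and> polarize e c u (?s y)
              = max (u y) (u (?s y))"
        then show ?thesis using le21 s2 by (auto simp: A_def A'_def B_def B'_def a_def a'_def b_def
            b'_def mult_nonpos_nonneg)
      next
        assume "x \<bullet> e \<ge> c \<and> polarize e c u x = min (u x) (u (?s x)) \<and> polarize e c u (?s x)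
            = max (u x) (u (?s x))"
          "y \<bullet> e \<le> c \<and> polarize e c u y = max (u y) (u (?s y)) \<and> polarize e c u (?s y)
              = min (u y) (u (?s y))"
        then show ?thesis using le21 s2 by (auto simp: A_def A'_def B_def B'_def a_def a'_def b_def
            b'_def mult_nonneg_nonpos)
      qed
    qed
    then have "(if d1 < \<epsilon> then (A - B)\<^sup>2 + (A' - B')\<^sup>2 else 0) + (if d2 < \<epsilon> then (A - B')\<^sup>2 + (A'
        - B)\<^sup>2 else 0)
      \<le> (if d1 < \<epsilon> then (a - b)\<^sup>2 + (a' - b')\<^sup>2 else 0) + (if d2 < \<epsilon> then (a - b')\<^sup>2 + (a'
          - b)\<^sup>2 else 0)"
      using sum by (cases "d1 < \<epsilon>"; cases "d2 < \<epsilon>") (auto; linarith)+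
    from ennreal_leI[OF this] show ?thesis
      by (simp only: T[symmetric] a_def a'_def b_def b'_def A_def A'_def B_def B'_def d
          d1_def[symmetric] d2_def[symmetric])
  qed
  have "4 * nl_energy \<epsilon> (polarize e c u) \<le> 4 * nl_energy \<epsilon> u"
    unfolding four[OF assms(1)] four[OF measurable_polarize[OF assms(1)]]
    by (intro nn_integral_mono pw)
  then show ?thesis by (simp add: ennreal_mult_le_mult_iff)
qed

text \<open>For \<open>c \<ge> 0\<close> reflecting a point of the side
  \<open>x \<bullet> e \<le> c\<close> moves it no closer to the origin, so the support stays in the
  ball. For points on opposite sides the reflected pair is nearer, which saves the Lipschitz
  constant.\<close>

lemma polarize_lip_class:
  assumes u: "u \<in> lip_class R" and e: "norm e = 1" and c: "c \<ge> 0"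
  shows "polarize e c u \<in> lip_class R"
  unfolding lip_class_def mem_Collect_eq
proof (intro conjI allI impI)
  have R: "R > 0" by (rule lip_class_pos[OF u])
  let ?s = "refl_hyp e c"
  show "\<bar>polarize e c u x - polarize e c u y\<bar> \<le> R * dist x y" for x y
  proof -
    have d: "dist (?s x) (?s y) = dist x y" "dist (?s x) y = dist x (?s y)"
      using dist_refl_hyp[OF e, of c x y] dist_refl_hyp[OF e, of c x "?s y"]
          by (simp_all add: refl_hyp_invol[OF e])
    have l: "\<bar>u x - u y\<bar> \<le> R * dist x y" "\<bar>u (?s x) - u (?s y)\<bar> \<le> R * dist x y"
      "\<bar>u x - u (?s y)\<bar> \<le> R * dist x (?s y)" "\<bar>u (?s x) - u y\<bar> \<le> R * dist x (?s y)"
      using lip_classD(1)[OF u, of x y] lip_classD(1)[OF u, of "?s x" "?s y"] lip_classD(1)[OF u, of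
          x "?s y"] lip_classD(1)[OF u, of "?s x" y]
      by (simp_all add: d)
    show ?thesis
    proof (cases "x \<bullet> e \<le> c \<longleftrightarrow> y \<bullet> e \<le> c")
      case True
      then show ?thesis using l(1,2) by (auto simp: polarize_def max_def min_def)
    next
      case False
      have "(x \<bullet> e - c) * (y \<bullet> e - c) \<le> 0" using False by (auto simp: mult_le_0_iff)
      then have "dist x (?s y) \<le> dist x y"
        using dist_refl_hyp_right[OF e, of x c y] by (intro power2_le_imp_le[OF _ zero_le_dist])
            linarith
      then have "R * dist x (?s y) \<le> R * dist x y" using R by (intro mult_left_mono) auto
      then show ?thesis using l by (auto simp: polarize_def max_def min_def)
    qed
  qed
  show "polarize e c u x \<ge> 0" for x using lip_classD(2)[OF u]
      by (auto simp: polarize_def max_def min_def)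
  show "polarize e c u x = 0" if "norm x \<ge> R" for x
  proof (cases "x \<bullet> e \<le> c")
    case True
    then have "(norm x)\<^sup>2 \<le> (norm (?s x))\<^sup>2" using norm_refl_hyp[OF e, of c x] c by simp
    then have "norm x \<le> norm (?s x)" by (rule power2_le_imp_le) simp
    then show ?thesis using that lip_classD(3)[OF u] by (simp add: polarize_def)
  next
    case False
    then show ?thesis using that lip_classD(3)[OF u, of x] lip_classD(2)[OF u, of "?s x"]
        by (simp add: polarize_def)
  qed
  show "sqnorm (polarize e c u) = 1"
    using nn_integral_polarize[OF lip_classD(6)[OF u] _ e, of "\<lambda>t. ennreal ((norm t)\<^sup>2)" c]
        lip_classD(4)[OF u]
    by (simp add: sqnorm_def)
qed

lemma potential_lip_class_finite:
  assumes u: "u \<in> lip_class R" and p: "0 \<le> p" "p < 2"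
  shows "potential p u \<le> ennreal ((2 * R\<^sup>2)\<^sup>2 * (R powr (2 - p) * powr_mass p))"
proof -
  have R: "R > 0" by (rule lip_class_pos[OF u])
  have "potential p u \<le> (\<integral>\<^sup>+x. ennreal ((2 * R\<^sup>2)\<^sup>2) * (if norm x < R then ennreal (norm (x::real^2)
      powr (- p)) else 0) \<partial>lborel)"
    unfolding potential_def
  proof (rule nn_integral_mono)
    fix x :: "real^2"
    show "ennreal (norm x powr (- p) * (u x)\<^sup>2) \<le> ennreal ((2 * R\<^sup>2)\<^sup>2) * (if norm x
        < R then ennreal (norm x powr (- p)) else 0)"
    proof (cases "norm x < R")
      case True
      have "(u x)\<^sup>2 \<le> (2 * R\<^sup>2)\<^sup>2"
        using lip_class_bound[OF u, of x] lip_classD(2)[OF u, of x] by (intro power_mono) auto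
      then have "norm x powr (- p) * (u x)\<^sup>2 \<le> (2 * R\<^sup>2)\<^sup>2 * norm x powr (- p)"
        by (subst mult.commute) (intro mult_right_mono, auto)
      then show ?thesis using True by (simp add: ennreal_mult[symmetric] ennreal_leI del:
          ennreal_mult)
    next
      case False
      then show ?thesis using lip_classD(3)[OF u, of x] by simp
    qed
  qed
  also have "\<dots> = ennreal ((2 * R\<^sup>2)\<^sup>2) * ennreal (R powr (2 - p) * powr_mass p)"
    by (subst nn_integral_cmult) (auto simp: nn_integral_powr_ball[OF p R])
  finally show ?thesis using powr_mass_nonneg[of p] by (simp add: ennreal_mult[symmetric])
qed

lemma quartic_lip_class_finite:
  assumes u: "u \<in> lip_class R"
  shows "quartic u \<le> ennreal ((2 * R\<^sup>2)\<^sup>2)"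
proof -
  have [measurable]: "u \<in> borel_measurable borel" by (rule lip_classD(6)[OF u])
  have "quartic u \<le> (\<integral>\<^sup>+x. ennreal ((2 * R\<^sup>2)\<^sup>2) * ennreal ((norm (u x))\<^sup>2) \<partial>lborel)"
    unfolding quartic_def
  proof (rule nn_integral_mono)
    fix x
    have "(u x)\<^sup>2 \<le> (2 * R\<^sup>2)\<^sup>2"
      using lip_class_bound[OF u, of x] lip_classD(2)[OF u, of x] by (intro power_mono) auto
    then have "(u x)^4 \<le> (2 * R\<^sup>2)\<^sup>2 * (norm (u x))\<^sup>2"
      using mult_right_mono[of "(u x)\<^sup>2" "(2 * R\<^sup>2)\<^sup>2" "(u x)\<^sup>2"]
          by (simp add: power4_eq_xxxx power2_eq_square mult_ac)
    then show "ennreal ((u x)^4) \<le> ennreal ((2 * R\<^sup>2)\<^sup>2) * ennreal ((norm (u x))\<^sup>2)"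
      by (subst ennreal_mult[symmetric]) (auto intro: ennreal_leI)
  qed
  also have "\<dots> = ennreal ((2 * R\<^sup>2)\<^sup>2) * sqnorm u"
    unfolding sqnorm_def by (rule nn_integral_cmult) measurable
  finally show ?thesis using lip_classD(4)[OF u] by simp
qed

text \<open>The potential is strictly radially monotone, so polarization strictly lowers the potential
  energy unless it does not change the function.\<close>
lemma polarize_potential_rigid:
  assumes u: "u \<in> lip_class R" and e: "norm e = 1" and c: "c > 0" and p: "0 < p" "p < 2"
    and le: "potential p (polarize e c u) \<le> potential p u" and x: "x \<bullet> e < c"
  shows "u (refl_hyp e c x) \<le> u x"
proof -
  let ?s = "refl_hyp e c"
  let ?w = "\<lambda>x::real^2. norm x powr (- p)"
  let ?v = "polarize e c u"
  have v: "?v \<in> lip_class R" using polarize_lip_class[OF u e] c by simp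
  have [measurable]: "u \<in> borel_measurable borel" "?v \<in> borel_measurable borel"
    using lip_classD(6)[OF u] lip_classD(6)[OF v] by auto
  have fin: "potential p u < \<infinity>" "potential p ?v < \<infinity>"
    using potential_lip_class_finite[OF u, of p] potential_lip_class_finite[OF v, of p] p
    by (auto simp: order_le_less_trans)
  have double: "2 * potential p g = (\<integral>\<^sup>+x. ennreal (?w x * (g x)\<^sup>2
      + ?w (?s x) * (g (?s x))\<^sup>2) \<partial>lborel)"
    if [measurable]: "g \<in> borel_measurable borel" for g
  proof -
    have "(\<integral>\<^sup>+x. ennreal (?w (?s x) * (g (?s x))\<^sup>2) \<partial>lborel) = potential p g"
      unfolding potential_def by (rule nn_integral_lborel_refl[OF _ e]) measurable
    then have "2 * potential p g = (\<integral>\<^sup>+x. ennreal (?w x * (g x)\<^sup>2) \<partial>lborel)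
        + (\<integral>\<^sup>+x. ennreal (?w (?s x) * (g (?s x))\<^sup>2) \<partial>lborel)"
      by (simp add: mult_2 potential_def)
    then show ?thesis by (subst (asm) nn_integral_add[symmetric]) auto
  qed
  define F where "F g x = ?w x * (g x)\<^sup>2 + ?w (?s x) * (g (?s x))\<^sup>2" for g :: "real^2 \<Rightarrow> real" and x
  have [measurable]: "F u \<in> borel_measurable borel" "F ?v \<in> borel_measurable borel"
    unfolding F_def[abs_def] by measurable
  have F0: "F g x \<ge> 0" for g x by (simp add: F_def)
  have FI: "(\<integral>\<^sup>+x. ennreal (F u x) \<partial>lborel) = 2 * potential p u" "(\<integral>\<^sup>+x. ennreal (F ?v x) \<partial>lborel)
      = 2 * potential p ?v"
    unfolding F_def by (simp_all add: double)
  have int: "integrable lborel (F u)" "integrable lborel (F ?v)"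
    using FI fin F0 by (auto intro!: integrableI_nonneg simp: ennreal_mult_less_top)
  have ns: "norm x \<le> norm (?s x)" if "x \<bullet> e \<le> c" for x
    using norm_refl_hyp[OF e, of c x] c that by (intro power2_le_imp_le[of "norm x"]) auto
  have wmono: "?w y \<le> ?w x" if "x \<noteq> 0" "norm x \<le> norm y" for x y
    using that p by (intro powr_mono2') auto
  \<comment> \<open>As polarization keeps or exchanges the two values, the change of the symmetrized
    density factors into a difference of weights and a difference of squares, and these have the
    same sign.\<close>
  have diff: "F ?v x - F u x = (?w x - ?w (?s x)) * ((?v x)\<^sup>2 - (u x)\<^sup>2)" for x
    using polarize_cases[OF e, of x c u] by (auto simp: F_def max_def min_def algebra_simps)
  have nonneg: "F u x \<le> F ?v x" if nz: "x \<noteq> 0" "?s x \<noteq> 0" for x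
  proof -
    have "(?w x - ?w (?s x)) * ((?v x)\<^sup>2 - (u x)\<^sup>2) \<ge> 0"
    proof (cases "x \<bullet> e \<le> c")
      case True
      have "?w (?s x) \<le> ?w x" using wmono[OF nz(1) ns[OF True]] .
      moreover have "(u x)\<^sup>2 \<le> (?v x)\<^sup>2"
        using True lip_classD(2)[OF u] by (intro power_mono) (auto simp: polarize_def)
      ultimately show ?thesis by simp
    next
      case False
      then have "?s x \<bullet> e \<le> c" using refl_hyp_side[OF e, of c x] by linarith
      then have "norm (?s x) \<le> norm x" using ns[of "?s x"] by (simp add: refl_hyp_invol[OF e])
      then have "?w x \<le> ?w (?s x)" using wmono[OF nz(2)] by simp
      moreover have "(?v x)\<^sup>2 \<le> (u x)\<^sup>2"
        using False lip_classD(2)[OF u] lip_classD(2)[OF v]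
            by (intro power_mono) (auto simp: polarize_def)
      ultimately show ?thesis by (simp add: mult_nonpos_nonpos)
    qed
    then show ?thesis using diff[of x] by simp
  qed
  \<comment> \<open>Because \<open>0 powr (- p) = 0\<close>, the weight is not monotone at the
    origin; the origin and its mirror image are removed.\<close>
  have aenz: "AE x in lborel. x \<noteq> 0 \<and> ?s x \<noteq> 0"
  proof -
    have "AE x in lborel. x \<noteq> ?s 0" "AE x in lborel. x \<noteq> (0::real^2)" by (rule AE_lborel_singleton)+
    then show ?thesis by eventually_elim (metis refl_hyp_invol[OF e])
  qed
  have "(\<integral>x. F ?v x \<partial>lborel) \<le> (\<integral>x. F u x \<partial>lborel)"
  proof -
    have "ennreal (\<integral>x. F ?v x \<partial>lborel) \<le> ennreal (\<integral>x. F u x \<partial>lborel)"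
      using FI le F0 int by (simp add: nn_integral_eq_integral[symmetric] mult_left_mono)
    then show ?thesis using F0 by (simp add: ennreal_le_iff Bochner_Integration.integral_nonneg)
  qed
  then have "(\<integral>x. F ?v x - F u x \<partial>lborel) \<le> 0" using int by simp
  moreover have aepos: "AE x in lborel. 0 \<le> F ?v x - F u x"
    using aenz by eventually_elim (simp add: nonneg)
  ultimately have "(\<integral>x. F ?v x - F u x \<partial>lborel) = 0"
    using integral_nonneg_AE[OF aepos] by linarith
  then have "AE x in lborel. F ?v x - F u x = 0"
    using integral_nonneg_eq_0_iff_AE[OF _ aepos] int by simp
  then have "AE x in lborel. x \<bullet> e < c \<longrightarrow> u (?s x) \<le> u x"
    using aenz
  proof eventually_elim
    case (elim x)
    show ?case
    proof
      assume xe: "x \<bullet> e < c"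
      have "(norm x)\<^sup>2 < (norm (?s x))\<^sup>2" using norm_refl_hyp[OF e, of c x] c xe by simp
      then have "norm x < norm (?s x)" by (rule power2_less_imp_less) simp
      then have "?w (?s x) < ?w x" using elim p by (intro powr_less_mono2_neg) auto
      then have "(?v x)\<^sup>2 = (u x)\<^sup>2" using elim diff[of x] by simp
      then have "?v x = u x" using lip_classD(2)[OF u, of x] lip_classD(2)[OF v, of x]
          by (simp add: power2_eq_iff_nonneg)
      then show "u (?s x) \<le> u x" using xe by (simp add: polarize_def)
    qed
  qed
  then have ae: "AE x\<in>{x. x \<bullet> e < c} in lebesgue. x \<in> {x. u (?s x) \<le> u x}"
    unfolding AE_lebesgue_iff by simp
  \<comment> \<open>A closed set that contains almost every point of an open set contains all of it;
    this removes the exceptional null set.\<close>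
  show ?thesis
  proof -
    have "continuous_on UNIV (\<lambda>x. ?s x)" unfolding refl_hyp_def by (intro continuous_intros)
    then have "continuous_on UNIV (\<lambda>x. u (?s x))"
      by (rule continuous_on_compose2[OF lip_classD(5)[OF u]]) auto
    then have "closed {x. u (?s x) \<le> u x}"
      by (intro closed_Collect_le lip_classD(5)[OF u])
    moreover have "open {x. x \<bullet> e < c}" by (intro open_Collect_less continuous_intros)
    ultimately have "x \<in> {x. u (?s x) \<le> u x}"
      using mem_closed_if_AE_lebesgue_open[of "{x. x \<bullet> e < c}" "{x. u (?s x) \<le> u x}" x] ae x by simp
    then show ?thesis by simp
  qed
qed

section \<open>Constrained minimizers\<close>

text \<open>Only the Dirichlet energies may fail to converge. Along a subsequence they tend to some
  \<open>A0\<close>, which bounds that of the limit, and \<open>t + b * t\<^sup>2\<close> is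
  increasing for \<open>t \<ge> 0\<close>.\<close>

lemma energy_lsc:
  assumes m: "\<And>n. v n \<in> borel_measurable borel" "u \<in> borel_measurable borel"
    and lim: "AE x in lborel. (\<lambda>n. v n x) \<longlonglongrightarrow> u x"
    and D: "\<And>n. dirichlet (v n) < \<infinity>" "\<And>n. enn2real (dirichlet (v n)) \<le> K"
    and P: "(\<lambda>n. potential p (v n)) \<longlonglongrightarrow> potential p u" "potential p u < \<infinity>"
    and Q: "(\<lambda>n. quartic (v n)) \<longlonglongrightarrow> quartic u" "quartic u < \<infinity>"
    and E: "\<And>n. energy p a b (v n) \<le> e n" "e \<longlonglongrightarrow> E" and b: "b \<ge> 0"
  shows "dirichlet u < \<infinity>" "energy p a b u \<le> E"
proof -
  define A where "A n = enn2real (dirichlet (v n))" for n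
  have "A n \<in> {0..K}" for n using D(2) by (simp add: A_def)
  then have "\<forall>n. A n \<in> {0..K}" by blast
  from seq_compactE[OF compact_imp_seq_compact[OF compact_Icc] this]
  obtain A0 r where A0: "A0 \<in> {0..K}" and r: "strict_mono r" and Ar: "(A \<circ> r) \<longlonglongrightarrow> A0" by metis
  have DA: "dirichlet (v n) = ennreal (A n)" for n using D(1)[of n] by (simp add: A_def)
  have Du: "dirichlet u \<le> ennreal A0"
  proof (rule dirichlet_lsc[where u = "\<lambda>n. v (r n)" and A = "A \<circ> r"])
    show "AE x in lborel. (\<lambda>n. v (r n) x) \<longlonglongrightarrow> u x"
      using lim by eventually_elim (use LIMSEQ_subseq_LIMSEQ[OF _ r] in \<open>force simp: o_def\<close>)
  qed (use m DA Ar in \<open>auto simp: A_def\<close>)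
  then show "dirichlet u < \<infinity>" by (simp add: order_le_less_trans)
  have Ple: "(\<lambda>n. enn2real (potential p (v (r n)))) \<longlonglongrightarrow> enn2real (potential p u)"
    using LIMSEQ_subseq_LIMSEQ[OF P(1) r] P(2) by (intro tendsto_enn2real) (auto simp: o_def)
  have Qle: "(\<lambda>n. enn2real (quartic (v (r n)))) \<longlonglongrightarrow> enn2real (quartic u)"
    using LIMSEQ_subseq_LIMSEQ[OF Q(1) r] Q(2) by (intro tendsto_enn2real) (auto simp: o_def)
  have lim_e: "(\<lambda>n. energy p a b (v (r n))) \<longlonglongrightarrow> A0 + b * A0\<^sup>2 - enn2real (potential p u)
      - a / 2 * enn2real (quartic u)"
    unfolding energy_def using Ar Ple Qle by (auto intro!: tendsto_intros simp: A_def o_def)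
  have "A0 + b * A0\<^sup>2 - enn2real (potential p u) - a / 2 * enn2real (quartic u) \<le> E"
    by (rule LIMSEQ_le[OF lim_e LIMSEQ_subseq_LIMSEQ[OF E(2) r]]) (use E(1) in \<open>auto simp: o_def\<close>)
  moreover have "enn2real (dirichlet u) \<le> A0"
    using enn2real_mono[OF Du] A0 by simp
  then have "enn2real (dirichlet u) + b * (enn2real (dirichlet u))\<^sup>2 \<le> A0 + b * A0\<^sup>2"
    using b by (intro add_mono mult_left_mono power_mono) auto
  ultimately show "energy p a b u \<le> E" unfolding energy_def by linarith
qed

text \<open>One dominated convergence statement serves the mass, the quartic and the potential term;
  \<open>F\<close> depends on \<open>x\<close> in order to carry the weight.\<close>

lemma lip_class_bounded_convergence:
  assumes v: "\<And>n. v n \<in> lip_class R" and lim: "\<And>x. (\<lambda>n. v n x) \<longlonglongrightarrow> u x"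
    and F: "\<And>x. continuous_on UNIV (F x)" "\<And>x t. 0 \<le> t \<Longrightarrow> t \<le> 2 * R\<^sup>2 \<Longrightarrow> F x t \<le> W x" "\<And>x. norm x \<ge> R
        \<Longrightarrow> F x 0 = (0::real)"
    and m: "\<And>g. g \<in> borel_measurable borel \<Longrightarrow> (\<lambda>x. F x (g x)) \<in> borel_measurable borel"
    and W: "W \<in> borel_measurable borel" "(\<integral>\<^sup>+x. (if norm x < R then ennreal (W x) else 0) \<partial>lborel)
        < \<infinity>"
  shows "(\<lambda>n. \<integral>\<^sup>+x. ennreal (F x (v n x)) \<partial>lborel) \<longlonglongrightarrow> (\<integral>\<^sup>+x. ennreal (F x (u x)) \<partial>lborel)"
proof (rule nn_integral_dominated_convergence[where w = "\<lambda>x.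
    if norm x < R then ennreal (W x) else 0"])
  have [measurable]: "v n \<in> borel_measurable borel" for n by (rule lip_classD(6)[OF v])
  have [measurable]: "u \<in> borel_measurable borel"
    by (rule borel_measurable_LIMSEQ_metric[where f = v]) (use lim in auto)
  show "(\<lambda>x. ennreal (F x (v n x))) \<in> borel_measurable lborel" for n using m[of "v n"] by simp
  show "(\<lambda>x. ennreal (F x (u x))) \<in> borel_measurable lborel" using m[of u] by simp
  show "(\<lambda>x. if norm x < R then ennreal (W x) else 0) \<in> borel_measurable lborel" using W(1)
      by measurable
  show "AE x in lborel. ennreal (F x (v n x)) \<le> (if norm x < R then ennreal (W x) else 0)" for n
  proof (rule AE_I2)
    fix x
    show "ennreal (F x (v n x)) \<le> (if norm x < R then ennreal (W x) else 0)"
    proof (cases "norm x < R")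
      case True
      then show ?thesis
        using F(2)[OF lip_classD(2)[OF v] lip_class_bound[OF v], of x n x]
            by (simp add: ennreal_leI)
    next
      case False
      then show ?thesis using lip_classD(3)[OF v, of x n] F(3)[of x] by simp
    qed
  qed
  show "AE x in lborel. (\<lambda>n. ennreal (F x (v n x))) \<longlonglongrightarrow> ennreal (F x (u x))"
  proof (intro AE_I2 tendsto_ennrealI)
    fix x
    have "isCont (F x) (u x)" using F(1)[of x] by (simp add: continuous_on_eq_continuous_at)
    then show "(\<lambda>n. F x (v n x)) \<longlonglongrightarrow> F x (u x)" by (rule isCont_tendsto_compose[OF _ lim])
  qed
qed (use W in auto)

lemma lip_class_minimizer:
  assumes ne: "lip_class R \<noteq> {}" and p: "0 < p" "p < 2" and a: "a > 0" and b: "b > 0"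
  obtains u where "u \<in> lip_class R" "\<And>v. v \<in> lip_class R \<Longrightarrow> energy p a b u \<le> energy p a b v"
proof -
  have R: "R > 0" using ne lip_class_pos by blast
  define CP where "CP = (2 * R\<^sup>2)\<^sup>2 * (R powr (2 - p) * powr_mass p)"
  define CQ where "CQ = (2 * R\<^sup>2)\<^sup>2"
  have C: "CP \<ge> 0" "CQ \<ge> 0" using powr_mass_nonneg[of p] by (simp_all add: CP_def CQ_def)
  have PQ: "enn2real (potential p v) \<le> CP" "enn2real (quartic v) \<le> CQ" if "v \<in> lip_class R" for v
    using potential_lip_class_finite[OF that, of p] quartic_lip_class_finite[OF that] p C
        enn2real_leI
    by (auto simp: CP_def CQ_def)
  \<comment> \<open>The potential and quartic terms are bounded on the class, so a bound on the
    energy is a bound on the Dirichlet energy.\<close>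
  have lower: "enn2real (dirichlet v) \<le> energy p a b v + CP + a / 2 * CQ" if "v \<in> lip_class R" for v
  proof -
    have "a / 2 * enn2real (quartic v) \<le> a / 2 * CQ" using PQ(2)[OF that] a
        by (intro mult_left_mono) auto
    moreover have "b * (enn2real (dirichlet v))\<^sup>2 \<ge> 0" using b by simp
    ultimately show ?thesis using PQ(1)[OF that] unfolding energy_def by linarith
  qed
  define I where "I = Inf (energy p a b ` lip_class R)"
  have bdd: "bdd_below (energy p a b ` lip_class R)"
  proof (rule bdd_belowI2)
    show "- CP - a / 2 * CQ \<le> energy p a b v" if "v \<in> lip_class R" for v
      using lower[OF that] enn2real_nonneg[of "dirichlet v"] by linarith
  qed
  have I: "I \<le> energy p a b v" if "v \<in> lip_class R" for v
    unfolding I_def using bdd that by (intro cInf_lower) auto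
  have "\<exists>v\<in>lip_class R. energy p a b v < I + 1 / real (Suc n)" for n
    using cInf_lessD[of "energy p a b ` lip_class R" "I + 1 / real (Suc n)"] ne
        by (auto simp: I_def)
  then obtain v where v: "\<And>n. v n \<in> lip_class R" "\<And>n. energy p a b (v n) < I + 1 / real (Suc n)"
      by metis
  have "\<exists>g (k::nat \<Rightarrow> nat). strict_mono k \<and> (\<forall>e>0. \<exists>N. \<forall>n x. n \<ge> N \<and> x \<in> cball 0 R \<longrightarrow> norm (v (k n) x
      - g x) < e)"
  proof (rule Arzela_Ascoli[of "cball (0::real^2) R" v "2 * R\<^sup>2"])
    show "norm (v n x) \<le> 2 * R\<^sup>2" for n x
      using lip_class_bound[OF v(1), of n x] lip_classD(2)[OF v(1), of n x] by simp
    show "\<exists>d. 0 < d \<and> (\<forall>n y. y \<in> cball 0 R \<and> norm (x - y) < d \<longrightarrow> norm (v n x - v n y) < e)"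
        if "0 < e" for x :: "real^2" and e
    proof (intro exI[of _ "e / R"] conjI allI impI)
      fix n and y :: "real^2" assume "y \<in> cball 0 R \<and> norm (x - y) < e / R"
      then have "R * dist x y < e" using R by (simp add: dist_norm field_simps)
      then show "norm (v n x - v n y) < e" using lip_classD(1)[OF v(1), of n x y] by simp
    qed (use that R in auto)
  next
    fix g and k :: "nat \<Rightarrow> nat"
    assume k: "strict_mono k"
      and g: "\<And>e. 0 < e \<Longrightarrow> \<exists>N. \<forall>n x. n \<ge> N \<and> x \<in> cball 0 R \<longrightarrow> norm (v (k n) x - g x) < e"
    show "\<exists>g (k::nat \<Rightarrow> nat). strict_mono k \<and> (\<forall>e>0. \<exists>N. \<forall>n x. n \<ge> N \<and> x \<in> cball 0 R
        \<longrightarrow> norm (v (k n) x - g x) < e)"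
      using k g by (intro exI[of _ g] exI[of _ k]) simp
  qed simp
  then obtain g and k :: "nat \<Rightarrow> nat" where g: "strict_mono k" "\<And>e. e > 0 \<Longrightarrow> \<exists>N. \<forall>n x. n \<ge> N \<and> x
      \<in> cball 0 R \<longrightarrow> norm (v (k n) x - g x) < e"
    by blast
  \<comment> \<open>The uniform limit is known on the closed ball only; outside it all members
    vanish.\<close>
  define u where "u x = (if norm x \<le> R then g x else 0)" for x
  have lim: "(\<lambda>n. v (k n) x) \<longlonglongrightarrow> u x" for x
  proof (cases "norm x \<le> R")
    case True
    show ?thesis
    proof (rule LIMSEQ_I)
      fix e :: real assume "e > 0"
      from g(2)[OF this] True show "\<exists>no. \<forall>n\<ge>no. norm (v (k n) x - u x) < e" by (auto simp: u_def)
    qed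
  next
    case False
    then show ?thesis using lip_classD(3)[OF v(1)] by (simp add: u_def)
  qed
  have um: "u \<in> borel_measurable borel"
    by (rule borel_measurable_LIMSEQ_metric[OF lip_classD(6)[OF v(1)] lim])
  have volR: "(\<integral>\<^sup>+x. (if norm (x::real^2) < R then ennreal c else 0) \<partial>lborel) < \<infinity>" for c
  proof -
    have "(\<integral>\<^sup>+x. (if norm (x::real^2) < R then ennreal c else 0) \<partial>lborel)
        = (\<integral>\<^sup>+x. ennreal c * indicator (ball (0::real^2) R) x \<partial>lborel)"
      by (intro nn_integral_cong) (auto simp: indicator_def)
    also have "\<dots> = ennreal c * emeasure lborel (ball (0::real^2) R)"
      by (rule nn_integral_cmult_indicator) simp
    also have "\<dots> < \<infinity>" using emeasure_lborel_ball_finite[of "0::real^2" R]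
        by (simp add: ennreal_mult_less_top)
    finally show ?thesis .
  qed
  have limS: "(\<lambda>n. sqnorm (v (k n))) \<longlonglongrightarrow> sqnorm u"
    unfolding sqnorm_def
  proof (rule lip_class_bounded_convergence[OF v(1) lim, where F = "\<lambda>x t. (norm t)\<^sup>2"
      and W = "\<lambda>x. CQ"])
    show "(norm t)\<^sup>2 \<le> CQ" if "0 \<le> t" "t \<le> 2 * R\<^sup>2" for t :: real
      unfolding CQ_def using that by (intro power_mono) auto
    show "(\<integral>\<^sup>+x. (if norm (x::real^2) < R then ennreal CQ else 0) \<partial>lborel) < \<infinity>" by (rule volR)
  qed (auto intro!: continuous_intros)
  have limQ: "(\<lambda>n. quartic (v (k n))) \<longlonglongrightarrow> quartic u"
    unfolding quartic_def
  proof (rule lip_class_bounded_convergence[OF v(1) lim, where F = "\<lambda>x t. t ^ 4"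
      and W = "\<lambda>x. (2 * R\<^sup>2) ^ 4"])
    show "t ^ 4 \<le> (2 * R\<^sup>2) ^ 4" if "0 \<le> t" "t \<le> 2 * R\<^sup>2" for t :: real
      using that by (intro power_mono) auto
    show "(\<integral>\<^sup>+x. (if norm (x::real^2) < R then ennreal ((2 * R\<^sup>2) ^ 4) else 0) \<partial>lborel) < \<infinity>"
        by (rule volR)
  qed (auto intro!: continuous_intros)
  have limP: "(\<lambda>n. potential p (v (k n))) \<longlonglongrightarrow> potential p u"
    unfolding potential_def
  proof (rule lip_class_bounded_convergence[OF v(1) lim, where F = "\<lambda>x t. norm x powr (- p) * t\<^sup>2"
      and W = "\<lambda>x. norm x powr (- p) * (2 * R\<^sup>2)\<^sup>2"])
    have "(\<integral>\<^sup>+x. (if norm (x::real^2) < R then ennreal (norm x powr (- p) * (2 * R\<^sup>2)\<^sup>2) else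
        0) \<partial>lborel)
      = (\<integral>\<^sup>+x. ennreal ((2 * R\<^sup>2)\<^sup>2) * (if norm (x::real^2) < R then ennreal (norm x powr (- p))
          else 0) \<partial>lborel)"
      by (intro nn_integral_cong) (auto simp: ennreal_mult[symmetric] mult.commute simp del:
          power_mult_distrib)
    also have "\<dots> < \<infinity>"
      using nn_integral_powr_ball[of p R] p R by (subst nn_integral_cmult) (auto simp:
          ennreal_mult_less_top simp del: power_mult_distrib)
    finally show "(\<integral>\<^sup>+x. (if norm x < R then ennreal (norm (x::real^2) powr (- p) * (2 * R\<^sup>2)\<^sup>2)
        else 0) \<partial>lborel) < \<infinity>" .
    show "norm x powr (- p) * t\<^sup>2 \<le> norm x powr (- p) * (2 * R\<^sup>2)\<^sup>2" if "0 \<le> t" "t \<le> 2 * R\<^sup>2" for t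
        and x :: "real^2"
      using that by (intro mult_left_mono power_mono) auto
  qed (auto intro!: continuous_intros)
  have u: "u \<in> lip_class R"
    unfolding lip_class_def mem_Collect_eq
  proof (intro conjI allI impI)
    show "\<bar>u x - u y\<bar> \<le> R * dist x y" for x y
    proof (rule LIMSEQ_le_const2)
      show "(\<lambda>n. \<bar>v (k n) x - v (k n) y\<bar>) \<longlonglongrightarrow> \<bar>u x - u y\<bar>" by (intro tendsto_intros lim)
    qed (use lip_classD(1)[OF v(1)] in auto)
    show "u x \<ge> 0" for x by (rule LIMSEQ_le_const[OF lim]) (use lip_classD(2)[OF v(1)] in auto)
    show "u x = 0" if "norm x \<ge> R" for x
      using lim[of x] lip_classD(3)[OF v(1) that] by (simp add: LIMSEQ_const_iff)
    show "sqnorm u = 1" using limS lip_classD(4)[OF v(1)] by (simp add: LIMSEQ_const_iff)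
  qed
  have "energy p a b u \<le> I"
  proof (rule energy_lsc(2)[where v = "\<lambda>n. v (k n)" and e = "\<lambda>n. I + 1 / real (Suc (k n))"
      and K = "I + 1 + CP + a / 2 * CQ"])
    show "enn2real (dirichlet (v (k n))) \<le> I + 1 + CP + a / 2 * CQ" for n
    proof -
      have "1 / real (Suc (k n)) \<le> 1" by simp
      then show ?thesis using lower[OF v(1), of "k n"] v(2)[of "k n"] by linarith
    qed
    show "potential p u < \<infinity>" "quartic u < \<infinity>"
      using potential_lip_class_finite[OF u, of p] quartic_lip_class_finite[OF u] p
          by (auto simp: order_le_less_trans)
    have "(\<lambda>n. 1 / real (Suc (k n))) \<longlonglongrightarrow> 0"
      using LIMSEQ_subseq_LIMSEQ[OF LIMSEQ_Suc[OF lim_1_over_n] g(1)] by (simp add: o_def)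
    from tendsto_add[OF tendsto_const this, of I] show "(\<lambda>n. I + 1 / real (Suc (k n))) \<longlonglongrightarrow> I" by simp
    show "energy p a b (v (k n)) \<le> I + 1 / real (Suc (k n))" for n using v(2)[of "k n"] by simp
  qed (use um lip_classD(6)[OF v(1)] lim limP limQ b dirichlet_lip_class[OF v(1)] in auto)
  then show ?thesis using I u by (intro that[of u]) (auto intro: order_trans)
qed

text \<open>The strict inequality matches what polarization yields, since two points of equal norm
  have their bisector through the origin. For continuous functions radial symmetry off the origin
  follows, see \<open>radially_antitone_profile\<close>.\<close>

definition radially_antitone :: "(real^2 \<Rightarrow> real) \<Rightarrow> bool" where
  "radially_antitone u \<longleftrightarrow> (\<forall>x y. norm x < norm y \<longrightarrow> u y \<le> u x)"

text \<open>The bisector of \<open>x\<close> and \<open>y\<close> has the origin strictly on the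
  side of \<open>x\<close>. Polarizing in it does not raise the Dirichlet energy and keeps the
  quartic term, so minimality leaves no room for a larger \<open>potential\<close>, and
  \<open>polarize_potential_rigid\<close> applies.\<close>

lemma lip_class_minimizer_antitone:
  assumes u: "u \<in> lip_class R" and min: "\<And>v. v \<in> lip_class R \<Longrightarrow> energy p a b u \<le> energy p a b v"
    and p: "0 < p" "p < 2" and a: "a > 0" and b: "b > 0"
  shows "radially_antitone u"
  unfolding radially_antitone_def
proof (intro allI impI)
  fix x y :: "real^2" assume xy: "norm x < norm y"
  then have ne: "norm (y - x) > 0" by auto
  define e where "e = (1 / norm (y - x)) *\<^sub>R (y - x)"
  have e: "norm e = 1" using ne by (simp add: e_def)
  \<comment> \<open>Signed distance of the perpendicular bisector from the origin, positive because
    \<open>norm x < norm y\<close>.\<close>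
  define c where "c = ((norm y)\<^sup>2 - (norm x)\<^sup>2) / (2 * norm (y - x))"
  have c: "c > 0" using xy ne by (simp add: c_def power_strict_mono)
  have n2: "(norm (y - x))\<^sup>2 = (norm y)\<^sup>2 + (norm x)\<^sup>2 - 2 * (x \<bullet> y)"
    by (simp add: power2_norm_eq_inner inner_diff_left inner_diff_right inner_commute)
  have xe: "x \<bullet> e - c = - norm (y - x) / 2"
  proof -
    have "x \<bullet> e - c = (2 * (x \<bullet> (y - x)) - ((norm y)\<^sup>2 - (norm x)\<^sup>2)) / (2 * norm (y - x))"
      using ne unfolding e_def c_def inner_scaleR_right by (simp add: field_simps)
    also have "2 * (x \<bullet> (y - x)) - ((norm y)\<^sup>2 - (norm x)\<^sup>2) = - (norm (y - x))\<^sup>2"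
      unfolding n2 by (simp add: inner_diff_right power2_norm_eq_inner)
    also have "- (norm (y - x))\<^sup>2 / (2 * norm (y - x)) = - norm (y - x) / 2"
      using ne by (simp add: power2_eq_square)
    finally show ?thesis .
  qed
  have sx: "refl_hyp e c x = y" using ne by (simp add: refl_hyp_def xe) (simp add: e_def)
  have pol: "polarize e c u \<in> lip_class R" using polarize_lip_class[OF u e] c by simp
  have um: "u \<in> borel_measurable borel" by (rule lip_classD(6)[OF u])
  have D: "dirichlet (polarize e c u) \<le> dirichlet u"
    by (intro dirichlet_mono nl_energy_polarize um e)
  have D': "enn2real (dirichlet (polarize e c u)) \<le> enn2real (dirichlet u)"
    using enn2real_mono[OF D] dirichlet_lip_class[OF u] by simp
  have Q: "quartic (polarize e c u) = quartic u"
    unfolding quartic_def by (rule nn_integral_polarize[OF um _ e]) simp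
  have "enn2real (dirichlet (polarize e c u)) + b * (enn2real (dirichlet (polarize e c u)))\<^sup>2
      \<le> enn2real (dirichlet u) + b * (enn2real (dirichlet u))\<^sup>2"
    using b D' by (intro add_mono mult_left_mono power_mono) auto
  then have "enn2real (potential p (polarize e c u)) \<le> enn2real (potential p u)"
    using min[OF pol] unfolding energy_def Q by linarith
  moreover have "potential p u < \<infinity>" "potential p (polarize e c u) < \<infinity>"
    using potential_lip_class_finite[OF u, of p] potential_lip_class_finite[OF pol, of p] p
        by (auto simp: order_le_less_trans)
  ultimately have "potential p (polarize e c u) \<le> potential p u"
    by (metis ennreal_enn2real ennreal_leI infinity_ennreal_def)
  from polarize_potential_rigid[OF u e c p this, of x] show "u y \<le> u x"
    using xe ne sx by simp
qed

section \<open>Radial estimates\<close>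

definition profile :: "(real^2 \<Rightarrow> real) \<Rightarrow> real \<Rightarrow> real" where
  "profile u r = u (r *\<^sub>R axis 1 1)"

lemma radially_antitoneD: "radially_antitone u \<Longrightarrow> norm x < norm y \<Longrightarrow> u y \<le> u x"
  by (simp add: radially_antitone_def)

lemma profile_le: "radially_antitone u \<Longrightarrow> r \<ge> 0 \<Longrightarrow> norm x < r \<Longrightarrow> profile u r \<le> u x"
  unfolding profile_def by (rule radially_antitoneD) simp_all

lemma profile_ge: "radially_antitone u \<Longrightarrow> r \<ge> 0 \<Longrightarrow> r < norm x \<Longrightarrow> u x \<le> profile u r"
  unfolding profile_def by (rule radially_antitoneD) simp_all

text \<open>The 32 is the square root of \<open>4 ^ 4 * 4\<close>: the first factor comes from the
  scale \<open>4 * r\<close> of the energy, the second from the radius \<open>r / 2\<close> of one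
  of the two discs compared in \<open>profile_halving\<close>.\<close>

definition log_slope :: real where "log_slope = 32 * sqrt ball_moment / pi"

lemma log_slope_nonneg: "log_slope \<ge> 0"
  using ball_moment_pos by (simp add: log_slope_def)

text \<open>The drop between the radii \<open>r\<close> and \<open>2 * r\<close> is seen by the
  nonlocal energy at the single scale \<open>4 * r\<close>. The areas and the normalization both
  scale like \<open>r ^ 4\<close>, so the bound does not depend on \<open>r\<close>.\<close>

lemma profile_halving:
  assumes u: "radially_antitone u" and r: "r > 0" and A: "dirichlet u \<le> ennreal A" "A \<ge> 0"
  shows "profile u r \<le> profile u (2 * r) + log_slope * sqrt A"
proof (cases "profile u r \<ge> profile u (2 * r)")
  case True
  define d where "d = profile u r - profile u (2 * r)"
  have d: "d \<ge> 0" using True by (simp add: d_def)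
  \<comment> \<open>The disc \<open>?S\<close> lies between the circles of radius
    \<open>2 * r\<close> and \<open>3 * r\<close>, so its points are within \<open>4 * r\<close> of
    all points of \<open>?B\<close>.\<close>
  let ?B = "ball (0::real^2) r" and ?S = "ball ((5/2 * r) *\<^sub>R (axis 1 1 :: real^2)) (r / 2)"
  have [measurable]: "?B \<in> sets borel" "?S \<in> sets borel" by simp_all
  have eB: "emeasure lborel ?B = ennreal (pi * r\<^sup>2)" by (rule emeasure_ball_real2) (use r in simp)
  have eS: "emeasure lborel ?S = ennreal (pi * (r / 2)\<^sup>2)"
      by (rule emeasure_ball_real2) (use r in simp)
  have "(\<integral>\<^sup>+x. \<integral>\<^sup>+y. ennreal (d\<^sup>2) * indicator ?S y * indicator ?B x \<partial>lborel \<partial>lborel)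
      \<le> nl_energy (4 * r) u"
    unfolding nl_energy_def
  proof (intro nn_integral_mono)
    fix x y :: "real^2"
    show "ennreal (d\<^sup>2) * indicator ?S y * indicator ?B x \<le> (if dist x y < 4 * r then ennreal ((u x
        - u y)\<^sup>2) else 0)"
    proof (cases "x \<in> ?B \<and> y \<in> ?S")
      case xy: True
      define z where "z = (5/2 * r) *\<^sub>R (axis 1 1 :: real^2)"
      have nz: "norm z = 5/2 * r" using r by (simp add: z_def)
      have yz: "norm (y - z) < r / 2" using xy by (simp add: z_def dist_norm norm_minus_commute)
      have y: "2 * r < norm y" "norm y < 3 * r"
        using norm_triangle_ineq3[of y z] yz nz by linarith+
      have x: "norm x < r" using xy by simp
      have "dist x y < 4 * r" using norm_triangle_ineq4[of x y] x y unfolding dist_norm by linarith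
      moreover have "d \<le> u x - u y"
        using profile_le[OF u _ x] profile_ge[OF u _ y(1)] r by (simp add: d_def)
      then have "d\<^sup>2 \<le> (u x - u y)\<^sup>2" using d by (rule power_mono)
      ultimately show ?thesis using xy by (simp add: ennreal_leI)
    qed auto
  qed
  also have "\<dots> \<le> ennreal (ball_moment * (4 * r) ^ 4) * dirichlet u"
    by (rule nl_energy_le_dirichlet) (use r in simp)
  also have "\<dots> \<le> ennreal (ball_moment * (4 * r) ^ 4) * ennreal A"
    by (intro mult_left_mono A) simp
  also have "\<dots> = ennreal (ball_moment * (4 * r) ^ 4 * A)"
    using A ball_moment_pos r by (simp add: ennreal_mult)
  also have "(\<integral>\<^sup>+x. \<integral>\<^sup>+y. ennreal (d\<^sup>2) * indicator ?S y * indicator ?B x \<partial>lborel \<partial>lborel)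
      = ennreal (d\<^sup>2) * emeasure lborel ?S * emeasure lborel ?B"
  proof -
    have "(\<integral>\<^sup>+y. ennreal (d\<^sup>2) * indicator ?S y * indicator ?B x \<partial>lborel) = ennreal (d\<^sup>2) * emeasure
        lborel ?S * indicator ?B x" for x
      by (subst nn_integral_multc, measurable) (subst nn_integral_cmult_indicator, auto)
    then show ?thesis by (simp only:) (rule nn_integral_cmult_indicator; simp)
  qed
  also have "\<dots> = ennreal (d\<^sup>2 * (pi * (r / 2)\<^sup>2) * (pi * r\<^sup>2))"
    unfolding eB eS by (simp add: ennreal_mult)
  finally have "d\<^sup>2 * (pi * (r / 2)\<^sup>2) * (pi * r\<^sup>2) \<le> ball_moment * (4 * r) ^ 4 * A"
    using A ball_moment_pos r by (subst (asm) ennreal_le_iff) auto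
  then have "d\<^sup>2 * pi\<^sup>2 * r ^ 4 \<le> (1024 * ball_moment * A) * r ^ 4"
    by (simp add: power_divide power2_eq_square power4_eq_xxxx algebra_simps)
  then have "d\<^sup>2 * pi\<^sup>2 \<le> 1024 * ball_moment * A" using r by simp
  moreover have "(log_slope * sqrt A)\<^sup>2 = 1024 * ball_moment * A / pi\<^sup>2"
    using A ball_moment_pos by (simp add: log_slope_def power_mult_distrib power_divide)
  ultimately have "d\<^sup>2 \<le> (log_slope * sqrt A)\<^sup>2"
    by (simp add: pos_le_divide_eq)
  then have "d \<le> log_slope * sqrt A" by (rule power2_le_imp_le) (use log_slope_nonneg A in simp)
  then show ?thesis by (simp add: d_def)
next
  case False
  moreover have "log_slope * sqrt A \<ge> 0" using log_slope_nonneg A by simp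
  ultimately show ?thesis by linarith
qed

text \<open>The disc of radius \<open>r\<close> alone carries mass at least
  \<open>pi * r\<^sup>2\<close> times the square of the profile; the factor \<open>pi\<close> is
  given away.\<close>

lemma profile_decay:
  assumes u: "radially_antitone u" "\<And>x. u x \<ge> 0" and r: "r > 0" and m: "sqnorm u \<le> 1"
  shows "profile u r \<le> 1 / r"
proof -
  have f: "profile u r \<ge> 0" using u(2) by (simp add: profile_def)
  have "ennreal ((profile u r)\<^sup>2) * emeasure lborel (ball (0::real^2) r) = (\<integral>\<^sup>+x. ennreal ((profile
      u r)\<^sup>2) * indicator (ball (0::real^2) r) x \<partial>lborel)"
    by (rule nn_integral_cmult_indicator[symmetric]) simp
  also have "\<dots> \<le> sqnorm u"
    unfolding sqnorm_def
    by (intro nn_integral_mono) (use f r profile_le[OF u(1), of r] in \<open>auto simp: indicator_def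
        intro!: ennreal_leI power_mono\<close>)
  also have "\<dots> \<le> 1" by (rule m)
  finally have "ennreal ((profile u r)\<^sup>2 * (pi * r\<^sup>2)) \<le> 1"
    using r by (simp add: emeasure_ball_real2 ennreal_mult)
  then have "(profile u r)\<^sup>2 * (pi * r\<^sup>2) \<le> 1" by simp
  moreover have "(profile u r)\<^sup>2 * r\<^sup>2 * 1 \<le> (profile u r)\<^sup>2 * r\<^sup>2 * pi"
    using pi_gt3 by (intro mult_left_mono) auto
  ultimately have "(profile u r * r)\<^sup>2 \<le> 1\<^sup>2" by (simp add: power_mult_distrib mult_ac)
  then have "profile u r * r \<le> 1" by (rule power2_le_imp_le) simp
  then show ?thesis using r by (simp add: field_simps)
qed

text \<open>The 2 comes from taking the profile at half the radius, since \<open>profile_ge\<close>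
  compares strictly different norms only.\<close>

lemma radial_outer_bound:
  assumes u: "radially_antitone u" "\<And>x. u x \<ge> 0" and m: "sqnorm u \<le> 1" and x: "x \<noteq> 0"
  shows "u x \<le> 2 / norm x"
  using profile_ge[OF u(1), of "norm x / 2" x] profile_decay[OF u _ m, of "norm x / 2"] x by simp

text \<open>Collects the constants of \<open>radial_inner_bound\<close>: at most
  \<open>log 2 t + 2\<close> halvings are used, and \<open>ln t \<le> t powr s / s\<close>.\<close>

definition log_const :: "real \<Rightarrow> real" where "log_const s = log_slope * (2 + 1 / (s * ln 2))"

lemma log_const_nonneg: "s > 0 \<Longrightarrow> log_const s \<ge> 0"
  unfolding log_const_def by (intro mult_nonneg_nonneg log_slope_nonneg add_nonneg_nonneg) auto

text \<open>Iterating \<open>profile_halving\<close> gives logarithmic growth towards the origin. It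
  is weakened to an arbitrarily small power \<open>s\<close>, because powers are what
  \<open>powr_mass\<close> can integrate.\<close>

lemma radial_inner_bound:
  assumes u: "radially_antitone u" "\<And>x. u x \<ge> 0" and m: "sqnorm u \<le> 1"
      and A: "dirichlet u \<le> ennreal A" "A \<ge> 0"
    and s: "s > 0" and x: "x \<noteq> 0" "norm x < \<rho>"
  shows "u x \<le> (1 / \<rho> + log_const s * sqrt A) * (\<rho> / norm x) powr s"
proof -
  have \<rho>: "\<rho> > 0" using x by (meson norm_ge_zero order_le_less_trans)
  have iter: "profile u (\<rho> / 2 ^ k) \<le> profile u \<rho> + real k * (log_slope * sqrt A)" for k
  proof (induction k)
    case (Suc k)
    have "profile u (\<rho> / 2 ^ Suc k) \<le> profile u (2 * (\<rho> / 2 ^ Suc k)) + log_slope * sqrt A"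
      using \<rho> by (intro profile_halving u A) auto
    also have "2 * (\<rho> / 2 ^ Suc k) = \<rho> / 2 ^ k" by simp
    finally show ?case using Suc by (simp add: algebra_simps)
  qed simp
  define t where "t = \<rho> / norm x"
  have t: "t > 1" using x by (simp add: t_def)
  \<comment> \<open>One more halving than the rounded logarithm makes the final radius strictly
    smaller than \<open>norm x\<close>.\<close>
  define k where "k = nat \<lceil>log 2 t\<rceil> + 1"
  have l0: "log 2 t > 0" using t by simp
  have "log 2 t < real k" unfolding k_def using l0 by linarith
  then have "t < 2 powr real k" using t by (simp add: log_less_iff)
  then have "t < 2 ^ k" by (simp add: powr_realpow)
  then have "\<rho> / 2 ^ k < norm x" using x by (simp add: t_def field_simps)
  then have "u x \<le> profile u (\<rho> / 2 ^ k)" using \<rho> by (intro profile_ge u) auto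
  also have "\<dots> \<le> profile u \<rho> + real k * (log_slope * sqrt A)" by (rule iter)
  also have "\<dots> \<le> 1 / \<rho> + ((2 + 1 / (s * ln 2)) * t powr s) * (log_slope * sqrt A)"
  proof (intro add_mono mult_right_mono)
    show "profile u \<rho> \<le> 1 / \<rho>" by (rule profile_decay[OF u \<rho> m])
    have ts: "t powr s \<ge> 1" using t s by (intro ge_one_powr_ge_zero) auto
    have "real k \<le> log 2 t + 2" unfolding k_def using l0 by linarith
    also have "log 2 t = ln t / ln 2" by (simp add: log_def)
    also have "\<dots> \<le> (t powr s / s) / ln 2"
      using t s by (intro divide_right_mono ln_powr_bound) auto
    finally have "real k \<le> (t powr s / s) / ln 2 + 2" by simp
    also have "\<dots> \<le> (1 / (s * ln 2)) * t powr s + 2 * t powr s" using ts s by (simp add: field_simps)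
    finally show "real k \<le> (2 + 1 / (s * ln 2)) * t powr s" by (simp add: algebra_simps)
    show "log_slope * sqrt A \<ge> 0" using log_slope_nonneg A by simp
  qed
  also have "\<dots> = 1 / \<rho> + log_const s * sqrt A * t powr s" by (simp add: log_const_def)
  also have "\<dots> \<le> (1 / \<rho>) * t powr s + log_const s * sqrt A * t powr s"
  proof -
    have "t powr s \<ge> 1" using t s by (intro ge_one_powr_ge_zero) auto
    then have "(1 / \<rho>) * 1 \<le> (1 / \<rho>) * t powr s" using \<rho> by (intro mult_left_mono) auto
    then show ?thesis by simp
  qed
  also have "\<dots> = (1 / \<rho> + log_const s * sqrt A) * (\<rho> / norm x) powr s"
    by (simp add: t_def algebra_simps)
  finally show ?thesis .
qed

lemma nn_integral_split_inner_outer: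
  fixes F :: "real^2 \<Rightarrow> ennreal"
  assumes [measurable]: "u \<in> borel_measurable borel"
    and q: "q \<ge> 0" "q < 2" and \<rho>: "\<rho> > 0" and c: "c \<ge> 0" "d \<ge> 0"
    and inner: "\<And>x. x \<noteq> 0 \<Longrightarrow> norm x < \<rho> \<Longrightarrow> F x \<le> ennreal (c * norm x powr (- q))"
    and outer: "\<And>x. norm x \<ge> \<rho> \<Longrightarrow> F x \<le> ennreal (d * (u x)\<^sup>2)"
  shows "(\<integral>\<^sup>+x. F x \<partial>lborel) \<le> ennreal (c * (\<rho> powr (2 - q) * powr_mass q)) + ennreal d * sqnorm u"
proof -
  have "(\<integral>\<^sup>+x. F x \<partial>lborel) \<le> (\<integral>\<^sup>+x. ennreal c * (if norm x < \<rho> then ennreal (norm x powr (- q))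
      else 0) + ennreal d * ennreal ((norm (u x))\<^sup>2) \<partial>lborel)"
  proof (rule nn_integral_mono_AE)
    have "AE x in lborel. x \<noteq> (0::real^2)" by (rule AE_lborel_singleton)
    then show "AE x in lborel. F x \<le> ennreal c * (if norm x < \<rho> then ennreal (norm x powr (- q))
        else 0) + ennreal d * ennreal ((norm (u x))\<^sup>2)"
    proof eventually_elim
      case (elim x)
      show ?case
      proof (cases "norm x < \<rho>")
        case True
        have "F x \<le> ennreal c * ennreal (norm x powr (- q))"
          using inner[OF elim True] c by (simp add: ennreal_mult)
        then show ?thesis using True by (simp add: add_increasing2)
      next
        case False
        then have "F x \<le> ennreal d * ennreal ((norm (u x))\<^sup>2)" using outer[of x] c
            by (simp add: ennreal_mult)
        then show ?thesis using False by simp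
      qed
    qed
  qed
  also have "\<dots> = ennreal c * (\<integral>\<^sup>+x. (if norm x < \<rho> then ennreal (norm (x::real^2) powr (- q)) else
      0) \<partial>lborel) + ennreal d * sqnorm u"
    unfolding sqnorm_def by (subst nn_integral_add) (auto simp: nn_integral_cmult)
  also have "\<dots> = ennreal (c * (\<rho> powr (2 - q) * powr_mass q)) + ennreal d * sqnorm u"
    using c powr_mass_nonneg[of q] by (simp add: nn_integral_powr_ball[OF q \<rho>] ennreal_mult)
  finally show ?thesis .
qed

lemma fourth_power_sum_le: "(x + y) ^ 4 \<le> 8 * (x ^ 4 + y ^ 4)" for x y :: real
proof -
  have sq: "(x + y)\<^sup>2 \<le> 2 * (x\<^sup>2 + y\<^sup>2)" for x y :: real
    using zero_le_power2[of "x - y"] by (simp add: power2_eq_square algebra_simps)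
  have "((x + y)\<^sup>2)\<^sup>2 \<le> (2 * (x\<^sup>2 + y\<^sup>2))\<^sup>2" by (intro power_mono sq) simp
  also have "\<dots> = 4 * (x\<^sup>2 + y\<^sup>2)\<^sup>2" by (simp only: power_mult_distrib) simp
  also have "\<dots> \<le> 4 * (2 * ((x\<^sup>2)\<^sup>2 + (y\<^sup>2)\<^sup>2))" by (intro mult_left_mono sq) simp
  finally show ?thesis by (simp add: power_mult[symmetric])
qed

text \<open>What matters is the explicit \<open>\<rho>\<close>: the coefficient of
  \<open>A\<^sup>2\<close> carries the factor \<open>\<rho>\<^sup>2\<close>, while outside the disc
  the bound \<open>2 / \<rho>\<close> on the function costs only a constant.\<close>

lemma quartic_radial_bound:
  assumes u: "radially_antitone u" "\<And>x. u x \<ge> 0" "u \<in> borel_measurable borel" and m: "sqnorm u \<le> 1"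
      and A: "dirichlet u \<le> ennreal A" "A \<ge> 0"
    and s: "s > 0" "4 * s < 2" and \<rho>: "\<rho> > 0"
  shows "quartic u \<le> ennreal (8 * (1 / \<rho> ^ 4 + log_const s ^ 4 * A\<^sup>2) * \<rho>\<^sup>2 * powr_mass (4 * s)
      + (2 / \<rho>)\<^sup>2)"
proof -
  let ?\<alpha> = "1 / \<rho> + log_const s * sqrt A"
  have \<alpha>: "?\<alpha> \<ge> 0" using \<rho> log_const_nonneg[OF s(1)] A by simp
  have "quartic u \<le> ennreal ((?\<alpha> ^ 4 * \<rho> powr (4 * s)) * (\<rho> powr (2 - 4 * s) * powr_mass (4 * s)))
      + ennreal ((2 / \<rho>)\<^sup>2) * sqnorm u"
    unfolding quartic_def
  proof (rule nn_integral_split_inner_outer[OF u(3)])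
    fix x :: "real^2" assume x: "x \<noteq> 0" "norm x < \<rho>"
    have "(u x) ^ 4 \<le> (?\<alpha> * (\<rho> / norm x) powr s) ^ 4"
      by (intro power_mono radial_inner_bound[OF u(1,2) m A s(1) x] u)
    also have "\<dots> = ?\<alpha> ^ 4 * (\<rho> / norm x) powr (4 * s)"
      using powr_realpow[of "(\<rho> / norm x) powr s" 4] x \<rho>
          by (simp add: power_mult_distrib powr_powr mult.commute)
    also have "(\<rho> / norm x) powr (4 * s) = \<rho> powr (4 * s) * norm x powr (- (4 * s))"
      using \<rho> by (simp add: powr_divide powr_minus_divide)
    finally show "ennreal ((u x) ^ 4) \<le> ennreal (?\<alpha> ^ 4 * \<rho> powr (4 * s) * norm x powr (- (4 * s)))"
      by (intro ennreal_leI) (simp add: mult.assoc)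
  next
    fix x :: "real^2" assume x: "norm x \<ge> \<rho>"
    then have "x \<noteq> 0" using \<rho> by auto
    have "u x \<le> 2 / norm x" by (rule radial_outer_bound[OF u(1,2) m \<open>x \<noteq> 0\<close>])
    also have "\<dots> \<le> 2 / \<rho>" using x \<rho> by (intro divide_left_mono mult_pos_pos) auto
    finally have "(u x)\<^sup>2 \<le> (2 / \<rho>)\<^sup>2" by (intro power_mono u)
    then have "(u x)\<^sup>2 * (u x)\<^sup>2 \<le> (2 / \<rho>)\<^sup>2 * (u x)\<^sup>2" by (rule mult_right_mono) simp
    then show "ennreal ((u x) ^ 4) \<le> ennreal ((2 / \<rho>)\<^sup>2 * (u x)\<^sup>2)"
      by (intro ennreal_leI) (simp add: power_add[symmetric])
  qed (use s \<rho> \<alpha> in auto)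
  also have "\<dots> \<le> ennreal ((?\<alpha> ^ 4 * \<rho> powr (4 * s)) * (\<rho> powr (2 - 4 * s) * powr_mass (4 * s)))
      + ennreal ((2 / \<rho>)\<^sup>2) * 1"
    by (intro add_left_mono mult_left_mono m) simp
  also have "\<dots> = ennreal ((?\<alpha> ^ 4 * \<rho> powr (4 * s)) * (\<rho> powr (2 - 4 * s) * powr_mass (4 * s))
      + (2 / \<rho>)\<^sup>2)"
    using powr_mass_nonneg[of "4 * s"] \<alpha> by (simp add: ennreal_plus)
  also have "\<dots> \<le> ennreal (8 * (1 / \<rho> ^ 4 + log_const s ^ 4 * A\<^sup>2) * \<rho>\<^sup>2 * powr_mass (4 * s)
      + (2 / \<rho>)\<^sup>2)"
  proof (intro ennreal_leI add_right_mono)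
    \<comment> \<open>The auxiliary exponent \<open>s\<close> drops out of the power of
      \<open>\<rho>\<close>.\<close>
    have "\<rho> powr (4 * s) * \<rho> powr (2 - 4 * s) = \<rho>\<^sup>2"
      using powr_add[of \<rho> "4 * s" "2 - 4 * s"] \<rho> by simp
    then have eq: "(?\<alpha> ^ 4 * \<rho> powr (4 * s)) * (\<rho> powr (2 - 4 * s) * powr_mass (4 * s))
        = ?\<alpha> ^ 4 * (\<rho>\<^sup>2 * powr_mass (4 * s))"
      by (metis mult.assoc)
    have "sqrt A ^ 4 = A\<^sup>2" using A by (simp add: power4_eq_xxxx power2_eq_square)
    then have "?\<alpha> ^ 4 \<le> 8 * (1 / \<rho> ^ 4 + log_const s ^ 4 * A\<^sup>2)"
      using fourth_power_sum_le[of "1 / \<rho>" "log_const s * sqrt A"]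
          by (simp add: power_mult_distrib power_divide)
    then show "(?\<alpha> ^ 4 * \<rho> powr (4 * s)) * (\<rho> powr (2 - 4 * s) * powr_mass (4 * s)) \<le> 8 * (1 / \<rho> ^ 4
        + log_const s ^ 4 * A\<^sup>2) * \<rho>\<^sup>2 * powr_mass (4 * s)"
      unfolding eq using powr_mass_nonneg[of "4 * s"]
          by (subst mult.assoc[of _ "\<rho>\<^sup>2"]) (intro mult_right_mono, auto)
  qed
  finally show ?thesis .
qed

text \<open>The bound is linear in \<open>A\<close>, so the Kirchhoff term dominates it whatever the
  splitting radius. Radius 1 makes the weight at most 1 outside.\<close>

lemma potential_radial_bound:
  assumes u: "radially_antitone u" "\<And>x. u x \<ge> 0" "u \<in> borel_measurable borel" and m: "sqnorm u \<le> 1"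
      and A: "dirichlet u \<le> ennreal A" "A \<ge> 0"
    and s: "s > 0" "p + 2 * s < 2" and p: "p > 0"
  shows "potential p u \<le> ennreal (2 * (1 + log_const s ^ 2 * A) * powr_mass (p + 2 * s) + 1)"
proof -
  let ?\<alpha> = "1 / 1 + log_const s * sqrt A"
  have \<alpha>: "?\<alpha> \<ge> 0" using log_const_nonneg[OF s(1)] A by simp
  have "potential p u \<le> ennreal (?\<alpha>\<^sup>2 * (1 powr (2 - (p + 2 * s)) * powr_mass (p + 2 * s)))
      + ennreal 1 * sqnorm u"
    unfolding potential_def
  proof (rule nn_integral_split_inner_outer[OF u(3)])
    fix x :: "real^2" assume x: "x \<noteq> 0" "norm x < 1"
    have "(u x)\<^sup>2 \<le> (?\<alpha> * (1 / norm x) powr s)\<^sup>2"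
      by (intro power_mono radial_inner_bound[OF u(1,2) m A s(1) x] u)
    also have "\<dots> = ?\<alpha>\<^sup>2 * (1 / norm x) powr (2 * s)"
      using powr_realpow[of "(1 / norm x) powr s" 2] x
          by (simp add: power_mult_distrib powr_powr mult.commute)
    also have "(1 / norm x) powr (2 * s) = norm x powr (- (2 * s))"
      by (simp add: powr_divide powr_minus_divide)
    finally have "norm x powr (- p) * (u x)\<^sup>2 \<le> norm x powr (- p) * (?\<alpha>\<^sup>2 * norm x powr (- (2 *
        s)))"
      by (rule mult_left_mono) simp
    also have "\<dots> = ?\<alpha>\<^sup>2 * norm x powr (- (p + 2 * s))"
      by (simp add: powr_add[symmetric] minus_add_distrib)
    finally show "ennreal (norm x powr (- p) * (u x)\<^sup>2) \<le> ennreal (?\<alpha>\<^sup>2 * norm x powr (- (p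
        + 2 * s)))"
      by (rule ennreal_leI)
  next
    fix x :: "real^2" assume x: "norm x \<ge> 1"
    have "norm x powr (- p) \<le> 1 powr (- p)" using x p by (intro powr_mono2') auto
    then have "norm x powr (- p) * (u x)\<^sup>2 \<le> 1 * (u x)\<^sup>2" by (intro mult_right_mono) auto
    then show "ennreal (norm x powr (- p) * (u x)\<^sup>2) \<le> ennreal (1 * (u x)\<^sup>2)" by (rule ennreal_leI)
  qed (use s p in auto)
  also have "\<dots> \<le> ennreal (?\<alpha>\<^sup>2 * powr_mass (p + 2 * s)) + ennreal 1 * 1"
    by (intro add_mono mult_left_mono m) auto
  also have "\<dots> = ennreal (?\<alpha>\<^sup>2 * powr_mass (p + 2 * s) + 1)"
    using powr_mass_nonneg[of "p + 2 * s"] by (subst ennreal_plus) auto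
  also have "\<dots> \<le> ennreal (2 * (1 + log_const s ^ 2 * A) * powr_mass (p + 2 * s) + 1)"
  proof (intro ennreal_leI add_right_mono mult_right_mono powr_mass_nonneg)
    have sq: "(x + y)\<^sup>2 \<le> 2 * (x\<^sup>2 + y\<^sup>2)" for x y :: real
      using zero_le_power2[of "x - y"] by (simp add: power2_eq_square algebra_simps)
    show "?\<alpha>\<^sup>2 \<le> 2 * (1 + log_const s ^ 2 * A)"
      using sq[of 1 "log_const s * sqrt A"] A by (simp add: power_mult_distrib)
  qed
  finally show ?thesis .
qed

text \<open>The quartic term has the same order \<open>A\<^sup>2\<close> as the Kirchhoff term, but its coefficient can
  be made small by choosing the splitting radius small.\<close>
lemma radial_coercivity:
  assumes p: "0 < p" "p < 2" and a: "a > 0" and b: "b > 0"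
  obtains K where "\<And>u. radially_antitone u \<Longrightarrow> (\<And>x. u x \<ge> 0) \<Longrightarrow> u \<in> borel_measurable borel \<Longrightarrow> sqnorm u
      \<le> 1
    \<Longrightarrow> dirichlet u < \<infinity> \<Longrightarrow> energy p a b u \<le> 0 \<Longrightarrow> enn2real (dirichlet u) \<le> K"
proof -
  \<comment> \<open>Small enough that the powers \<open>- (4 * s)\<close> and
    \<open>- (p + 2 * s)\<close> of the norm are both integrable near the origin.\<close>
  define s where "s = min (1/4) ((2 - p) / 4)"
  have s: "s > 0" "4 * s < 2" "p + 2 * s < 2" using p by (auto simp: s_def min_def field_simps)
  define L where "L = log_const s"
  define J where "J = powr_mass (4 * s)"
  define J' where "J' = powr_mass (p + 2 * s)"
  have nn: "L \<ge> 0" "J \<ge> 0" "J' \<ge> 0" using log_const_nonneg[OF s(1)] powr_mass_nonneg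
      by (simp_all add: L_def J_def J'_def)
  \<comment> \<open>Chosen so that the coefficient \<open>4 * a * L ^ 4 * J * \<rho>\<^sup>2\<close>
    of \<open>A\<^sup>2\<close> coming from the quartic term is at most \<open>b / 2\<close>; the 1
    keeps the denominator positive.\<close>
  define \<rho> where "\<rho> = sqrt (b / (8 * a * L ^ 4 * J + 1))"
  have den: "8 * a * L ^ 4 * J + 1 > 0" using a nn by (intro add_nonneg_pos mult_nonneg_nonneg) auto
  have \<rho>: "\<rho> > 0" using den b by (simp add: \<rho>_def)
  have \<rho>2: "\<rho>\<^sup>2 = b / (8 * a * L ^ 4 * J + 1)" using den b by (simp add: \<rho>_def)
  have small: "4 * a * L ^ 4 * J * \<rho>\<^sup>2 \<le> b / 2"
    unfolding \<rho>2 using den b a nn by (simp add: field_simps)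
  define c2 where "c2 = 2 * J' + 1 + a / 2 * (8 * (1 / \<rho> ^ 4) * \<rho>\<^sup>2 * J + (2 / \<rho>)\<^sup>2)"
  define c3 where "c3 = 2 * L\<^sup>2 * J'"
  have c: "c2 \<ge> 0" "c3 \<ge> 0" using nn a \<rho> by (auto simp: c2_def c3_def intro!: add_nonneg_nonneg
      mult_nonneg_nonneg)
  show ?thesis
  \<comment> \<open>For \<open>A > 1\<close> the constant \<open>c2\<close> is absorbed into the
    linear term; the 1 in the maximum covers the remaining case.\<close>
  proof (rule that[of "max 1 (2 * (c2 + c3) / b)"])
    fix u assume u: "radially_antitone u" "\<And>x. u x \<ge> 0" "u \<in> borel_measurable borel"
        and m: "sqnorm u \<le> 1"
      and D: "dirichlet u < \<infinity>" and E: "energy p a b u \<le> 0"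
    define A where "A = enn2real (dirichlet u)"
    have A: "dirichlet u \<le> ennreal A" "A \<ge> 0" using D by (simp_all add: A_def)
    have Q: "enn2real (quartic u) \<le> 8 * (1 / \<rho> ^ 4 + L ^ 4 * A\<^sup>2) * \<rho>\<^sup>2 * J + (2 / \<rho>)\<^sup>2"
      using quartic_radial_bound[OF u m A s(1,2) \<rho>] nn \<rho> unfolding L_def[symmetric] J_def[symmetric]
      by (intro enn2real_leI) auto
    have P: "enn2real (potential p u) \<le> 2 * (1 + L\<^sup>2 * A) * J' + 1"
      using potential_radial_bound[OF u m A s(1,3) p(1)] nn A(2)
          unfolding L_def[symmetric] J'_def[symmetric]
      by (intro enn2real_leI) auto
    have "A + b * A\<^sup>2 \<le> enn2real (potential p u) + a / 2 * enn2real (quartic u)"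
      using E by (simp add: energy_def A_def)
    also have "\<dots> \<le> (2 * (1 + L\<^sup>2 * A) * J' + 1) + a / 2 * (8 * (1 / \<rho> ^ 4 + L ^ 4 * A\<^sup>2) * \<rho>\<^sup>2 * J
        + (2 / \<rho>)\<^sup>2)"
      using P Q a by (intro add_mono mult_left_mono) auto
    also have "\<dots> = c2 + c3 * A + (4 * a * L ^ 4 * J * \<rho>\<^sup>2) * A\<^sup>2"
      by (simp add: c2_def c3_def algebra_simps)
    also have "\<dots> \<le> c2 + c3 * A + b / 2 * A\<^sup>2"
      by (intro add_left_mono mult_right_mono small) simp
    finally have "b / 2 * A\<^sup>2 \<le> c2 + c3 * A" using A by simp
    show "enn2real (dirichlet u) \<le> max 1 (2 * (c2 + c3) / b)"
    proof (cases "A \<le> 1")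
      case False
      have "b / 2 * A\<^sup>2 \<le> c2 * A + c3 * A"
        using \<open>b / 2 * A\<^sup>2 \<le> c2 + c3 * A\<close> mult_left_mono[of 1 A c2] False c by simp
      then have "(b / 2 * A) * A \<le> (c2 + c3) * A" by (simp add: power2_eq_square algebra_simps)
      then have "b / 2 * A \<le> c2 + c3" using False by (simp add: mult_le_cancel_right)
      then have "A \<le> 2 * (c2 + c3) / b" using b by (simp add: field_simps)
      then show ?thesis by (simp add: A_def)
    qed (simp add: A_def)
  qed
qed

section \<open>Dilation and density\<close>

lemma sqnorm_dilate:
  fixes u :: "real^2 \<Rightarrow> real"
  assumes [measurable]: "u \<in> borel_measurable borel" and s: "s > 0"
  shows "sqnorm (\<lambda>x. u ((1/s) *\<^sub>R x)) = ennreal (s\<^sup>2) * sqnorm u"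
proof -
  have "sqnorm (\<lambda>x. u ((1/s) *\<^sub>R x)) = ennreal (s ^ DIM(real^2)) * (\<integral>\<^sup>+x. ennreal ((norm (u ((1/s)
      *\<^sub>R (s *\<^sub>R x))))\<^sup>2) \<partial>lborel)"
    unfolding sqnorm_def by (rule nn_integral_lborel_scale[OF _ s]) measurable
  then show ?thesis using s by (simp add: sqnorm_def)
qed

lemma quartic_dilate:
  assumes [measurable]: "u \<in> borel_measurable borel" and s: "s > 0"
  shows "quartic (\<lambda>x. u ((1/s) *\<^sub>R x)) = ennreal (s\<^sup>2) * quartic u"
proof -
  have "quartic (\<lambda>x. u ((1/s) *\<^sub>R x)) = ennreal (s ^ DIM(real^2)) * (\<integral>\<^sup>+x. ennreal ((u ((1/s) *\<^sub>R (s
      *\<^sub>R x))) ^ 4) \<partial>lborel)"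
    unfolding quartic_def by (rule nn_integral_lborel_scale[OF _ s]) measurable
  then show ?thesis using s by (simp add: quartic_def)
qed

lemma potential_dilate:
  assumes [measurable]: "u \<in> borel_measurable borel" and s: "s > 0"
  shows "potential p (\<lambda>x. u ((1/s) *\<^sub>R x)) = ennreal (s powr (2 - p)) * potential p u"
proof -
  have "potential p (\<lambda>x. u ((1/s) *\<^sub>R x)) = ennreal (s ^ DIM(real^2)) * (\<integral>\<^sup>+x. ennreal (norm (s *\<^sub>R
      x) powr (- p) * (u ((1/s) *\<^sub>R (s *\<^sub>R x)))\<^sup>2) \<partial>lborel)"
    unfolding potential_def by (rule nn_integral_lborel_scale[OF _ s]) measurable
  also have "(\<integral>\<^sup>+x. ennreal (norm (s *\<^sub>R x) powr (- p) * (u ((1/s) *\<^sub>R (s *\<^sub>R x)))\<^sup>2) \<partial>lborel)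
      = ennreal (s powr (- p)) * potential p u"
    unfolding potential_def using s by (subst nn_integral_cmult[symmetric]) (auto simp: powr_mult
        ennreal_mult[symmetric] mult_ac)
  also have "ennreal (s ^ DIM(real^2)) * (ennreal (s powr (- p)) * potential p u)
      = ennreal (s\<^sup>2 * s powr (- p)) * potential p u"
    using s by (simp add: ennreal_mult mult.assoc)
  also have "s\<^sup>2 * s powr (- p) = s powr (2 - p)" using powr_add[of s 2 "- p"] s by simp
  finally show ?thesis .
qed

text \<open>In the plane dilations leave the Dirichlet energy unchanged, so missing mass can be
  restored at no cost.\<close>
lemma normalize_by_dilation:
  assumes m: "u \<in> borel_measurable borel" and u: "0 < sqnorm u" "sqnorm u \<le> 1"
      and D: "dirichlet u < \<infinity>"
    and PQ: "potential p u < \<infinity>" "quartic u < \<infinity>" and p: "p < 2" and a: "a \<ge> 0" and b: "b \<ge> 0"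
  obtains s where "s \<ge> 1" "sqnorm (\<lambda>x. u ((1/s) *\<^sub>R x)) = 1" "energy p a b (\<lambda>x. u ((1/s) *\<^sub>R x))
      \<le> energy p a b u"
    "dirichlet (\<lambda>x. u ((1/s) *\<^sub>R x)) < \<infinity>"
proof -
  obtain r where r: "sqnorm u = ennreal r" "r \<ge> 0" using u(2)
      by (cases "sqnorm u") (auto simp: top_unique)
  have r1: "0 < r" "r \<le> 1" using u r by (simp_all add: ennreal_le_1)
  \<comment> \<open>Dilation by \<open>s\<close> multiplies the mass by \<open>s\<^sup>2\<close>, so
    this brings it from \<open>r\<close> to 1. Since \<open>r \<le> 1\<close> the factor is at least
    1, which makes both attractive terms grow.\<close>
  define s where "s = 1 / sqrt r"
  have s: "s \<ge> 1" "s > 0" using r1 by (simp_all add: s_def)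
  let ?v = "\<lambda>x. u ((1/s) *\<^sub>R x)"
  have "sqnorm ?v = ennreal (s\<^sup>2) * ennreal r" by (simp only: sqnorm_dilate[OF m s(2)] r)
  also have "\<dots> = 1" using r1 by (simp add: ennreal_mult[symmetric] s_def power_divide)
  finally have 1: "sqnorm ?v = 1" .
  have Dle: "dirichlet ?v \<le> dirichlet u" by (rule dirichlet_dilate_le[OF m s(2)])
  have D': "enn2real (dirichlet ?v) \<le> enn2real (dirichlet u)" using enn2real_mono[OF Dle] D by simp
  have "enn2real (dirichlet ?v) + b * (enn2real (dirichlet ?v))\<^sup>2 \<le> enn2real (dirichlet u)
      + b * (enn2real (dirichlet u))\<^sup>2"
    using b D' by (intro add_mono mult_left_mono power_mono) auto
  moreover have "enn2real (potential p u) \<le> enn2real (potential p ?v)"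
  proof -
    have "1 \<le> s powr (2 - p)" using s p by (intro ge_one_powr_ge_zero) auto
    then have "1 * enn2real (potential p u) \<le> s powr (2 - p) * enn2real (potential p u)"
        by (intro mult_right_mono) auto
    then show ?thesis by (simp add: potential_dilate[OF m s(2)] enn2real_mult)
  qed
  moreover have "enn2real (quartic u) \<le> enn2real (quartic ?v)"
  proof -
    have "1 \<le> s\<^sup>2" using s by (intro one_le_power)
    then have "1 * enn2real (quartic u) \<le> s\<^sup>2 * enn2real (quartic u)"
        by (intro mult_right_mono) auto
    then show ?thesis by (simp add: quartic_dilate[OF m s(2)] enn2real_mult)
  qed
  then have "a / 2 * enn2real (quartic u) \<le> a / 2 * enn2real (quartic ?v)" using a
      by (intro mult_left_mono) auto
  ultimately have "energy p a b ?v \<le> energy p a b u" unfolding energy_def by linarith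
  with 1 s Dle D show ?thesis by (intro that[of s]) (auto simp: order_le_less_trans)
qed

lemma lip_class_mono: "u \<in> lip_class R \<Longrightarrow> R \<le> R' \<Longrightarrow> u \<in> lip_class R'"
  unfolding lip_class_def by (auto intro: order_trans[OF _ mult_right_mono[OF _ zero_le_dist]])

lemma lip_classI:
  assumes "\<And>x y. \<bar>u x - u y\<bar> \<le> L * dist x y" "\<And>x. u x \<ge> 0" "\<And>x. norm x \<ge> R \<Longrightarrow> u x = 0" "sqnorm u = 1"
  shows "u \<in> lip_class (max L R)"
  using assms unfolding lip_class_def by (auto intro: order_trans[OF _ mult_right_mono[OF
      max.cobounded1 zero_le_dist]])

lemma test_function_lipschitz:
  fixes \<rho> :: "'a::euclidean_space \<Rightarrow> real"
  assumes \<rho>: "test_function \<rho>"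
  obtains L where "L \<ge> 0" "\<And>x y. \<bar>\<rho> x - \<rho> y\<bar> \<le> L * dist x y"
proof -
  obtain R where R: "\<And>x v. norm x \<ge> R \<Longrightarrow> frechet_derivative \<rho> (at x) v = 0"
    using test_function_support[OF \<rho>] by metis
  have "\<exists>D\<ge>0. \<forall>x. \<bar>frechet_derivative \<rho> (at x) i\<bar> \<le> D" for i
    using compact_support_bounded[OF test_function_derivative_continuous[OF \<rho>], of R i] R
        by (metis less_imp_le)
  then obtain D where D: "\<And>i. D i \<ge> 0" "\<And>i x. \<bar>frechet_derivative \<rho> (at x) i\<bar> \<le> D i" by metis
  define L where "L = (\<Sum>i\<in>Basis. D (i::'a))"
  have bnd: "norm (frechet_derivative \<rho> (at x) v) \<le> L * norm v" for x v
  proof -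
    have "\<bar>frechet_derivative \<rho> (at x) v\<bar> \<le> (\<Sum>i\<in>Basis. \<bar>(v \<bullet> i) * frechet_derivative \<rho> (at x) i\<bar>)"
      by (subst frechet_derivative_expand[OF \<rho>]) (rule sum_abs)
    also have "\<dots> \<le> (\<Sum>i\<in>Basis. norm v * D i)"
      by (intro sum_mono) (auto simp: abs_mult intro!: mult_mono D Basis_le_norm)
    finally show ?thesis by (simp add: L_def sum_distrib_left mult.commute)
  qed
  have "norm (\<rho> x - \<rho> y) \<le> L * norm (x - y)" for x y
  proof (rule differentiable_bound[of UNIV])
    show "(\<rho> has_derivative frechet_derivative \<rho> (at x)) (at x within UNIV)" for x
      using test_function_has_derivative[OF \<rho>] by simp
    show "onorm (frechet_derivative \<rho> (at x)) \<le> L" for x by (rule onorm_le[OF bnd])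
  qed auto
  then show ?thesis using D(1) by (intro that[of L]) (auto simp: L_def dist_norm sum_nonneg)
qed

text \<open>The increment of the kernel is at most \<open>M * dist x y\<close> and supported in two
  balls of fixed radius, on which the integral of \<open>\<bar>u\<bar>\<close> is bounded, uniformly
  in the centre, by square norm plus volume.\<close>

lemma conv_lipschitz:
  fixes u :: "'a::euclidean_space \<Rightarrow> real"
  assumes [measurable]: "u \<in> borel_measurable borel" and u: "sqnorm u < \<infinity>" and \<rho>: "test_function \<rho>"
  obtains L where "\<And>x y. \<bar>conv u \<rho> x - conv u \<rho> y\<bar> \<le> L * dist x y"
proof -
  note [measurable] = test_function_measurable[OF \<rho>]
  obtain M where M: "M \<ge> 0" "\<And>x y. \<bar>\<rho> x - \<rho> y\<bar> \<le> M * dist x y" using test_function_lipschitz[OF \<rho>]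
      by metis
  obtain R where R: "\<And>x. norm x \<ge> R \<Longrightarrow> \<rho> x = 0" using test_function_support[OF \<rho>] by metis
  define I where "I = (\<integral>z. (norm (u z))\<^sup>2 \<partial>lborel) + measure lborel (cball (0::'a) R)"
  have Iu: "integrable lborel (\<lambda>z. (norm (u z))\<^sup>2)" by (rule integrable_sqnorm[OF assms(1) u])
  have i0: "integrable lborel (\<lambda>z. \<bar>u z\<bar> * indicator (cball x R) z)" for x :: 'a
  proof (rule integrable_times_bounded_support[where C = 1 and R = "R + norm x + 1"])
    fix y :: 'a assume "R + norm x + 1 \<le> norm y"
    then have "dist x y > R" using norm_triangle_ineq2[of y x]
        by (simp add: dist_norm norm_minus_commute)
    then show "indicator (cball x R) y = (0::real)" by simp
  qed (use u in \<open>auto simp: sqnorm_def indicator_def\<close>)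
  have bI: "(\<integral>z. \<bar>u z\<bar> * indicator (cball x R) z \<partial>lborel) \<le> I" for x
  proof -
    have ic: "integrable lborel (indicator (cball x R) :: 'a \<Rightarrow> real)"
      using emeasure_lborel_cball_finite[of x R] by (simp add: integrable_indicator_iff)
    have "(\<integral>z. \<bar>u z\<bar> * indicator (cball x R) z \<partial>lborel) \<le> (\<integral>z. (norm (u z))\<^sup>2
        + indicator (cball x R) z \<partial>lborel)"
    proof (rule integral_mono[OF i0])
      fix z
      have "\<bar>u z\<bar> \<le> (u z)\<^sup>2 + 1"
        using zero_le_power2[of "\<bar>u z\<bar> - 1"] zero_le_power2[of "u z"] unfolding power2_diff by simp
      then show "\<bar>u z\<bar> * indicator (cball x R) z \<le> (norm (u z))\<^sup>2 + indicator (cball x R) z"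
        by (auto simp: indicator_def)
    qed (use Iu ic in auto)
    also have "\<dots> = (\<integral>z. (norm (u z))\<^sup>2 \<partial>lborel) + measure lborel (cball x R)" using Iu ic by simp
    also have "measure lborel (cball x R) = measure lborel (cball (0::'a) R)"
    proof -
      have "emeasure lborel (cball x R) = (\<integral>\<^sup>+z. indicator (cball x R) z \<partial>lborel)" by simp
      also have "\<dots> = (\<integral>\<^sup>+z. indicator (cball 0 R) (z + - x) \<partial>lborel)"
        by (intro nn_integral_cong) (simp add: indicator_def dist_norm norm_minus_commute)
      also have "\<dots> = (\<integral>\<^sup>+z. indicator (cball (0::'a) R) z \<partial>lborel)"
        by (rule nn_integral_lborel_translate, rule borel_measurable_indicator) simp
      finally show ?thesis by (simp add: measure_def)
    qed
    finally show ?thesis by (simp add: I_def)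
  qed
  have "\<bar>conv u \<rho> x - conv u \<rho> y\<bar> \<le> (2 * M * I) * dist x y" for x y
  proof -
    have cx: "integrable lborel (\<lambda>z. u z * \<rho> (x - z))" for x
      by (rule integrable_conv'[OF assms(1) u test_function_continuous[OF \<rho>] R])
    have "conv u \<rho> x - conv u \<rho> y = (\<integral>z. u z * (\<rho> (x - z) - \<rho> (y - z)) \<partial>lborel)"
      using cx[of x] cx[of y] by (simp add: conv_def right_diff_distrib)
    also have "\<bar>\<dots>\<bar> \<le> (\<integral>z. \<bar>u z * (\<rho> (x - z) - \<rho> (y - z))\<bar> \<partial>lborel)" by (rule integral_abs_bound)
    also have "\<dots> \<le> (\<integral>z. M * dist x y * (\<bar>u z\<bar> * indicator (cball x R) z + \<bar>u z\<bar> * indicator (cball y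
        R) z) \<partial>lborel)"
    proof (rule integral_mono)
      show "integrable lborel (\<lambda>z. \<bar>u z * (\<rho> (x - z) - \<rho> (y - z))\<bar>)"
        using cx[of x] cx[of y] by (intro integrable_abs) (simp add: right_diff_distrib)
      show "integrable lborel (\<lambda>z. M * dist x y * (\<bar>u z\<bar> * indicator (cball x R) z
          + \<bar>u z\<bar> * indicator (cball y R) z))"
        using i0[of x] i0[of y] by simp
      fix z
      have d: "\<bar>\<rho> (x - z) - \<rho> (y - z)\<bar> \<le> M * dist x y" using M(2)[of "x - z" "y - z"]
          by (simp add: dist_norm)
      show "\<bar>u z * (\<rho> (x - z) - \<rho> (y - z))\<bar> \<le> M * dist x y * (\<bar>u z\<bar> * indicator (cball x R) z
          + \<bar>u z\<bar> * indicator (cball y R) z)"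
      proof (cases "z \<in> cball x R \<or> z \<in> cball y R")
        case True
        have "\<bar>u z * (\<rho> (x - z) - \<rho> (y - z))\<bar> \<le> M * dist x y * \<bar>u z\<bar>"
          using mult_right_mono[OF d, of "\<bar>u z\<bar>"] by (simp add: abs_mult mult.commute)
        also have "\<dots> \<le> M * dist x y * (\<bar>u z\<bar> * indicator (cball x R) z + \<bar>u z\<bar> * indicator (cball y
            R) z)"
          using True M(1) by (intro mult_left_mono) (auto simp: indicator_def)
        finally show ?thesis .
      next
        case False
        then have "norm (x - z) \<ge> R" "norm (y - z) \<ge> R" by (auto simp: dist_norm)
        then show ?thesis using M(1) by (simp add: R)
      qed
    qed
    also have "\<dots> = M * dist x y * ((\<integral>z. \<bar>u z\<bar> * indicator (cball x R) z \<partial>lborel)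
        + (\<integral>z. \<bar>u z\<bar> * indicator (cball y R) z \<partial>lborel))"
      using i0[of x] i0[of y] by simp
    also have "\<dots> \<le> M * dist x y * (I + I)"
      using M(1) by (intro mult_left_mono add_mono bI) auto
    finally show ?thesis by (simp add: mult_ac)
  qed
  then show ?thesis by (rule that)
qed

lemma sqnorm_tail:
  fixes u :: "'a::euclidean_space \<Rightarrow> real"
  assumes [measurable]: "u \<in> borel_measurable borel" and u: "sqnorm u < \<infinity>" and \<eta>: "\<eta> > 0"
  obtains N :: nat where "(\<integral>\<^sup>+x. (if norm x \<ge> real N then ennreal ((u x)\<^sup>2) else 0) \<partial>lborel)
      < ennreal \<eta>"
proof -
  have "(\<lambda>N::nat. \<integral>\<^sup>+x. (if norm x \<ge> real N then ennreal ((u x)\<^sup>2) else 0) \<partial>lborel)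
      \<longlonglongrightarrow> (\<integral>\<^sup>+x. 0 \<partial>(lborel :: 'a measure))"
  proof (rule nn_integral_dominated_convergence[where w = "\<lambda>x. ennreal ((norm (u x))\<^sup>2)"])
    show "AE x in lborel. (\<lambda>N. if norm x \<ge> real N then ennreal ((u x)\<^sup>2) else 0) \<longlonglongrightarrow> 0"
    proof (rule AE_I2, rule tendsto_eventually)
      fix x :: 'a
      obtain N :: nat where "norm x < real N" using reals_Archimedean2 by blast
      then show "\<forall>\<^sub>F n in sequentially. (if norm x \<ge> real n then ennreal ((u x)\<^sup>2) else 0) = 0"
        by (intro eventually_sequentiallyI[of N]) auto
    qed
    show "(\<integral>\<^sup>+x. ennreal ((norm (u x))\<^sup>2) \<partial>lborel) < \<infinity>" using u by (simp add: sqnorm_def)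
  qed auto
  then have "\<forall>\<^sub>F N in sequentially. (\<integral>\<^sup>+x. (if norm x \<ge> real N then ennreal ((u x)\<^sup>2) else
      0) \<partial>lborel) < ennreal \<eta>"
    using \<eta> by (intro order_tendstoD(2)) auto
  then show ?thesis using that by (auto simp: eventually_sequentially)
qed

text \<open>By Jensen's inequality the square of the convolution at \<open>x\<close> is at most a
  constant times the mass of \<open>u\<close> near \<open>x\<close>, which is part of a tail when
  \<open>x\<close> is far out. A small truncation then produces compact support.\<close>

lemma conv_vanishes_at_infinity:
  fixes u :: "'a::euclidean_space \<Rightarrow> real"
  assumes \<rho>: "mollifier \<rho>" and [measurable]: "u \<in> borel_measurable borel" and u: "sqnorm u < \<infinity>"
      and e: "e > 0"
  obtains R where "\<And>x. norm x \<ge> R \<Longrightarrow> conv u \<rho> x < e"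
proof -
  interpret mollifier \<rho> by (rule \<rho>)
  obtain S where S: "\<And>x. norm x \<ge> S \<Longrightarrow> \<rho> x = 0" using test_function_support[OF test] by metis
  obtain C where C: "C > 0" "\<And>x. \<bar>\<rho> x\<bar> \<le> C" using compact_support_bounded[OF
      test_function_continuous[OF test] S] by metis
  have "e\<^sup>2 / C > 0" using e C by simp
  from sqnorm_tail[OF assms(2) u this] obtain N :: nat where
    N: "(\<integral>\<^sup>+x. (if norm x \<ge> real N then ennreal ((u x)\<^sup>2) else 0) \<partial>lborel) < ennreal (e\<^sup>2 / C)"
        by metis
  have "conv u \<rho> x < e" if x: "norm x \<ge> real N + S" for x
  proof -
    have "ennreal ((conv u \<rho> x)\<^sup>2) \<le> (\<integral>\<^sup>+w. ennreal ((u (x - w))\<^sup>2 * \<rho> w) \<partial>lborel)"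
      by (rule conv_square_le) measurable
    also have "\<dots> \<le> (\<integral>\<^sup>+w. ennreal C * (if norm (x - w) \<ge> real N then ennreal ((u (x
        - w))\<^sup>2) else 0) \<partial>lborel)"
    proof (rule nn_integral_mono)
      fix w
      show "ennreal ((u (x - w))\<^sup>2 * \<rho> w) \<le> ennreal C * (if norm (x - w) \<ge> real N then ennreal ((u
          (x - w))\<^sup>2) else 0)"
      proof (cases "norm w < S")
        case True
        then have "norm (x - w) \<ge> real N" using x norm_triangle_ineq2[of x w] by linarith
        moreover have "(u (x - w))\<^sup>2 * \<rho> w \<le> C * (u (x - w))\<^sup>2"
          using mult_left_mono[of "\<rho> w" C "(u (x - w))\<^sup>2"] C(2)[of w] by (simp add: mult.commute)
        ultimately show ?thesis using C(1) by (simp add: ennreal_mult[symmetric] ennreal_leI)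
      qed (simp add: S)
    qed
    also have "\<dots> = (\<integral>\<^sup>+y. ennreal C * (if norm y \<ge> real N then ennreal ((u y)\<^sup>2) else 0) \<partial>lborel)"
      by (rule nn_integral_lborel_reflect) measurable
    also have "\<dots> = ennreal C * (\<integral>\<^sup>+y. (if norm y \<ge> real N then ennreal ((u y)\<^sup>2) else 0) \<partial>lborel)"
      by (rule nn_integral_cmult) measurable
    also have "\<dots> < ennreal C * ennreal (e\<^sup>2 / C)"
      using N C(1) by (intro ennreal_mult_strict_left_mono) auto
    also have "\<dots> = ennreal (e\<^sup>2)" using C(1) by (simp add: ennreal_mult[symmetric])
    finally have "(conv u \<rho> x)\<^sup>2 < e\<^sup>2" by (simp add: ennreal_less_iff)
    then show ?thesis using e by (intro power2_less_imp_less[of "conv u \<rho> x" e]) auto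
  qed
  then show ?thesis by (rule that)
qed

text \<open>\<open>enn2real\<close> is not monotone at infinity, so nothing can be claimed where
  \<open>f k\<close> is infinite; hence the premise inside the conclusion.\<close>

lemma eventually_enn2real_ge:
  fixes f :: "nat \<Rightarrow> ennreal"
  assumes le: "x \<le> liminf f" and \<delta>: "\<delta> > 0"
  shows "\<forall>\<^sub>F k in sequentially. f k < \<infinity> \<longrightarrow> enn2real x - \<delta> \<le> enn2real (f k)"
proof (cases x)
  \<comment> \<open>Here \<open>enn2real x = 0\<close>, so the lower bound is negative.\<close>
  case top
  then show ?thesis using \<delta> by (simp add: order_trans[OF _ enn2real_nonneg])
next
  case (real r)
  show ?thesis
  proof (cases "r \<le> \<delta>")
    case True
    then show ?thesis using real by (simp add: order_trans[OF _ enn2real_nonneg])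
  next
    case False
    then have "ennreal (r - \<delta>) < ennreal r" using \<delta> real by (simp add: ennreal_less_iff)
    then have "ennreal (r - \<delta>) < liminf f" using le real by (simp add: order_less_le_trans)
    then have "\<forall>\<^sub>F k in sequentially. ennreal (r - \<delta>) < f k" by (rule less_LiminfD)
    then show ?thesis
    proof eventually_elim
      case (elim k)
      show ?case
      proof
        assume "f k < \<infinity>"
        then obtain t where "f k = ennreal t" "t \<ge> 0" by (cases "f k") auto
        then show "enn2real x - \<delta> \<le> enn2real (f k)" using elim real False
            by (simp add: ennreal_less_iff)
      qed
    qed
  qed
qed

text \<open>Mollification and the maps \<open>t \<mapsto> |t|\<close> and \<open>t \<mapsto> max (t - c) 0\<close> do not increase the nonlocal
  energies, so the Dirichlet energy only decreases; for the other terms Fatou's lemma gives the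
  right inequality.\<close>
lemma lip_class_density:
  fixes v :: "real^2 \<Rightarrow> real"
  assumes [measurable]: "v \<in> borel_measurable borel" and v: "sqnorm v = 1" "dirichlet v < \<infinity>"
    and p: "0 < p" "p < 2" and a: "a > 0" and b: "b > 0" and \<delta>: "\<delta> > 0"
  obtains R w where "w \<in> lip_class R" "energy p a b w \<le> energy p a b v + \<delta>"
proof -
  define u where "u x = \<bar>v x\<bar>" for x
  have um [measurable]: "u \<in> borel_measurable borel" unfolding u_def[abs_def] by measurable
  have u0: "u x \<ge> 0" for x by (simp add: u_def)
  have su: "sqnorm u = 1" using v(1) by (simp add: sqnorm_def u_def)
  have sfin: "sqnorm u < \<infinity>" by (simp add: su)
  have Du: "dirichlet u \<le> dirichlet v"
    by (intro dirichlet_mono nl_energy_contraction) (simp add: u_def)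
  have Dufin: "dirichlet u < \<infinity>" using Du v(2) by (rule order_le_less_trans)
  define U where "U k = conv u (dyadic_moll k)" for k
  \<comment> \<open>As \<open>U k\<close> tends to 0 at infinity, subtracting a constant before
    taking the positive part gives compact support.\<close>
  define w where "w k x = max (U k x - 1 / real (Suc k)) 0" for k x
  have t: "test_function (dyadic_moll k)" for k by (rule mollifier.test[OF mollifier_dyadic])
  have Um [measurable]: "U k \<in> borel_measurable borel" for k
    unfolding U_def by (rule measurable_conv[OF um test_function_measurable(1)[OF t]])
  have wm [measurable]: "w k \<in> borel_measurable borel" for k unfolding w_def[abs_def] by measurable
  have U0: "U k x \<ge> 0" for k x
    unfolding U_def conv_def using u0 mollifier.nonneg[OF mollifier_dyadic]
    by (intro Bochner_Integration.integral_nonneg mult_nonneg_nonneg) auto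
  have w0: "w k x \<ge> 0" for k x by (simp add: w_def)
  have Dw: "dirichlet (w k) \<le> dirichlet v" for k
  proof -
    have "dirichlet (w k) \<le> dirichlet (U k)"
      by (intro dirichlet_mono nl_energy_contraction) (auto simp: w_def max_def)
    also have "\<dots> \<le> dirichlet u"
      unfolding U_def by (intro dirichlet_mono nl_energy_conv_le[OF mollifier_dyadic] um sfin)
    finally show ?thesis using Du by (rule order_trans)
  qed
  have sw: "sqnorm (w k) \<le> 1" for k
  proof -
    have "sqnorm (w k) \<le> sqnorm (U k)"
      unfolding sqnorm_def using U0[of k] by (intro nn_integral_mono ennreal_leI power_mono) (auto
          simp: w_def max_def)
    also have "\<dots> \<le> sqnorm u" unfolding U_def by (rule mollifier.sqnorm_conv_le[OF mollifier_dyadic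
        um])
    finally show ?thesis by (simp add: su)
  qed
  have lim: "AE x in lborel. (\<lambda>k. w k x) \<longlonglongrightarrow> u x"
    using dyadic_conv_tendsto_AE[OF um sfin Dufin]
  proof eventually_elim
    case (elim x)
    have "(\<lambda>k. max (U k x - 1 / real (Suc k)) 0) \<longlonglongrightarrow> max (u x - 0) 0"
      using elim unfolding U_def by (intro tendsto_max tendsto_diff tendsto_const LIMSEQ_Suc[OF
          lim_1_over_n])
    then show ?case using u0[of x] by (simp add: w_def)
  qed
  have fatou: "(\<integral>\<^sup>+x. ennreal (F x (u x)) \<partial>lborel) \<le> liminf (\<lambda>k. \<integral>\<^sup>+x. ennreal (F x (w k
      x)) \<partial>lborel)"
    if F: "\<And>x. continuous_on UNIV (F x)" and m: "\<And>g. g \<in> borel_measurable borel \<Longrightarrow> (\<lambda>x. F x (g x))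
        \<in> borel_measurable borel"
    for F :: "real^2 \<Rightarrow> real \<Rightarrow> real"
  proof -
    have "(\<integral>\<^sup>+x. ennreal (F x (u x)) \<partial>lborel) \<le> (\<integral>\<^sup>+x. liminf (\<lambda>k. ennreal (F x (w k x))) \<partial>lborel)"
    proof (rule nn_integral_mono_AE, use lim in eventually_elim)
      case (elim x)
      have "isCont (F x) (u x)" using F[of x] by (simp add: continuous_on_eq_continuous_at)
      then have "(\<lambda>k. ennreal (F x (w k x))) \<longlonglongrightarrow> ennreal (F x (u x))"
        by (intro tendsto_ennrealI isCont_tendsto_compose[OF _ elim])
      from lim_imp_Liminf[OF trivial_limit_sequentially this] show ?case by simp
    qed
    also have "\<dots> \<le> liminf (\<lambda>k. \<integral>\<^sup>+x. ennreal (F x (w k x)) \<partial>lborel)"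
      using m[OF wm] by (intro nn_integral_liminf) auto
    finally show ?thesis .
  qed
  have LS: "1 \<le> liminf (\<lambda>k. sqnorm (w k))"
    using fatou[of "\<lambda>x t. (norm t)\<^sup>2"] su by (simp add: sqnorm_def continuous_intros)
  have LP: "potential p u \<le> liminf (\<lambda>k. potential p (w k))"
    unfolding potential_def by (rule fatou) (auto intro!: continuous_intros)
  have LQ: "quartic u \<le> liminf (\<lambda>k. quartic (w k))"
    unfolding quartic_def by (rule fatou) (auto intro!: continuous_intros)
  \<comment> \<open>Splits \<open>\<delta>\<close> between the potential term, of weight 1, and the
    quartic term, of weight \<open>a / 2\<close>.\<close>
  define \<eta> where "\<eta> = \<delta> / (1 + a / 2)"
  have \<eta>: "\<eta> > 0" using \<delta> a by (simp add: \<eta>_def)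
  have "0 < liminf (\<lambda>k. sqnorm (w k))" using LS by (rule less_le_trans[OF zero_less_one])
  then have "\<forall>\<^sub>F k in sequentially. 0 < sqnorm (w k)" by (rule less_LiminfD)
  with eventually_enn2real_ge[OF LP \<eta>] eventually_enn2real_ge[OF LQ \<eta>]
  have "\<forall>\<^sub>F k in sequentially. 0 < sqnorm (w k) \<and> (potential p (w k) < \<infinity> \<longrightarrow> enn2real (potential p u)
      - \<eta> \<le> enn2real (potential p (w k)))
      \<and> (quartic (w k) < \<infinity> \<longrightarrow> enn2real (quartic u) - \<eta> \<le> enn2real (quartic (w k)))"
    by eventually_elim auto
  then obtain k where k: "0 < sqnorm (w k)" "potential p (w k) < \<infinity> \<longrightarrow> enn2real (potential p u) - \<eta>
      \<le> enn2real (potential p (w k))"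
      "quartic (w k) < \<infinity> \<longrightarrow> enn2real (quartic u) - \<eta> \<le> enn2real (quartic (w k))"
    by (metis (mono_tags, lifting) eventually_happens' trivial_limit_sequentially)
  obtain L where L: "\<And>x y. \<bar>U k x - U k y\<bar> \<le> L * dist x y"
    unfolding U_def using conv_lipschitz[OF um sfin t] by metis
  obtain S where S: "\<And>x. norm x \<ge> S \<Longrightarrow> U k x < 1 / real (Suc k)"
    unfolding U_def using conv_vanishes_at_infinity[OF mollifier_dyadic um sfin, of "1 / real (Suc
        k)" k] by auto
  have wL: "\<bar>w k x - w k y\<bar> \<le> L * dist x y" for x y using L[of x y] by (auto simp: w_def max_def)
  have wS: "w k x = 0" if "norm x \<ge> S" for x using S[OF that] by (simp add: w_def)
  define M where "M = max L S"
  obtain r where r: "sqnorm (w k) = ennreal r" "r > 0" "r \<le> 1"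
    using k(1) sw[of k] by (cases "sqnorm (w k)") (auto simp: top_unique)
  \<comment> \<open>Rescaling the amplitude puts \<open>W\<close> in a Lipschitz class, whence the
    potential and quartic terms of \<open>w k\<close> are finite. It is not the competitor, since it
    may raise the Dirichlet energy; the mass is restored by a dilation instead.\<close>
  define W where "W x = w k x / sqrt r" for x
  have sqW: "sqnorm W = 1"
  proof -
    have "sqnorm (\<lambda>x. (1 / sqrt r) *\<^sub>R w k x) = ennreal ((1 / sqrt r)\<^sup>2) * sqnorm (w k)"
        by (rule sqnorm_scale[OF wm])
    also have "\<dots> = 1" using r by (simp add: ennreal_mult[symmetric] power_divide)
    finally show ?thesis by (simp add: W_def[abs_def])
  qed
  have Wc: "W \<in> lip_class (max (L / sqrt r) S)"
  proof (rule lip_classI)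
    fix x y
    have "\<bar>W x - W y\<bar> = \<bar>w k x - w k y\<bar> / sqrt r" using r
        by (simp add: W_def diff_divide_distrib[symmetric])
    also have "\<dots> \<le> L * dist x y / sqrt r" using r by (intro divide_right_mono wL) auto
    finally show "\<bar>W x - W y\<bar> \<le> L / sqrt r * dist x y" by simp
  qed (use w0 wS sqW r in \<open>auto simp: W_def\<close>)
  have Wle: "w k x \<le> W x" for x
  proof -
    have "w k x * sqrt r \<le> w k x * 1" using r w0[of k x] by (intro mult_left_mono) auto
    then show ?thesis using r by (simp add: W_def field_simps)
  qed
  have fin: "potential p (w k) < \<infinity>" "quartic (w k) < \<infinity>"
  proof -
    have "potential p (w k) \<le> potential p W"
      unfolding potential_def using w0 Wle by (intro nn_integral_mono ennreal_leI mult_left_mono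
          power_mono) auto
    then show "potential p (w k) < \<infinity>" using potential_lip_class_finite[OF Wc, of p] p
        by (auto simp: order_le_less_trans)
    have "quartic (w k) \<le> quartic W"
      unfolding quartic_def using w0 Wle by (intro nn_integral_mono ennreal_leI power_mono) auto
    then show "quartic (w k) < \<infinity>" using quartic_lip_class_finite[OF Wc]
        by (auto simp: order_le_less_trans)
  qed
  have Dwfin: "dirichlet (w k) < \<infinity>" using Dw v(2) by (rule order_le_less_trans)
  from normalize_by_dilation[OF wm k(1) sw Dwfin fin p(2), of a b] a b
  obtain s where s: "s \<ge> 1" "sqnorm (\<lambda>x. w k ((1/s) *\<^sub>R x)) = 1" "energy p a b (\<lambda>x. w k ((1/s) *\<^sub>R
      x)) \<le> energy p a b (w k)"
    by (metis less_imp_le)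
  have "L \<ge> 0"
  proof -
    have "0 \<le> L * dist (axis 1 1 :: real^2) 0" using L[of "axis 1 1" 0]
        by (meson abs_ge_zero order_trans)
    then show ?thesis by simp
  qed
  have ws: "(\<lambda>x. w k ((1/s) *\<^sub>R x)) \<in> lip_class (max L (s * S))"
  proof (rule lip_classI)
    fix x y
    have "\<bar>w k ((1/s) *\<^sub>R x) - w k ((1/s) *\<^sub>R y)\<bar> \<le> L * dist ((1/s) *\<^sub>R x) ((1/s) *\<^sub>R y)"
        by (rule wL)
    also have "dist ((1/s) *\<^sub>R x) ((1/s) *\<^sub>R y) = dist x y / s"
      using s by (simp add: dist_norm scaleR_diff_right[symmetric])
    also have "L * (dist x y / s) \<le> L * dist x y"
      using s \<open>L \<ge> 0\<close> mult_right_mono[of 1 s "dist x y"]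
          by (intro mult_left_mono) (auto simp: field_simps)
    finally show "\<bar>w k ((1/s) *\<^sub>R x) - w k ((1/s) *\<^sub>R y)\<bar> \<le> L * dist x y" .
  next
    fix x :: "real^2" assume "s * S \<le> norm x"
    then have "S \<le> norm ((1/s) *\<^sub>R x)" using s by (simp add: field_simps)
    then show "w k ((1/s) *\<^sub>R x) = 0" by (rule wS)
  qed (use w0 s in auto)
  have "energy p a b (w k) \<le> energy p a b v + \<delta>"
  proof -
    have D: "enn2real (dirichlet (w k)) \<le> enn2real (dirichlet v)" using enn2real_mono[OF Dw] v(2)
        by simp
    have "enn2real (dirichlet (w k)) + b * (enn2real (dirichlet (w k)))\<^sup>2 \<le> enn2real (dirichlet v)
        + b * (enn2real (dirichlet v))\<^sup>2"
      using b D by (intro add_mono mult_left_mono power_mono) auto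
    moreover have "potential p u = potential p v" "quartic u = quartic v"
      by (simp_all add: potential_def quartic_def u_def)
    moreover have "a / 2 * (enn2real (quartic u) - \<eta>) \<le> a / 2 * enn2real (quartic (w k))"
      using k(3) fin a by (intro mult_left_mono) auto
    moreover have "(1 + a / 2) * \<eta> = \<delta>" using a unfolding \<eta>_def
        by (intro nonzero_mult_div_cancel_left[of "1
        + a / 2" \<delta>, unfolded times_divide_eq_right[symmetric]]) auto
    then have "\<eta> + a / 2 * \<eta> = \<delta>" by (simp add: distrib_right)
    ultimately show ?thesis using k(2) fin unfolding energy_def by (simp add: right_diff_distrib)
  qed
  with s(3) have "energy p a b (\<lambda>x. w k ((1/s) *\<^sub>R x)) \<le> energy p a b v + \<delta>" by (rule order_trans)
  with ws show ?thesis by (rule that)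
qed

section \<open>A competitor of negative energy\<close>

lemma nl_energy_scale:
  assumes [measurable]: "u \<in> borel_measurable borel"
  shows "nl_energy \<epsilon> (\<lambda>x. c * u x) = ennreal (c\<^sup>2) * nl_energy \<epsilon> u"
proof -
  have "(\<integral>\<^sup>+y. (if dist x y < \<epsilon> then ennreal ((c * u x - c * u y)\<^sup>2) else 0) \<partial>lborel)
      = ennreal (c\<^sup>2) * (\<integral>\<^sup>+y. (if dist x y < \<epsilon> then ennreal ((u x - u y)\<^sup>2) else 0) \<partial>lborel)" for x
    by (subst nn_integral_cmult[symmetric])
      (auto simp: right_diff_distrib[symmetric] power_mult_distrib ennreal_mult intro!:
          nn_integral_cong)
  then show ?thesis unfolding nl_energy_def by (simp only:) (rule nn_integral_cmult; measurable)
qed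

lemma dirichlet_scale_le:
  assumes "u \<in> borel_measurable borel"
  shows "dirichlet (\<lambda>x. c * u x) \<le> ennreal (c\<^sup>2) * dirichlet u"
proof (rule dirichlet_le)
  fix \<epsilon> :: real assume "\<epsilon> > 0"
  then have "ennreal (c\<^sup>2) * nl_energy \<epsilon> u \<le> ennreal (c\<^sup>2) * (ennreal (ball_moment * \<epsilon> ^ 4) *
      dirichlet u)"
    by (intro mult_left_mono nl_energy_le_dirichlet) auto
  then show "nl_energy \<epsilon> (\<lambda>x. c * u x) \<le> ennreal (ball_moment * \<epsilon> ^ 4) * (ennreal (c\<^sup>2) * dirichlet
      u)"
    by (simp add: nl_energy_scale[OF assms] mult_ac)
qed

text \<open>Spreading a function over the scale \<open>s\<close> makes the Dirichlet energy of order \<open>s\<^sup>-\<^sup>2\<close>, which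
  is smaller than the potential energy of order \<open>s\<^sup>-\<^sup>p\<close> for large \<open>s\<close>.\<close>
lemma lip_class_negative_energy:
  assumes p: "0 < p" "p < 2" and a: "a > 0" and b: "b > 0"
  obtains R w where "w \<in> lip_class R" "energy p a b w < 0"
proof -
  define h where "h x = max (1 - norm x) 0" for x :: "real^2"
  have hc: "continuous_on UNIV h" unfolding h_def by (intro continuous_intros)
  have hm [measurable]: "h \<in> borel_measurable borel"
      by (rule borel_measurable_continuous_onI[OF hc])
  have hL: "\<bar>h x - h y\<bar> \<le> 1 * dist x y" for x y
    using norm_triangle_ineq3[of x y] by (auto simp: h_def max_def dist_norm)
  have h0: "h x \<ge> 0" "norm x \<ge> 1 \<Longrightarrow> h x = 0" "norm x < 1 \<Longrightarrow> h x > 0" for x by (auto simp: h_def)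
  have hs: "sqnorm h < \<infinity>" by (rule sqnorm_compact_support_finite[OF hc h0(2)])
  have pos: "(\<integral>\<^sup>+x. ennreal (F x) \<partial>lborel) > 0"
    if [measurable]: "F \<in> borel_measurable borel" and F: "\<And>x. x \<noteq> 0 \<Longrightarrow> norm x < 1 \<Longrightarrow> F x > 0"
        for F :: "real^2 \<Rightarrow> real"
  proof (rule ccontr)
    assume "\<not> (\<integral>\<^sup>+x. ennreal (F x) \<partial>lborel) > 0"
    then have "AE x in lborel. ennreal (F x) = 0" by (subst (asm) zero_less_iff_neq_zero) (simp add:
        nn_integral_0_iff_AE)
    moreover have "AE x in lborel. x \<noteq> (0::real^2)" by (rule AE_lborel_singleton)
    ultimately have "AE x in lborel. x \<notin> ball (0::real^2) 1"
      by eventually_elim (use F in \<open>force simp: ennreal_eq_0_iff not_le[symmetric]\<close>)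
    then have "emeasure lborel (ball (0::real^2) 1) = 0"
      by (subst (asm) AE_iff_measurable[of "ball (0::real^2) 1"]) auto
    then show False by (simp add: emeasure_ball_real2)
  qed
  have "sqnorm h > 0" unfolding sqnorm_def using h0(3)
      by (intro pos) (auto simp: less_imp_neq[symmetric])
  then obtain m where m: "sqnorm h = ennreal m" "m > 0" using hs by (cases "sqnorm h") auto
  have Ph: "potential p h > 0" unfolding potential_def using h0(3)
      by (intro pos) (auto simp: less_imp_neq[symmetric])
  define \<phi> where "\<phi> x = h x / sqrt m" for x
  have \<phi>c: "\<phi> \<in> lip_class (max (1 / sqrt m) 1)"
  proof (rule lip_classI)
    fix x y
    have "\<bar>\<phi> x - \<phi> y\<bar> = \<bar>h x - h y\<bar> / sqrt m" using m
        by (simp add: \<phi>_def diff_divide_distrib[symmetric])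
    also have "\<dots> \<le> 1 * dist x y / sqrt m" using m by (intro divide_right_mono hL) auto
    finally show "\<bar>\<phi> x - \<phi> y\<bar> \<le> 1 / sqrt m * dist x y" by simp
  next
    have "sqnorm (\<lambda>x. (1 / sqrt m) *\<^sub>R h x) = ennreal ((1 / sqrt m)\<^sup>2) * sqnorm h"
        by (rule sqnorm_scale[OF hm])
    also have "\<dots> = 1" using m by (simp add: ennreal_mult[symmetric] power_divide)
    finally show "sqnorm \<phi> = 1" by (simp add: \<phi>_def[abs_def])
  qed (use h0 m in \<open>auto simp: \<phi>_def\<close>)
  have \<phi>m [measurable]: "\<phi> \<in> borel_measurable borel" by (rule lip_classD(6)[OF \<phi>c])
  define A where "A = enn2real (dirichlet \<phi>)"
  have A: "dirichlet \<phi> = ennreal A" "A \<ge> 0" using dirichlet_lip_class[OF \<phi>c]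
      by (simp_all add: A_def)
  define P where "P = enn2real (potential p \<phi>)"
  have Pfin: "potential p \<phi> = ennreal P" using potential_lip_class_finite[OF \<phi>c, of p] p
    by (auto simp: P_def order_le_less_trans)
  have "potential p \<phi> > 0"
    unfolding potential_def using h0(3) m by (intro pos) (auto simp: \<phi>_def less_imp_neq[symmetric])
  then have P: "P > 0" using Pfin by simp
  \<comment> \<open>The Dirichlet and Kirchhoff terms divided by \<open>s powr (- p)\<close>, the
    order of the potential term; both exponents are negative because \<open>p < 2\<close>.\<close>
  have "((\<lambda>s. A * s powr (p - 2) + b * A\<^sup>2 * s powr (p - 4)) \<longlongrightarrow> A * 0 + b * A\<^sup>2 * 0) at_top"
    using p by (intro tendsto_intros tendsto_neg_powr filterlim_ident) auto
  then have "\<forall>\<^sub>F s in at_top. A * s powr (p - 2) + b * A\<^sup>2 * s powr (p - 4) < P"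
    using P by (intro order_tendstoD(2)) auto
  then have "\<forall>\<^sub>F s in at_top. A * s powr (p - 2) + b * A\<^sup>2 * s powr (p - 4) < P \<and> s \<ge> (1::real)"
    using eventually_ge_at_top[of 1] by eventually_elim auto
  then obtain s where s: "A * s powr (p - 2) + b * A\<^sup>2 * s powr (p - 4) < P" "s \<ge> 1"
    by (metis (mono_tags, lifting) eventually_happens' trivial_limit_at_top_linorder)
  have s0: "s > 0" using s by simp
  \<comment> \<open>The amplitude factor compensates the growth of the mass under the
    dilation.\<close>
  define w where "w x = (1/s) * \<phi> ((1/s) *\<^sub>R x)" for x
  have \<phi>sm: "(\<lambda>x. \<phi> ((1/s) *\<^sub>R x)) \<in> borel_measurable borel" by measurable
  define L where "L = max (1 / sqrt m) 1"
  have L: "L > 0" by (simp add: L_def)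
  note \<phi>c = \<phi>c[folded L_def]
  have w: "w \<in> lip_class (max L (s * L))"
  proof (rule lip_classI)
    fix x y
    have "\<bar>w x - w y\<bar> = (1/s) * \<bar>\<phi> ((1/s) *\<^sub>R x) - \<phi> ((1/s) *\<^sub>R y)\<bar>"
      using s0 by (simp add: w_def diff_divide_distrib[symmetric])
    also have "\<dots> \<le> 1 * \<bar>\<phi> ((1/s) *\<^sub>R x) - \<phi> ((1/s) *\<^sub>R y)\<bar>" using s by (intro mult_right_mono) auto
    also have "\<dots> \<le> L * dist ((1/s) *\<^sub>R x) ((1/s) *\<^sub>R y)" using lip_classD(1)[OF \<phi>c] by simp
    also have "dist ((1/s) *\<^sub>R x) ((1/s) *\<^sub>R y) = dist x y / s"
      using s0 by (simp add: dist_norm scaleR_diff_right[symmetric])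
    also have "L * (dist x y / s) \<le> L * dist x y"
      using s L mult_right_mono[of 1 s "dist x y"]
          by (intro mult_left_mono) (auto simp: field_simps)
    finally show "\<bar>w x - w y\<bar> \<le> L * dist x y" .
  next
    fix x :: "real^2" assume "s * L \<le> norm x"
    then have "L \<le> norm ((1/s) *\<^sub>R x)" using s0 by (simp add: field_simps)
    then show "w x = 0" using lip_classD(3)[OF \<phi>c] by (simp add: w_def)
  next
    have "sqnorm (\<lambda>x. (1/s) *\<^sub>R \<phi> ((1/s) *\<^sub>R x)) = ennreal ((1/s)\<^sup>2) * (ennreal (s\<^sup>2) * sqnorm \<phi>)"
      by (simp only: sqnorm_scale[OF \<phi>sm] sqnorm_dilate[OF \<phi>m s0])
    also have "\<dots> = 1" using s0 lip_classD(4)[OF \<phi>c]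
        by (simp add: ennreal_mult[symmetric] power_divide)
    finally show "sqnorm w = 1" by (simp add: w_def[abs_def])
  qed (use lip_classD(2)[OF \<phi>c] s0 in \<open>auto simp: w_def\<close>)
  have "dirichlet w \<le> ennreal ((1/s)\<^sup>2) * dirichlet \<phi>"
    unfolding w_def[abs_def]
    by (rule order_trans[OF dirichlet_scale_le[OF \<phi>sm] mult_left_mono[OF dirichlet_dilate_le[OF \<phi>m
        s0]]]) simp
  also have "\<dots> = ennreal (A * s powr (- 2))"
    using A s0 by (simp add: ennreal_mult[symmetric] powr_minus power_divide inverse_eq_divide)
  finally have Dw: "enn2real (dirichlet w) \<le> A * s powr (- 2)"
    using A(2) by (intro enn2real_leI) auto
  have "potential p w = ennreal ((1/s)\<^sup>2) * potential p (\<lambda>x. \<phi> ((1/s) *\<^sub>R x))"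
    unfolding potential_def w_def
    by (subst nn_integral_cmult[symmetric]) (auto simp: ennreal_mult[symmetric] power_divide
        mult_ac)
  also have "\<dots> = ennreal ((1/s)\<^sup>2 * (s powr (2 - p) * P))"
    using s0 P by (simp only: potential_dilate[OF \<phi>m s0] Pfin) (simp add: ennreal_mult)
  also have "(1/s)\<^sup>2 * (s powr (2 - p) * P) = s powr (- p) * P"
    using powr_add[of s "- 2" "2 - p"] s0 by (simp add: powr_minus power_divide inverse_eq_divide)
  finally have Pw: "enn2real (potential p w) = s powr (- p) * P" using P by simp
  have "energy p a b w \<le> A * s powr (- 2) + b * (A * s powr (- 2))\<^sup>2 - s powr (- p) * P"
  proof -
    have "b * (enn2real (dirichlet w))\<^sup>2 \<le> b * (A * s powr (- 2))\<^sup>2"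
      using b Dw by (intro mult_left_mono power_mono) auto
    moreover have "a / 2 * enn2real (quartic w) \<ge> 0" using a by simp
    ultimately show ?thesis using Dw unfolding energy_def Pw by linarith
  qed
  also have "\<dots> = s powr (- p) * (A * s powr (p - 2) + b * A\<^sup>2 * s powr (p - 4) - P)"
  proof -
    have e1: "s powr (- p) * s powr (p - 2) = s powr (- 2)" by (simp add: powr_add[symmetric])
    have e2: "s powr (- p) * s powr (p - 4) = (s powr (- 2))\<^sup>2"
        by (simp add: powr_add[symmetric] power2_eq_square)
    have "s powr (- p) * (A * s powr (p - 2) + b * A\<^sup>2 * s powr (p - 4) - P)
      = A * (s powr (- p) * s powr (p - 2)) + b * A\<^sup>2 * (s powr (- p) * s powr (p - 4))
          - s powr (- p) * P"
      by (simp add: algebra_simps)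
    then show ?thesis unfolding e1 e2 by (simp add: power_mult_distrib)
  qed
  also have "\<dots> < 0" using s(1) s0 by (intro mult_pos_neg) auto
  finally show ?thesis using w by (intro that)
qed

section \<open>Existence of a minimizer\<close>

text \<open>Monotonicity compares different norms only, so the value at \<open>x\<close> is squeezed
  between the profile at slightly larger and slightly smaller radii; continuity closes the
  gap.\<close>

lemma radially_antitone_profile:
  assumes u: "radially_antitone u" and c: "continuous_on UNIV u" and x: "x \<noteq> 0"
  shows "u x = profile u (norm x)"
proof (rule antisym)
  have cp: "continuous_on UNIV (profile u)"
    unfolding profile_def[abs_def] by (rule continuous_on_compose2[OF c]) (auto intro!:
        continuous_intros)
  then have ic: "isCont (profile u) (norm x)" by (simp add: continuous_on_eq_continuous_at)
  have l1: "(\<lambda>n. norm x * (1 + 1 / real (Suc n))) \<longlonglongrightarrow> norm x * (1 + 0)"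
    and l2: "(\<lambda>n. norm x * (1 - 1 / real (Suc n))) \<longlonglongrightarrow> norm x * (1 - 0)"
    by (intro tendsto_intros LIMSEQ_Suc[OF lim_1_over_n])+
  have t1: "(\<lambda>n. profile u (norm x * (1 + 1 / real (Suc n)))) \<longlonglongrightarrow> profile u (norm x)"
    and t2: "(\<lambda>n. profile u (norm x * (1 - 1 / real (Suc n)))) \<longlonglongrightarrow> profile u (norm x)"
    using isCont_tendsto_compose[OF ic] l1 l2 by simp_all
  show "profile u (norm x) \<le> u x"
  proof (rule LIMSEQ_le_const2[OF t1], intro exI allI impI)
    fix n
    have "norm x * 1 < norm x * (1 + 1 / real (Suc n))" using x
        by (intro mult_strict_left_mono) auto
    then show "profile u (norm x * (1 + 1 / real (Suc n))) \<le> u x" by (intro profile_le u) auto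
  qed
  show "u x \<le> profile u (norm x)"
  proof (rule LIMSEQ_le_const[OF t2], intro exI allI impI)
    fix n
    have "norm x * (1 - 1 / real (Suc n)) < norm x * 1" using x
        by (intro mult_strict_left_mono) auto
    then show "u x \<le> profile u (norm x * (1 - 1 / real (Suc n)))"
        by (intro profile_ge u) (auto simp: field_simps)
  qed
qed

lemma AE_norm_not_in_countable:
  assumes "countable D" shows "AE x in lborel. norm (x::real^2) \<notin> D"
proof -
  have "AE x in lborel. norm (x::real^2) \<noteq> r" for r
  proof -
    have "negligible (sphere (0::real^2) r)" by (rule negligible_sphere)
    then have "sphere (0::real^2) r \<in> null_sets lebesgue" by (simp add: negligible_iff_null_sets)
    then have "AE x in lebesgue. x \<notin> sphere (0::real^2) r" by (rule AE_not_in)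
    then show ?thesis unfolding AE_lebesgue_iff by eventually_elim simp
  qed
  then have "AE x in lborel. \<forall>r\<in>D. norm (x::real^2) \<noteq> r"
    by (subst AE_ball_countable[OF assms]) auto
  then show ?thesis by eventually_elim auto
qed

text \<open>Helly's theorem is applied to \<open>t \<mapsto> 1 / (1 + v(e\<^sup>t))\<close>, which is increasing and bounded
  although the profiles are not uniformly bounded near the origin.\<close>
lemma radially_antitone_Helly:
  assumes u: "\<And>n. radially_antitone (u n)" "\<And>n x. u n x \<ge> 0" "\<And>n. continuous_on UNIV (u n)"
      and m: "\<And>n. sqnorm (u n) \<le> 1"
  obtains r f where "strict_mono (r :: nat \<Rightarrow> nat)" "antimono_on {0<..} f" "\<And>t. f t \<ge> 0" "f
      \<in> borel_measurable borel"
    "AE x in lborel. (\<lambda>n. u (r n) x) \<longlonglongrightarrow> f (norm x)"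
proof -
  define g where "g n t = 1 / (1 + profile (u n) (exp t))" for n t
  have p0: "profile (u n) r \<ge> 0" for n r using u(2) by (simp add: profile_def)
  have pc: "continuous_on UNIV (profile (u n))" for n
    unfolding profile_def[abs_def] by (rule continuous_on_compose2[OF u(3)]) (auto intro!:
        continuous_intros)
  have gc: "continuous_on UNIV (g n)" for n
  proof -
    have "1 + profile (u n) (exp t) \<noteq> 0" for t using p0[of n "exp t"] by linarith
    then show ?thesis unfolding g_def[abs_def]
      by (intro continuous_intros continuous_on_compose2[OF pc]) auto
  qed
  have anti: "profile (u n) t \<le> profile (u n) s" if "0 \<le> s" "s < t" for n s t
    unfolding profile_def by (rule radially_antitoneD[OF u(1)]) (use that in simp)
  have "mono (g n)" for n
  proof (rule monoI)
    fix s t :: real assume "s \<le> t"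
    then have "profile (u n) (exp t) \<le> profile (u n) (exp s)" using anti[of "exp s" "exp t" n]
        by (cases "s = t") auto
    then show "g n s \<le> g n t" unfolding g_def using p0[of n "exp t"]
        by (intro divide_left_mono mult_pos_pos) auto
  qed
  moreover have "continuous (at_right x) (g n)" for n x
    using gc[of n] by (simp add: continuous_on_eq_continuous_at
        continuous_at_imp_continuous_at_within)
  moreover have g01: "0 \<le> g n t" "g n t \<le> 1" for n t using p0[of n "exp t"] by (simp_all add: g_def)
  then have "\<bar>g n t\<bar> \<le> 1" for n t by simp
  ultimately obtain r F where r: "strict_mono (r :: nat \<Rightarrow> nat)" and F: "mono F" "\<And>x. \<bar>F x\<bar> \<le> 1"
    and lim: "\<And>x. continuous (at x) F \<Longrightarrow> (\<lambda>n. g (r n) x) \<longlonglongrightarrow> F x"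
    using Helly_selection[of g 1] by metis
  \<comment> \<open>The decay \<open>1 / exp t\<close> of the profiles bounds all \<open>g n\<close>
    from below by a positive function, so the limit keeps a finite reciprocal.\<close>
  define low where "low t = 1 / (1 + exp (- t))" for t :: real
  have glow: "low t \<le> g n t" for n t
  proof -
    have "profile (u n) (exp t) \<le> 1 / exp t" by (rule profile_decay[OF u(1,2) _ m]) simp
    then show ?thesis unfolding g_def low_def using p0[of n "exp t"]
      by (intro divide_left_mono mult_pos_pos) (auto simp: exp_minus inverse_eq_divide
          add_pos_nonneg)
  qed
  have low: "0 < low t" "low t \<le> 1" for t by (simp_all add: low_def add_pos_pos)
  have lowm: "low s \<le> low t" if "s \<le> t" for s t unfolding low_def using that
      by (intro divide_left_mono mult_pos_pos) (auto simp: add_pos_pos)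
  \<comment> \<open>Helly's theorem identifies the limit only at continuity points of
    \<open>F\<close>, where it is at least \<open>low\<close>. The maximum is positive everywhere,
    still increasing, and agrees with \<open>F\<close> at those points.\<close>
  define G where "G t = max (F t) (low t)" for t
  have G: "0 < G t" "G t \<le> 1" for t using low[of t] F(2)[of t] by (auto simp: G_def abs_le_iff)
  have Gm: "mono G"
    by (rule monoI, unfold G_def) (rule max.mono[OF monoD[OF F(1)] lowm])
  \<comment> \<open>Undoes both the reciprocal and the exponential change of variable.\<close>
  define f where "f t = 1 / G (ln t) - 1" for t
  have "antimono_on {0<..} f"
  proof (rule monotone_onI)
    fix s t :: real assume "s \<in> {0<..}" "t \<in> {0<..}" "s \<le> t"
    then have "G (ln s) \<le> G (ln t)" by (intro monoD[OF Gm]) simp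
    then show "f s \<ge> f t" unfolding f_def using G by (intro diff_right_mono divide_left_mono
        mult_pos_pos) auto
  qed
  moreover have "f t \<ge> 0" for t using G[of "ln t"] by (simp add: f_def)
  moreover have "f \<in> borel_measurable borel"
    using borel_measurable_mono[OF Gm] unfolding f_def[abs_def] by measurable
  moreover have "AE x in lborel. (\<lambda>n. u (r n) x) \<longlonglongrightarrow> f (norm x)"
  proof -
    \<comment> \<open>A monotone function has countably many discontinuities, so the exceptional
      points form a countable union of circles.\<close>
    let ?D = "exp ` {t. \<not> isCont F t}"
    have "countable ?D" by (intro countable_image mono_ctble_discont F(1))
    then have "AE x in lborel. norm (x::real^2) \<notin> ?D" by (rule AE_norm_not_in_countable)
    moreover have "AE x in lborel. x \<noteq> (0::real^2)" by (rule AE_lborel_singleton)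
    ultimately show ?thesis
    proof eventually_elim
      case (elim x)
      define t where "t = ln (norm x)"
      have t: "exp t = norm x" using elim by (simp add: t_def)
      have "isCont F t" using elim(1) t by (metis (mono_tags, lifting) imageI mem_Collect_eq)
      then have l: "(\<lambda>n. g (r n) t) \<longlonglongrightarrow> F t" by (rule lim)
      have "low t \<le> F t" by (rule LIMSEQ_le_const[OF l]) (use glow in auto)
      then have FG: "F t = G t" by (simp add: G_def)
      have "(\<lambda>n. 1 / g (r n) t - 1) \<longlonglongrightarrow> 1 / F t - 1"
        using G[of t] FG by (intro tendsto_intros l) auto
      moreover have "1 / g (r n) t - 1 = u (r n) x" for n
        using radially_antitone_profile[OF u(1) u(3) elim(2), of "r n"] p0[of "r n" "norm x"]
            by (simp add: g_def t)
      ultimately show ?case using FG by (simp add: f_def t_def)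
    qed
  qed
  ultimately show ?thesis using r by (intro that)
qed

theorem theorem1:
  fixes p a b :: real
  assumes "0 < p" "p < 2" and "a > 0" and "b > 0"
  defines "V \<equiv> \<lambda>x :: real^2. - (norm x powr (- p))"
  shows "\<exists>u. is_minimizer a V b u \<and> (AE x in lebesgue. u x \<ge> 0) \<and>
             radially_symmetric_decreasing u"
proof -
  note p = assms(1,2) and a = assms(3) and b = assms(4)
  \<comment> \<open>A negative upper bound for all later energies: it yields the Dirichlet bound and
    excludes a zero limit. Its radius \<open>R0\<close> starts the exhaustion, so no class is
    empty.\<close>
  obtain R0 w0 where w0: "w0 \<in> lip_class R0" "energy p a b w0 < 0"
    using lip_class_negative_energy[OF p a b] by metis
  have ne: "lip_class (R0 + real n) \<noteq> {}" for n using lip_class_mono[OF w0(1), of "R0 + real n"]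
      by auto
  have "\<exists>u. u \<in> lip_class (R0 + real n) \<and> (\<forall>v\<in>lip_class (R0 + real n). energy p a b u
      \<le> energy p a b v)" for n
    using lip_class_minimizer[OF ne p a b] by metis
  then obtain u where u: "\<And>n. u n \<in> lip_class (R0 + real n)"
    and min: "\<And>n v. v \<in> lip_class (R0 + real n) \<Longrightarrow> energy p a b (u n) \<le> energy p a b v" by metis
  have anti: "radially_antitone (u n)" for n by (rule lip_class_minimizer_antitone[OF u min p a b])
  note u0 = lip_classD(2)[OF u] and um = lip_classD(6)[OF u] and uc = lip_classD(5)[OF u]
  have su: "sqnorm (u n) \<le> 1" for n using lip_classD(4)[OF u, of n] by simp
  have Dfin: "dirichlet (u n) < \<infinity>" for n by (rule dirichlet_lip_class[OF u])
  have Ew0: "energy p a b (u n) \<le> energy p a b w0" for n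
      by (rule min, rule lip_class_mono[OF w0(1)]) simp
  obtain K0 where K0: "\<And>n. enn2real (dirichlet (u n)) \<le> K0"
  proof (rule radial_coercivity[OF p a b])
    fix K assume *: "\<And>u. radially_antitone u \<Longrightarrow> (\<And>x. u x \<ge> 0) \<Longrightarrow> u \<in> borel_measurable borel \<Longrightarrow> sqnorm u
        \<le> 1
      \<Longrightarrow> dirichlet u < \<infinity> \<Longrightarrow> energy p a b u \<le> 0 \<Longrightarrow> enn2real (dirichlet u) \<le> K"
    have "enn2real (dirichlet (u n)) \<le> K" for n
      by (rule *[OF anti u0 um su Dfin]) (use Ew0[of n] w0(2) in simp)
    then show ?thesis by (rule that)
  qed
  define K where "K = max K0 0"
  have K: "dirichlet (u n) \<le> ennreal K" "K \<ge> 0" "enn2real (dirichlet (u n)) \<le> K" for n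
  proof -
    show "enn2real (dirichlet (u n)) \<le> K" using K0[of n] by (simp add: K_def)
    then have "ennreal (enn2real (dirichlet (u n))) \<le> ennreal K" by (rule ennreal_leI)
    then show "dirichlet (u n) \<le> ennreal K" using Dfin[of n] by simp
  qed (simp add: K_def)
  obtain r f where r: "strict_mono (r :: nat \<Rightarrow> nat)" and f: "antimono_on {0<..} f" "\<And>t. f t \<ge> 0" "f
      \<in> borel_measurable borel"
    and lim: "AE x in lborel. (\<lambda>n. u (r n) x) \<longlonglongrightarrow> f (norm x)"
    by (rule radially_antitone_Helly[where u = u, OF anti u0 uc su]) (rule that, assumption+)
  define U where "U x = f (norm x)" for x :: "real^2"
  have Um [measurable]: "U \<in> borel_measurable borel" using f(3) unfolding U_def[abs_def]
      by measurable
  \<comment> \<open>Only an inequality: the bound \<open>2 / norm x\<close> is not square integrable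
    at infinity, so mass may escape.\<close>
  have sU: "sqnorm U \<le> 1" by (rule sqnorm_Fatou[of "\<lambda>n. u (r n)"]) (use um lim su in \<open>auto simp:
      U_def\<close>)
  \<comment> \<open>The same exponent as in \<open>radial_coercivity\<close>, now used to build
    dominating functions near the origin.\<close>
  define s where "s = min (1/4) ((2 - p) / 4)"
  have s: "s > 0" "4 * s < 2" "p + 2 * s < 2" using p by (auto simp: s_def min_def field_simps)
  define c where "c = 1 / 1 + log_const s * sqrt K"
  have c0: "c \<ge> 0" using log_const_nonneg[OF s(1)] K by (simp add: c_def)
  have inner: "u n x \<le> c * norm x powr (- s)" if "x \<noteq> 0" "norm x < 1" for n x
    using radial_inner_bound[OF anti u0 su K(1,2) s(1) that, of n]
        by (simp add: c_def powr_divide powr_minus_divide)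
  have outer: "u n x \<le> 2 * norm x powr (- 1)" if "x \<noteq> 0" for n x
    using radial_outer_bound[OF anti u0 su that, of n] that by (simp add: powr_minus_divide)
  \<comment> \<open>The radial bounds give a dominating function made of two powers of the norm: one
    integrable at the origin, with \<open>q < 2\<close>, and one integrable at infinity, with
    \<open>q' > 2\<close>.\<close>
  have dominated: "(\<lambda>n. \<integral>\<^sup>+x. ennreal (F x (u (r n) x)) \<partial>lborel)
      \<longlonglongrightarrow> (\<integral>\<^sup>+x. ennreal (F x (U x)) \<partial>lborel)
      \<and> (\<integral>\<^sup>+x. ennreal (F x (U x)) \<partial>lborel) < \<infinity>"
    if F: "\<And>x. continuous_on UNIV (F x)" and m: "\<And>g. g \<in> borel_measurable borel \<Longrightarrow> (\<lambda>x. F x (g x))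
        \<in> borel_measurable borel"
      and q: "0 \<le> q" "q < 2" "q' > 2"
      and in': "\<And>x t. x \<noteq> 0 \<Longrightarrow> norm x < 1 \<Longrightarrow> 0 \<le> t \<Longrightarrow> t \<le> c * norm x powr (- s) \<Longrightarrow> F x t
          \<le> C * norm x powr (- q)"
      and out': "\<And>x t. x \<noteq> 0 \<Longrightarrow> norm x \<ge> 1 \<Longrightarrow> 0 \<le> t \<Longrightarrow> t \<le> 2 * norm x powr (- 1) \<Longrightarrow> F x t
          \<le> C * norm x powr (- q')"
      and C: "C \<ge> 0"
    for F :: "real^2 \<Rightarrow> real \<Rightarrow> real" and q q' C
  proof -
    let ?W = "\<lambda>x::real^2. ennreal C * ((if norm x < 1 then ennreal (norm x powr (- q)) else 0)
        + (if norm x \<ge> 1 then ennreal (norm x powr (- q')) else 0))"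
    have Wint: "(\<integral>\<^sup>+x. ?W x \<partial>lborel) < \<infinity>"
    proof -
      have "(\<integral>\<^sup>+x. ?W x \<partial>lborel) = ennreal C * ((\<integral>\<^sup>+x. (if norm x < 1 then ennreal (norm (x::real^2)
          powr (- q)) else 0) \<partial>lborel) + (\<integral>\<^sup>+x. (if norm x \<ge> 1 then ennreal (norm (x::real^2) powr
          (- q')) else 0) \<partial>lborel))"
        by (subst nn_integral_cmult, measurable) (subst nn_integral_add, auto)
      then show ?thesis using powr_integrable_near_0[OF q(1,2)] powr_integrable_at_infinity[OF q(3)]
        by (simp add: ennreal_mult_less_top)
    qed
    have "AE x in lborel. x \<noteq> (0::real^2)" by (rule AE_lborel_singleton)
    then have bound: "AE x in lborel. ennreal (F x (u (r n) x)) \<le> ?W x" for n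
    proof eventually_elim
      case (elim x)
      show ?case
      proof (cases "norm x < 1")
        case True
        have "F x (u (r n) x) \<le> C * norm x powr (- q)"
            by (rule in'[OF elim True u0 inner[OF elim True]])
        then show ?thesis using True C by (simp add: ennreal_mult[symmetric] ennreal_leI)
      next
        case False
        then have "F x (u (r n) x) \<le> C * norm x powr (- q')" using out'[OF elim _ u0 outer[OF elim]]
            by simp
        then show ?thesis using False C by (simp add: ennreal_mult[symmetric] ennreal_leI)
      qed
    qed
    have FL: "AE x in lborel. (\<lambda>n. ennreal (F x (u (r n) x))) \<longlonglongrightarrow> ennreal (F x (U x))"
      using lim
    proof eventually_elim
      case (elim x)
      have "isCont (F x) (U x)" using F[of x] by (simp add: continuous_on_eq_continuous_at)
      from isCont_tendsto_compose[OF this] elim show ?case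
          by (intro tendsto_ennrealI) (simp add: U_def)
    qed
    have conv: "(\<lambda>n. \<integral>\<^sup>+x. ennreal (F x (u (r n) x)) \<partial>lborel) \<longlonglongrightarrow> (\<integral>\<^sup>+x. ennreal (F x (U x)) \<partial>lborel)"
      by (rule nn_integral_dominated_convergence[OF _ _ _ _ Wint FL])
        (use m[OF um] m[OF Um] bound in auto)
    have "(\<integral>\<^sup>+x. ennreal (F x (U x)) \<partial>lborel) \<le> (\<integral>\<^sup>+x. ?W x \<partial>lborel)"
      by (rule LIMSEQ_le_const2[OF conv]) (use nn_integral_mono_AE[OF bound] in blast)
    with Wint conv show ?thesis by (auto simp: order_le_less_trans)
  qed
  \<comment> \<open>The constants \<open>c\<^sup>2 + 4\<close> and \<open>c ^ 4 + 16\<close> serve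
    the inner and the outer estimate alike, because \<open>dominated\<close> takes a single
    \<open>C\<close>.\<close>
  have cs: "(t::real)\<^sup>2 \<le> (c\<^sup>2 + 4) * norm x powr (- (2 * s))" "t ^ 4 \<le> (c ^ 4
      + 16) * norm x powr (- (4 * s))"
    if "x \<noteq> 0" "0 \<le> t" "t \<le> c * norm x powr (- s)" for x :: "real^2" and t
  proof -
    have e: "(norm x powr (- s)) ^ n = norm x powr (- (real n * s))" for n
      using powr_realpow[of "norm x powr (- s)" n] that(1) by (simp add: powr_powr mult.commute)
    have "t\<^sup>2 \<le> (c * norm x powr (- s))\<^sup>2" using that by (intro power_mono) auto
    also have "\<dots> = c\<^sup>2 * norm x powr (- (2 * s))" by (simp add: power_mult_distrib e)
    also have "\<dots> \<le> (c\<^sup>2 + 4) * norm x powr (- (2 * s))" by (intro mult_right_mono) auto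
    finally show "t\<^sup>2 \<le> (c\<^sup>2 + 4) * norm x powr (- (2 * s))" .
    have "t ^ 4 \<le> (c * norm x powr (- s)) ^ 4" using that by (intro power_mono) auto
    also have "\<dots> = c ^ 4 * norm x powr (- (4 * s))" by (simp add: power_mult_distrib e)
    also have "\<dots> \<le> (c ^ 4 + 16) * norm x powr (- (4 * s))" by (intro mult_right_mono) auto
    finally show "t ^ 4 \<le> (c ^ 4 + 16) * norm x powr (- (4 * s))" .
  qed
  have co: "(t::real)\<^sup>2 \<le> (c\<^sup>2 + 4) * norm x powr (- 2)" "t ^ 4 \<le> (c ^ 4 + 16) * norm x powr (- 4)"
    if "x \<noteq> 0" "0 \<le> t" "t \<le> 2 * norm x powr (- 1)" for x :: "real^2" and t
  proof -
    have e: "(norm x powr (- 1)) ^ n = norm x powr (- real n)" for n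
    proof -
      have "(norm x powr (- 1)) ^ n = (norm x powr (- 1)) powr real n"
        by (rule powr_realpow[symmetric]) (use that(1) in simp)
      also have "\<dots> = norm x powr (- 1 * real n)" by (rule powr_powr)
      finally show ?thesis by simp
    qed
    have "t\<^sup>2 \<le> (2 * norm x powr (- 1))\<^sup>2" using that by (intro power_mono) auto
    also have "\<dots> = 4 * norm x powr (- 2)" by (simp only: power_mult_distrib e) simp
    also have "\<dots> \<le> (c\<^sup>2 + 4) * norm x powr (- 2)" by (intro mult_right_mono) auto
    finally show "t\<^sup>2 \<le> (c\<^sup>2 + 4) * norm x powr (- 2)" .
    have "t ^ 4 \<le> (2 * norm x powr (- 1)) ^ 4" using that by (intro power_mono) auto
    also have "\<dots> = 16 * norm x powr (- 4)" by (simp only: power_mult_distrib e) simp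
    also have "\<dots> \<le> (c ^ 4 + 16) * norm x powr (- 4)" by (intro mult_right_mono) auto
    finally show "t ^ 4 \<le> (c ^ 4 + 16) * norm x powr (- 4)" .
  qed
  have Q: "(\<lambda>n. quartic (u (r n))) \<longlonglongrightarrow> quartic U \<and> quartic U < \<infinity>"
    unfolding quartic_def
    by (rule dominated[where q = "4 * s" and q' = 4
        and C = "c ^ 4 + 16"]) (use s cs(2) co(2) in \<open>auto intro!: continuous_intros\<close>)
  have P: "(\<lambda>n. potential p (u (r n))) \<longlonglongrightarrow> potential p U \<and> potential p U < \<infinity>"
    unfolding potential_def
  \<comment> \<open>Outside the unit disc the weight supplies the decay that the square of
    \<open>2 / norm x\<close> lacks.\<close>
  proof (rule dominated[where q = "p + 2 * s" and q' = "p + 2" and C = "c\<^sup>2 + 4"])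
    fix x :: "real^2" and t :: real assume x: "x \<noteq> 0" "0 \<le> t"
    have pa: "norm x powr (- (p + q)) = norm x powr (- p) * norm x powr (- q)" for q
      using powr_add[of "norm x" "- p" "- q"] by simp
    { assume "t \<le> c * norm x powr (- s)"
      from mult_left_mono[OF cs(1)[OF x this] powr_ge_zero[of "norm x" "- p"]]
      show "norm x powr (- p) * t\<^sup>2 \<le> (c\<^sup>2 + 4) * norm x powr (- (p + 2 * s))"
        unfolding pa by (simp only: mult_ac) }
    { assume "t \<le> 2 * norm x powr (- 1)"
      from mult_left_mono[OF co(1)[OF x this] powr_ge_zero[of "norm x" "- p"]]
      show "norm x powr (- p) * t\<^sup>2 \<le> (c\<^sup>2 + 4) * norm x powr (- (p + 2))"
        unfolding pa by (simp only: mult_ac) }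
  qed (use s p in \<open>auto intro!: continuous_intros\<close>)
  \<comment> \<open>Stated for tails, since a given Lipschitz competitor is known to belong to the
    classes only from some index on.\<close>
  have lsc: "dirichlet U < \<infinity> \<and> energy p a b U \<le> e" if N: "\<And>n. n \<ge> N \<Longrightarrow> energy p a b (u n) \<le> e"
      for N e
  proof -
    have rN: "r (n + N) \<ge> N" for n using seq_suble[OF r, of "n + N"] by simp
    have 1: "AE x in lborel. (\<lambda>n. u (r (n + N)) x) \<longlonglongrightarrow> U x"
      using lim
    proof eventually_elim
      case (elim x)
      from LIMSEQ_ignore_initial_segment[OF elim, of N] show ?case by (simp add: U_def)
    qed
    have 2: "(\<lambda>n. potential p (u (r (n + N)))) \<longlonglongrightarrow> potential p U" "(\<lambda>n. quartic (u (r (n + N))))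
        \<longlonglongrightarrow> quartic U"
      using P Q by (auto intro: LIMSEQ_ignore_initial_segment)
    show ?thesis
      using energy_lsc[of "\<lambda>n. u (r (n + N))" U K p a b "\<lambda>n. e" e] um Um 1 Dfin K(3) 2 P Q N[OF rN]
          b by simp
  qed
  have DU: "dirichlet U < \<infinity>" and EU: "energy p a b U \<le> energy p a b w0"
      using lsc[of 0 "energy p a b w0"] Ew0 by auto
  \<comment> \<open>A zero limit would have zero potential and quartic terms, hence nonnegative
    energy, whereas the energy of \<open>U\<close> is at most that of \<open>w0\<close>.\<close>
  have sU0: "sqnorm U > 0"
  proof (rule ccontr)
    assume "\<not> sqnorm U > 0"
    then have "AE x in lborel. U x = 0" by (simp add: sqnorm_def nn_integral_0_iff_AE not_less)
    then have "potential p U = 0" "quartic U = 0"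
      unfolding potential_def quartic_def by (auto simp: nn_integral_0_iff_AE elim: eventually_mono)
    then have "energy p a b U \<ge> 0" using b by (simp add: energy_def)
    then show False using EU w0(2) by simp
  qed
  obtain \<sigma> where \<sigma>: "\<sigma> \<ge> 1" "sqnorm (\<lambda>x. U ((1/\<sigma>) *\<^sub>R x)) = 1" "energy p a b (\<lambda>x. U ((1/\<sigma>) *\<^sub>R x))
      \<le> energy p a b U"
    "dirichlet (\<lambda>x. U ((1/\<sigma>) *\<^sub>R x)) < \<infinity>"
    using normalize_by_dilation[OF Um sU0 sU DU, of p a b] P Q p a b by (metis less_imp_le)
  define w where "w x = U ((1/\<sigma>) *\<^sub>R x)" for x
  have wm: "w \<in> borel_measurable borel" unfolding w_def[abs_def] by measurable
  have w: "sqnorm w = 1" "dirichlet w < \<infinity>" "sqnorm w < \<infinity>" using \<sigma> by (simp_all add: w_def[abs_def])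
  note wE = kirchhoff_energy_eq[OF borel_measurable_lebesgueI[OF wm] wm _ w(3,2)]
  have wH: "w \<in> H1" by (rule weak_gradient_sqnorm(1)[OF borel_measurable_lebesgueI[OF wm] wm _
      w(3,2)]) simp
  have least: "kirchhoff_energy a V b w \<le> kirchhoff_energy a V b v" if v: "v \<in> H1" "L2_norm v = 1"
      for v
  proof -
    obtain v' where v': "v' \<in> borel_measurable borel" "AE x in lborel. v x = v' x" "sqnorm v'
        < \<infinity>" "dirichlet v' < \<infinity>"
      by (rule H1_borel_representative[OF v(1)])
    have vl: "v \<in> borel_measurable lebesgue" using v(1) by (simp add: H1_def L2_def)
    note vE = kirchhoff_energy_eq[OF vl v'(1,2,3,4)]
    have "enn2real (sqnorm v') = 1" using vE(2) v(2) by simp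
    then have sv: "sqnorm v' = 1" using v'(3) by (cases "sqnorm v'") auto
    have "energy p a b w \<le> energy p a b v'"
    \<comment> \<open>A competitor in \<open>H1\<close> is matched up to \<open>\<delta>\<close> by
      a Lipschitz one, which lies in every class of sufficiently large index and so bounds the
      constrained minima there.\<close>
    proof (rule field_le_epsilon)
      fix \<delta> :: real assume "\<delta> > 0"
      from lip_class_density[OF v'(1) sv v'(4) p a b this] obtain R z where
        z: "z \<in> lip_class R" "energy p a b z \<le> energy p a b v' + \<delta>" by metis
      obtain N :: nat where N: "R - R0 \<le> real N" using real_arch_simple by blast
      have "energy p a b (u n) \<le> energy p a b v' + \<delta>" if "n \<ge> N" for n
      proof -
        have "R \<le> R0 + real n" using N that by linarith
        from min[OF lip_class_mono[OF z(1) this]] z(2) show ?thesis by linarith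
      qed
      then have "energy p a b U \<le> energy p a b v' + \<delta>" using lsc[of N] by blast
      with \<sigma>(3) show "energy p a b w \<le> energy p a b v' + \<delta>" unfolding w_def[abs_def]
          by (rule order_trans)
    qed
    then show ?thesis unfolding V_def using wE(1)[of a p b] vE(1)[of a p b] by simp
  qed
  have L2w: "L2_norm w = 1" using wE(2) w(1) by simp
  have "is_minimizer a V b w"
    unfolding is_minimizer_def ground_state_energy_def
  proof (intro conjI wH L2w antisym)
    show "ereal (kirchhoff_energy a V b w) \<le> (INF u \<in> {u \<in> H1. L2_norm u
        = 1}. ereal (kirchhoff_energy a V b u))"
      by (rule INF_greatest) (use least in auto)
    show "(INF u \<in> {u \<in> H1. L2_norm u = 1}. ereal (kirchhoff_energy a V b u))
        \<le> ereal (kirchhoff_energy a V b w)"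
      by (rule INF_lower) (use wH L2w in auto)
  qed
  moreover have "AE x in lebesgue. w x \<ge> 0" by (simp add: w_def U_def f(2))
  moreover have "radially_symmetric_decreasing w"
    unfolding radially_symmetric_decreasing_def
  proof (intro exI[of _ "\<lambda>t. f (t / \<sigma>)"] conjI)
    show "antimono_on {0<..} (\<lambda>t. f (t / \<sigma>))"
    proof (rule monotone_onI)
      fix x y :: real assume "x \<in> {0<..}" "y \<in> {0<..}" "x \<le> y"
      then show "f (x / \<sigma>) \<ge> f (y / \<sigma>)"
        using \<sigma>(1) by (intro monotone_onD[OF f(1)]) (auto simp: divide_right_mono)
    qed
    show "AE x in lebesgue. w x = f (norm x / \<sigma>)" using \<sigma>(1) by (simp add: w_def U_def)
  qed
  ultimately show ?thesis by blast
qed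

end
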